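(* Let $M$ be an o-minimal structure, let $H$ be an abelian definably connected group definable in $M$, and let $1 \to \Gamma \xrightarrow{\iota} G \xrightarrow{\pi} H \to 1$ be a finite central extension of $H$. Then $(G,\pi,M)$ is naturally interpretable in $M$.
   Context: An o-minimal structure is a structure $M$ with a dense linear order such that every definable subset of $M$ is a finite union of points and open intervals. Groups definable in $M$ have universe contained in some $M^n$. A definable group is definably connected if it has no proper definable subgroup of finite index. The paper freely adjoins finitely many constants to $M$, so $H$ may be taken $\emptyset$-definable and definability in $M$ may use finitely many parameters. A finite central extension is an exact sequence of abstract groups with $\Gamma$ finite and $\iota(\Gamma)$ central in $G$. The structure $(G,\pi,M)$ has sorts for $\Gamma$, $G$ and $M$, with symbols for the group operations, $\iota$, $\pi$ and all symbols of $M$. It is naturally interpretable in $M$ if there are a group $G_0$ and a homomorphism $\pi_0:G_0\to H$ definable in $M$ and an isomorphism of structures $(G,\pi,M)\cong(G_0,\pi_0,M)$ (isomorphisms $\Gamma\to\ker\pi_0$, $G\to G_0$ commuting with the maps to $H$) which is the identity on $M$. *)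

theory Defs
  imports "HOL-Algebra.Coset"
begin

section \<open>First-order structures on a dense linear order\<close>

text \<open>The universe of a structure is a whole type \<open>'m\<close> of class \<^class>\<open>dense_linorder\<close>, and \<open><\<close> is
  always part of the language. A symbol is a name together with an arity, so every language
  (also one without further symbols) is an instance. The class allows endpoints.\<close>

record ('f, 'r, 'm) fo_structure =
  fun_symbols :: "('f \<times> nat) set"
  rel_symbols :: "('r \<times> nat) set"
  fun_interp :: "'f \<Rightarrow> 'm list \<Rightarrow> 'm"
  rel_interp :: "'r \<Rightarrow> 'm list \<Rightarrow> bool"

datatype 'f fo_term = Var nat | Fun 'f "'f fo_term list"

datatype ('f, 'r) fo_formula =
    Eq "'f fo_term" "'f fo_term"
  | Less "'f fo_term" "'f fo_term"
  | Rel 'r "'f fo_term list"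
  | Neg "('f, 'r) fo_formula"
  | Conj "('f, 'r) fo_formula" "('f, 'r) fo_formula"
  | Exists nat "('f, 'r) fo_formula"

primrec wf_term :: "('f, 'r, 'm) fo_structure \<Rightarrow> 'f fo_term \<Rightarrow> bool" where
  "wf_term M (Var i) \<longleftrightarrow> True"
| "wf_term M (Fun f ts) \<longleftrightarrow> (f, length ts) \<in> fun_symbols M \<and> list_all (wf_term M) ts"

primrec wf_formula :: "('f, 'r, 'm) fo_structure \<Rightarrow> ('f, 'r) fo_formula \<Rightarrow> bool" where
  "wf_formula M (Eq s t) \<longleftrightarrow> wf_term M s \<and> wf_term M t"
| "wf_formula M (Less s t) \<longleftrightarrow> wf_term M s \<and> wf_term M t"
| "wf_formula M (Rel r ts) \<longleftrightarrow> (r, length ts) \<in> rel_symbols M \<and> list_all (wf_term M) ts"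
| "wf_formula M (Neg p) \<longleftrightarrow> wf_formula M p"
| "wf_formula M (Conj p q) \<longleftrightarrow> wf_formula M p \<and> wf_formula M q"
| "wf_formula M (Exists i p) \<longleftrightarrow> wf_formula M p"

primrec term_value :: "('f, 'r, 'm) fo_structure \<Rightarrow> (nat \<Rightarrow> 'm) \<Rightarrow> 'f fo_term \<Rightarrow> 'm" where
  "term_value M e (Var i) = e i"
| "term_value M e (Fun f ts) = fun_interp M f (map (term_value M e) ts)"

primrec satisfies ::
  "('f, 'r, 'm::dense_linorder) fo_structure \<Rightarrow> (nat \<Rightarrow> 'm) \<Rightarrow> ('f, 'r) fo_formula \<Rightarrow> bool" where
  "satisfies M e (Eq s t) \<longleftrightarrow> term_value M e s = term_value M e t"
| "satisfies M e (Less s t) \<longleftrightarrow> term_value M e s < term_value M e t"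
| "satisfies M e (Rel r ts) \<longleftrightarrow> rel_interp M r (map (term_value M e) ts)"
| "satisfies M e (Neg p) \<longleftrightarrow> \<not> satisfies M e p"
| "satisfies M e (Conj p q) \<longleftrightarrow> satisfies M e p \<and> satisfies M e q"
| "satisfies M e (Exists i p) \<longleftrightarrow> (\<exists>a. satisfies M (e(i := a)) p)"

text \<open>Definability with parameters. Points of \<open>M\<^sup>n\<close> are lists of length \<open>n\<close>; the variables below \<open>n\<close>
  stand for the coordinates and the remaining ones take their parameter values from \<open>e\<close>. Only
  finitely many of these values matter, because a formula has finitely many variables.\<close>

definition definable :: "('f, 'r, 'm::dense_linorder) fo_structure \<Rightarrow> nat \<Rightarrow> 'm list set \<Rightarrow> bool" where
  "definable M n X \<longleftrightarrow> (\<exists>p e. wf_formula M p \<and>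
     X = {xs. length xs = n \<and> satisfies M (\<lambda>i. if i < n then xs ! i else e i) p})"

definition open_interval :: "'m::linorder set \<Rightarrow> bool" where
  "open_interval I \<longleftrightarrow> (\<exists>a b. I = {a<..<b} \<or> I = {a<..} \<or> I = {..<b}) \<or> I = UNIV"

text \<open>A one-point order is vacuously dense and is excluded by the first conjunct.\<close>

definition o_minimal :: "('f, 'r, 'm::dense_linorder) fo_structure \<Rightarrow> bool" where
  "o_minimal M \<longleftrightarrow> (\<exists>a b :: 'm. a \<noteq> b) \<and>
     (\<forall>X. definable M 1 X \<longrightarrow>
        (\<exists>\<I>. finite \<I> \<and> (\<forall>I\<in>\<I>. (\<exists>a. I = {a}) \<or> open_interval I) \<and> {x. [x] \<in> X} = \<Union>\<I>))"


section \<open>Definable groups\<close>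

definition definable_map ::
  "('f, 'r, 'm::dense_linorder) fo_structure \<Rightarrow> nat \<Rightarrow> nat \<Rightarrow> 'm list set \<Rightarrow> ('m list \<Rightarrow> 'm list) \<Rightarrow> bool"
  where "definable_map M m n X f \<longleftrightarrow> definable M (m + n) {x @ f x |x. x \<in> X}"

text \<open>The universe is a definable subset of \<open>M\<^sup>n\<close> and the graph of the multiplication is definable
  in \<open>M\<^sup>3\<^sup>n\<close>.\<close>

definition definable_group ::
  "('f, 'r, 'm::dense_linorder) fo_structure \<Rightarrow> nat \<Rightarrow> 'm list monoid \<Rightarrow> bool" where
  "definable_group M n H \<longleftrightarrow> group H \<and> definable M n (carrier H) \<and>
     definable M (3 * n) {x @ y @ (x \<otimes>\<^bsub>H\<^esub> y) |x y. x \<in> carrier H \<and> y \<in> carrier H}"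

definition definably_connected ::
  "('f, 'r, 'm::dense_linorder) fo_structure \<Rightarrow> nat \<Rightarrow> 'm list monoid \<Rightarrow> bool" where
  "definably_connected M n H \<longleftrightarrow>
     \<not> (\<exists>K. subgroup K H \<and> definable M n K \<and> K \<noteq> carrier H \<and> finite (rcosets\<^bsub>H\<^esub> K))"


section \<open>Finite central extensions and natural interpretability\<close>

definition finite_central_extension ::
  "'c monoid \<Rightarrow> ('c \<Rightarrow> 'g) \<Rightarrow> 'g monoid \<Rightarrow> ('g \<Rightarrow> 'h) \<Rightarrow> 'h monoid \<Rightarrow> bool" where
  "finite_central_extension \<Gamma> \<iota> G \<pi> H \<longleftrightarrow>
     group_hom \<Gamma> G \<iota> \<and> group_hom G H \<pi> \<and>
     inj_on \<iota> (carrier \<Gamma>) \<and> \<iota> ` carrier \<Gamma> = kernel G H \<pi> \<and> \<pi> ` carrier G = carrier H \<and>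
     finite (carrier \<Gamma>) \<and>
     (\<forall>c\<in>carrier \<Gamma>. \<forall>g\<in>carrier G. \<iota> c \<otimes>\<^bsub>G\<^esub> g = g \<otimes>\<^bsub>G\<^esub> \<iota> c)"

text \<open>Isomorphisms \<open>(G, \<pi>, M) \<cong> (G\<^sub>0, \<pi>\<^sub>0, M)\<close> of three-sorted structures that are the identity on the
  sort \<open>M\<close>: \<open>\<gamma>\<close> acts on the sort \<open>\<Gamma>\<close>, with image the sort \<open>ker \<pi>\<^sub>0\<close>, whose embedding into \<open>G\<^sub>0\<close> is the
  inclusion, and \<open>\<phi>\<close> acts on the sort \<open>G\<close>. The symbols of \<open>M\<close> impose no condition on them.\<close>

definition extension_iso_over ::
  "'c monoid \<Rightarrow> ('c \<Rightarrow> 'g) \<Rightarrow> 'g monoid \<Rightarrow> ('g \<Rightarrow> 'h) \<Rightarrow>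
   'k monoid \<Rightarrow> ('k \<Rightarrow> 'h) \<Rightarrow> 'h monoid \<Rightarrow> ('c \<Rightarrow> 'k) \<Rightarrow> ('g \<Rightarrow> 'k) \<Rightarrow> bool" where
  "extension_iso_over \<Gamma> \<iota> G \<pi> G\<^sub>0 \<pi>\<^sub>0 H \<gamma> \<phi> \<longleftrightarrow>
     \<gamma> \<in> iso \<Gamma> (G\<^sub>0\<lparr>carrier := kernel G\<^sub>0 H \<pi>\<^sub>0\<rparr>) \<and> \<phi> \<in> iso G G\<^sub>0 \<and>
     (\<forall>c\<in>carrier \<Gamma>. \<phi> (\<iota> c) = \<gamma> c) \<and>
     (\<forall>g\<in>carrier G. \<pi>\<^sub>0 (\<phi> g) = \<pi> g)"

definition naturally_interpretable ::
  "('f, 'r, 'm::dense_linorder) fo_structure \<Rightarrow> nat \<Rightarrow>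
   'c monoid \<Rightarrow> ('c \<Rightarrow> 'g) \<Rightarrow> 'g monoid \<Rightarrow> ('g \<Rightarrow> 'm list) \<Rightarrow> 'm list monoid \<Rightarrow> bool" where
  "naturally_interpretable M n \<Gamma> \<iota> G \<pi> H \<longleftrightarrow>
     (\<exists>k G\<^sub>0 \<pi>\<^sub>0. definable_group M k G\<^sub>0 \<and>
        \<pi>\<^sub>0 \<in> hom G\<^sub>0 H \<and> definable_map M k n (carrier G\<^sub>0) \<pi>\<^sub>0 \<and>
        (\<exists>\<gamma> \<phi>. extension_iso_over \<Gamma> \<iota> G \<pi> G\<^sub>0 \<pi>\<^sub>0 H \<gamma> \<phi>))"

end

theory Submission
  imports Defs "HOL-Algebra.FiniteProduct"
begin

text \<open>Let \<open>m\<close> be the order of \<open>\<Gamma>\<close>. If \<open>H\<close> is divisible by \<open>m\<close>, then \<open>G\<close> is abelian, and its \<open>m\<close>-th power map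
  factors through a homomorphism \<open>sec: H \<rightarrow> G\<close> whose image together with \<open>\<Gamma>\<close> generates \<open>G\<close>. Hence \<open>G\<close> is
  the quotient of \<open>\<Gamma> \<times> H\<close> by a subgroup that embeds in the \<open>m\<close>-torsion of \<open>H\<close>. If that torsion is finite,
  the quotient is definable, by choosing lexicographically least representatives.

  The torsion is finite because the o-minimal Euler characteristic of a definable set is divisible by
  the order of every finite group acting definably and freely on it. For finite torsion, subgroups of
  infinite index in a descending chain of power subgroups would each lower the dimension, so the
  \<open>m\<close>-th powers have finite index, and definable connectedness makes \<open>H\<close> divisible. The Euler
  characteristic is an iterated integral over the coordinates; its invariance under definable
  bijections is a Fubini theorem, which rests on monotonicity and uniform finiteness. No cell
  decomposition is needed.\<close>

section \<open>Definable predicates\<close>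

text \<open>The structure need not expand a group and has no definable choice, so a quotient is
  within reach only if its classes are finite; this is why everything turns on the finiteness of
  torsion. The power map factors through \<open>H\<close> because \<open>\<Gamma>\<close> is
  annihilated by its order \<open>m\<close>. The kernel of the map from \<open>\<Gamma>\<close>
  \<times> H to G, which sends (c, h) to the product of \<open>\<iota> c\<close> and
  \<open>sec h\<close>, projects injectively to H and lands in the \<open>m\<close>-torsion, because
  \<open>\<pi> (sec h)\<close> is \<open>h [^] m\<close>. An infinite group V of bounded exponent
  contains arbitrarily large finite subgroups, which forces Euler characteristic 0 on V \<times> V
  and -1 after removal of the neutral element; so no nontrivial finite group acts freely on the
  rest. Inversion is such an action for odd exponent but is trivial for exponent 2. The square V
  \<times> V is taken because it has a further automorphism, of order 3. All other even exponents
  reduce to smaller ones by squaring. Of dimension theory only one fact is used: infinitely many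
  disjoint pieces of dimension at least e in a definable family fill a set of dimension at least e +
  1.\<close>

primrec rename_term :: "(nat \<Rightarrow> nat) \<Rightarrow> 'f fo_term \<Rightarrow> 'f fo_term" where
  "rename_term \<rho> (Var i) = Var (\<rho> i)"
| "rename_term \<rho> (Fun f ts) = Fun f (map (rename_term \<rho>) ts)"

lemma term_value_rename: "term_value M E (rename_term \<rho> t) = term_value M (\<lambda>i. E (\<rho> i)) t"
proof (induction t)
  case (Fun f ts)
  then have "map (term_value M E) (map (rename_term \<rho>) ts) = map (term_value M (\<lambda>i. E (\<rho> i))) ts"
    by simp
  then show ?case by (simp del: map_map)
qed simp

lemma wf_rename: "wf_term M t \<Longrightarrow> wf_term M (rename_term \<rho> t)"
  by (induction t) (auto simp: list_all_iff)

lemma term_value_finite_vars: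
  "\<exists>K::nat. \<forall>E E'. (\<forall>i<K. E i = E' i) \<longrightarrow> term_value M E t = term_value M E' t"
proof (induction t)
  case (Var i)
  show ?case by (rule exI[of _ "Suc i"]) simp
next
  case (Fun f ts)
  then obtain K where K: "\<And>t E E'. t \<in> set ts \<Longrightarrow> \<forall>i<(K t::nat). E i = E' i \<Longrightarrow>
      term_value M E t = term_value M E' t" by metis
  have "term_value M E (Fun f ts) = term_value M E' (Fun f ts)"
    if "\<forall>i<Max (insert 0 (K ` set ts)). E i = E' i" for E E'
  proof -
    have "term_value M E t = term_value M E' t" if "t \<in> set ts" for t
    proof (rule K[OF that], intro allI impI)
      fix i assume "i < K t"
      also have "K t \<le> Max (insert 0 (K ` set ts))" using that by (intro Max_ge) auto
      finally show "E i = E' i" using \<open>\<forall>i<_. _\<close> by blast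
    qed
    then have "map (term_value M E) ts = map (term_value M E') ts" by simp
    then show ?thesis by (simp only: term_value.simps)
  qed
  then show ?case by blast
qed

lemma terms_value_finite_vars:
  "\<exists>K::nat. \<forall>E E'. (\<forall>i<K. E i = E' i) \<longrightarrow> map (term_value M E) ts = map (term_value M E') ts"
proof (induction ts)
  case (Cons t ts)
  obtain K where K: "\<forall>E E'. (\<forall>i<(K::nat). E i = E' i) \<longrightarrow> term_value M E t = term_value M E' t"
    using term_value_finite_vars by blast
  obtain L where L: "\<forall>E E'. (\<forall>i<(L::nat). E i = E' i) \<longrightarrow> map (term_value M E) ts = map (term_value M E') ts"
    using Cons by blast
  show ?case by (rule exI[of _ "max K L"]) (use K L in \<open>simp add: less_max_iff_disj\<close>)
qed simp

text \<open>A quantified formula inherits the bound of its body, since the bound variable receives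
  the same value under both valuations. Through this fact predicates on infinite valuations behave
  like predicates of finitely many arguments.\<close>

lemma satisfies_finite_vars:
  "\<exists>K::nat. \<forall>E E'. (\<forall>i<K. E i = E' i) \<longrightarrow> satisfies M E p = satisfies M E' p"
proof (induction p)
  case (Eq s t)
  obtain K where K: "\<And>E E'. (\<forall>i<(K::nat). E i = E' i) \<Longrightarrow>
      map (term_value M E) [s, t] = map (term_value M E') [s, t]"
    using terms_value_finite_vars by blast
  show ?case
  proof (rule exI[of _ K], intro allI impI, goal_cases)
    case (1 E E')
    from K[OF this] show ?case by simp
  qed
next
  case (Less s t)
  obtain K where K: "\<And>E E'. (\<forall>i<(K::nat). E i = E' i) \<Longrightarrow>
      map (term_value M E) [s, t] = map (term_value M E') [s, t]"
    using terms_value_finite_vars by blast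
  show ?case
  proof (rule exI[of _ K], intro allI impI, goal_cases)
    case (1 E E')
    from K[OF this] show ?case by simp
  qed
next
  case (Rel r ts)
  show ?case
  proof -
    obtain K where K: "\<And>E E'. (\<forall>i<(K::nat). E i = E' i) \<Longrightarrow>
        map (term_value M E) ts = map (term_value M E') ts"
      using terms_value_finite_vars by blast
    show ?thesis
    proof (rule exI[of _ K], intro allI impI, goal_cases)
      case (1 E E')
      from K[OF this] show ?case by (simp only: satisfies.simps)
    qed
  qed
next
  case (Conj p q)
  then obtain K L where K: "\<forall>E E'. (\<forall>i<(K::nat). E i = E' i) \<longrightarrow> satisfies M E p = satisfies M E' p"
    and L: "\<forall>E E'. (\<forall>i<(L::nat). E i = E' i) \<longrightarrow> satisfies M E q = satisfies M E' q" by blast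
  show ?case
  proof (rule exI[of _ "max K L"], intro allI impI)
    fix E E' :: "nat \<Rightarrow> 'a" assume "\<forall>i<max K L. E i = E' i"
    then have "satisfies M E p = satisfies M E' p" "satisfies M E q = satisfies M E' q"
      using K L by (simp_all only: less_max_iff_disj) blast+
    then show "satisfies M E (Conj p q) = satisfies M E' (Conj p q)" by simp
  qed
next
  case (Exists j p)
  then obtain K where K: "\<And>E E'. (\<forall>i<(K::nat). E i = E' i) \<Longrightarrow> satisfies M E p = satisfies M E' p" by blast
  have "satisfies M E (Exists j p) = satisfies M E' (Exists j p)" if "\<forall>i<K. E i = E' i" for E E'
  proof -
    have "satisfies M (E(j := a)) p = satisfies M (E'(j := a)) p" for a
      by (rule K) (use that in simp)
    then show ?thesis by simp
  qed
  then show ?case by blast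
qed auto

text \<open>Renaming of variables and insertion of parameters in one operation; these are the
  substitutions that an allocation of formula variables absorbs directly. Substitution of definable
  functions is derived later in \<open>Def_subst\<close>.\<close>

definition look :: "(nat \<Rightarrow> nat + 'm) \<Rightarrow> (nat \<Rightarrow> 'm) \<Rightarrow> nat \<Rightarrow> 'm" where
  "look \<sigma> v i = (case \<sigma> i of Inl j \<Rightarrow> v j | Inr c \<Rightarrow> c)"

text \<open>\<open>P\<close> is definable with parameters \<open>e\<close>: for every allocation of formula variables \<open>g\<close> to the
  arguments of \<open>P\<close> and \<open>h\<close> to the parameters which leaves infinitely many variables unused, some
  formula expresses \<open>P\<close>. Quantifying over the allocations makes the closure properties immediate,
  as no substitution into formulas with bound variables is needed.\<close>

definition dpred :: "('f, 'r, 'm::dense_linorder) fo_structure \<Rightarrow> ((nat \<Rightarrow> 'm) \<Rightarrow> bool) \<Rightarrow> bool" where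
  "dpred M P \<longleftrightarrow> (\<exists>e::nat \<Rightarrow> 'm. \<forall>g h. infinite (- (range g \<union> range h)) \<longrightarrow>
     (\<exists>p. wf_formula M p \<and> (\<forall>E. (\<forall>j. E (h j) = e j) \<longrightarrow> satisfies M E p = P (\<lambda>i. E (g i)))))"

lemma dpredE:
  assumes "dpred M P"
  obtains e :: "nat \<Rightarrow> _" where "\<And>g h. infinite (- (range g \<union> range h)) \<Longrightarrow>
     (\<exists>p. wf_formula M p \<and> (\<forall>E. (\<forall>j. E (h j) = e j) \<longrightarrow> satisfies M E p = P (\<lambda>i. E (g i))))"
proof -
  from assms obtain e :: "nat \<Rightarrow> _" where "\<forall>g h. infinite (- (range g \<union> range h)) \<longrightarrow>
     (\<exists>p. wf_formula M p \<and> (\<forall>E. (\<forall>j. E (h j) = e j) \<longrightarrow> satisfies M E p = P (\<lambda>i. E (g i))))"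
    unfolding dpred_def by (elim exE)
  then have "\<And>g h. infinite (- (range g \<union> range h)) \<Longrightarrow>
     (\<exists>p. wf_formula M p \<and> (\<forall>E. (\<forall>j. E (h j) = e j) \<longrightarrow> satisfies M E p = P (\<lambda>i. E (g i))))"
    by (elim allE impE) assumption+
  then show thesis by (rule that)
qed

lemma dpred_atom:
  assumes "\<And>\<rho>. wf_formula M (A \<rho>)"
    and "\<And>\<rho> E. satisfies M E (A \<rho>) = Q (\<lambda>i. E (\<rho> i))"
  shows "dpred M (\<lambda>v. Q (look \<sigma> v))"
  unfolding dpred_def
\<comment> \<open>Parameter number \<open>i\<close> is the constant that replaces variable
  \<open>i\<close> of the atom; \<open>undefined\<close> only fills the positions without
  one.\<close>
proof (intro exI[of _ "\<lambda>i. case \<sigma> i of Inl j \<Rightarrow> undefined | Inr c \<Rightarrow> c"] allI impI, goal_cases)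
  case (1 g h)
  let ?\<rho> = "\<lambda>i. case \<sigma> i of Inl j \<Rightarrow> g j | Inr c \<Rightarrow> h i"
  have "satisfies M E (A ?\<rho>) = Q (look \<sigma> (\<lambda>i. E (g i)))"
    if "\<forall>j. E (h j) = (case \<sigma> j of Inl j \<Rightarrow> undefined | Inr c \<Rightarrow> c)" for E
  proof -
    have "(\<lambda>i. E (?\<rho> i)) = look \<sigma> (\<lambda>i. E (g i))"
      using that by (auto simp: look_def fun_eq_iff split: sum.splits)
    then show ?thesis using assms(2)[of E ?\<rho>] by simp
  qed
  then show ?case using assms(1) by blast
qed

lemma dpred_neg:
  assumes "dpred M P" shows "dpred M (\<lambda>v. \<not> P v)"
proof -
  obtain e :: "nat \<Rightarrow> _" where e: "\<And>g h. infinite (- (range g \<union> range h)) \<Longrightarrow>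
     (\<exists>p. wf_formula M p \<and> (\<forall>E. (\<forall>j. E (h j) = e j) \<longrightarrow> satisfies M E p = P (\<lambda>i. E (g i))))"
    by (rule dpredE[OF assms]) (rule that)
  show ?thesis unfolding dpred_def
  proof (intro exI[of _ e] allI impI, goal_cases)
    case (1 g h)
    from e[OF this] obtain p where "wf_formula M p \<and> (\<forall>E. (\<forall>j. E (h j) = e j) \<longrightarrow> satisfies M E p = P (\<lambda>i. E (g i)))"
      by (elim exE)
    then show ?case by (intro exI[of _ "Neg p"]) simp
  qed
qed

lemma dpred_conj:
  assumes "dpred M P" "dpred M Q" shows "dpred M (\<lambda>v. P v \<and> Q v)"
proof -
  obtain e :: "nat \<Rightarrow> _" where e: "\<And>g h. infinite (- (range g \<union> range h)) \<Longrightarrow>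
     (\<exists>p. wf_formula M p \<and> (\<forall>E. (\<forall>j. E (h j) = e j) \<longrightarrow> satisfies M E p = P (\<lambda>i. E (g i))))"
    by (rule dpredE[OF assms(1)]) (rule that)
  obtain e' :: "nat \<Rightarrow> _" where e': "\<And>g h. infinite (- (range g \<union> range h)) \<Longrightarrow>
     (\<exists>p. wf_formula M p \<and> (\<forall>E. (\<forall>j. E (h j) = e' j) \<longrightarrow> satisfies M E p = Q (\<lambda>i. E (g i))))"
    by (rule dpredE[OF assms(2)]) (rule that)
  show ?thesis unfolding dpred_def
  \<comment> \<open>The two parameter sequences are interleaved: even positions belong to
    \<open>P\<close>, odd ones to \<open>Q\<close>.\<close>
  proof (intro exI[of _ "\<lambda>i. if even i then e (i div 2) else e' (i div 2)"] allI impI, goal_cases)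
    case (1 g h)
    have "infinite (- (range g \<union> range (\<lambda>i. h (2 * i))))" "infinite (- (range g \<union> range (\<lambda>i. h (2 * i + 1))))"
      by (rule infinite_super[OF _ 1]; blast)+
    from e[OF this(1)] e'[OF this(2)] obtain p q where "wf_formula M p" "wf_formula M q"
      and p: "\<And>E. (\<forall>j. E (h (2 * j)) = e j) \<Longrightarrow> satisfies M E p = P (\<lambda>i. E (g i))"
      and q: "\<And>E. (\<forall>j. E (h (2 * j + 1)) = e' j) \<Longrightarrow> satisfies M E q = Q (\<lambda>i. E (g i))"
      by blast
    show ?case
    proof (intro exI[of _ "Conj p q"] conjI allI impI)
      show "wf_formula M (Conj p q)" using \<open>wf_formula M p\<close> \<open>wf_formula M q\<close> by simp
      fix E assume E: "\<forall>j. E (h j) = (if even j then e (j div 2) else e' (j div 2))"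
      have "\<forall>j. E (h (2 * j)) = e j" "\<forall>j. E (h (2 * j + 1)) = e' j" by (simp_all add: E)
      then show "satisfies M E (Conj p q) = (P (\<lambda>i. E (g i)) \<and> Q (\<lambda>i. E (g i)))"
        using p q by simp
    qed
  qed
qed

lemma dpred_ex:
  assumes "dpred M P" shows "dpred M (\<lambda>v. \<exists>a. P (case_nat a v))"
proof -
  obtain e :: "nat \<Rightarrow> _" where e: "\<And>g h. infinite (- (range g \<union> range h)) \<Longrightarrow>
     (\<exists>p. wf_formula M p \<and> (\<forall>E. (\<forall>j. E (h j) = e j) \<longrightarrow> satisfies M E p = P (\<lambda>i. E (g i))))"
    by (rule dpredE[OF assms]) (rule that)
  show ?thesis unfolding dpred_def
  proof (intro exI[of _ e] allI impI, goal_cases)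
    case (1 g h)
    obtain k where k: "k \<notin> range g" "k \<notin> range h"
      using infinite_imp_nonempty[OF 1] by blast
    have "- (range (case_nat k g) \<union> range h) = - (range g \<union> range h) - {k}"
    proof -
      have "range (case_nat k g) = insert k (range g)"
        by (auto split: nat.splits)
      then show ?thesis by auto
    qed
    then have "infinite (- (range (case_nat k g) \<union> range h))" using 1 by simp
    from e[OF this] obtain p where "wf_formula M p"
      and p: "\<And>E. (\<forall>j. E (h j) = e j) \<Longrightarrow> satisfies M E p = P (\<lambda>i. E (case_nat k g i))" by blast
    show ?case
    proof (intro exI[of _ "Exists k p"] conjI allI impI)
      show "wf_formula M (Exists k p)" using \<open>wf_formula M p\<close> by simp
      fix E assume E: "\<forall>j. E (h j) = e j"
      have "satisfies M (E(k := a)) p = P (case_nat a (\<lambda>i. E (g i)))" for a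
      proof -
        have "(E(k := a)) (h j) = e j" for j using E k by (metis fun_upd_other rangeI)
        moreover have "(\<lambda>i. (E(k := a)) (case_nat k g i)) = case_nat a (\<lambda>i. E (g i))"
          using k by (auto simp: fun_eq_iff split: nat.splits)
        ultimately show ?thesis using p[of "E(k := a)"] by simp
      qed
      then show "satisfies M E (Exists k p) = (\<exists>a. P (case_nat a (\<lambda>i. E (g i))))" by simp
    qed
  qed
qed

lemma dpred_look:
  assumes "dpred M P" shows "dpred M (\<lambda>v. P (look \<sigma> v))"
proof -
  obtain e :: "nat \<Rightarrow> _" where e: "\<And>g h. infinite (- (range g \<union> range h)) \<Longrightarrow>
     (\<exists>p. wf_formula M p \<and> (\<forall>E. (\<forall>j. E (h j) = e j) \<longrightarrow> satisfies M E p = P (\<lambda>i. E (g i))))"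
    by (rule dpredE[OF assms]) (rule that)
  let ?c = "\<lambda>i. case \<sigma> i of Inl j \<Rightarrow> undefined | Inr c \<Rightarrow> c"
  show ?thesis unfolding dpred_def
  \<comment> \<open>Even positions hold the parameters of \<open>P\<close>, odd ones the constants
    introduced by \<open>\<sigma>\<close>.\<close>
  proof (intro exI[of _ "\<lambda>i. if even i then e (i div 2) else ?c (i div 2)"] allI impI, goal_cases)
    case (1 g h)
    let ?\<rho> = "\<lambda>i. case \<sigma> i of Inl j \<Rightarrow> g j | Inr c \<Rightarrow> h (2 * i + 1)"
    have "range ?\<rho> \<union> range (\<lambda>i. h (2 * i)) \<subseteq> range g \<union> range h"
      by (auto split: sum.splits)
    then have "infinite (- (range ?\<rho> \<union> range (\<lambda>i. h (2 * i))))"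
      by (intro infinite_super[OF _ 1]) blast
    from e[OF this] obtain p where "wf_formula M p"
      and p: "\<And>E. (\<forall>j. E (h (2 * j)) = e j) \<Longrightarrow> satisfies M E p = P (\<lambda>i. E (?\<rho> i))" by blast
    show ?case
    proof (intro exI[of _ p] conjI allI impI)
      show "wf_formula M p" by fact
      fix E assume E: "\<forall>j. E (h j) = (if even j then e (j div 2) else ?c (j div 2))"
      have "\<forall>j. E (h (2 * j)) = e j" and c: "\<forall>j. E (h (2 * j + 1)) = ?c j" by (simp_all add: E)
      moreover have "(\<lambda>i. E (?\<rho> i)) = look \<sigma> (\<lambda>i. E (g i))"
        using c by (auto simp: look_def fun_eq_iff split: sum.splits)
      ultimately show "satisfies M E p = P (look \<sigma> (\<lambda>i. E (g i)))" using p[of E] by simp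
    qed
  qed
qed

text \<open>The bound variable \<open>k\<close> turns into argument 0 and all other arguments move
  up by one. Named variables are thereby converted into the positional ones that
  \<open>dpred_ex\<close> quantifies.\<close>

lemma look_Exists: "(look \<sigma> v)(k := a) = look (\<lambda>i. if i = k then Inl 0 else map_sum Suc id (\<sigma> i)) (case_nat a v)"
proof
  show "((look \<sigma> v)(k := a)) i = look (\<lambda>i. if i = k then Inl 0 else map_sum Suc id (\<sigma> i)) (case_nat a v) i" for i
    by (cases "\<sigma> i") (simp_all add: look_def)
qed

lemma dpred_satisfies: "wf_formula M p \<Longrightarrow> dpred M (\<lambda>v. satisfies M (look \<sigma> v) p)"
proof (induction p arbitrary: \<sigma>)
  case (Eq s t)
  then show ?case
    by (intro dpred_atom[where A = "\<lambda>\<rho>. Eq (rename_term \<rho> s) (rename_term \<rho> t)"])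
      (auto simp: term_value_rename wf_rename)
next
  case (Less s t)
  then show ?case
    by (intro dpred_atom[where A = "\<lambda>\<rho>. Less (rename_term \<rho> s) (rename_term \<rho> t)"])
      (auto simp: term_value_rename wf_rename)
next
  case (Rel r ts)
  then show ?case
    by (intro dpred_atom[where A = "\<lambda>\<rho>. Rel r (map (rename_term \<rho>) ts)"])
      (auto simp: term_value_rename wf_rename list_all_iff o_def)
next
  case (Neg p)
  then have "wf_formula M p" by simp
  then show ?case unfolding satisfies.simps by (intro dpred_neg Neg.IH)
next
  case (Conj p q)
  then have "wf_formula M p" "wf_formula M q" by simp_all
  then show ?case unfolding satisfies.simps by (intro dpred_conj Conj.IH)
next
  case (Exists k p)
  then have "wf_formula M p" by simp
  then show ?case
    unfolding satisfies.simps look_Exists by (intro dpred_ex Exists.IH)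
qed

lemma dpred_less: "dpred M (\<lambda>v. v i < v j)"
  using dpred_satisfies[of M "Less (Var i) (Var j)" Inl] by (simp add: look_def)

lemma dpred_finite_vars:
  assumes "dpred M P" shows "\<exists>n::nat. \<forall>v w. (\<forall>i<n. v i = w i) \<longrightarrow> P v = P w"
proof -
  obtain e :: "nat \<Rightarrow> _" where e: "\<And>g h. infinite (- (range g \<union> range h)) \<Longrightarrow>
     (\<exists>p. wf_formula M p \<and> (\<forall>E. (\<forall>j. E (h j) = e j) \<longrightarrow> satisfies M E p = P (\<lambda>i. E (g i))))"
    by (rule dpredE[OF assms]) (rule that)
  define g h k :: "nat \<Rightarrow> nat" where "g i = 3 * i" and "h i = 3 * i + 1" and "k i = 3 * i + 2" for i
  have ghk: "g i \<noteq> h j" "g i \<noteq> k j" "h i \<noteq> k j" for i j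
    by (auto simp: g_def h_def k_def; presburger)+
  have "range k \<subseteq> - (range g \<union> range h)" using ghk[symmetric] by auto
  moreover have "infinite (range k)" using finite_imageD[of k UNIV] by (auto simp: inj_on_def k_def)
  ultimately have "infinite (- (range g \<union> range h))" using finite_subset by blast
  from e[OF this] obtain p where p: "\<And>E. (\<forall>j. E (h j) = e j) \<Longrightarrow> satisfies M E p = P (\<lambda>i. E (g i))" by blast
  obtain K where K: "\<And>E E'. (\<forall>i<(K::nat). E i = E' i) \<Longrightarrow> satisfies M E p = satisfies M E' p"
    using satisfies_finite_vars by blast
  define B where "B v i = (if i mod 3 = 0 then v (i div 3) else e (i div 3))" for v and i :: nat
  have "Suc (3 * j) div 3 = j" for j by presburger
  then have B: "B v (h j) = e j" "B v (g j) = v j" for v j by (simp_all add: B_def h_def g_def)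
  have "P v = P w" if "\<forall>i<K. v i = w i" for v w
  proof -
    have "satisfies M (B v) p = satisfies M (B w) p"
      by (rule K) (use that in \<open>auto simp: B_def\<close>)
    then show ?thesis using p[of "B v"] p[of "B w"] B by simp
  qed
  then show ?thesis by blast
qed

lemma definable_imp_dpred:
  assumes "definable M n X" shows "dpred M (\<lambda>v. map v [0..<n] \<in> X)"
proof -
  obtain p e where "wf_formula M p"
    and X: "X = {xs. length xs = n \<and> satisfies M (\<lambda>i. if i < n then xs ! i else e i) p}"
    using assms unfolding definable_def by blast
  from dpred_satisfies[OF this(1), of "\<lambda>i. if i < n then Inl i else Inr (e i)"]
  show ?thesis
    unfolding X by (rule back_subst[of "dpred M"]) (auto simp: fun_eq_iff look_def intro!: arg_cong2[of _ _ _ _ "satisfies M"])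
qed

lemma dpred_imp_definable:
  assumes P: "dpred M (\<lambda>v. map v [0..<n] \<in> X)" and X: "\<And>x. x \<in> X \<Longrightarrow> length x = n"
  shows "definable M n X"
proof -
  obtain e :: "nat \<Rightarrow> _" where e: "\<And>g h. infinite (- (range g \<union> range h)) \<Longrightarrow>
     (\<exists>p. wf_formula M p \<and> (\<forall>E. (\<forall>j. E (h j) = e j) \<longrightarrow> satisfies M E p = (map (\<lambda>i. E (g i)) [0..<n] \<in> X)))"
    by (rule dpredE[OF P]) (rule that)
  \<comment> \<open>The coordinates keep their places below \<open>n\<close>, all other arguments
    share the place \<open>n\<close>, and the parameters take every second place beyond it, so that
    infinitely many remain free.\<close>
  define g h k :: "nat \<Rightarrow> nat" where "g i = (if i < n then i else n)"
    and "h i = n + 1 + 2 * i" and "k i = n + 2 + 2 * i" for i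
  have ghk: "g i \<noteq> h j" "g i \<noteq> k j" "h i \<noteq> k j" for i j
    by (auto simp: g_def h_def k_def; presburger)+
  have "range k \<subseteq> - (range g \<union> range h)" using ghk[symmetric] by auto
  moreover have "infinite (range k)" using finite_imageD[of k UNIV] by (auto simp: inj_on_def k_def)
  ultimately have "infinite (- (range g \<union> range h))" using finite_subset by blast
  from e[OF this] obtain p where "wf_formula M p"
    and p: "\<And>E. (\<forall>j. E (h j) = e j) \<Longrightarrow> satisfies M E p = (map (\<lambda>i. E (g i)) [0..<n] \<in> X)" by blast
  let ?e = "\<lambda>i. e ((i - n - 1) div 2)"
  have "satisfies M (\<lambda>i. if i < n then xs ! i else ?e i) p = (xs \<in> X)" if "length xs = n" for xs
  proof -
    have "map (\<lambda>i. if g i < n then xs ! g i else ?e (g i)) [0..<n] = xs"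
      using that by (intro nth_equalityI) (auto simp: g_def)
    then show ?thesis
      using p[of "\<lambda>i. if i < n then xs ! i else ?e i"] by (simp add: h_def)
  qed
  then have "X = {xs. length xs = n \<and> satisfies M (\<lambda>i. if i < n then xs ! i else ?e i) p}"
    using X by blast
  then show ?thesis unfolding definable_def using \<open>wf_formula M p\<close> by (intro exI[of _ p] exI[of _ ?e]) blast
qed

section \<open>Definability in an abstract o-minimal structure\<close>

named_theorems def_intro

text \<open>The neighbourhood is two-sided, so at an endpoint of the line \<open>near\<close> fails
  for every predicate. Endpoints therefore count among the boundary points in
  \<open>finite_boundary\<close>.\<close>

definition near :: "'m::linorder \<Rightarrow> ('m \<Rightarrow> bool) \<Rightarrow> bool" where
  "near x Q \<longleftrightarrow> (\<exists>a b. a < x \<and> x < b \<and> (\<forall>z. a < z \<longrightarrow> z < b \<longrightarrow> Q z))"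

lemma near_self: "near x Q \<Longrightarrow> Q x"
  by (auto simp: near_def)

lemma near_mono: "near x P \<Longrightarrow> (\<And>z. P z \<Longrightarrow> Q z) \<Longrightarrow> near x Q"
  by (auto simp: near_def)

lemma near_conj: "near x P \<Longrightarrow> near x Q \<Longrightarrow> near x (\<lambda>z. P z \<and> Q z)"
proof -
  assume "near x P" "near x Q"
  then obtain a b c d where "a < x" "x < b" "c < x" "x < d"
    "\<forall>z. a < z \<longrightarrow> z < b \<longrightarrow> P z" "\<forall>z. c < z \<longrightarrow> z < d \<longrightarrow> Q z"
    unfolding near_def by blast
  then show ?thesis
    unfolding near_def by (intro exI[of _ "max a c"] exI[of _ "min b d"]) auto
qed

lemma near_interval: "a < x \<Longrightarrow> x < b \<Longrightarrow> near x (\<lambda>z. a < z \<and> z < b)"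
  by (auto simp: near_def)

definition islub :: "('m \<Rightarrow> 'm \<Rightarrow> bool) \<Rightarrow> ('m \<Rightarrow> bool) \<Rightarrow> 'm \<Rightarrow> bool" where
  "islub r A s \<longleftrightarrow> (\<forall>z. A z \<longrightarrow> z = s \<or> r z s) \<and> (\<forall>t. r t s \<longrightarrow> (\<exists>z. A z \<and> r t z))"

text \<open>Arguments with a direction are carried out once for a relation \<open>r\<close> that is
  the order or its reverse. Passing to the converse by \<open>lin_conv\<close> swaps left and right,
  suprema and infima, increasing and decreasing functions.\<close>

definition lin :: "('m::linorder \<Rightarrow> 'm \<Rightarrow> bool) \<Rightarrow> bool" where
  "lin r \<longleftrightarrow> r = (<) \<or> r = (>)"

lemma lin_less: "lin (<)" and lin_greater: "lin (>)"
  by (auto simp: lin_def)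

lemma lin_conv: "lin r \<Longrightarrow> lin (\<lambda>x y. r y x)"
  by (auto simp: lin_def fun_eq_iff)

lemma lin_trans: "lin r \<Longrightarrow> r x y \<Longrightarrow> r y z \<Longrightarrow> r x z"
  and lin_irrefl: "lin r \<Longrightarrow> \<not> r x x"
  and lin_asym: "lin r \<Longrightarrow> r x y \<Longrightarrow> \<not> r y x"
  and lin_total: "lin r \<Longrightarrow> x \<noteq> y \<Longrightarrow> r x y \<or> r y x"
  by (auto simp: lin_def)

lemma lin_dense: "lin r \<Longrightarrow> r (x::'m::dense_linorder) y \<Longrightarrow> \<exists>z. r x z \<and> r z y"
  by (auto simp: lin_def dest: dense)

text \<open>From here on formulas do not occur: only these closure properties of definable
  predicates are used, and \<open>dpred M\<close> has them. As valuations are infinite,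
  \<open>Def_finite_vars\<close> records that each predicate still has finitely many
  arguments.\<close>

locale omin =
  fixes Def :: "((nat \<Rightarrow> 'm::dense_linorder) \<Rightarrow> bool) \<Rightarrow> bool"
  assumes Def_neg: "Def P \<Longrightarrow> Def (\<lambda>v. \<not> P v)"
    and Def_conj: "Def P \<Longrightarrow> Def Q \<Longrightarrow> Def (\<lambda>v. P v \<and> Q v)"
    and Def_ex_nat: "Def P \<Longrightarrow> Def (\<lambda>v. \<exists>a. P (case_nat a v))"
    and Def_less_var: "Def (\<lambda>v. v i < v j)"
    and Def_look: "Def P \<Longrightarrow> Def (\<lambda>v. P (look \<sigma> v))"
    and Def_finite_vars: "Def P \<Longrightarrow> \<exists>n::nat. \<forall>v w. (\<forall>i<n. v i = w i) \<longrightarrow> P v = P w"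
    and nontrivial: "\<exists>a b::'m. a \<noteq> b"
    and omin: "Def (\<lambda>v. v 0 \<in> A) \<Longrightarrow>
      \<exists>F. finite F \<and> (\<forall>J\<in>F. (\<exists>a. J = {a}) \<or> open_interval J) \<and> A = \<Union>F"
begin

text \<open>Predicates with distinguished arguments are turned into predicates on valuations by shifting
  the valuation, so that a quantifier is removed by a rule whose premise has no bound variable.\<close>

abbreviation DefP :: "('m \<Rightarrow> (nat \<Rightarrow> 'm) \<Rightarrow> bool) \<Rightarrow> bool" where
  "DefP P \<equiv> Def (\<lambda>w. P (w 0) (\<lambda>i. w (Suc i)))"

definition dfn :: "((nat \<Rightarrow> 'm) \<Rightarrow> 'm) \<Rightarrow> bool" where
  "dfn t \<longleftrightarrow> Def (\<lambda>w. w 0 = t (\<lambda>i. w (Suc i)))"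

lemma Def_disj: "Def P \<Longrightarrow> Def Q \<Longrightarrow> Def (\<lambda>v. P v \<or> Q v)"
  using Def_neg[OF Def_conj[OF Def_neg Def_neg, of P Q]] by simp

lemma Def_imp: "Def P \<Longrightarrow> Def Q \<Longrightarrow> Def (\<lambda>v. P v \<longrightarrow> Q v)"
  unfolding imp_conv_disj by (intro Def_disj Def_neg)

lemma Def_eq_var: "Def (\<lambda>v. v i = v j)"
  using Def_conj[OF Def_neg[OF Def_less_var[of i j]] Def_neg[OF Def_less_var[of j i]]]
  by (rule back_subst[of Def]) (auto simp: fun_eq_iff)

lemma Def_const: "Def (\<lambda>v. b)"
  using Def_eq_var[of 0 0] Def_neg[OF Def_eq_var[of 0 0]] by (cases b) simp_all

lemma Def_ex: "DefP Q \<Longrightarrow> Def (\<lambda>v. \<exists>x. Q x v)"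
  by (drule Def_ex_nat) simp

lemma Def_all: "DefP Q \<Longrightarrow> Def (\<lambda>v. \<forall>x. Q x v)"
  using Def_neg[OF Def_ex[of "\<lambda>x v. \<not> Q x v"]] Def_neg[of "\<lambda>w. Q (w 0) (\<lambda>i. w (Suc i))"] by simp

lemma Def_fball: "finite A \<Longrightarrow> (\<And>a. a \<in> A \<Longrightarrow> Def (P a)) \<Longrightarrow> Def (\<lambda>v. \<forall>a\<in>A. P a v)"
  by (induction A rule: finite_induct) (auto intro: Def_const Def_conj)

lemma Def_fbex: "finite A \<Longrightarrow> (\<And>a. a \<in> A \<Longrightarrow> Def (P a)) \<Longrightarrow> Def (\<lambda>v. \<exists>a\<in>A. P a v)"
  by (induction A rule: finite_induct) (auto intro: Def_const Def_disj)

text \<open>The tuple takes the first \<open>n\<close> positions of the shifted valuation; each step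
  of the induction quantifies position 0.\<close>

lemma Def_list_ex:
  "Def (\<lambda>w. Q (map w [0..<n]) (\<lambda>i. w (i + n))) \<Longrightarrow> Def (\<lambda>v. \<exists>xs. length xs = n \<and> Q xs v)"
proof (induction n arbitrary: Q)
  case 0
  then show ?case by simp
next
  case (Suc n)
  have "map w [0..<Suc n] = w 0 # map (\<lambda>i. w (Suc i)) [0..<n]" for w :: "nat \<Rightarrow> 'm"
    by (simp add: upt_conv_Cons map_Suc_upt[symmetric] del: upt_Suc map_Suc_upt)
  with Suc.prems have "Def (\<lambda>w. Q (w 0 # map (\<lambda>i. w (Suc i)) [0..<n]) (\<lambda>i. w (Suc (i + n))))"
    by simp
  then have "Def (\<lambda>v. \<exists>x. Q (x # map v [0..<n]) (\<lambda>i. v (i + n)))"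
    by (rule Def_ex[of "\<lambda>x v. Q (x # map v [0..<n]) (\<lambda>i. v (i + n))"])
  from Suc.IH[of "\<lambda>ys v. \<exists>x. Q (x # ys) v", OF this]
  show ?case
    by (rule back_subst[of Def]) (auto simp: fun_eq_iff length_Suc_conv)
qed

text \<open>By finite dependence only the first \<open>n\<close> substituted values matter. They are
  quantified as a tuple \<open>xs\<close> whose entries satisfy the graph predicates of the
  substituted functions.\<close>

lemma Def_subst:
  assumes "Def P" "\<And>i. dfn (\<lambda>v. s v i)"
  shows "Def (\<lambda>v. P (s v))"
proof -
  obtain n where n: "\<And>v w. (\<forall>i<(n::nat). v i = w i) \<Longrightarrow> P v = P w"
    using Def_finite_vars[OF assms(1)] by blast
  have "Def (\<lambda>w. w i = s (\<lambda>j. w (j + n)) i)" for i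
    using Def_look[OF assms(2)[of i, unfolded dfn_def], of "case_nat (Inl i) (\<lambda>j. Inl (j + n))"] by (simp add: look_def)
  moreover have "Def (\<lambda>w. P (\<lambda>i. if i < n then w i else undefined))"
    using Def_look[OF assms(1), of "\<lambda>i. if i < n then Inl i else Inr undefined"]
    by (rule back_subst[of Def]) (auto simp: fun_eq_iff look_def intro!: arg_cong[of _ _ P])
  ultimately have "Def (\<lambda>w. (\<forall>i\<in>{..<n}. w i = s (\<lambda>j. w (j + n)) i) \<and>
      P (\<lambda>i. if i < n then w i else undefined))"
    by (intro Def_conj Def_fball) auto
  then have "Def (\<lambda>w. (\<forall>i\<in>{..<n}. map w [0..<n] ! i = s (\<lambda>j. w (j + n)) i) \<and>
      P (\<lambda>i. if i < n then map w [0..<n] ! i else undefined))"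
    by (rule back_subst[of Def]) (auto simp: fun_eq_iff cong: if_cong)
  from Def_list_ex[where Q = "\<lambda>xs v. (\<forall>i\<in>{..<n}. xs ! i = s v i) \<and>
      P (\<lambda>i. if i < n then xs ! i else undefined)", OF this]
  show ?thesis
  proof (rule back_subst[of Def], intro ext)
    fix v
    have *: "P (\<lambda>i. if i < n then xs ! i else undefined) = P (s v)" if "\<forall>i\<in>{..<n}. xs ! i = s v i" for xs
      by (rule n) (use that in auto)
    have "length (map (s v) [0..<n]) = n \<and> (\<forall>i\<in>{..<n}. map (s v) [0..<n] ! i = s v i)" by simp
    then show "(\<exists>xs. length xs = n \<and> (\<forall>i\<in>{..<n}. xs ! i = s v i) \<and>
        P (\<lambda>i. if i < n then xs ! i else undefined)) = P (s v)"
      using * by blast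
  qed
qed

lemma DefP_app:
  assumes "DefP P" "dfn t" "\<And>i. dfn (\<lambda>v. s v i)"
  shows "Def (\<lambda>v. P (t v) (s v))"
proof -
  have "dfn (\<lambda>v. case_nat (t v) (s v) i)" for i
    using assms(2,3) by (cases i) simp_all
  from Def_subst[OF assms(1), of "\<lambda>v. case_nat (t v) (s v)", OF this] show ?thesis by simp
qed

lemma dfn_var [def_intro]: "dfn (\<lambda>v. v i)"
  unfolding dfn_def by (rule Def_eq_var)

lemma dfn_const [def_intro]: "dfn (\<lambda>v. c)"
  using Def_look[OF Def_eq_var[of 0 1], of "case_nat (Inl 0) (\<lambda>_. Inr c)"] by (simp add: look_def dfn_def)

lemma dfn_upd [def_intro]:
  "(\<And>i. dfn (\<lambda>v. s v i)) \<Longrightarrow> dfn t \<Longrightarrow> dfn (\<lambda>v. (fun_upd (s v) l (t v)) i)"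
  by (cases "i = l") simp_all

lemma dfn_comp:
  assumes "dfn t" "\<And>i. dfn (\<lambda>v. s v i)" shows "dfn (\<lambda>v. t (s v))"
proof -
  have "dfn (\<lambda>w. case_nat (w 0) (s (\<lambda>i. w (Suc i))) i)" for i
  proof (cases i)
    case (Suc j)
    then show ?thesis
      using Def_look[OF assms(2)[of j, unfolded dfn_def], of "\<lambda>i. Inl (if i = 0 then 0 else Suc i)"]
      by (simp add: look_def dfn_def)
  qed (simp add: dfn_var)
  from Def_subst[OF assms(1)[unfolded dfn_def], of "\<lambda>w. case_nat (w 0) (s (\<lambda>i. w (Suc i)))", OF this]
  show ?thesis by (simp add: dfn_def)
qed

lemma D2_app:
  assumes "Def (\<lambda>v. R (v 0) (v (Suc 0)))" "dfn s" "dfn t" shows "Def (\<lambda>v. R (s v) (t v))"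
proof -
  have "dfn (\<lambda>v. if i = 0 then s v else t v)" for i :: nat
    using assms(2,3) by (cases i) simp_all
  from Def_subst[OF assms(1), of "\<lambda>v i. if i = 0 then s v else t v", OF this] show ?thesis by simp
qed

lemma Def_less [def_intro]: "dfn s \<Longrightarrow> dfn t \<Longrightarrow> Def (\<lambda>v. s v < t v)"
  by (rule D2_app[where R = "(<)", OF Def_less_var])

lemma Def_eq [def_intro]: "dfn s \<Longrightarrow> dfn t \<Longrightarrow> Def (\<lambda>v. s v = t v)"
  by (rule D2_app[where R = "(=)", OF Def_eq_var])

lemma Def_le [def_intro]: assumes "dfn s" "dfn t" shows "Def (\<lambda>v. s v \<le> t v)"
  using Def_neg[OF Def_less[OF assms(2,1)]] by (simp add: not_less)

lemmas [def_intro] = Def_const Def_neg Def_conj Def_disj Def_imp Def_ex Def_all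

abbreviation D1 :: "('m \<Rightarrow> bool) \<Rightarrow> bool" where "D1 A \<equiv> Def (\<lambda>v. A (v 0))"

abbreviation D2 :: "('m \<Rightarrow> 'm \<Rightarrow> bool) \<Rightarrow> bool" where "D2 R \<equiv> Def (\<lambda>v. R (v 0) (v (Suc 0)))"

abbreviation Dfun :: "('m \<Rightarrow> 'm) \<Rightarrow> bool" where "Dfun f \<equiv> D2 (\<lambda>x y. y = f x)"

lemma D1_app: "D1 A \<Longrightarrow> dfn t \<Longrightarrow> Def (\<lambda>v. A (t v))"
  by (rule DefP_app[of "\<lambda>x v. A x" t "\<lambda>v i. v i"]) (auto intro: def_intro)

lemma Dfun_app: assumes "Dfun f" "dfn t" shows "dfn (\<lambda>v. f (t v))"
proof -
  have "dfn (\<lambda>w. t (\<lambda>i. w (Suc i)))" by (intro dfn_comp[OF assms(2)] dfn_var)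
  from D2_app[OF assms(1) this dfn_var, of 0] show ?thesis unfolding dfn_def .
qed

lemma D2_lin: "lin r \<Longrightarrow> D2 r"
  unfolding lin_def by (auto intro: def_intro)

lemma Def_lin: "lin r \<Longrightarrow> dfn s \<Longrightarrow> dfn t \<Longrightarrow> Def (\<lambda>v. r (s v) (t v))"
  by (rule D2_app[OF D2_lin])

lemma Dfun_const: "Dfun (\<lambda>x. c)"
  by (intro def_intro)

lemma Def_near [def_intro]:
  assumes "DefP Q" "dfn t" shows "Def (\<lambda>v. near (t v) (\<lambda>z. Q z v))"
  unfolding near_def
  by (intro def_intro DefP_app[OF assms(1)] dfn_comp[OF assms(2)])

lemma Def_islub [def_intro]:
  assumes "DefP Q" "dfn t" "lin r" shows "Def (\<lambda>v. islub r (\<lambda>z. Q z v) (t v))"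
  unfolding islub_def
  by (intro def_intro Def_lin[OF assms(3)] DefP_app[OF assms(1)] dfn_comp[OF assms(2)])

text \<open>Unique values give a function on the domain of \<open>R\<close>. Outside it the constant
  \<open>undefined\<close> is assigned, which costs one parameter and makes the graph of a total
  function definable.\<close>

lemma Dfun_from_relation:
  assumes "D2 R" "\<And>x y y'. R x y \<Longrightarrow> R x y' \<Longrightarrow> y = y'"
  obtains f where "Dfun f" "\<And>x y. R x y \<Longrightarrow> f x = y"
proof -
  define f where "f x = (if \<exists>y. R x y then SOME y. R x y else undefined)" for x
  have f: "if \<exists>y. R x y then R x (f x) else f x = undefined" for x
    by (simp add: f_def someI_ex)
  have *: "f x = y" if "R x y" for x y
  proof (rule assms(2))
    show "R x (f x)" using f[of x] that by (auto split: if_splits)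
  qed (rule that)
  have "y = f x \<longleftrightarrow> R x y \<or> \<not> (\<exists>y. R x y) \<and> y = undefined" for x y
    using *[of x y] f[of x] by (metis (full_types))
  moreover have "D2 (\<lambda>x y. R x y \<or> \<not> (\<exists>y. R x y) \<and> y = undefined)"
    by (intro def_intro D2_app[OF assms(1)])
  ultimately have "Dfun f" by simp
  with * show thesis using that by blast
qed

section \<open>Definable subsets of the line\<close>

lemma infinite_imp_interval:
  assumes "D1 A" "infinite {x. A x}"
  shows "\<exists>a b. a < b \<and> (\<forall>z. a < z \<longrightarrow> z < b \<longrightarrow> A z)"
proof -
  obtain F where F: "finite F" "\<forall>J\<in>F. (\<exists>a. J = {a}) \<or> open_interval J" "{x. A x} = \<Union>F"
    using omin[of "{x. A x}"] assms(1) by auto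
  then obtain J where J: "J \<in> F" "infinite J" using assms(2) by (metis finite_Union)
  then have "open_interval J" using F(2) by auto
  moreover obtain p q :: 'm where "p < q" using nontrivial by (metis linorder_neqE)
  moreover obtain x where "x \<in> J" using J infinite_imp_nonempty by blast
  ultimately have "\<exists>a b. a < b \<and> {a<..<b} \<subseteq> J" unfolding open_interval_def
  proof (elim disjE exE)
    fix a b assume "J = {a<..<b}"
    with \<open>x \<in> J\<close> show ?thesis by (intro exI[of _ a] exI[of _ b]) auto
  next
    fix a b assume "J = {a<..}"
    with \<open>x \<in> J\<close> show ?thesis by (intro exI[of _ a] exI[of _ x]) auto
  next
    fix a b assume "J = {..<b}"
    with \<open>x \<in> J\<close> show ?thesis by (intro exI[of _ x] exI[of _ b]) auto
  qed blast
  then show ?thesis using J F(3) by fastforce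
qed

lemma infinite_imp_intervalE:
  assumes "infinite {x. A x}" "D1 A"
  obtains a b where "a < b" "\<And>z. a < z \<Longrightarrow> z < b \<Longrightarrow> A z"
  using infinite_imp_interval[OF assms(2,1)] by blast

lemma interval_infinite: "a < b \<Longrightarrow> (\<And>z::'m. a < z \<Longrightarrow> z < b \<Longrightarrow> A z) \<Longrightarrow> infinite {x. A x}"
  using infinite_Ioo[of a b] infinite_super[of "{a<..<b}" "{x. A x}"] by (simp add: subset_eq)

text \<open>By o-minimality infinity is witnessed by an interval, and that is a first-order
  condition. Hence finiteness of the fibres of a family is itself definable, without a bound on
  their size.\<close>

lemma infinite_iff_interval:
  "D1 A \<Longrightarrow> infinite {x. A x} \<longleftrightarrow> (\<exists>a b. a < b \<and> (\<forall>z. a < z \<longrightarrow> z < b \<longrightarrow> A z))"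
proof
  assume "\<exists>a b. a < b \<and> (\<forall>z. a < z \<longrightarrow> z < b \<longrightarrow> A z)"
  then obtain a b where "a < b" "\<And>z. a < z \<Longrightarrow> z < b \<Longrightarrow> A z" by blast
  then show "infinite {x. A x}" by (rule interval_infinite)
qed (rule infinite_imp_interval)

lemma near_infinite: "near (x::'m) A \<Longrightarrow> infinite {z. A z}"
proof -
  assume "near x A"
  then obtain a b where "a < x" "x < b" and ab: "\<And>z. a < z \<Longrightarrow> z < b \<Longrightarrow> A z"
    unfolding near_def by blast
  show ?thesis by (rule interval_infinite[of a b]) (use ab less_trans[OF \<open>a < x\<close> \<open>x < b\<close>] in auto)
qed

lemma DefP_fix: "DefP Q \<Longrightarrow> D1 (\<lambda>x. Q x v)"
  by (rule DefP_app[of Q "\<lambda>w. w 0" "\<lambda>w. v"]) (auto intro: def_intro)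

lemma Def_infinite [def_intro]:
  assumes "DefP Q" shows "Def (\<lambda>v. infinite {x. Q x v})"
  unfolding infinite_iff_interval[OF DefP_fix[OF assms]]
  by (intro def_intro DefP_app[OF assms])

lemma Def_finite [def_intro]:
  assumes "DefP Q" shows "Def (\<lambda>v. finite {x. Q x v})"
  using Def_neg[OF Def_infinite[OF assms]] by simp

text \<open>Definable completeness, which stands in for completeness of the order: a bounded piece
  of the decomposition is empty or has a supremum, and the supremum of the union is the largest of
  these.\<close>

lemma lub_less:
  assumes "D1 A" "A x" "\<And>z. A z \<Longrightarrow> z \<le> u"
  shows "\<exists>s. islub (<) A s"
proof -
  obtain F where F: "finite F" "\<forall>J\<in>F. (\<exists>a. J = {a}) \<or> open_interval J" "{x. A x} = \<Union>F"
    using omin[of "{x. A x}"] assms(1) by auto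
  have piece: "J = {} \<or> (\<exists>s. islub (<) (\<lambda>z. z \<in> J) s)"
    if "(\<exists>a. J = {a}) \<or> open_interval J" and u: "\<forall>z\<in>J. z \<le> u" for J
  proof (rule disjCI)
    assume nolub: "\<nexists>s. islub (<) (\<lambda>z. z \<in> J) s"
    have "u \<notin> J"
    proof
      assume "u \<in> J"
      then have "islub (<) (\<lambda>z. z \<in> J) u" using u by (auto simp: islub_def)
      then show False using nolub by blast
    qed
    have "\<nexists>a. J = {a}"
    proof
      assume "\<exists>a. J = {a}"
      then show False using nolub by (auto simp: islub_def)
    qed
    with that obtain a b where "J = {a<..<b} \<or> J = {a<..} \<or> J = {..<b} \<or> J = UNIV"
      by (auto simp: open_interval_def)
    then consider "J = {a<..<b}" | "J = {a<..}" | "J = {..<b}" | "J = UNIV" by blast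
    then show "J = {}"
    proof cases
      case 1
      have "islub (<) (\<lambda>z. z \<in> J) b" if "a < b"
        unfolding islub_def
      proof (intro conjI allI impI)
        fix t assume "t < b"
        then obtain z where "max a t < z" "z < b" using dense[of "max a t" b] \<open>a < b\<close> by auto
        then show "\<exists>z. z \<in> J \<and> t < z" using 1 by auto
      qed (use 1 in auto)
      then have "\<not> a < b" using nolub by blast
      then show ?thesis using 1 by simp
    next
      case 2
      \<comment> \<open>A nonempty ray to the right that is bounded by \<open>u\<close> would
        contain \<open>u\<close>.\<close>
      then show ?thesis using \<open>u \<notin> J\<close> u by (auto intro: less_le_trans)
    next
      case 3
      have "islub (<) (\<lambda>z. z \<in> J) b"
        using 3 by (auto simp: islub_def dest: dense)
      then show ?thesis using nolub by blast
    next
      case 4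
      then show ?thesis using \<open>u \<notin> J\<close> by simp
    qed
  qed
  have "\<Union>F = {} \<or> (\<exists>s. islub (<) (\<lambda>z. z \<in> \<Union>F) s)"
    if "finite F" "\<forall>J\<in>F. (\<exists>a. J = {a}) \<or> open_interval J" "\<forall>z\<in>\<Union>F. z \<le> u" for F
    using that
  proof (induction F rule: finite_induct)
    case (insert J F)
    then consider "J = {}" | "\<Union>F = {}" "J \<noteq> {}" | "J \<noteq> {}" "\<Union>F \<noteq> {}" by blast
    then show ?case
    proof cases
      case 1
      then show ?thesis using insert by auto
    next
      case 2
      then have "\<Union>(insert J F) = J" by blast
      then show ?thesis using piece[of J] insert.prems by (metis UnionI insertI1)
    next
      case 3
      then obtain s t where s: "islub (<) (\<lambda>z. z \<in> J) s" and t: "islub (<) (\<lambda>z. z \<in> \<Union>F) t"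
        using piece[of J] insert by auto
      have "islub (<) (\<lambda>z. z \<in> \<Union>(insert J F)) (max s t)"
        unfolding islub_def
      proof (intro conjI allI impI)
        fix z assume "z \<in> \<Union>(insert J F)"
        then have "z \<le> s \<or> z \<le> t" using s t by (auto simp: islub_def le_less)
        then show "z = max s t \<or> z < max s t" by (auto simp: max_def le_less)
      next
        fix u assume "u < max s t"
        then show "\<exists>z. z \<in> \<Union>(insert J F) \<and> u < z"
          using s t unfolding islub_def less_max_iff_disj by blast
      qed
      then show ?thesis by blast
    qed
  qed simp
  from this[OF F(1,2)] have "\<Union>F = {} \<or> (\<exists>s. islub (<) (\<lambda>z. z \<in> \<Union>F) s)"
    using F(3) assms(3) by blast
  then show ?thesis using F(3)[symmetric] assms(2) by auto
qed

lemma lub_ex: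
  assumes r: "lin r" and A: "D1 A" "A x" "\<And>z. A z \<Longrightarrow> z = u \<or> r z u"
  shows "\<exists>s. islub r A s"
  using r unfolding lin_def
proof
  assume "r = (<)"
  then show ?thesis using lub_less[of A x u] A by (auto simp: le_less)
next
  assume r: "r = (>)"
  \<comment> \<open>An infimum is found as the supremum of the definable set of lower bounds, which
    \<open>x\<close> bounds from above.\<close>
  let ?L = "\<lambda>t. \<forall>z. A z \<longrightarrow> t \<le> z"
  have "D1 ?L" by (intro def_intro D1_app[OF A(1)])
  then obtain s where s: "islub (<) ?L s"
    using lub_less[of ?L u x] A r by (auto simp: le_less)
  have "islub (>) A s"
    unfolding islub_def
  proof (intro conjI allI impI)
    fix z assume "A z"
    then have "\<not> z < s" using s unfolding islub_def by (meson leD)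
    then show "z = s \<or> z > s" by auto
  next
    fix t assume "t > s"
    then have "\<not> ?L t" using s by (auto simp: islub_def)
    then show "\<exists>z. A z \<and> t > z" by (auto simp: not_le)
  qed
  then show ?thesis using r by blast
qed

text \<open>An interval of boundary points cannot exist: \<open>A\<close> or its complement is
  infinite on it, hence contains a subinterval, and the points of that one are not boundary
  points.\<close>

lemma finite_boundary:
  assumes "D1 A" shows "finite {x. \<not> near x A \<and> \<not> near x (\<lambda>z. \<not> A z)}"
proof (rule ccontr)
  assume "infinite {x. \<not> near x A \<and> \<not> near x (\<lambda>z. \<not> A z)}"
  moreover have "D1 (\<lambda>x. \<not> near x A \<and> \<not> near x (\<lambda>z. \<not> A z))"
    by (intro def_intro D1_app[OF assms])
  ultimately obtain a b where ab: "a < b"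
    "\<And>x. a < x \<Longrightarrow> x < b \<Longrightarrow> \<not> near x A \<and> \<not> near x (\<lambda>z. \<not> A z)"
    by (rule infinite_imp_intervalE) blast
  have *: False if "D1 B" "\<And>x. a < x \<Longrightarrow> x < b \<Longrightarrow> \<not> near x B"
    and inf: "infinite {x. a < x \<and> x < b \<and> B x}" for B
  proof -
    have D: "D1 (\<lambda>x. a < x \<and> x < b \<and> B x)" by (intro def_intro D1_app[OF that(1)])
    obtain c d where cd: "c < d" "\<And>x. c < x \<Longrightarrow> x < d \<Longrightarrow> a < x \<and> x < b \<and> B x"
      by (rule infinite_imp_intervalE[OF inf D]) (rule that)
    obtain x where "c < x" "x < d" using dense \<open>c < d\<close> by blast
    then have "near x B" using cd unfolding near_def by blast
    then show False using that(2) cd \<open>c < x\<close> \<open>x < d\<close> by blast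
  qed
  have "{x. a < x \<and> x < b \<and> A x} \<union> {x. a < x \<and> x < b \<and> \<not> A x} = {a<..<b}" by auto
  then have "infinite {x. a < x \<and> x < b \<and> A x} \<or> infinite {x. a < x \<and> x < b \<and> \<not> A x}"
    using infinite_Ioo[OF \<open>a < b\<close>] by (metis finite_UnI)
  then show False
    using *[of A] *[of "\<lambda>z. \<not> A z"] ab assms Def_neg by blast
qed

definition conv :: "('m \<Rightarrow> bool) \<Rightarrow> bool" where
  "conv C \<longleftrightarrow> (\<forall>x y z. C x \<longrightarrow> C y \<longrightarrow> x < z \<longrightarrow> z < y \<longrightarrow> C z)"

text \<open>The supremum of the initial segment on which \<open>A\<close> holds is a point of
  \<open>C\<close>, and local constancy there pushes the segment further unless it already reaches
  the end. Definable suprema thus make convex sets connected.\<close>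

lemma connected:
  assumes "D1 A" "conv C" "\<And>z. C z \<Longrightarrow> near z A \<or> near z (\<lambda>z. \<not> A z)" "C x" "C y" "A x"
  shows "A y"
proof -
  have right: "A y" if A: "D1 A" "\<And>z. C z \<Longrightarrow> near z A \<or> near z (\<lambda>z. \<not> A z)" and "C x" "C y" "A x" "x < y" for A x y
  proof (rule ccontr)
    assume "\<not> A y"
    let ?S = "\<lambda>z. x \<le> z \<and> z \<le> y \<and> (\<forall>w. x \<le> w \<longrightarrow> w \<le> z \<longrightarrow> A w)"
    have "D1 ?S" by (intro def_intro D1_app[OF A(1)])
    moreover have "?S x" using \<open>A x\<close> \<open>x < y\<close> by auto
    ultimately obtain s where s: "islub (<) ?S s" using lub_less[of ?S x y] by auto
    have sx: "x \<le> s" and sy: "s \<le> y"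
    proof -
      have "x = s \<or> x < s" using s \<open>?S x\<close> unfolding islub_def by blast
      then show "x \<le> s" by auto
      show "s \<le> y" using s unfolding islub_def by (meson not_le leD)
    qed
    have below: "A w" if "x \<le> w" "w < s" for w
      using s that unfolding islub_def by (meson less_imp_le)
    have "C s" using assms(2) \<open>C x\<close> \<open>C y\<close> sx sy unfolding conv_def by (metis le_less)
    then consider "near s A" | "near s (\<lambda>z. \<not> A z)" using A(2) by blast
    then show False
    proof cases
      case 1
      then have "A s" by (rule near_self)
      then have "s < y" using sy \<open>\<not> A y\<close> by (auto simp: le_less)
      from 1 obtain a b where ab: "a < s" "s < b" "\<And>z. a < z \<Longrightarrow> z < b \<Longrightarrow> A z"
        unfolding near_def by blast
      obtain t where t: "s < t" "t < min b y" using dense[of s "min b y"] ab \<open>s < y\<close> by auto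
      have "A w" if "x \<le> w" "w \<le> t" for w
      proof (cases "w < s")
        case False
        then have "a < w" "w < b" using that t ab(1) by auto
        then show ?thesis by (rule ab(3))
      qed (use below that in blast)
      then have "?S t" using t sx by auto
      then have "t = s \<or> t < s" using s unfolding islub_def by blast
      then show False using t by auto
    next
      case 2
      then have "\<not> A s" using near_self by blast
      then have "x < s" using sx \<open>A x\<close> by (auto simp: le_less)
      from 2 obtain a b where ab: "a < s" "s < b" "\<And>z. a < z \<Longrightarrow> z < b \<Longrightarrow> \<not> A z"
        unfolding near_def by blast
      obtain t where "max a x < t" "t < s" using dense[of "max a x" s] ab \<open>x < s\<close> by auto
      then show False using below[of t] ab by (simp add: less_imp_le)
    qed
  qed
  show ?thesis
  proof (rule ccontr)
    assume "\<not> A y"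
    then consider "x < y" | "y < x" using assms(6) by (metis linorder_neqE)
    then show False
    proof cases
      case 1
      then show False using right[of A x y] assms \<open>\<not> A y\<close> by blast
    next
      case 2
      have "D1 (\<lambda>z. \<not> A z)" by (intro def_intro D1_app[OF assms(1)])
      from right[OF this, of y x] show False using assms 2 \<open>\<not> A y\<close> by auto
    qed
  qed
qed

lemma conv_lin: "lin r \<Longrightarrow> conv (\<lambda>z. r a z \<and> r z b)"
  unfolding lin_def conv_def by auto

lemma avoid_finite:
  assumes "lin r" "r a c" "finite (B :: 'm set)"
  shows "\<exists>b. r a b \<and> (b = c \<or> r b c) \<and> (\<forall>z\<in>B. \<not> (r a z \<and> r z b))"
  using assms(3)
proof (induction B rule: finite_induct)
  case empty
  then show ?case using assms(2) by blast
next
  case (insert x B)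
  then obtain b where b: "r a b" "b = c \<or> r b c" "\<forall>z\<in>B. \<not> (r a z \<and> r z b)" by blast
  show ?case
  proof (cases "r a x \<and> r x b")
    case True
    then show ?thesis using b assms(1) by (intro exI[of _ x]) (auto simp: lin_def)
  next
    case False
    then show ?thesis using b by (intro exI[of _ b]) auto
  qed
qed

text \<open>Shorten the interval until it contains none of the finitely many boundary points; on
  what is left \<open>connected\<close> applies.\<close>

lemma germ:
  assumes r: "lin r" and A: "D1 A" and "r a c"
  obtains b where "r a b" "b = c \<or> r b c" "\<And>z. r a z \<Longrightarrow> r z b \<Longrightarrow> A z"
  | b where "r a b" "b = c \<or> r b c" "\<And>z. r a z \<Longrightarrow> r z b \<Longrightarrow> \<not> A z"
proof -
  obtain b where b: "r a b" "b = c \<or> r b c"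
    "\<forall>z\<in>{x. \<not> near x A \<and> \<not> near x (\<lambda>z. \<not> A z)}. \<not> (r a z \<and> r z b)"
    using avoid_finite[OF r \<open>r a c\<close> finite_boundary[OF A]] by blast
  have *: "A z" if "r a z" "r z b" "r a w" "r w b" "A w" for z w
    by (rule connected[OF A conv_lin[OF r, of a b], of w z]) (use b that in auto)
  show thesis
  proof (cases "\<exists>w. r a w \<and> r w b \<and> A w")
    case True
    then show thesis using that(1)[OF b(1,2)] * by blast
  next
    case False
    then show thesis using that(2)[OF b(1,2)] by blast
  qed
qed

end

context omin
begin

section \<open>Monotonicity\<close>

lemma subintervalE:
  assumes "infinite {x. a < x \<and> x < b \<and> B x}" "D1 B"
  obtains c d where "a \<le> c" "c < d" "d \<le> b" "\<And>z. c < z \<Longrightarrow> z < d \<Longrightarrow> B z"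
proof -
  have D: "D1 (\<lambda>x. a < x \<and> x < b \<and> B x)" by (intro def_intro D1_app[OF assms(2)])
  obtain c d where cd: "c < d" "\<And>x. c < x \<Longrightarrow> x < d \<Longrightarrow> a < x \<and> x < b \<and> B x"
    by (rule infinite_imp_intervalE[OF assms(1) D]) (rule that)
  have "a \<le> c"
  proof (rule ccontr)
    assume "\<not> a \<le> c"
    then obtain z where "c < z" "z < min a d" using dense[of c "min a d"] cd(1) by (auto simp: not_le)
    then show False using cd(2)[of z] by auto
  qed
  moreover have "d \<le> b"
  proof (rule ccontr)
    assume "\<not> d \<le> b"
    then obtain z where "max c b < z" "z < d" using dense[of "max c b" d] cd(1) by (auto simp: not_le)
    then show False using cd(2)[of z] by auto
  qed
  ultimately show thesis using that cd by blast
qed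

text \<open>One alternative is infinite on the interval and hence holds on a subinterval. Such
  shrinking replaces a partition of the whole interval in the arguments below.\<close>

lemma pigeonhole_interval:
  assumes "finite S" "a < b" "\<And>x. a < x \<Longrightarrow> x < b \<Longrightarrow> \<exists>i\<in>S. A i x" "\<And>i. i \<in> S \<Longrightarrow> D1 (A i)"
  obtains i c d where "i \<in> S" "a \<le> c" "c < d" "d \<le> b" "\<And>z. c < z \<Longrightarrow> z < d \<Longrightarrow> A i z"
proof -
  have "{a<..<b} = (\<Union>i\<in>S. {x. a < x \<and> x < b \<and> A i x})" using assms(3) by auto
  then have "infinite (\<Union>i\<in>S. {x. a < x \<and> x < b \<and> A i x})"
    using infinite_Ioo[OF assms(2)] by simp
  then obtain i where i: "i \<in> S" "infinite {x. a < x \<and> x < b \<and> A i x}"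
    using finite_UN_I[OF assms(1), of "\<lambda>i. {x. a < x \<and> x < b \<and> A i x}"] by metis
  show thesis
    by (rule subintervalE[OF i(2) assms(4)[OF i(1)]]) (rule that[OF i(1)])
qed

lemma split_interval:
  assumes "a < (b :: 'm)"
  obtains "infinite {x. a < x \<and> x < b \<and> B x}" | "infinite {x. a < x \<and> x < b \<and> \<not> B x}"
proof -
  have "{a<..<b} = {x. a < x \<and> x < b \<and> B x} \<union> {x. a < x \<and> x < b \<and> \<not> B x}" by auto
  then have "infinite ({x. a < x \<and> x < b \<and> B x} \<union> {x. a < x \<and> x < b \<and> \<not> B x})"
    using infinite_Ioo[OF assms] by simp
  then show thesis using that by auto
qed

section \<open>Germs on one side of a point\<close>

definition germr :: "('m \<Rightarrow> 'm \<Rightarrow> bool) \<Rightarrow> 'm \<Rightarrow> ('m \<Rightarrow> bool) \<Rightarrow> bool" where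
  "germr r x Q \<longleftrightarrow> (\<exists>b. r x b \<and> (\<forall>z. r x z \<longrightarrow> r z b \<longrightarrow> Q z))"

lemma Def_germr [def_intro]:
  assumes "lin r" "DefP Q" "dfn t" shows "Def (\<lambda>v. germr r (t v) (\<lambda>z. Q z v))"
  unfolding germr_def
  by (intro def_intro Def_lin[OF assms(1)] DefP_app[OF assms(2)] dfn_comp[OF assms(3)])

lemma germr_mono: "germr r x P \<Longrightarrow> (\<And>z. r x z \<Longrightarrow> P z \<Longrightarrow> Q z) \<Longrightarrow> germr r x Q"
  unfolding germr_def by meson

lemma germr_conj:
  assumes "lin r" "germr r x P" "germr r x Q" shows "germr r x (\<lambda>z. P z \<and> Q z)"
proof -
  from assms obtain b c where b: "r x b" "\<forall>z. r x z \<longrightarrow> r z b \<longrightarrow> P z"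
    and c: "r x c" "\<forall>z. r x z \<longrightarrow> r z c \<longrightarrow> Q z"
    unfolding germr_def by blast
  show ?thesis
  proof (cases "r b c")
    case True
    then show ?thesis unfolding germr_def
      using b c lin_trans[OF assms(1)] by (intro exI[of _ b]) blast
  next
    case False
    then have "c = b \<or> r c b" using lin_total[OF assms(1)] by blast
    then show ?thesis unfolding germr_def
      using b c lin_trans[OF assms(1)] by (intro exI[of _ c]) blast
  qed
qed

lemma germr_ex: assumes "lin r" "germr r x Q" shows "\<exists>z. r x z \<and> Q z"
  using assms lin_dense[OF assms(1)] unfolding germr_def by blast

lemma germr_upto: "r x c \<Longrightarrow> germr r x (\<lambda>z. r z c)"
  unfolding germr_def by blast

lemma germr_conj_upto: "lin r \<Longrightarrow> germr r x P \<Longrightarrow> r x c \<Longrightarrow> germr r x (\<lambda>z. P z \<and> r z c)"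
  by (erule germr_conj) (auto intro: germr_upto)

lemma germr_dichotomy:
  assumes "lin r" "D1 Q" "r x c" shows "germr r x Q \<or> germr r x (\<lambda>z. \<not> Q z)"
  by (rule germ[OF assms]) (unfold germr_def, blast+)

lemma near_germr: "lin r \<Longrightarrow> near x Q \<Longrightarrow> germr r x Q"
  unfolding lin_def near_def germr_def by auto

text \<open>In the direction \<open>r\<close>, this is the infimum of the left ends of the tails
  before \<open>b\<close> on which \<open>Q\<close> holds. The point \<open>c\<close> bounds them
  from below, so that the infimum exists.\<close>

lemma least_tail:
  assumes r: "lin r" and Q: "D1 Q" and d0: "d0 = c \<or> r c d0" "r d0 b" "\<And>y. r d0 y \<Longrightarrow> r y b \<Longrightarrow> Q y"
  obtains d where "d = c \<or> r c d" "r d b" "\<forall>y. r d y \<longrightarrow> r y b \<longrightarrow> Q y"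
    "\<forall>d'. d' = c \<or> r c d' \<longrightarrow> (\<forall>y. r d' y \<longrightarrow> r y b \<longrightarrow> Q y) \<longrightarrow> \<not> r d' d"
proof -
  let ?K = "\<lambda>d. (d = c \<or> r c d) \<and> r d b \<and> (\<forall>y. r d y \<longrightarrow> r y b \<longrightarrow> Q y)"
  note tr = lin_trans[OF r]
  have "D1 ?K" by (intro def_intro Def_lin[OF r] D1_app[OF Q])
  moreover have "?K d0" using d0 by blast
  moreover have "z = c \<or> (\<lambda>x y. r y x) z c" if "?K z" for z using that by blast
  ultimately obtain d where d: "islub (\<lambda>x y. r y x) ?K d"
    using lub_ex[OF lin_conv[OF r], of ?K d0 c] by blast
  have low: "z = d \<or> r d z" if "?K z" for z using d that unfolding islub_def by blast
  have app: "\<exists>z. ?K z \<and> r z t" if "r d t" for t using d that unfolding islub_def by blast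
  have "d = c \<or> r c d"
  proof (rule ccontr)
    assume "\<not> (d = c \<or> r c d)"
    then have "r d c" using lin_total[OF r] by blast
    then show False using app[of c] lin_asym[OF r] lin_irrefl[OF r] by blast
  qed
  moreover have "r d b" using low[OF \<open>?K d0\<close>] d0(2) tr by blast
  moreover have "Q y" if "r d y" "r y b" for y using app[OF that(1)] that(2) by blast
  moreover have "\<not> r d' d" if "d' = c \<or> r c d'" "\<And>y. r d' y \<Longrightarrow> r y b \<Longrightarrow> Q y" for d'
  proof
    assume "r d' d"
    then have "?K d'" using that tr \<open>r d b\<close> by blast
    then show False using low \<open>r d' d\<close> lin_asym[OF r] lin_irrefl[OF r] by blast
  qed
  ultimately show thesis using that by blast
qed

lemma Def_fun2:
  assumes "Dfun f" "lin r" "dfn s" "dfn t" shows "Def (\<lambda>v. r (f (s v)) (f (t v)))"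
  by (intro Def_lin[OF assms(2)] Dfun_app[OF assms(1)] assms(3,4))

text \<open>Travelling in the direction \<open>r\<close>, the values pass at \<open>v\<close> from
  one side of a level \<open>k\<close> to the other, downwards in the sense of \<open>s\<close>. The
  value at \<open>v\<close> itself is left open.\<close>

definition crosses :: "('m \<Rightarrow> 'm \<Rightarrow> bool) \<Rightarrow> ('m \<Rightarrow> 'm \<Rightarrow> bool) \<Rightarrow> ('m \<Rightarrow> 'm) \<Rightarrow> 'm \<Rightarrow> bool" where
  "crosses r s f v \<longleftrightarrow> (\<exists>k. germr (\<lambda>x y. r y x) v (\<lambda>z. s k (f z)) \<and> germr r v (\<lambda>z. s (f z) k))"

text \<open>Every point is a strict local minimum in the sense of \<open>s\<close>. Past finitely
  many points each point is followed by one of smaller value, so the values finally stay below a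
  fixed \<open>f c\<close>; where this final stretch begins, \<open>f\<close> crosses the level
  \<open>f c\<close>.\<close>

lemma crosses_ex:
  assumes r: "lin r" and s: "lin s" and f: "Dfun f" and "r a b"
    and inj: "\<And>x y. r a x \<Longrightarrow> r x b \<Longrightarrow> r a y \<Longrightarrow> r y b \<Longrightarrow> f x = f y \<Longrightarrow> x = y"
    and right: "\<And>x. r a x \<Longrightarrow> r x b \<Longrightarrow> germr r x (\<lambda>z. s (f x) (f z))"
    and left: "\<And>x. r a x \<Longrightarrow> r x b \<Longrightarrow> germr (\<lambda>x y. r y x) x (\<lambda>z. s (f x) (f z))"
  shows "\<exists>v. r a v \<and> r v b \<and> crosses r s f v"
proof -
  note tr = lin_trans[OF r] and ts = lin_trans[OF s]
  note as = lin_asym[OF s] and tot = lin_total[OF s] and r' = lin_conv[OF r]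
  let ?J = "\<lambda>x. r a x \<and> r x b"
  \<comment> \<open>Points whose value lies below all later ones. An interval of them would make
    \<open>f\<close> increasing there, against the local minimum on the left of each point.\<close>
  let ?B = "\<lambda>x. ?J x \<and> (\<forall>y. ?J y \<longrightarrow> r x y \<longrightarrow> s (f x) (f y))"
  have DB: "D1 ?B" by (intro def_intro Def_lin[OF r] Def_fun2[OF f s])
  have "finite {x. ?B x}"
  proof (rule ccontr)
    assume inf: "infinite {x. ?B x}"
    obtain p q where pq: "p < q" "\<And>z. p < z \<Longrightarrow> z < q \<Longrightarrow> ?B z"
      by (rule infinite_imp_intervalE[OF inf DB]) (rule that)
    obtain y where y: "p < y" "y < q" using dense[OF pq(1)] by blast
    have "?J y" using pq(2)[OF y] by blast
    then have "germr (\<lambda>x y. r y x) y (\<lambda>z. s (f y) (f z))" using left by blast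
    from germr_conj[OF r' this near_germr[OF r' near_interval[OF y]]]
    obtain z where z: "r z y" "s (f y) (f z)" "p < z" "z < q" using germr_ex[OF r'] by blast
    then show False using pq(2)[of z] \<open>?J y\<close> as by blast
  qed
  from avoid_finite[OF r' \<open>r a b\<close> this] obtain a' where a': "r a' b" "a' = a \<or> r a a'"
    "\<And>z. r a' z \<Longrightarrow> r z b \<Longrightarrow> \<not> ?B z" by blast
  have JJ: "?J x" if "r a' x" "r x b" for x using that a'(2) tr by blast
  have inj': "s (f x) (f y) \<or> s (f y) (f x)" if "?J x" "?J y" "x \<noteq> y" for x y
    using that inj tot by blast
  have later: "\<exists>y. r x y \<and> r y b \<and> s (f y) (f x)" if x: "r a' x" "r x b" for x
  proof -
    obtain y where "?J y" "r x y" "\<not> s (f x) (f y)" using a'(3)[OF x] JJ[OF x] by blast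
    then show ?thesis using inj'[of x y] JJ[OF x] lin_irrefl[OF r] by blast
  qed
  obtain c where c: "r a' c" "r c b" using lin_dense[OF r a'(1)] by blast
  have DQ: "D1 (\<lambda>y. s (f y) (f c))" "D1 (\<lambda>y. \<not> s (f y) (f c))"
    by (intro def_intro Def_lin[OF s] Dfun_app[OF f])+
  have max_ex: "\<exists>w. (w = c \<or> r c w) \<and> r w d \<and> (w = u \<or> r u w)" if "r u d" "r c d" for u d
    using that lin_total[OF r, of u c] by blast
  have mid_ex: "\<exists>w. r c w \<and> r w d \<and> r u w" if "r u d" "r c d" for u d
  proof -
    obtain w where w: "(w = c \<or> r c w) \<and> r w d \<and> (w = u \<or> r u w)" using max_ex[OF \<open>r u d\<close> \<open>r c d\<close>] by blast
    then obtain w' where "r w w'" "r w' d" using lin_dense[OF r] by blast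
    then show ?thesis using w tr by blast
  qed
  \<comment> \<open>Otherwise let \<open>d\<close> start the longest final stretch without values
    below \<open>f c\<close>. A later value is smaller than \<open>f d\<close>, so
    \<open>f d\<close> lies above \<open>f c\<close>, and the local minimum at \<open>d\<close>
    extends the stretch to the left.\<close>
  have "\<not> germr (\<lambda>x y. r y x) b (\<lambda>y. \<not> s (f y) (f c))"
  proof
    assume "germr (\<lambda>x y. r y x) b (\<lambda>y. \<not> s (f y) (f c))"
    then obtain b1 where b1: "r b1 b" "\<And>y. r b1 y \<Longrightarrow> r y b \<Longrightarrow> \<not> s (f y) (f c)"
      unfolding germr_def by blast
    obtain d0 where d0: "d0 = c \<or> r c d0" "r d0 b" "d0 = b1 \<or> r b1 d0" using max_ex[OF b1(1) c(2)] by blast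
    then have d0': "\<And>y. r d0 y \<Longrightarrow> r y b \<Longrightarrow> \<not> s (f y) (f c)" using b1(2) tr by blast
    obtain d where d0: "d = c \<or> r c d" "r d b" "\<forall>y. r d y \<longrightarrow> r y b \<longrightarrow> \<not> s (f y) (f c)"
      "\<forall>d'. d' = c \<or> r c d' \<longrightarrow> (\<forall>y. r d' y \<longrightarrow> r y b \<longrightarrow> \<not> s (f y) (f c)) \<longrightarrow> \<not> r d' d"
      by (rule least_tail[OF r DQ(2) d0(1,2) d0']) (assumption | rule that)+
    note d = d0(1,2) d0(3,4)[rule_format]
    have dJ: "r a' d" using d(1) c tr by blast
    obtain y where y: "r d y" "r y b" "s (f y) (f d)" using later[OF dJ d(2)] by blast
    have "s (f c) (f d)"
    proof (rule ccontr)
      assume "\<not> s (f c) (f d)"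
      then have "f c = f d \<or> s (f d) (f c)" using tot by blast
      then show False using y d(3)[OF y(1,2)] ts by auto
    qed
    then have "r c d" using d(1) lin_irrefl[OF s] by blast
    obtain w where w: "r w d" "\<And>z. r w z \<Longrightarrow> r z d \<Longrightarrow> s (f d) (f z)"
      using left[of d] JJ[OF dJ d(2)] unfolding germr_def by blast
    obtain w' where w': "r c w'" "r w' d" "r w w'" using mid_ex[OF w(1) \<open>r c d\<close>] by blast
    have "\<not> s (f y) (f c)" if "r w' y" "r y b" for y
    proof -
      consider "y = d" | "r d y" | "r y d" using lin_total[OF r] by blast
      then show ?thesis
      proof cases
        case 1
        then show ?thesis using \<open>s (f c) (f d)\<close> as by blast
      next
        case 2
        then show ?thesis using d(3) that by blast
      next
        case 3
        then have "s (f d) (f y)" using w(2) w'(3) that tr by blast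
        then show ?thesis using \<open>s (f c) (f d)\<close> as ts by blast
      qed
    qed
    then show False using d(4)[of w'] w' by blast
  qed
  then have "germr (\<lambda>x y. r y x) b (\<lambda>y. s (f y) (f c))"
    using germr_dichotomy[OF r' DQ(1) c(2)] by blast
  then obtain b1 where b1: "r b1 b" "\<And>y. r b1 y \<Longrightarrow> r y b \<Longrightarrow> s (f y) (f c)"
    unfolding germr_def by blast
  obtain d0 where d0: "d0 = c \<or> r c d0" "r d0 b" "d0 = b1 \<or> r b1 d0" using max_ex[OF b1(1) c(2)] by blast
  then have d0': "\<And>y. r d0 y \<Longrightarrow> r y b \<Longrightarrow> s (f y) (f c)" using b1(2) tr by blast
  \<comment> \<open>The start of the longest final stretch below \<open>f c\<close> is the crossing
    point: immediately before it the values exceed \<open>f c\<close>.\<close>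
  obtain v where v0: "v = c \<or> r c v" "r v b" "\<forall>y. r v y \<longrightarrow> r y b \<longrightarrow> s (f y) (f c)"
    "\<forall>d'. d' = c \<or> r c d' \<longrightarrow> (\<forall>y. r d' y \<longrightarrow> r y b \<longrightarrow> s (f y) (f c)) \<longrightarrow> \<not> r d' v"
    by (rule least_tail[OF r DQ(1) d0(1,2) d0']) (assumption | rule that)+
  note v = v0(1,2) v0(3,4)[rule_format]
  have vJ: "r a' v" using v(1) c tr by blast
  have "v \<noteq> c"
  proof
    assume "v = c"
    have "germr r c (\<lambda>z. s (f c) (f z) \<and> r z b)"
      by (rule germr_conj_upto[OF r _ c(2)]) (use right JJ[OF c] in blast)
    then obtain z where "r c z" "s (f c) (f z)" "r z b" using germr_ex[OF r] by blast
    then show False using v(3)[of z] \<open>v = c\<close> as by blast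
  qed
  then have "r c v" using v(1) by blast
  have "germr r v (\<lambda>z. s (f v) (f z) \<and> r z b)"
    by (rule germr_conj_upto[OF r _ v(2)]) (use right JJ[OF vJ v(2)] in blast)
  then obtain z where "r v z" "s (f v) (f z)" "r z b" using germr_ex[OF r] by blast
  then have fv: "s (f v) (f c)" using v(3)[of z] ts by blast
  have "\<not> germr (\<lambda>x y. r y x) v (\<lambda>y. s (f y) (f c))"
  proof
    assume "germr (\<lambda>x y. r y x) v (\<lambda>y. s (f y) (f c))"
    then obtain w where w: "r w v" "\<And>z. r w z \<Longrightarrow> r z v \<Longrightarrow> s (f z) (f c)"
      unfolding germr_def by blast
    obtain w' where w': "r c w'" "r w' v" "r w w'" using mid_ex[OF w(1) \<open>r c v\<close>] by blast
    have "s (f y) (f c)" if "r w' y" "r y b" for y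
    proof -
      consider "y = v" | "r v y" | "r y v" using lin_total[OF r] by blast
      then show ?thesis
      proof cases
        case 1
        then show ?thesis using fv by simp
      next
        case 2
        then show ?thesis using v(3) that by blast
      next
        case 3
        moreover have "r w y" using w'(3) that(1) tr by blast
        ultimately show ?thesis using w(2) by blast
      qed
    qed
    then show False using v(4)[of w'] w' by blast
  qed
  then have "germr (\<lambda>x y. r y x) v (\<lambda>y. \<not> s (f y) (f c))"
    using germr_dichotomy[OF r' DQ(1) \<open>r c v\<close>] by blast
  moreover have "germr (\<lambda>x y. r y x) v (\<lambda>z. r c z)"
    by (rule germr_upto[of "\<lambda>x y. r y x", OF \<open>r c v\<close>])
  ultimately have "germr (\<lambda>x y. r y x) v (\<lambda>y. \<not> s (f y) (f c) \<and> r c y)"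
    by (rule germr_conj[OF r'])
  then have "germr (\<lambda>x y. r y x) v (\<lambda>y. s (f c) (f y))"
  proof (rule germr_mono)
    fix z assume z: "r z v" "\<not> s (f z) (f c) \<and> r c z"
    then have "?J z" "?J c" "z \<noteq> c" using JJ c vJ v(2) tr lin_irrefl[OF r] by blast+
    then show "s (f c) (f z)" using inj' z(2) by blast
  qed
  moreover have "germr r v (\<lambda>y. s (f y) (f c))"
    unfolding germr_def using v(2,3) by blast
  ultimately have "crosses r s f v" unfolding crosses_def by blast
  then show ?thesis using JJ[OF vJ v(2)] by blast
qed

lemma crosses_conv:
  assumes r: "lin r" and s: "lin s" and "crosses r s f v" "crosses (\<lambda>x y. r y x) s f v" shows False
proof -
  obtain k where k: "germr (\<lambda>x y. r y x) v (\<lambda>z. s k (f z))" "germr r v (\<lambda>z. s (f z) k)"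
    using assms(3) unfolding crosses_def by blast
  obtain l where l: "germr r v (\<lambda>z. s l (f z))" "germr (\<lambda>x y. r y x) v (\<lambda>z. s (f z) l)"
    using assms(4) unfolding crosses_def by blast
  have "s k l" using germr_ex[OF lin_conv[OF r] germr_conj[OF lin_conv[OF r] k(1) l(2)]] lin_trans[OF s] by blast
  moreover have "s l k" using germr_ex[OF r germr_conj[OF r l(1) k(2)]] lin_trans[OF s] by blast
  ultimately show False using lin_asym[OF s] by blast
qed

text \<open>Crossings exist in every subinterval, so by o-minimality they fill one. The same
  argument in the reverse direction produces inside it a crossing of the opposite kind, which
  \<open>crosses_conv\<close> excludes.\<close>

lemma no_local_extrema:
  assumes s: "lin s" and f: "Dfun f" and "a < b"
    and inj: "\<And>x y. a < x \<Longrightarrow> x < b \<Longrightarrow> a < y \<Longrightarrow> y < b \<Longrightarrow> f x = f y \<Longrightarrow> x = y"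
    and right: "\<And>x. a < x \<Longrightarrow> x < b \<Longrightarrow> germr (<) x (\<lambda>z. s (f x) (f z))"
    and left: "\<And>x. a < x \<Longrightarrow> x < b \<Longrightarrow> germr (>) x (\<lambda>z. s (f x) (f z))"
  shows False
proof -
  have sub: "\<exists>v. c < v \<and> v < d \<and> crosses (<) s f v" if "a \<le> c" "c < d" "d \<le> b" for c d
    by (rule crosses_ex[OF lin_less s f \<open>c < d\<close>]) (use that inj right left in auto)
  have D: "D1 (crosses (<) s f)"
    unfolding crosses_def by (intro def_intro Def_lin[OF s] lin_less lin_greater Dfun_app[OF f])
  have "infinite {v. a < v \<and> v < b \<and> crosses (<) s f v}"
  proof
    assume "finite {v. a < v \<and> v < b \<and> crosses (<) s f v}"
    from avoid_finite[OF lin_less \<open>a < b\<close> this] obtain d where d: "a < d" "d = b \<or> d < b"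
      "\<forall>v\<in>{v. a < v \<and> v < b \<and> crosses (<) s f v}. \<not> (a < v \<and> v < d)" by blast
    have "d \<le> b" using d(2) by auto
    then obtain v where v: "a < v" "v < d" "crosses (<) s f v" using sub[of a d] d(1) by blast
    then show False using d(3) \<open>d \<le> b\<close> by auto
  qed
  from subintervalE[OF this D] obtain c d where cd: "a \<le> c" "c < d" "d \<le> b"
    "\<And>z. c < z \<Longrightarrow> z < d \<Longrightarrow> crosses (<) s f z" by blast
  have "\<exists>v. v < d \<and> c < v \<and> crosses (>) s f v"
    by (rule crosses_ex[OF lin_greater s f \<open>c < d\<close>]) (use cd inj right left in auto)
  then show False using cd(4) crosses_conv[OF lin_less s] by blast
qed

text \<open>Let \<open>t\<close> be the supremum of the segments on which all values exceed
  \<open>f x\<close>. Increase to the left of \<open>t\<close> settles the value at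
  \<open>t\<close>, and increase to its right carries the segment beyond it.\<close>

lemma local_increasing:
  assumes s: "lin s" and f: "Dfun f" and J: "conv J"
    and right: "\<And>x. J x \<Longrightarrow> germr (<) x (\<lambda>z. s (f x) (f z))"
    and left: "\<And>x. J x \<Longrightarrow> germr (>) x (\<lambda>z. s (f z) (f x))"
    and xy: "J x" "J y" "x < y"
  shows "s (f x) (f y)"
proof (rule ccontr)
  assume no: "\<not> s (f x) (f y)"
  note ts = lin_trans[OF s]
  let ?S = "\<lambda>z. x < z \<and> z \<le> y \<and> (\<forall>w. x < w \<longrightarrow> w < z \<longrightarrow> s (f x) (f w))"
  have "D1 ?S" by (intro def_intro Def_lin[OF s] Dfun_app[OF f])
  moreover obtain b where b: "x < b" "\<And>z. x < z \<Longrightarrow> z < b \<Longrightarrow> s (f x) (f z)"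
    using right[OF xy(1)] unfolding germr_def by blast
  have "?S (min b y)" using b xy by auto
  ultimately obtain t where t: "islub (<) ?S t" using lub_less[of ?S "min b y" y] by auto
  have "min b y = t \<or> min b y < t" using t \<open>?S (min b y)\<close> unfolding islub_def by blast
  moreover have "x < min b y" using b(1) xy by simp
  ultimately have "x < t" by (elim disjE) (simp, rule less_trans)
  have "t \<le> y" using t unfolding islub_def by (meson not_le leD)
  have below: "s (f x) (f w)" if "x < w" "w < t" for w using t that unfolding islub_def by blast
  have "J t" using J xy \<open>x < t\<close> \<open>t \<le> y\<close> unfolding conv_def by (metis le_less)
  have "germr (>) t (\<lambda>z. s (f z) (f t) \<and> x < z)"
    by (rule germr_conj_upto[OF lin_greater left[OF \<open>J t\<close>] \<open>x < t\<close>])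
  then obtain w where "w < t" "s (f w) (f t)" "x < w" using germr_ex[OF lin_greater] by blast
  then have "s (f x) (f t)" using below ts by blast
  then have "t < y" using no \<open>t \<le> y\<close> by (auto simp: le_less)
  obtain b where b: "t < b" "\<And>z. t < z \<Longrightarrow> z < b \<Longrightarrow> s (f t) (f z)"
    using right[OF \<open>J t\<close>] unfolding germr_def by blast
  have "?S (min b y)"
  proof (intro conjI allI impI)
    show "x < min b y" using \<open>x < t\<close> b(1) xy by auto
    fix w assume w: "x < w" "w < min b y"
    show "s (f x) (f w)"
    proof (cases w t rule: linorder_cases)
      case greater
      then show ?thesis using b(2) w \<open>s (f x) (f t)\<close> ts by auto
    qed (use below w \<open>s (f x) (f t)\<close> in auto)
  qed simp
  then have "min b y = t \<or> min b y < t" using t unfolding islub_def by blast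
  then show False using b(1) \<open>t < y\<close> by (auto simp: min_def split: if_splits)
qed

definition cont :: "('m \<Rightarrow> 'm) \<Rightarrow> 'm \<Rightarrow> bool" where
  "cont f x \<longleftrightarrow> (\<forall>u. u < f x \<longrightarrow> near x (\<lambda>z. u < f z)) \<and> (\<forall>u. f x < u \<longrightarrow> near x (\<lambda>z. f z < u))"

lemma cont_lin1: "cont f x \<Longrightarrow> lin r \<Longrightarrow> r u (f x) \<Longrightarrow> near x (\<lambda>z. r u (f z))"
  and cont_lin2: "cont f x \<Longrightarrow> lin r \<Longrightarrow> r (f x) u \<Longrightarrow> near x (\<lambda>z. r (f z) u)"
  unfolding cont_def lin_def by auto

lemma D1_cont: assumes "Dfun f" shows "D1 (cont f)"
  unfolding cont_def by (intro def_intro Dfun_app[OF assms])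

text \<open>If no value is taken infinitely often, each fibre has a least element. These least
  elements are infinitely many, hence contain an interval, and on it \<open>f\<close> is
  injective.\<close>

lemma const_or_inj:
  assumes f: "Dfun f" and "a < b"
  obtains c d k where "a \<le> c" "c < d" "d \<le> b" "\<And>x. c < x \<Longrightarrow> x < d \<Longrightarrow> f x = k"
  | c d where "a \<le> c" "c < d" "d \<le> b" "inj_on f {c<..<d}"
proof (cases "\<exists>k. infinite {x. a < x \<and> x < b \<and> f x = k}")
  case True
  then obtain k where inf: "infinite {x. a < x \<and> x < b \<and> f x = k}" by blast
  have D: "D1 (\<lambda>x. f x = k)" by (intro def_intro Dfun_app[OF f])
  show thesis by (rule subintervalE[OF inf D]) (rule that(1))
next
  case False
  let ?A = "\<lambda>x. \<forall>w. a < w \<longrightarrow> w < b \<longrightarrow> f w = f x \<longrightarrow> x \<le> w"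
  have D: "D1 ?A" by (intro def_intro Dfun_app[OF f])
  have "infinite {x. a < x \<and> x < b \<and> ?A x}"
  proof
    assume fin: "finite {x. a < x \<and> x < b \<and> ?A x}"
    have "{a<..<b} \<subseteq> (\<Union>y\<in>{x. a < x \<and> x < b \<and> ?A x}. {x. a < x \<and> x < b \<and> f x = f y})"
    proof
      fix x assume x: "x \<in> {a<..<b}"
      let ?F = "{w. a < w \<and> w < b \<and> f w = f x}"
      have "finite ?F" using False by blast
      moreover have "?F \<noteq> {}" using x by auto
      ultimately have "Min ?F \<in> ?F" "\<And>w. w \<in> ?F \<Longrightarrow> Min ?F \<le> w" by (rule Min_in) (rule Min_le[OF \<open>finite ?F\<close>])
      then show "x \<in> (\<Union>y\<in>{x. a < x \<and> x < b \<and> ?A x}. {x. a < x \<and> x < b \<and> f x = f y})"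
        using x by (intro UN_I[of "Min ?F"]) auto
    qed
    moreover have "finite (\<Union>y\<in>{x. a < x \<and> x < b \<and> ?A x}. {x. a < x \<and> x < b \<and> f x = f y})"
      using fin False by blast
    ultimately show False using infinite_Ioo[OF \<open>a < b\<close>] finite_subset by blast
  qed
  from subintervalE[OF this D] obtain c d where cd: "a \<le> c" "c < d" "d \<le> b"
    "\<And>z. c < z \<Longrightarrow> z < d \<Longrightarrow> ?A z" by blast
  have "inj_on f {c<..<d}"
  proof (rule inj_onI)
    fix x y assume xy: "x \<in> {c<..<d}" "y \<in> {c<..<d}" "f x = f y"
    then have "a < x" "x < b" "a < y" "y < b" using cd by auto
    then have "x \<le> y" "y \<le> x" using cd(4)[of x] cd(4)[of y] xy by auto
    then show "x = y" by simp
  qed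
  then show thesis using that(2) cd by blast
qed

text \<open>The image is infinite, so it contains an interval. Over a smaller closed interval every
  intermediate value is attained, and a monotone function with this property is continuous.\<close>

lemma cont_monotone_sub:
  assumes s: "lin s" and f: "Dfun f" and "a < b"
    and mono: "\<And>x y. a < x \<Longrightarrow> x < y \<Longrightarrow> y < b \<Longrightarrow> s (f x) (f y)"
  obtains c d where "a \<le> c" "c < d" "d \<le> b" "\<And>x. c < x \<Longrightarrow> x < d \<Longrightarrow> cont f x"
proof -
  note ts = lin_trans[OF s]
  let ?R = "\<lambda>y. \<exists>x. a < x \<and> x < b \<and> f x = y"
  have inj: "inj_on f {a<..<b}"
  proof (rule inj_onI)
    fix x y assume "x \<in> {a<..<b}" "y \<in> {a<..<b}" "f x = f y"
    then show "x = y"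
      using mono[of x y] mono[of y x] lin_irrefl[OF s] by (cases x y rule: linorder_cases) auto
  qed
  have "{y. ?R y} = f ` {a<..<b}" by auto
  then have inf: "infinite {y. ?R y}"
    using finite_imageD[OF _ inj] infinite_Ioo[OF \<open>a < b\<close>] by metis
  have DR: "D1 ?R" by (intro def_intro Dfun_app[OF f])
  obtain p q where pq: "p < q" "\<And>y. p < y \<Longrightarrow> y < q \<Longrightarrow> ?R y"
    by (rule infinite_imp_intervalE[OF inf DR]) (rule that)
  have "\<exists>p' q'. s p' q' \<and> (\<forall>y. (y = p' \<or> s p' y) \<longrightarrow> (y = q' \<or> s y q') \<longrightarrow> ?R y)"
  proof -
    obtain y1 where y1: "p < y1" "y1 < q" using dense[OF pq(1)] by blast
    then obtain y2 where y2: "y1 < y2" "y2 < q" using dense by blast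
    have R: "?R y" if "y = y1 \<or> y1 < y" "y = y2 \<or> y < y2" for y
      using pq(2)[of y] that y1 y2 by auto
    show ?thesis using s unfolding lin_def
    proof
      assume "s = (<)"
      then show ?thesis using R y2(1) by - (rule exI[of _ y1], rule exI[of _ y2], blast)
    next
      assume "s = (>)"
      then show ?thesis using R y2(1) by - (rule exI[of _ y2], rule exI[of _ y1], blast)
    qed
  qed
  then obtain p' q' where pq': "s p' q'" "\<And>y. y = p' \<or> s p' y \<Longrightarrow> y = q' \<or> s y q' \<Longrightarrow> ?R y" by blast
  obtain c where c: "a < c" "c < b" "f c = p'" using pq'(2)[of p'] pq'(1) by blast
  obtain d where d: "a < d" "d < b" "f d = q'" using pq'(2)[of q'] pq'(1) by blast
  have refl_less: "x < y" if "a < x" "x < b" "a < y" "y < b" "s (f x) (f y)" for x y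
    using that mono[of y x] lin_asym[OF s] lin_irrefl[OF s] by (cases x y rule: linorder_cases) auto
  have "c < d" using refl_less[of c d] c d pq'(1) by auto
  have "cont f x" if x: "c < x" "x < d" for x
  proof -
    have ab: "a < x" "x < b" using x c d by auto
    have fx: "s p' (f x)" "s (f x) q'" using mono[of c x] mono[of x d] x c d ab by auto
    have 1: "near x (\<lambda>z. s u (f z))" if "s u (f x)" for u
    proof -
      have "\<exists>m. (m = p' \<or> s p' m) \<and> (m = u \<or> s u m) \<and> s m (f x)"
        using lin_total[OF s, of u p'] that fx by blast
      then obtain m m' where m: "m = p' \<or> s p' m" "m = u \<or> s u m" "s m m'" "s m' (f x)"
        using lin_dense[OF s] by blast
      then have "?R m'" using pq'(2)[of m'] fx ts by blast
      then obtain z where z: "a < z" "z < b" "f z = m'" by blast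
      then have "z < x" using refl_less m ab by blast
      have "near x (\<lambda>w. z < w \<and> w < b)" by (rule near_interval) fact+
      then show ?thesis
        by (rule near_mono) (use mono[of z] z m ts in blast)
    qed
    have 2: "near x (\<lambda>z. s (f z) u)" if "s (f x) u" for u
    proof -
      have "\<exists>m. (m = q' \<or> s m q') \<and> (m = u \<or> s m u) \<and> s (f x) m"
        using lin_total[OF s, of u q'] that fx by blast
      then obtain m m' where m: "m = q' \<or> s m q'" "m = u \<or> s m u" "s m' m" "s (f x) m'"
        using lin_dense[OF s] by blast
      then have "?R m'" using pq'(2)[of m'] fx ts by blast
      then obtain z where z: "a < z" "z < b" "f z = m'" by blast
      then have "x < z" using refl_less m ab by blast
      have "near x (\<lambda>w. a < w \<and> w < z)" by (rule near_interval) fact+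
      then show ?thesis
        by (rule near_mono) (use mono[of _ z] z m ts in blast)
    qed
    show ?thesis using s 1 2 unfolding cont_def lin_def by blast
  qed
  then show thesis using that[of c d] \<open>c < d\<close> c d by auto
qed

theorem monotonicity:
  assumes f: "Dfun f" and "a < b"
  obtains c d k where "a \<le> c" "c < d" "d \<le> b" "\<And>x. c < x \<Longrightarrow> x < d \<Longrightarrow> f x = k"
  | c d s where "a \<le> c" "c < d" "d \<le> b" "lin s" "\<And>x y. c < x \<Longrightarrow> x < y \<Longrightarrow> y < d \<Longrightarrow> s (f x) (f y)"
    "\<And>x. c < x \<Longrightarrow> x < d \<Longrightarrow> cont f x"
proof (rule const_or_inj[OF assms])
  fix c d k assume "a \<le> c" "c < d" "d \<le> b" "\<And>x. c < x \<Longrightarrow> x < d \<Longrightarrow> f x = k"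
  then show thesis by (rule that(1))
next
  fix a' b' assume ab': "a \<le> a'" "a' < b'" "b' \<le> b" and inj: "inj_on f {a'<..<b'}"
  \<comment> \<open>The type of a point: \<open>s\<close> describes the values to its right and
    \<open>t\<close> those to its left. Equal relations mean local monotonicity, different ones a
    strict local extremum.\<close>
  let ?T = "\<lambda>(s, t) x. germr (<) x (\<lambda>z. s (f x) (f z)) \<and> germr (>) x (\<lambda>z. t (f z) (f x))"
  let ?L = "{(<), (>)} :: ('m \<Rightarrow> 'm \<Rightarrow> bool) set"
  have types: "\<exists>p \<in> ?L \<times> ?L. ?T p x" if x: "a' < x" "x < b'" for x
  proof -
    have D: "D1 (\<lambda>z. f x < f z)" "D1 (\<lambda>z. f z < f x)"
      by (intro def_intro Dfun_app[OF f])+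
    have ne: "f z \<noteq> f x" if "a' < z" "z < b'" "z \<noteq> x" for z
      using inj x that by (auto simp: inj_on_def)
    have "germr (<) x (\<lambda>z. f x < f z) \<or> germr (<) x (\<lambda>z. f x > f z)"
    proof (rule disjCI)
      assume "\<not> germr (<) x (\<lambda>z. f x > f z)"
      then have "germr (<) x (\<lambda>z. \<not> f x > f z \<and> z < b')"
        by (intro germr_conj_upto[OF lin_less _ x(2)]) (use germr_dichotomy[OF lin_less D(2) x(2)] in blast)
      then show "germr (<) x (\<lambda>z. f x < f z)"
        by (rule germr_mono) (use ne x in \<open>metis less_trans linorder_neqE less_irrefl\<close>)
    qed
    moreover have "germr (>) x (\<lambda>z. f z < f x) \<or> germr (>) x (\<lambda>z. f z > f x)"
    proof (rule disjCI)
      assume "\<not> germr (>) x (\<lambda>z. f z > f x)"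
      then have "germr (>) x (\<lambda>z. \<not> f z > f x \<and> z > a')"
        by (intro germr_conj_upto[OF lin_greater _ x(1)]) (use germr_dichotomy[OF lin_greater D(1) x(1)] in blast)
      then show "germr (>) x (\<lambda>z. f z < f x)"
        by (rule germr_mono) (use ne x in \<open>metis less_trans linorder_neqE less_irrefl\<close>)
    qed
    ultimately show ?thesis by auto
  qed
  have DT: "D1 (?T p)" if "p \<in> ?L \<times> ?L" for p
  proof -
    obtain s t where p: "p = (s, t)" "lin s" "lin t" using \<open>p \<in> _\<close> by (auto simp: lin_def)
    show ?thesis unfolding p(1) prod.case
      by (intro def_intro lin_less lin_greater Def_lin[OF p(2)] Def_lin[OF p(3)] Dfun_app[OF f])
  qed
  have "finite (?L \<times> ?L)" by simp
  then obtain p c d where p: "p \<in> ?L \<times> ?L" and cd: "a' \<le> c" "c < d" "d \<le> b'"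
    and T: "\<And>x. c < x \<Longrightarrow> x < d \<Longrightarrow> ?T p x"
    by (rule pigeonhole_interval[OF _ ab'(2) types DT]) (assumption | rule that)+
  obtain s t where st: "p = (s, t)" "lin s" "lin t" using p by (auto simp: lin_def)
  have inj': "x = y" if "c < x" "x < d" "c < y" "y < d" "f x = f y" for x y
  proof (rule inj_onD[OF inj that(5)])
    show "x \<in> {a'<..<b'}" "y \<in> {a'<..<b'}"
      using le_less_trans[OF cd(1)] less_le_trans[OF _ cd(3)] that by auto
  qed
  have "s = t"
  proof (rule ccontr)
    assume "s \<noteq> t"
    then have t: "t = (\<lambda>x y. s y x)" using st by (auto simp: lin_def)
    show False
      by (rule no_local_extrema[OF st(2) f cd(2) inj']) (use T st t in auto)
  qed
  have mono: "s (f x) (f y)" if "c < x" "x < y" "y < d" for x y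
    by (rule local_increasing[OF st(2) f conv_lin[OF lin_less, of c d]])
      (use T st \<open>s = t\<close> that in auto)
  show thesis
  proof (rule cont_monotone_sub[OF st(2) f cd(2) mono])
    fix c' d' assume c'd': "c \<le> c'" "c' < d'" "d' \<le> d" "\<And>x. c' < x \<Longrightarrow> x < d' \<Longrightarrow> cont f x"
    have "a \<le> c'" "d' \<le> b" using c'd' cd ab' by auto
    then show thesis
      by (rule that(2)[OF _ \<open>c' < d'\<close> _ st(2)]) (use mono c'd' in auto)
  qed
qed

lemma cont_sub:
  assumes f: "Dfun f" and "a < b"
  obtains c d where "a \<le> c" "c < d" "d \<le> b" "\<And>x. c < x \<Longrightarrow> x < d \<Longrightarrow> cont f x"
proof (rule monotonicity[OF assms])
  fix c d k assume cd: "a \<le> c" "c < d" "d \<le> b" and k: "\<And>x. c < x \<Longrightarrow> x < d \<Longrightarrow> f x = k"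
  have "cont f x" if "c < x" "x < d" for x
    using near_interval[OF that] k that unfolding cont_def by (auto elim: near_mono)
  then show thesis using that cd by blast
qed (use that in blast)

end

context omin
begin

section \<open>Exchanging the coordinates of the plane\<close>

text \<open>At a common point of continuity, a value strictly between \<open>f x\<close> and
  \<open>g x\<close> remains between them nearby.\<close>

lemma separate:
  assumes r: "lin r" and f: "Dfun f" and g: "Dfun g" and "a < b"
    and fg: "\<And>x. a < x \<Longrightarrow> x < b \<Longrightarrow> r (f x) (g x)"
  obtains c d s where "a \<le> c" "c < d" "d \<le> b" "\<And>x. c < x \<Longrightarrow> x < d \<Longrightarrow> r (f x) s \<and> r s (g x)"
proof -
  obtain c d where cd: "a \<le> c" "c < d" "d \<le> b" "\<And>x. c < x \<Longrightarrow> x < d \<Longrightarrow> cont f x"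
    by (rule cont_sub[OF f \<open>a < b\<close>]) (rule that)
  obtain c' d' where cd': "c \<le> c'" "c' < d'" "d' \<le> d" "\<And>x. c' < x \<Longrightarrow> x < d' \<Longrightarrow> cont g x"
    by (rule cont_sub[OF g \<open>c < d\<close>]) (rule that)
  obtain x where x: "c' < x" "x < d'" using dense[OF cd'(2)] by blast
  then have xc: "c < x" "x < d" using cd' by auto
  then have xa: "a < x" "x < b" using cd by auto
  obtain s where s: "r (f x) s" "r s (g x)" using lin_dense[OF r fg[OF xa]] by blast
  have "near x (\<lambda>z. (r (f z) s \<and> r s (g z)) \<and> (a < z \<and> z < b))"
    by (intro near_conj[OF near_conj[OF cont_lin2[OF cd(4)[OF xc] r s(1)] cont_lin1[OF cd'(4)[OF x] r s(2)]]
      near_interval[OF xa]])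
  then obtain p q where pq: "p < x" "x < q"
    "\<And>z. p < z \<Longrightarrow> z < q \<Longrightarrow> (r (f z) s \<and> r s (g z)) \<and> (a < z \<and> z < b)"
    unfolding near_def by blast
  have "max a p < x" "x < min b q" using pq xa by auto
  then have "max a p < min b q" by (rule less_trans)
  then show thesis
    by (intro that[of "max a p" "min b q" s]) (use pq in auto)
qed

lemma islub_unique: "lin r \<Longrightarrow> islub r A s \<Longrightarrow> islub r A t \<Longrightarrow> s = t"
  unfolding islub_def lin_def
  by (elim disjE) (metis linorder_neqE less_asym)+

lemma finite_lin_min:
  assumes "lin r" "finite S" "S \<noteq> {}"
  shows "\<exists>m\<in>S. \<forall>y\<in>S. y = m \<or> r m y"
  using assms(1) unfolding lin_def
proof
  assume "r = (<)"
  then show ?thesis using Min_in[OF assms(2,3)] Min_le[OF assms(2)] by (metis le_less)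
next
  assume "r = (>)"
  then show ?thesis using Max_in[OF assms(2,3)] Max_ge[OF assms(2)] by (metis le_less)
qed

text \<open>Singles out the first interval of \<open>Z\<close> beyond \<open>c\<close> by its left
  end. The infimum of all left ends is again one: otherwise \<open>Z\<close> would fail immediately
  after it, where left ends accumulate.\<close>

lemma first_germ:
  assumes r: "lin r" and D: "D1 Z" and Zc: "\<And>u. Z u \<Longrightarrow> r c u" and inf: "infinite {u. Z u}"
  shows "\<exists>p. ((p = c \<or> r c p) \<and> germr r p Z) \<and> (\<forall>q. (q = c \<or> r c q) \<and> germr r q Z \<longrightarrow> q = p \<or> r p q)"
proof -
  note r' = lin_conv[OF r] and tr = lin_trans[OF r]
  let ?P = "\<lambda>p. (p = c \<or> r c p) \<and> germr r p Z"
  obtain u w where uw: "u < w" "\<And>z. u < z \<Longrightarrow> z < w \<Longrightarrow> Z z"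
    by (rule infinite_imp_intervalE[OF inf D]) (rule that)
  obtain p where p: "u < p" "p < w" using dense[OF uw(1)] by blast
  have "near p Z" using near_interval[OF p] by (rule near_mono) (use uw(2) in blast)
  then have "?P p" using near_germr[OF r] near_self Zc by blast
  moreover have "D1 ?P" by (intro def_intro D1_app[OF D] Def_lin[OF r] r)
  ultimately obtain g where g: "islub (\<lambda>x y. r y x) ?P g"
    using lub_ex[OF r', of ?P p c] by blast
  have low: "q = g \<or> r g q" if "?P q" for q using g that unfolding islub_def by blast
  have app: "\<exists>z. ?P z \<and> r z t" if "r g t" for t using g that unfolding islub_def by blast
  have "g = c \<or> r c g"
  proof (rule ccontr)
    assume "\<not> (g = c \<or> r c g)"
    then have "r g c" using lin_total[OF r] by blast
    then show False using app[of c] lin_asym[OF r] lin_irrefl[OF r] by blast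
  qed
  moreover have "germr r g Z"
  proof (rule ccontr)
    assume no: "\<not> germr r g Z"
    then have "g \<noteq> p" using \<open>?P p\<close> by blast
    then have "r g p" using low \<open>?P p\<close> by blast
    then have "germr r g (\<lambda>z. \<not> Z z)" using germr_dichotomy[OF r D] no by blast
    then obtain t where t: "r g t" "\<And>z. r g z \<Longrightarrow> r z t \<Longrightarrow> \<not> Z z" unfolding germr_def by blast
    obtain q where q: "?P q" "r q t" using app[OF t(1)] by blast
    then have "r g q" using low no by blast
    obtain z where "r q z \<and> (Z z \<and> r z t)"
      using germr_ex[OF r germr_conj_upto[OF r _ q(2)]] q(1) by blast
    then show False using t(2) \<open>r g q\<close> tr by blast
  qed
  ultimately show ?thesis using low by blast
qed

text \<open>The first interval in each fibre has ends \<open>f x\<close> and \<open>g x\<close>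
  which are definable functions of \<open>x\<close>. On some subinterval a constant lies strictly
  between them, and this is an infinite row.\<close>

lemma exchange_weak:
  assumes X: "D2 X" and inf: "infinite {x. infinite {y. X x y}}"
  shows "\<exists>y. infinite {x. X x y}"
proof -
  \<comment> \<open>Any point will do. It halves the fibres so that one half is infinite for
    infinitely many \<open>x\<close>, and it bounds the left ends in that half.\<close>
  obtain c :: 'm where True by blast
  have split: "{x. infinite {y. X x y}} \<subseteq>
      {x. infinite {y. X x y \<and> c < y}} \<union> {x. infinite {y. X x y \<and> c > y}}"
  proof
    fix x assume "x \<in> {x. infinite {y. X x y}}"
    moreover have "{y. X x y} \<subseteq> insert c ({y. X x y \<and> c < y} \<union> {y. X x y \<and> c > y})" by auto
    ultimately show "x \<in> {x. infinite {y. X x y \<and> c < y}} \<union> {x. infinite {y. X x y \<and> c > y}}"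
      using finite_subset by fastforce
  qed
  obtain r where r: "lin r" and inf': "infinite {x. infinite {y. X x y \<and> r c y}}"
  proof (cases "infinite {x. infinite {y. X x y \<and> c < y}}")
    case True
    then show thesis using that[OF lin_less] by blast
  next
    case False
    then have "infinite {x. infinite {y. X x y \<and> c > y}}"
      using inf split by (meson finite_UnI finite_subset)
    then show thesis using that[OF lin_greater] by blast
  qed
  note r' = lin_conv[OF r] and tr = lin_trans[OF r]
  define Z where "Z x y \<longleftrightarrow> X x y \<and> r c y" for x y
  have DZ: "D2 Z" unfolding Z_def by (intro def_intro D2_app[OF X] Def_lin[OF r])
  note Z_app = D2_app[OF DZ]
  have DI: "D1 (\<lambda>x. infinite {y. Z x y})" by (intro def_intro Z_app)
  obtain a b where "a < b" and ab: "\<And>x. a < x \<Longrightarrow> x < b \<Longrightarrow> infinite {y. Z x y}"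
    by (rule infinite_imp_intervalE[OF inf'[folded Z_def] DI]) (rule that)
  let ?P = "\<lambda>x p. (p = c \<or> r c p) \<and> germr r p (Z x)"
  let ?L = "\<lambda>x p. ?P x p \<and> (\<forall>q. ?P x q \<longrightarrow> q = p \<or> r p q)"
  have DP: "D2 ?P" by (intro def_intro Z_app Def_lin[OF r] r)
  have DL: "D2 ?L" by (intro def_intro Z_app Def_lin[OF r] r)
  have L_ex: "\<exists>p. ?L x p" if x: "a < x" "x < b" for x
    by (rule first_germ[OF r _ _ ab[OF x]]) (intro Z_app def_intro, simp add: Z_def)
  obtain f where f: "Dfun f" and fL: "\<And>x p. ?L x p \<Longrightarrow> f x = p"
  proof (rule Dfun_from_relation[OF DL])
    show "p = q" if "?L x p" "?L x q" for x p q using that lin_asym[OF r] by blast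
  qed (rule that)
  have fP: "germr r (f x) (Z x)" if "a < x" "x < b" for x
    using L_ex[OF that] fL by blast
  let ?K = "\<lambda>x s. \<forall>z. r (f x) z \<longrightarrow> z = s \<or> r z s \<longrightarrow> Z x z"
  have DK: "D2 ?K" by (intro def_intro Z_app Def_lin[OF r] Dfun_app[OF f])
  note K_app = D2_app[OF DK]
  have DU: "D1 (\<lambda>x. \<forall>s. r (f x) s \<longrightarrow> ?K x s)"
    by (intro def_intro Z_app Def_lin[OF r] Dfun_app[OF f])
  have DN: "D1 (\<lambda>x. \<not> (\<forall>s. r (f x) s \<longrightarrow> ?K x s))" by (intro Def_neg DU)
  consider "infinite {x. a < x \<and> x < b \<and> (\<forall>s. r (f x) s \<longrightarrow> ?K x s)}"
    | "infinite {x. a < x \<and> x < b \<and> \<not> (\<forall>s. r (f x) s \<longrightarrow> ?K x s)}"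
    by (rule split_interval[OF \<open>a < b\<close>])
  then show ?thesis
  proof cases
    case 1
    \<comment> \<open>Here the interval extends to the end of the line, and a constant beyond
      \<open>f x\<close> works near a point of continuity of \<open>f\<close>.\<close>
    obtain a' b' where ab': "a \<le> a'" "a' < b'" "b' \<le> b"
      and K: "\<And>x. a' < x \<Longrightarrow> x < b' \<Longrightarrow> \<forall>s. r (f x) s \<longrightarrow> ?K x s"
      by (rule subintervalE[OF 1 DU]) (rule that)
    obtain c d where cd: "a' \<le> c" "c < d" "d \<le> b'" "\<And>x. c < x \<Longrightarrow> x < d \<Longrightarrow> cont f x"
      by (rule cont_sub[OF f ab'(2)]) (rule that)
    obtain x where x: "c < x" "x < d" using dense[OF cd(2)] by blast
    then have x': "a' < x" "x < b'" using cd by auto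
    then have "a < x" "x < b" using ab' by auto
    from germr_ex[OF r fP[OF this]] obtain s where s: "r (f x) s" by blast
    have "near x (\<lambda>z. r (f z) s \<and> (a' < z \<and> z < b'))"
      by (rule near_conj[OF cont_lin2[OF cd(4)[OF x] r s] near_interval[OF x']])
    then have "near x (\<lambda>z. Z z s)" by (rule near_mono) (use K in blast)
    then have "near x (\<lambda>z. X z s)" by (rule near_mono) (simp add: Z_def)
    then show ?thesis using near_infinite by blast
  next
    case 2
    obtain a' b' where ab': "a \<le> a'" "a' < b'" "b' \<le> b"
      and K: "\<And>x. a' < x \<Longrightarrow> x < b' \<Longrightarrow> \<not> (\<forall>s. r (f x) s \<longrightarrow> ?K x s)"
      by (rule subintervalE[OF 2 DN]) (rule that)
    let ?N = "\<lambda>x s. r (f x) s \<and> \<not> ?K x s"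
    have DG: "D2 (\<lambda>x. islub (\<lambda>x y. r y x) (?N x))"
      by (intro def_intro r' Z_app Def_lin[OF r] Dfun_app[OF f])
    obtain g where g: "Dfun g" and gN: "\<And>x s. islub (\<lambda>x y. r y x) (?N x) s \<Longrightarrow> g x = s"
      by (rule Dfun_from_relation[OF DG islub_unique[OF r']]) (assumption | rule that)+
    have G: "islub (\<lambda>x y. r y x) (?N x) (g x)" if x: "a' < x" "x < b'" for x
    proof -
      obtain s where "?N x s" using K[OF x] by blast
      moreover have "D1 (?N x)" by (intro def_intro Z_app Def_lin[OF r] Dfun_app[OF f])
      ultimately obtain s where "islub (\<lambda>x y. r y x) (?N x) s"
        using lub_ex[OF r', of "?N x" s "f x"] by blast
      then show ?thesis using gN by simp
    qed
    have fg: "r (f x) (g x)" if x: "a' < x" "x < b'" for x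
    proof (rule ccontr)
      assume no: "\<not> r (f x) (g x)"
      have "a < x" "x < b" using x ab' by auto
      from fP[OF this] obtain t where t: "r (f x) t" "\<And>z. r (f x) z \<Longrightarrow> r z t \<Longrightarrow> Z x z"
        unfolding germr_def by blast
      have "r (g x) t" using no t(1) lin_total[OF r] tr by metis
      then obtain z where z: "?N x z" "r z t" using G[OF x] unfolding islub_def by blast
      then show False using t(2) tr by blast
    qed
    have KK: "Z x s" if "a' < x" "x < b'" "r (f x) s" "r s (g x)" for x s
    proof -
      have "\<not> ?N x s"
        using G[OF that(1,2)] that(4) lin_asym[OF r] lin_irrefl[OF r] unfolding islub_def by blast
      then show ?thesis using that(3) by blast
    qed
    obtain c d s where cd: "a' \<le> c" "c < d" "d \<le> b'"
      and s: "\<And>x. c < x \<Longrightarrow> x < d \<Longrightarrow> r (f x) s \<and> r s (g x)"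
      by (rule separate[OF r f g ab'(2) fg]) (assumption | rule that)+
    have "infinite {x. X x s}"
    proof (rule interval_infinite[OF cd(2)])
      fix x assume x: "c < x" "x < d"
      then have "a' < x" "x < b'" using cd by auto
      from KK[OF this] show "X x s" using s[OF x] Z_def by blast
    qed
    then show ?thesis by blast
  qed
qed

text \<open>If the infinite rows were finitely many, deleting them would remove only finitely many
  points from each column, and \<open>exchange_weak\<close> would find a further infinite
  row.\<close>

theorem exchange:
  assumes X: "D2 X" and inf: "infinite {x. infinite {y. X x y}}"
  shows "infinite {y. infinite {x. X x y}}"
proof
  assume fin: "finite {y. infinite {x. X x y}}"
  let ?Y = "\<lambda>x y. X x y \<and> (\<forall>u\<in>{y. infinite {x. X x y}}. y \<noteq> u)"
  have "infinite {y. ?Y x y}" if "infinite {y. X x y}" for x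
  proof -
    have "{y. ?Y x y} = {y. X x y} - {y. infinite {x. X x y}}" by auto
    then show ?thesis using that fin by (simp add: Diff_infinite_finite)
  qed
  then have I: "infinite {x. infinite {y. ?Y x y}}"
    by (intro infinite_super[OF _ inf]) blast
  have D: "D2 ?Y" by (intro def_intro Def_fball[OF fin] D2_app[OF X])
  obtain y where y: "infinite {x. ?Y x y}" using exchange_weak[OF D I] by blast
  then have "infinite {x. X x y}" by (rule infinite_super[rotated]) blast
  moreover obtain x where "?Y x y" using infinite_imp_nonempty[OF y] by blast
  ultimately show False by blast
qed

text \<open>Definable choice over an interval without any group structure. If infinitely many fibres
  are infinite, exchange yields a horizontal segment and the choice is constant; otherwise the
  fibres are finite on a subinterval and have least elements.\<close>

lemma curve_selection:
  assumes Z: "D2 Z" and inf: "infinite {x. a < x \<and> x < b \<and> (\<exists>y. Z x y)}"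
  obtains c d h where "a \<le> c" "c < d" "d \<le> b" "Dfun h" "\<And>x. c < x \<Longrightarrow> x < d \<Longrightarrow> Z x (h x)"
proof -
  note Z_app = D2_app[OF Z]
  show thesis
  proof (cases "infinite {x. infinite {y. a < x \<and> x < b \<and> Z x y}}")
    case True
    have "D2 (\<lambda>x y. a < x \<and> x < b \<and> Z x y)" by (intro def_intro Z_app)
    from exchange_weak[OF this True] obtain y where y: "infinite {x. a < x \<and> x < b \<and> Z x y}" by blast
    have D: "D1 (\<lambda>x. Z x y)" by (intro def_intro Z_app)
    show thesis
      by (rule subintervalE[OF y D]) (rule that[OF _ _ _ Dfun_const])
  next
    case False
    let ?B = "\<lambda>x. (\<exists>y. Z x y) \<and> finite {y. Z x y}"
    have "{x. a < x \<and> x < b \<and> (\<exists>y. Z x y)} \<subseteq>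
        {x. a < x \<and> x < b \<and> ?B x} \<union> {x. infinite {y. a < x \<and> x < b \<and> Z x y}}" by auto
    then have inf': "infinite {x. a < x \<and> x < b \<and> ?B x}"
      using inf False by (meson finite_UnI finite_subset)
    have D: "D1 ?B" by (intro def_intro Z_app)
    obtain c d where cd: "a \<le> c" "c < d" "d \<le> b" "\<And>x. c < x \<Longrightarrow> x < d \<Longrightarrow> ?B x"
      by (rule subintervalE[OF inf' D]) (rule that)
    let ?M = "\<lambda>x y. Z x y \<and> (\<forall>z. Z x z \<longrightarrow> y \<le> z)"
    have DM: "D2 ?M" by (intro def_intro Z_app)
    obtain h where h: "Dfun h" "\<And>x y. ?M x y \<Longrightarrow> h x = y"
    proof (rule Dfun_from_relation[OF DM])
      show "p = q" if "?M x p" "?M x q" for x p q using that by (meson antisym)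
    qed (rule that)
    have "Z x (h x)" if x: "c < x" "x < d" for x
    proof -
      have "finite {y. Z x y}" "{y. Z x y} \<noteq> {}" using cd(4)[OF x] by auto
      from Min_in[OF this] Min_le[OF this(1)] have "?M x (Min {y. Z x y})" by blast
      then show ?thesis using h(2) by metis
    qed
    then show thesis using that cd h(1) by blast
  qed
qed

section \<open>Local constancy of the number of points in a fibre\<close>

text \<open>Excludes the endpoints of the line, as local arguments in the fibres need two-sided
  neighbourhoods. The excluded points are finitely many and are treated separately.\<close>

definition inner :: "'m \<Rightarrow> bool" where "inner y \<longleftrightarrow> (\<exists>a. a < y) \<and> (\<exists>b. y < b)"

lemma D1_inner: "D1 inner"
  unfolding inner_def by (intro def_intro)

lemma Def_inner [def_intro]: "dfn t \<Longrightarrow> Def (\<lambda>v. inner (t v))"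
  by (rule D1_app[OF D1_inner])

lemma inner_between: "a < y \<Longrightarrow> y < b \<Longrightarrow> inner y"
  unfolding inner_def by blast

lemma finite_not_inner: "finite {y. \<not> inner y}"
proof -
  have D: "D1 (\<lambda>y. \<not> inner y)" by (intro def_intro)
  show ?thesis
  proof (rule ccontr)
    assume inf: "infinite {y. \<not> inner y}"
    obtain a b where ab: "a < b" "\<And>y. a < y \<Longrightarrow> y < b \<Longrightarrow> \<not> inner y"
      by (rule infinite_imp_intervalE[OF inf D]) (rule that)
    then show False using dense[OF ab(1)] inner_between by blast
  qed
qed

lemma inner_lin: "inner y \<Longrightarrow> lin r \<Longrightarrow> \<exists>z. r y z"
  unfolding inner_def lin_def by auto

text \<open>Beyond \<open>h x\<close> in the direction \<open>r\<close> the fibre either has a next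
  point, and \<open>separate\<close> puts a constant between the two, or it has none, and continuity
  of \<open>h\<close> supplies the constant.\<close>

lemma box_side:
  assumes X: "D2 X" and fin: "\<And>x. finite {y. X x y}" and h: "Dfun h" and "a < b"
    and inn: "\<And>x. a < x \<Longrightarrow> x < b \<Longrightarrow> inner (h x)" and r: "lin r"
  obtains c d w where "a \<le> c" "c < d" "d \<le> b" "\<And>x. c < x \<Longrightarrow> x < d \<Longrightarrow> r (h x) w"
    "\<And>x z. c < x \<Longrightarrow> x < d \<Longrightarrow> r (h x) z \<Longrightarrow> r z w \<Longrightarrow> \<not> X x z"
proof -
  note tr = lin_trans[OF r]
  let ?N = "\<lambda>x y. X x y \<and> r (h x) y \<and> (\<forall>z. X x z \<longrightarrow> r (h x) z \<longrightarrow> z = y \<or> r y z)"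
  have DN: "D2 ?N" by (intro def_intro D2_app[OF X] Def_lin[OF r] Dfun_app[OF h])
  have DE: "D1 (\<lambda>x. \<exists>y. ?N x y)" by (intro def_intro D2_app[OF X] Def_lin[OF r] Dfun_app[OF h])
  have DE': "D1 (\<lambda>x. \<not> (\<exists>y. ?N x y))" by (intro Def_neg DE)
  consider "infinite {x. a < x \<and> x < b \<and> (\<exists>y. ?N x y)}" | "infinite {x. a < x \<and> x < b \<and> \<not> (\<exists>y. ?N x y)}"
    by (rule split_interval[OF \<open>a < b\<close>])
  then show thesis
  proof cases
    case 1
    obtain c d g where cd: "a \<le> c" "c < d" "d \<le> b" and g: "Dfun g" "\<And>x. c < x \<Longrightarrow> x < d \<Longrightarrow> ?N x (g x)"
      by (rule curve_selection[OF DN 1]) (assumption | rule that)+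
    have hg: "r (h x) (g x)" if "c < x" "x < d" for x using g(2)[OF that] by blast
    obtain c' d' w where cd': "c \<le> c'" "c' < d'" "d' \<le> d"
      and w: "\<And>x. c' < x \<Longrightarrow> x < d' \<Longrightarrow> r (h x) w \<and> r w (g x)"
      by (rule separate[OF r h g(1) cd(2) hg]) (assumption | rule that)+
    show thesis
    proof (rule that[of c' d' w])
      show "a \<le> c'" "c' < d'" "d' \<le> b" using cd cd' by auto
      fix x assume x: "c' < x" "x < d'"
      then show "r (h x) w" using w by blast
      fix z assume z: "r (h x) z" "r z w"
      have "c < x" "x < d" using x cd' by auto
      from g(2)[OF this] show "\<not> X x z"
        using z w[OF x] tr lin_asym[OF r] lin_irrefl[OF r] by metis
    qed
  next
    case 2
    obtain c d where cd: "a \<le> c" "c < d" "d \<le> b" "\<And>x. c < x \<Longrightarrow> x < d \<Longrightarrow> \<not> (\<exists>y. ?N x y)"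
      by (rule subintervalE[OF 2 DE']) (rule that)
    have none: "\<not> X x z" if x: "c < x" "x < d" and z: "r (h x) z" for x z
    proof
      assume "X x z"
      then have "{z. X x z \<and> r (h x) z} \<noteq> {}" "finite {z. X x z \<and> r (h x) z}"
        using z fin[of x] by (auto elim: rev_finite_subset)
      from finite_lin_min[OF r this(2,1)] show False using cd(4)[OF x] by blast
    qed
    obtain c' d' where cd': "c \<le> c'" "c' < d'" "d' \<le> d" "\<And>x. c' < x \<Longrightarrow> x < d' \<Longrightarrow> cont h x"
      by (rule cont_sub[OF h cd(2)]) (rule that)
    obtain x where x: "c' < x" "x < d'" using dense[OF cd'(2)] by blast
    have xc: "c < x" "x < d" using x cd' by auto
    then have "a < x" "x < b" using cd by auto
    then obtain w where w: "r (h x) w" using inner_lin[OF inn r] by blast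
    have "near x (\<lambda>z. r (h z) w \<and> (c < z \<and> z < d))"
      by (rule near_conj[OF cont_lin2[OF cd'(4)[OF x] r w] near_interval[OF xc]])
    then obtain p q where pq: "p < x" "x < q" "\<And>z. p < z \<Longrightarrow> z < q \<Longrightarrow> r (h z) w \<and> (c < z \<and> z < d)"
      unfolding near_def by blast
    show thesis
    proof (rule that[of "max c p" "min d q" w])
      show "a \<le> max c p" "min d q \<le> b" using cd by (auto simp: le_max_iff_disj min_le_iff_disj)
      have "max c p < x" "x < min d q" using pq xc by auto
      then show "max c p < min d q" by (rule less_trans)
    qed (use pq none in auto)
  qed
qed

lemma box:
  assumes X: "D2 X" and fin: "\<And>x. finite {y. X x y}" and h: "Dfun h" and "a < b"
    and inn: "\<And>x. a < x \<Longrightarrow> x < b \<Longrightarrow> inner (h x)"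
  obtains c d u w where "a \<le> c" "c < d" "d \<le> b" "\<And>x. c < x \<Longrightarrow> x < d \<Longrightarrow> u < h x \<and> h x < w"
    "\<And>x z. c < x \<Longrightarrow> x < d \<Longrightarrow> u < z \<Longrightarrow> z < w \<Longrightarrow> X x z \<Longrightarrow> z = h x"
proof -
  obtain c d w where cd: "a \<le> c" "c < d" "d \<le> b" and w: "\<And>x. c < x \<Longrightarrow> x < d \<Longrightarrow> h x < w"
    "\<And>x z. c < x \<Longrightarrow> x < d \<Longrightarrow> h x < z \<Longrightarrow> z < w \<Longrightarrow> \<not> X x z"
    by (rule box_side[OF X fin h \<open>a < b\<close> inn lin_less]) (assumption | rule that)+
  have inn': "inner (h x)" if "c < x" "x < d" for x
    by (rule inn) (use that cd in auto)
  obtain c' d' u where cd': "c \<le> c'" "c' < d'" "d' \<le> d" and u: "\<And>x. c' < x \<Longrightarrow> x < d' \<Longrightarrow> u < h x"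
    "\<And>x z. c' < x \<Longrightarrow> x < d' \<Longrightarrow> z < h x \<Longrightarrow> u < z \<Longrightarrow> \<not> X x z"
    by (rule box_side[OF X fin h \<open>c < d\<close> inn' lin_greater]) (assumption | rule that)+
  show thesis
  proof (rule that[of c' d' u w])
    show "a \<le> c'" "c' < d'" "d' \<le> b" using cd cd' by auto
    fix x assume x: "c' < x" "x < d'"
    then have x': "c < x" "x < d" using cd' by auto
    show "u < h x \<and> h x < w" using u(1)[OF x] w(1)[OF x'] by blast
    show "z = h x" if "u < z" "z < w" "X x z" for z
      using u(2)[OF x, of z] w(2)[OF x', of z] that by (metis linorder_neqE)
  qed
qed

text \<open>\<open>steady X x\<close> is a first-order condition, uniform in \<open>X\<close>, which forces the fibres near \<open>x\<close> to have
  as many points as the fibre at \<open>x\<close>; the cardinality itself is not expressible at this stage,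
  as it is not yet known to be bounded.\<close>

definition steady :: "('m \<Rightarrow> 'm \<Rightarrow> bool) \<Rightarrow> 'm \<Rightarrow> bool" where
  "steady X x \<longleftrightarrow>
    (\<forall>y. \<not> X x y \<longrightarrow> inner y \<longrightarrow> (\<exists>u w. u < y \<and> y < w \<and>
       near x (\<lambda>x'. \<forall>z. u < z \<longrightarrow> z < w \<longrightarrow> \<not> X x' z))) \<and>
    (\<forall>y. X x y \<longrightarrow> (\<forall>u w. u < y \<longrightarrow> y < w \<longrightarrow> near x (\<lambda>x'. \<exists>z. u < z \<and> z < w \<and> X x' z))) \<and>
    (\<forall>y. X x y \<longrightarrow> (\<exists>u w. u < y \<and> y < w \<and> near x (\<lambda>x'. \<forall>z z'. u < z \<longrightarrow> z < w \<longrightarrow>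
       u < z' \<longrightarrow> z' < w \<longrightarrow> X x' z \<longrightarrow> X x' z' \<longrightarrow> z = z'))) \<and>
    (\<exists>s. (\<exists>z. s < z) \<and> near x (\<lambda>x'. \<forall>z. s < z \<longrightarrow> \<not> X x' z)) \<and>
    (\<exists>s. (\<exists>z. s > z) \<and> near x (\<lambda>x'. \<forall>z. s > z \<longrightarrow> \<not> X x' z))"

text \<open>A Heine-Borel argument: the set of \<open>t\<close> up to which one neighbourhood of
  \<open>x\<close> keeps the fibres empty has a definable supremum, and the local condition at this
  supremum moves it on to \<open>b\<close>.\<close>

lemma steady_interval:
  assumes X: "D2 X" and st: "steady X x" and "a \<le> b" "inner a" "inner b"
    and no: "\<And>y. a \<le> y \<Longrightarrow> y \<le> b \<Longrightarrow> \<not> X x y"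
  shows "near x (\<lambda>x'. \<forall>z. a \<le> z \<longrightarrow> z \<le> b \<longrightarrow> \<not> X x' z)"
proof -
  have n1: "\<exists>u w. u < y \<and> y < w \<and> near x (\<lambda>x'. \<forall>z. u < z \<longrightarrow> z < w \<longrightarrow> \<not> X x' z)"
    if "a \<le> y" "y \<le> b" for y
  proof -
    obtain p q where "p < a" "b < q" using assms(4,5) unfolding inner_def by blast
    then have "inner y" using that by (intro inner_between[of p y q]) auto
    then show ?thesis using st no[OF that] unfolding steady_def by blast
  qed
  let ?S = "\<lambda>t. a \<le> t \<and> t \<le> b \<and> near x (\<lambda>x'. \<forall>z. a \<le> z \<longrightarrow> z \<le> t \<longrightarrow> \<not> X x' z)"
  have "D1 ?S" by (intro def_intro D2_app[OF X])
  moreover have "?S a"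
  proof -
    obtain u w where "u < a" "a < w" "near x (\<lambda>x'. \<forall>z. u < z \<longrightarrow> z < w \<longrightarrow> \<not> X x' z)"
      using n1[of a] \<open>a \<le> b\<close> by auto
    then show ?thesis using \<open>a \<le> b\<close> by (auto elim!: near_mono)
  qed
  ultimately obtain s where s: "islub (<) ?S s" using lub_less[of ?S a b] by auto
  have "a = s \<or> a < s" using s \<open>?S a\<close> unfolding islub_def by blast
  then have "a \<le> s" by auto
  have "s \<le> b" using s unfolding islub_def by (meson not_le leD)
  obtain u w where uw: "u < s" "s < w" and N: "near x (\<lambda>x'. \<forall>z. u < z \<longrightarrow> z < w \<longrightarrow> \<not> X x' z)"
    using n1[OF \<open>a \<le> s\<close> \<open>s \<le> b\<close>] by blast
  obtain t where t: "?S t" "u < t" using s uw(1) unfolding islub_def by blast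
  have ext: "near x (\<lambda>x'. \<forall>z. a \<le> z \<longrightarrow> z \<le> p \<longrightarrow> \<not> X x' z)" if "p < w" for p
  proof -
    have "near x (\<lambda>x'. (\<forall>z. a \<le> z \<longrightarrow> z \<le> t \<longrightarrow> \<not> X x' z) \<and> (\<forall>z. u < z \<longrightarrow> z < w \<longrightarrow> \<not> X x' z))"
      using near_conj N t(1) by blast
    then show ?thesis
    proof (rule near_mono, intro allI impI)
      fix x' z assume *: "(\<forall>z. a \<le> z \<longrightarrow> z \<le> t \<longrightarrow> \<not> X x' z) \<and> (\<forall>z. u < z \<longrightarrow> z < w \<longrightarrow> \<not> X x' z)"
        "a \<le> z" "z \<le> p"
      show "\<not> X x' z"
      proof (cases "z \<le> t")
        case False
        then have "u < z" "z < w" using t(2) * that by auto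
        then show ?thesis using * by blast
      qed (use * in blast)
    qed
  qed
  have "s = b"
  proof (rule ccontr)
    assume "s \<noteq> b"
    then have "s < min w b" using uw \<open>s \<le> b\<close> by auto
    then obtain p where p: "s < p" "p < min w b" using dense by blast
    then have "?S p" using ext[of p] \<open>a \<le> s\<close> by auto
    then have "p = s \<or> p < s" using s unfolding islub_def by blast
    then show False using p by auto
  qed
  then show ?thesis using ext uw by blast
qed

text \<open>Split off the lowest point \<open>y\<close> above \<open>s\<close>. It lies between
  \<open>p\<close> and \<open>q\<close>, where nearby fibres have exactly one point; from
  \<open>s\<close> to \<open>p\<close> nearby fibres are empty, and above \<open>q\<close> the
  induction hypothesis applies.\<close>

lemma steady_card_above:
  assumes X: "D2 X" and fin: "\<And>x. finite {y. X x y}" and inn: "\<And>x y. X x y \<Longrightarrow> inner y"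
    and st: "steady X x"
  shows "inner s \<Longrightarrow> \<not> X x s \<Longrightarrow> card {z. X x z \<and> s < z} = k \<Longrightarrow>
    near x (\<lambda>x'. card {z. X x' z \<and> s < z} = k)"
proof (induction k arbitrary: s)
  case 0
  have "finite {z. X x z \<and> s < z}" using fin[of x] by (rule rev_finite_subset) blast
  then have none: "\<not> X x z" if "s < z" for z using 0(3) that by auto
  obtain t where t: "\<exists>z. t < z" "near x (\<lambda>x'. \<forall>z. t < z \<longrightarrow> \<not> X x' z)"
    using st unfolding steady_def by blast
  have "near x (\<lambda>x'. \<forall>z. s < z \<longrightarrow> \<not> X x' z)"
  proof (cases "t \<le> s")
    case True
    show ?thesis by (rule near_mono[OF t(2)]) (use True in auto)
  next
    case False
    then have "s < t" by simp
    then have "inner t" using t(1) unfolding inner_def by blast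
    have "\<not> X x y" if "s \<le> y" for y using that none 0(2) by (cases "y = s") auto
    then have "near x (\<lambda>x'. \<forall>z. s \<le> z \<longrightarrow> z \<le> t \<longrightarrow> \<not> X x' z)"
      using \<open>s < t\<close> by (intro steady_interval[OF X st _ \<open>inner s\<close> \<open>inner t\<close>]) auto
    from near_conj[OF this t(2)] show ?thesis
      by (rule near_mono) (metis less_imp_le not_le)
  qed
  then show ?case by (rule near_mono) (metis (mono_tags, lifting) card.empty empty_Collect_eq)
next
  case (Suc k)
  let ?A = "{z. X x z \<and> s < z}"
  have finA: "finite ?A" using fin[of x] by (rule rev_finite_subset) blast
  have "?A \<noteq> {}" using Suc(4) by force
  define y where "y = Min ?A"
  have y: "X x y" "s < y" using Min_in[OF finA \<open>?A \<noteq> {}\<close>] by (simp_all add: y_def)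
  have ymin: "y \<le> z" if "X x z" "s < z" for z using Min_le[OF finA] that by (simp add: y_def)
  obtain u w where uw: "u < y" "y < w" and one: "near x (\<lambda>x'. \<forall>z z'. u < z \<longrightarrow> z < w \<longrightarrow>
       u < z' \<longrightarrow> z' < w \<longrightarrow> X x' z \<longrightarrow> X x' z' \<longrightarrow> z = z')"
    using st y(1) unfolding steady_def by blast
  obtain p where p: "max u s < p" "p < y" using dense[of "max u s" y] uw y by auto
  obtain q' where q': "y < q'" "q' \<le> w" "\<forall>z\<in>{z. X x z}. \<not> (y < z \<and> z < q')"
    using avoid_finite[OF lin_less uw(2) fin[of x]] by (metis le_less)
  obtain q where q: "y < q" "q < q'" using dense[OF q'(1)] by blast
  have inner_pq: "inner p" "inner q"
    using inner_between[of s p y] inner_between[of y q q'] p q by auto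
  have Xq: "\<not> X x q" using q' q by blast
  have "{z. X x z \<and> q < z} = ?A - {y}"
  proof (intro equalityI subsetI)
    fix z assume "z \<in> ?A - {y}"
    then have "X x z" "y < z" using ymin[of z] by auto
    then show "z \<in> {z. X x z \<and> q < z}" using q' q by (auto simp: not_less dest: le_less_trans)
  qed (use y q in auto)
  then have "card {z. X x z \<and> q < z} = k" using Suc(4) y by simp
  note IH = Suc.IH[OF inner_pq(2) Xq this]
  have "near x (\<lambda>x'. \<exists>z. p < z \<and> z < q \<and> X x' z)"
    using st y(1) p(2) q(1) unfolding steady_def by blast
  moreover have "near x (\<lambda>x'. \<forall>z. s \<le> z \<longrightarrow> z \<le> p \<longrightarrow> \<not> X x' z)"
  proof (rule steady_interval[OF X st _ Suc(2) inner_pq(1)])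
    show "s \<le> p" using p by auto
    show "\<not> X x z" if "s \<le> z" "z \<le> p" for z
    proof
      assume "X x z"
      then have "s < z" using that(1) Suc(3) by (auto simp: le_less)
      then show False using ymin[OF \<open>X x z\<close>] that(2) p(2) by auto
    qed
  qed
  moreover have "near x (\<lambda>x'. \<forall>z. q \<le> z \<longrightarrow> z \<le> q \<longrightarrow> \<not> X x' z)"
    by (rule steady_interval[OF X st _ inner_pq(2) inner_pq(2)]) (use Xq in auto)
  ultimately have "near x (\<lambda>x'. ((\<exists>z. p < z \<and> z < q \<and> X x' z) \<and> (\<forall>z. s \<le> z \<longrightarrow> z \<le> p \<longrightarrow> \<not> X x' z)) \<and>
      ((\<forall>z. q \<le> z \<longrightarrow> z \<le> q \<longrightarrow> \<not> X x' z) \<and> (card {z. X x' z \<and> q < z} = k \<and>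
      (\<forall>z z'. u < z \<longrightarrow> z < w \<longrightarrow> u < z' \<longrightarrow> z' < w \<longrightarrow> X x' z \<longrightarrow> X x' z' \<longrightarrow> z = z'))))"
    using IH one by (intro near_conj)
  then show ?case
  proof (rule near_mono, elim conjE exE)
    fix x' z0 assume z0: "p < z0" "z0 < q" "X x' z0" and sp: "\<forall>z. s \<le> z \<longrightarrow> z \<le> p \<longrightarrow> \<not> X x' z"
      and nq: "\<forall>z. q \<le> z \<longrightarrow> z \<le> q \<longrightarrow> \<not> X x' z" and k: "card {z. X x' z \<and> q < z} = k"
      and one: "\<forall>z z'. u < z \<longrightarrow> z < w \<longrightarrow> u < z' \<longrightarrow> z' < w \<longrightarrow> X x' z \<longrightarrow> X x' z' \<longrightarrow> z = z'"
    have bd: "u < p" "s < p" "q < w" using p q q' by auto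
    have "{z. X x' z \<and> s < z} = insert z0 {z. X x' z \<and> q < z}"
    proof (intro equalityI subsetI)
      fix z assume "z \<in> {z. X x' z \<and> s < z}"
      then have z: "X x' z" "s < z" by auto
      then have "p < z" using sp by (metis less_imp_le not_le)
      show "z \<in> insert z0 {z. X x' z \<and> q < z}"
      proof (cases "q < z")
        case False
        then have "z < q" using nq z by (metis not_le order_le_less)
        then have "z = z0" using one z z0 bd \<open>p < z\<close> by (meson less_trans)
        then show ?thesis by simp
      qed (use z in simp)
    next
      fix z assume "z \<in> insert z0 {z. X x' z \<and> q < z}"
      then show "z \<in> {z. X x' z \<and> s < z}" using z0 bd p q by auto
    qed
    moreover have "finite {z. X x' z \<and> q < z}" using fin[of x'] by (rule rev_finite_subset) blast
    moreover have "z0 \<notin> {z. X x' z \<and> q < z}" using z0 by auto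
    ultimately show "card {z. X x' z \<and> s < z} = Suc k" using k by simp
  qed
qed

lemma steady_card:
  assumes X: "D2 X" and fin: "\<And>x. finite {y. X x y}" and inn: "\<And>x y. X x y \<Longrightarrow> inner y"
    and st: "steady X x"
  shows "near x (\<lambda>x'. card {y. X x' y} = card {y. X x y})"
proof -
  obtain t z where t: "z < t" "near x (\<lambda>x'. \<forall>z. t > z \<longrightarrow> \<not> X x' z)"
    using st unfolding steady_def by blast
  obtain s where s: "z < s" "s < t" using dense[OF t(1)] by blast
  have "inner s" by (rule inner_between[OF s])
  have eq: "{y. X x' y \<and> s < y} = {y. X x' y}" if "\<forall>z. t > z \<longrightarrow> \<not> X x' z" for x'
    using that s(2) by (auto simp: not_less) (metis less_le_trans not_le order_le_less)
  have now: "\<forall>z. t > z \<longrightarrow> \<not> X x z" using near_self[OF t(2)] .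
  have "near x (\<lambda>x'. card {z. X x' z \<and> s < z} = card {y. X x y})"
    by (rule steady_card_above[OF X fin inn st \<open>inner s\<close>]) (use now s eq[OF now] in auto)
  from near_conj[OF this t(2)] show ?thesis
    by (rule near_mono) (use eq in auto)
qed

text \<open>If a clause failed infinitely often, \<open>curve_selection\<close> would give a
  function \<open>h\<close> of failing points on an interval; a box around its graph, or continuity
  of \<open>h\<close>, restores the clause at some point. In the two clauses about the ends of the
  line, \<open>h\<close> is the extreme point of the fibre.\<close>

lemma finite_not_steady:
  assumes X: "D2 X" and fin: "\<And>x. finite {y. X x y}" and inn: "\<And>x y. X x y \<Longrightarrow> inner y"
  shows "finite {x. \<not> steady X x}"
proof -
  note X_app = D2_app[OF X]
  have 1: "finite {x. \<exists>y. Z x y}"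
    if Z: "D2 Z" and contra: "\<And>a b h. a < b \<Longrightarrow> Dfun h \<Longrightarrow> (\<And>x. a < x \<Longrightarrow> x < b \<Longrightarrow> Z x (h x)) \<Longrightarrow>
      \<exists>x. a < x \<and> x < b \<and> \<not> Z x (h x)" for Z
  proof (rule ccontr)
    assume inf: "infinite {x. \<exists>y. Z x y}"
    have D: "D1 (\<lambda>x. \<exists>y. Z x y)" by (intro def_intro D2_app[OF Z])
    obtain a b where ab: "a < b" "\<And>x. a < x \<Longrightarrow> x < b \<Longrightarrow> \<exists>y. Z x y"
      by (rule infinite_imp_intervalE[OF inf D]) (rule that)
    have inf': "infinite {x. a < x \<and> x < b \<and> (\<exists>y. Z x y)}"
      by (rule interval_infinite[OF ab(1)]) (use ab(2) in blast)
    obtain c d h where "c < d" "Dfun h" "\<And>x. c < x \<Longrightarrow> x < d \<Longrightarrow> Z x (h x)"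
      by (rule curve_selection[OF Z inf']) (rule that)
    then show False using contra by blast
  qed
  let ?Z1 = "\<lambda>x y. \<not> X x y \<and> inner y \<and> \<not> (\<exists>u w. u < y \<and> y < w \<and>
       near x (\<lambda>x'. \<forall>z. u < z \<longrightarrow> z < w \<longrightarrow> \<not> X x' z))"
  let ?Z2 = "\<lambda>x y. X x y \<and> \<not> (\<forall>u w. u < y \<longrightarrow> y < w \<longrightarrow> near x (\<lambda>x'. \<exists>z. u < z \<and> z < w \<and> X x' z))"
  let ?Z3 = "\<lambda>x y. X x y \<and> \<not> (\<exists>u w. u < y \<and> y < w \<and> near x (\<lambda>x'. \<forall>z z'. u < z \<longrightarrow> z < w \<longrightarrow>
       u < z' \<longrightarrow> z' < w \<longrightarrow> X x' z \<longrightarrow> X x' z' \<longrightarrow> z = z'))"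
  let ?B = "\<lambda>r x. \<not> (\<exists>s. (\<exists>z. r s z) \<and> near x (\<lambda>x'. \<forall>z. r s z \<longrightarrow> \<not> X x' z))"
  have Z1: "finite {x. \<exists>y. ?Z1 x y}"
  proof (rule 1)
    show "D2 ?Z1" by (intro def_intro X_app)
    fix a b h assume ab: "a < b" and h: "Dfun h" and Z: "\<And>x. a < x \<Longrightarrow> x < b \<Longrightarrow> ?Z1 x (h x)"
    have inn': "inner (h x)" if "a < x" "x < b" for x using Z[OF that] by blast
    obtain c d u w where cd: "a \<le> c" "c < d" "d \<le> b" and u: "\<And>x. c < x \<Longrightarrow> x < d \<Longrightarrow> u < h x \<and> h x < w"
      and w: "\<And>x z. c < x \<Longrightarrow> x < d \<Longrightarrow> u < z \<Longrightarrow> z < w \<Longrightarrow> X x z \<Longrightarrow> z = h x"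
      by (rule box[OF X fin h ab inn']) (assumption | rule that)+
    obtain x where x: "c < x" "x < d" using dense[OF cd(2)] by blast
    have "near x (\<lambda>x'. \<forall>z. u < z \<longrightarrow> z < w \<longrightarrow> \<not> X x' z)"
    proof (rule near_mono[OF near_interval[OF x]], intro allI impI notI)
      fix x' z assume *: "c < x' \<and> x' < d" "u < z" "z < w" "X x' z"
      then have "z = h x'" using w by blast
      have "a < x'" "x' < b" using * cd by auto
      then show False using Z \<open>z = h x'\<close> \<open>X x' z\<close> by blast
    qed
    then have "\<not> ?Z1 x (h x)" using u[OF x] by blast
    moreover have "a < x" "x < b" using x cd by auto
    ultimately show "\<exists>x. a < x \<and> x < b \<and> \<not> ?Z1 x (h x)" by blast
  qed
  have Z2: "finite {x. \<exists>y. ?Z2 x y}"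
  proof (rule 1)
    show "D2 ?Z2" by (intro def_intro X_app)
    fix a b h assume ab: "a < b" and h: "Dfun h" and Z: "\<And>x. a < x \<Longrightarrow> x < b \<Longrightarrow> ?Z2 x (h x)"
    obtain c d where cd: "a \<le> c" "c < d" "d \<le> b" "\<And>x. c < x \<Longrightarrow> x < d \<Longrightarrow> cont h x"
      by (rule cont_sub[OF h ab]) (rule that)
    obtain x where x: "c < x" "x < d" using dense[OF cd(2)] by blast
    have xa: "a < x" "x < b" using x cd by auto
    have "near x (\<lambda>x'. \<exists>z. u < z \<and> z < w \<and> X x' z)" if uw: "u < h x" "h x < w" for u w
    proof -
      have "near x (\<lambda>x'. (u < h x' \<and> h x' < w) \<and> (a < x' \<and> x' < b))"
        by (intro near_conj[OF near_conj[OF cont_lin1[OF cd(4)[OF x] lin_less uw(1)]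
          cont_lin2[OF cd(4)[OF x] lin_less uw(2)]] near_interval[OF xa]])
      then show ?thesis by (rule near_mono) (use Z in blast)
    qed
    then show "\<exists>x. a < x \<and> x < b \<and> \<not> ?Z2 x (h x)" using xa by blast
  qed
  have Z3: "finite {x. \<exists>y. ?Z3 x y}"
  proof (rule 1)
    show "D2 ?Z3" by (intro def_intro X_app)
    fix a b h assume ab: "a < b" and h: "Dfun h" and Z: "\<And>x. a < x \<Longrightarrow> x < b \<Longrightarrow> ?Z3 x (h x)"
    have inn': "inner (h x)" if "a < x" "x < b" for x using Z[OF that] inn by blast
    obtain c d u w where cd: "a \<le> c" "c < d" "d \<le> b" and u: "\<And>x. c < x \<Longrightarrow> x < d \<Longrightarrow> u < h x \<and> h x < w"
      and w: "\<And>x z. c < x \<Longrightarrow> x < d \<Longrightarrow> u < z \<Longrightarrow> z < w \<Longrightarrow> X x z \<Longrightarrow> z = h x"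
      by (rule box[OF X fin h ab inn']) (assumption | rule that)+
    obtain x where x: "c < x" "x < d" using dense[OF cd(2)] by blast
    have "near x (\<lambda>x'. \<forall>z z'. u < z \<longrightarrow> z < w \<longrightarrow> u < z' \<longrightarrow> z' < w \<longrightarrow> X x' z \<longrightarrow> X x' z' \<longrightarrow> z = z')"
      by (rule near_mono[OF near_interval[OF x]]) (use w in blast)
    then have "\<not> ?Z3 x (h x)" using u[OF x] by blast
    moreover have "a < x" "x < b" using x cd by auto
    ultimately show "\<exists>x. a < x \<and> x < b \<and> \<not> ?Z3 x (h x)" by blast
  qed
  have B: "finite {x. ?B r x}" if r: "lin r" for r
  proof (rule ccontr)
    assume inf: "infinite {x. ?B r x}"
    have D: "D1 (?B r)" by (intro def_intro X_app Def_lin[OF r])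
    obtain a b where ab: "a < b" "\<And>x. a < x \<Longrightarrow> x < b \<Longrightarrow> ?B r x"
      by (rule infinite_imp_intervalE[OF inf D]) (rule that)
    let ?M = "\<lambda>x y. X x y \<and> (\<forall>z. X x z \<longrightarrow> \<not> r y z)"
    have DM: "D2 ?M" by (intro def_intro X_app Def_lin[OF r])
    have DM': "D1 (\<lambda>x. \<not> (\<exists>y. ?M x y))" by (intro def_intro X_app Def_lin[OF r])
    consider "infinite {x. a < x \<and> x < b \<and> (\<exists>y. ?M x y)}" | "infinite {x. a < x \<and> x < b \<and> \<not> (\<exists>y. ?M x y)}"
      by (rule split_interval[OF \<open>a < b\<close>])
    then show False
    proof cases
      case 1
      obtain c d h where cd: "a \<le> c" "c < d" "d \<le> b" and h: "Dfun h" "\<And>x. c < x \<Longrightarrow> x < d \<Longrightarrow> ?M x (h x)"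
        by (rule curve_selection[OF DM 1]) (assumption | rule that)+
      obtain c' d' where cd': "c \<le> c'" "c' < d'" "d' \<le> d" "\<And>x. c' < x \<Longrightarrow> x < d' \<Longrightarrow> cont h x"
        by (rule cont_sub[OF h(1) cd(2)]) (rule that)
      obtain x where x: "c' < x" "x < d'" using dense[OF cd'(2)] by blast
      have xc: "c < x" "x < d" using x cd' by auto
      have xa: "a < x" "x < b" using xc cd by auto
      obtain t where "r (h x) t" using inner_lin[OF inn r] h(2)[OF xc] by blast
      then obtain s where s: "r (h x) s" "r s t" using lin_dense[OF r] by blast
      have "near x (\<lambda>x'. r (h x') s \<and> (c < x' \<and> x' < d))"
        by (rule near_conj[OF cont_lin2[OF cd'(4)[OF x] r s(1)] near_interval[OF xc]])
      then have "near x (\<lambda>x'. \<forall>z. r s z \<longrightarrow> \<not> X x' z)"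
        by (rule near_mono) (use h(2) lin_trans[OF r] in blast)
      then show False using ab(2)[OF xa] s(2) by blast
    next
      case 2
      obtain c d where cd: "a \<le> c" "c < d" "d \<le> b" "\<And>x. c < x \<Longrightarrow> x < d \<Longrightarrow> \<not> (\<exists>y. ?M x y)"
        by (rule subintervalE[OF 2 DM']) (rule that)
      have none: "\<not> X x y" if x: "c < x" "x < d" for x y
      proof
        assume "X x y"
        then have "{y. X x y} \<noteq> {}" by blast
        from finite_lin_min[OF lin_conv[OF r] fin this]
        obtain m where m: "X x m" "\<And>y. X x y \<Longrightarrow> y = m \<or> r y m" by auto
        have "\<not> r m z" if "X x z" for z
          using m(2)[OF that] lin_asym[OF r, of m z] lin_irrefl[OF r, of m] by auto
        then show False using cd(4)[OF x] m(1) by blast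
      qed
      obtain x where x: "c < x" "x < d" using dense[OF cd(2)] by blast
      have xa: "a < x" "x < b" using x cd by auto
      have "near x (\<lambda>x'. \<forall>z. r s z \<longrightarrow> \<not> X x' z)" for s
        by (rule near_mono[OF near_interval[OF x]]) (use none in blast)
      moreover have "\<exists>s z. r s z" using lin_total[OF r, of a x] xa(1) by (metis less_irrefl)
      ultimately show False using ab(2)[OF xa] by blast
    qed
  qed
  have "{x. \<not> steady X x} \<subseteq> ({x. \<exists>y. ?Z1 x y} \<union> {x. \<exists>y. ?Z2 x y} \<union> {x. \<exists>y. ?Z3 x y}) \<union>
      ({x. ?B (<) x} \<union> {x. ?B (>) x})"
    unfolding steady_def by blast
  then show ?thesis
    using Z1 Z2 Z3 B[OF lin_less] B[OF lin_greater] by (meson finite_UnI finite_subset)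
qed

end

context omin
begin

section \<open>Uniform finiteness\<close>

definition deps :: "nat set \<Rightarrow> ((nat \<Rightarrow> 'm) \<Rightarrow> 'b) \<Rightarrow> bool" where
  "deps I P \<longleftrightarrow> (\<forall>v w. (\<forall>i\<in>I. v i = w i) \<longrightarrow> P v = P w)"

lemma depsD: "deps I P \<Longrightarrow> (\<And>i. i \<in> I \<Longrightarrow> v i = w i) \<Longrightarrow> P v = P w"
  unfolding deps_def by blast

lemma deps_upd: "deps (insert j I) P \<Longrightarrow> (\<And>i. i \<in> I \<Longrightarrow> v i = w i) \<Longrightarrow> P (v(j := t)) = P (w(j := t))"
  by (erule depsD) auto

lemma Def_card_ge:
  assumes "DefP P" "\<And>v. finite {t. P t v}" shows "Def (\<lambda>v. c \<le> card {t. P t v})"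
  using assms
proof (induction c arbitrary: P)
  case 0
  show ?case by (simp add: Def_const)
next
  case (Suc c)
  have "Def (\<lambda>w. c \<le> card {y. P y (\<lambda>i. w (Suc i)) \<and> w 0 < y})"
  proof (rule Suc.IH)
    show "DefP (\<lambda>y w. P y (\<lambda>i. w (Suc i)) \<and> w 0 < y)"
      by (intro def_intro DefP_app[OF Suc.prems(1)])
    show "finite {y. P y (\<lambda>i. w (Suc i)) \<and> w 0 < y}" for w
      using Suc.prems(2)[of "\<lambda>i. w (Suc i)"] by (rule rev_finite_subset) blast
  qed
  then have D: "Def (\<lambda>v. \<exists>x. P x v \<and> c \<le> card {y. P y v \<and> x < y})"
    by (intro Def_ex Def_conj DefP_app[OF Suc.prems(1)] def_intro)
  have "Suc c \<le> card {y. P y v} \<longleftrightarrow> (\<exists>x. P x v \<and> c \<le> card {y. P y v \<and> x < y})" for v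
  proof
    assume le: "Suc c \<le> card {y. P y v}"
    then have ne: "{y. P y v} \<noteq> {}" by (metis card.empty not_less_eq_eq zero_le)
    define x where "x = Min {y. P y v}"
    have "P x v" using Min_in[OF Suc.prems(2) ne] by (simp add: x_def)
    have "{y. P y v \<and> x < y} = {y. P y v} - {x}"
      using Min_le[OF Suc.prems(2)[of v]] by (auto simp: x_def le_less)
    then have "c \<le> card {y. P y v \<and> x < y}"
      using le \<open>P x v\<close> by (simp add: card_Diff_singleton)
    then show "\<exists>x. P x v \<and> c \<le> card {y. P y v \<and> x < y}" using \<open>P x v\<close> by blast
  next
    assume "\<exists>x. P x v \<and> c \<le> card {y. P y v \<and> x < y}"
    then obtain x where x: "P x v" "c \<le> card {y. P y v \<and> x < y}" by blast
    have "finite {y. P y v \<and> x < y}" using Suc.prems(2)[of v] by (rule rev_finite_subset) blast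
    then have "Suc c \<le> card (insert x {y. P y v \<and> x < y})" using x by simp
    also have "\<dots> \<le> card {y. P y v}"
      by (rule card_mono[OF Suc.prems(2)]) (use x in blast)
    finally show "Suc c \<le> card {y. P y v}" .
  qed
  then show ?case using D by simp
qed

lemma Def_card_eq:
  assumes "DefP P" "\<And>v. finite {t. P t v}" shows "Def (\<lambda>v. card {t. P t v} = c)"
proof -
  have "Def (\<lambda>v. c \<le> card {t. P t v} \<and> \<not> Suc c \<le> card {t. P t v})"
    by (intro Def_conj Def_neg Def_card_ge assms)
  then show ?thesis by (rule back_subst[of Def]) (auto simp: fun_eq_iff)
qed

lemma near_avoid:
  assumes "finite B" "x \<notin> B" "a < x" "x < (b :: 'm)"
  obtains c d where "a \<le> c" "c < x" "x < d" "d \<le> b" "\<And>z. c < z \<Longrightarrow> z < d \<Longrightarrow> z \<notin> B"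
proof -
  obtain d where d: "x < d" "d = b \<or> d < b" "\<forall>z\<in>B. \<not> (x < z \<and> z < d)"
    using avoid_finite[OF lin_less assms(4,1)] by blast
  obtain c where c: "c < x" "c = a \<or> a < c" "\<forall>z\<in>B. \<not> (z < x \<and> c < z)"
    using avoid_finite[OF lin_greater assms(3,1)] by blast
  show thesis
  proof (rule that[of c d])
    fix z assume "c < z" "z < d"
    then show "z \<notin> B" using c d assms(2) by (cases z x rule: linorder_cases) auto
  qed (use c d in auto)
qed

lemma card_below_less:
  assumes "finite {z. E z}" "E x" "x < (y::'m)" shows "card {z. E z \<and> z < x} < card {z. E z \<and> z < y}"
proof (rule psubset_card_mono)
  show "finite {z. E z \<and> z < y}" using assms(1) by (rule rev_finite_subset) blast
  show "{z. E z \<and> z < x} \<subset> {z. E z \<and> z < y}" using assms by (auto dest: less_trans)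
qed

text \<open>Uniform finiteness for families whose parameters are the coordinates in
  \<open>I\<close>; in this form it admits an induction on \<open>I\<close>.\<close>

definition UFI :: "nat set \<Rightarrow> bool" where
  "UFI I \<longleftrightarrow> (\<forall>P. DefP P \<longrightarrow> (\<forall>t. deps I (P t)) \<longrightarrow> (\<forall>v. finite {t. P t v}) \<longrightarrow>
     (\<exists>N. \<forall>v. card {t. P t v} \<le> N))"

lemma UFI_D:
  assumes "UFI I" "DefP P" "\<And>t. deps I (P t)" "\<And>v. finite {t. P t v}"
  shows "\<exists>N. \<forall>v. card {t. P t v} \<le> N"
  using assms unfolding UFI_def by simp

text \<open>\<open>k\<close> is constant near every good point along every coordinate, and all but finitely many points of
  a line are good. To eliminate a coordinate \<open>j\<close>, cut each line in direction \<open>j\<close> at its finitely many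
  exceptional points; their number is uniformly bounded. On the \<open>i\<close>-th piece \<open>k\<close> is constant and
  defines a function of the remaining coordinates, which is again of this kind: by the exchange
  lemma, for all but finitely many \<open>x\<close> on a line some point of the piece is good and remains in the
  piece near \<open>x\<close>.\<close>

lemma finite_range:
  fixes k :: "(nat \<Rightarrow> 'm) \<Rightarrow> nat"
  assumes "finite I" and UF: "\<And>J. J \<subset> I \<Longrightarrow> UFI J"
    and dk: "deps I k" and dS: "deps I S" and DS: "Def S"
    and Dk: "\<And>\<kappa>. Def (\<lambda>v. S v \<and> k v = \<kappa>)"
    and DG: "\<And>l. l \<in> I \<Longrightarrow> Def (G l)" and dG: "\<And>l. l \<in> I \<Longrightarrow> deps I (G l)"
    and exc: "\<And>l v. l \<in> I \<Longrightarrow> finite {x. S (v(l := x)) \<and> \<not> G l (v(l := x))}"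
    and loc: "\<And>l v. l \<in> I \<Longrightarrow> S v \<Longrightarrow> G l v \<Longrightarrow> near (v l) (\<lambda>x. S (v(l := x)) \<and> k (v(l := x)) = k v)"
    and graph: "\<And>l B. l \<in> I \<Longrightarrow> Def B \<Longrightarrow> deps I B \<Longrightarrow>
      (\<And>v x x'. B (v(l := x)) \<Longrightarrow> B (v(l := x')) \<Longrightarrow> x = x') \<Longrightarrow> finite (k ` {v. S v \<and> B v})"
  shows "finite (k ` {v. S v})"
  using assms
proof (induction I arbitrary: k S G rule: finite_induct)
  case empty
  then have "k v = k undefined" for v by (auto simp: deps_def)
  then have "k ` {v. S v} \<subseteq> {k undefined}" by auto
  then show ?case using finite_subset by blast
next
  case (insert j I)
  note UF = insert.prems(1) and dk = insert.prems(2) and dS = insert.prems(3) and DS = insert.prems(4)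
    and Dk = insert.prems(5) and DG = insert.prems(6) and dG = insert.prems(7) and exc = insert.prems(8)
    and loc = insert.prems(9) and graph = insert.prems(10)
  have DGj: "Def (G j)" using DG by simp
  define Ok where "Ok t v \<longleftrightarrow> S (v(j := t)) \<and> G j (v(j := t))" for t v
  \<comment> \<open>Cut points of the line in direction \<open>j\<close>: the boundary of the set of
    good points, and the points of \<open>S\<close> that are not good. Between them
    \<open>Ok\<close> is constant, and where it holds so is \<open>k\<close>.\<close>
  define E where "E t v \<longleftrightarrow> \<not> near t (\<lambda>z. Ok z v) \<and> \<not> near t (\<lambda>z. \<not> Ok z v) \<or>
      S (v(j := t)) \<and> \<not> G j (v(j := t))" for t v
  define idx where "idx t v = card {z. E z v \<and> z < t}" for t v
  define C where "C i t v \<longleftrightarrow> S (v(j := t)) \<and> \<not> E t v \<and> idx t v = i" for i t v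
  have DO: "DefP Ok" unfolding Ok_def by (intro def_intro Def_subst[OF DS] Def_subst[OF DGj])
  have DE: "DefP E" unfolding E_def
    by (intro def_intro DefP_app[OF DO] Def_subst[OF DS] Def_subst[OF DGj])
  have Ok_cong: "Ok t v = Ok t w" if "\<And>i. i \<in> I \<Longrightarrow> v i = w i" for t v w
  proof -
    have "S (v(j := t)) = S (w(j := t))" by (rule deps_upd[OF dS that])
    moreover have "G j (v(j := t)) = G j (w(j := t))" by (rule deps_upd[OF dG[OF insertI1] that])
    ultimately show ?thesis unfolding Ok_def by simp
  qed
  have E_cong: "E t v = E t w" if vw: "\<And>i. i \<in> I \<Longrightarrow> v i = w i" for t v w
  proof -
    have "Ok z v = Ok z w" for z by (rule Ok_cong[OF vw])
    moreover have "S (v(j := t)) = S (w(j := t))" by (rule deps_upd[OF dS vw])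
    moreover have "G j (v(j := t)) = G j (w(j := t))" by (rule deps_upd[OF dG[OF insertI1] vw])
    ultimately show ?thesis unfolding E_def by simp
  qed
  have idx_cong: "idx t v = idx t w" if vw: "\<And>i. i \<in> I \<Longrightarrow> v i = w i" for t v w
  proof -
    have "E z v = E z w" for z by (rule E_cong[OF vw])
    then show ?thesis unfolding idx_def by simp
  qed
  have C_cong: "C i t v = C i t w" if vw: "\<And>i. i \<in> I \<Longrightarrow> v i = w i" for i t v w
  proof -
    have "E t v = E t w" by (rule E_cong[OF vw])
    moreover have "idx t v = idx t w" by (rule idx_cong[OF vw])
    moreover have "S (v(j := t)) = S (w(j := t))" by (rule deps_upd[OF dS vw])
    ultimately show ?thesis unfolding C_def by simp
  qed
  have upd_E: "E t (v(j := x)) = E t v" for t v x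
    by (rule E_cong) (use insert.hyps in auto)
  have upd_idx: "idx t (v(j := x)) = idx t v" for t v x
    by (rule idx_cong) (use insert.hyps in auto)
  have fE: "finite {t. E t v}" for v
  proof -
    have "{t. E t v} = {t. \<not> near t (\<lambda>z. Ok z v) \<and> \<not> near t (\<lambda>z. \<not> Ok z v)} \<union>
        {t. S (v(j := t)) \<and> \<not> G j (v(j := t))}" unfolding E_def by blast
    then show ?thesis
      by (simp only:) (intro finite_UnI finite_boundary DefP_fix[OF DO] exc insertI1)
  qed
  have "\<forall>t. deps I (E t)" unfolding deps_def using E_cong by blast
  moreover have "UFI I" using UF[of I] insert.hyps by blast
  ultimately obtain N where N: "\<And>v. card {t. E t v} \<le> N" using DE fE unfolding UFI_def by blast
  have idx_le: "idx t v \<le> N" for t v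
    unfolding idx_def using card_mono[OF fE[of v], of "{z. E z v \<and> z < t}"] N[of v] by fastforce
  have Didx: "DefP (\<lambda>t v. idx t v = i)" for i
    unfolding idx_def
  proof (rule Def_card_eq)
    show "DefP (\<lambda>z w. E z (\<lambda>i. w (Suc i)) \<and> z < w 0)" by (intro def_intro DefP_app[OF DE])
    show "finite {z. E z (\<lambda>i. w (Suc i)) \<and> z < w 0}" for w
      using fE[of "\<lambda>i. w (Suc i)"] by (rule rev_finite_subset) blast
  qed
  have DC: "DefP (C i)" for i
    unfolding C_def by (intro def_intro Def_subst[OF DS] DefP_app[OF DE] DefP_app[OF Didx])
  have C_Ok: "Ok t v \<and> near t (\<lambda>z. Ok z v)" if "C i t v" for i t v
    using that near_self[of t "\<lambda>z. \<not> Ok z v"] unfolding C_def E_def Ok_def by blast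
  have C_open: "near t (\<lambda>z. C i z v)" if Ct: "C i t v" for i t v
  proof -
    obtain a b where ab: "a < t" "t < b" "\<And>z. a < z \<Longrightarrow> z < b \<Longrightarrow> Ok z v"
      using C_Ok[OF Ct] unfolding near_def by blast
    have "t \<notin> {t. E t v}" using Ct unfolding C_def by blast
    then obtain c d where cd: "a \<le> c" "c < t" "t < d" "d \<le> b" "\<And>z. c < z \<Longrightarrow> z < d \<Longrightarrow> z \<notin> {t. E t v}"
      using near_avoid[OF fE _ ab(1,2)] by blast
    have "C i z v" if z: "c < z" "z < d" for z
    proof -
      have "{y. E y v \<and> y < z} = {y. E y v \<and> y < t}"
      proof (intro equalityI subsetI)
        fix y assume y: "y \<in> {y. E y v \<and> y < z}"
        then have "\<not> (c < y \<and> y < d)" using cd(5) by blast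
        then show "y \<in> {y. E y v \<and> y < t}" using y z cd by auto
      next
        fix y assume y: "y \<in> {y. E y v \<and> y < t}"
        then have "\<not> (c < y \<and> y < d)" using cd(5) by blast
        then show "y \<in> {y. E y v \<and> y < z}" using y z cd by auto
      qed
      moreover have "Ok z v" using ab(3) z cd by auto
      ultimately show ?thesis using Ct cd(5)[OF z] unfolding C_def idx_def Ok_def by auto
    qed
    then show ?thesis unfolding near_def using cd(2,3) by blast
  qed
  have const_less: "k (v(j := t')) = k (v(j := t))" if C: "C i t v" "C i t' v" and "t < t'" for i t t' v
  proof -
    let ?I = "\<lambda>z. t \<le> z \<and> z \<le> t'"
    have cI: "conv ?I" unfolding conv_def by auto
    have noE: "\<not> E z v" if "?I z" for z
    proof
      assume Ez: "E z v"
      then have "z \<noteq> t" "z \<noteq> t'" using C unfolding C_def by auto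
      then have "t < z" "z < t'" using that by auto
      have "card {y. E y v \<and> y < z} < card {y. E y v \<and> y < t'}"
        by (rule card_below_less[OF fE Ez \<open>z < t'\<close>])
      moreover have "card {y. E y v \<and> y < t} \<le> card {y. E y v \<and> y < z}"
      proof (rule card_mono)
        show "finite {y. E y v \<and> y < z}" using fE[of v] by (rule rev_finite_subset) blast
      qed (use \<open>t < z\<close> in auto)
      ultimately show False using C unfolding C_def idx_def by simp
    qed
    have Ok: "Ok z v" if "?I z" for z
    proof (rule connected[where x = t and y = z, OF DefP_fix[OF DO] cI])
      show "near z (\<lambda>z. Ok z v) \<or> near z (\<lambda>z. \<not> Ok z v)" if "?I z" for z
        using noE[OF that] unfolding E_def by blast
    qed (use C_Ok[OF C(1)] \<open>t < t'\<close> that in auto)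
    let ?A = "\<lambda>z. S (v(j := z)) \<and> k (v(j := z)) = k (v(j := t))"
    have DA: "D1 ?A" by (rule Def_subst[OF Dk]) (intro def_intro)
    have "?A t'"
    proof (rule connected[where x = t and y = t', OF DA cI])
      fix z assume z: "?I z"
      from Ok[OF z] have "near ((v(j := z)) j) (\<lambda>x. S ((v(j := z))(j := x)) \<and> k ((v(j := z))(j := x)) = k (v(j := z)))"
        unfolding Ok_def by (intro loc[OF insertI1]) blast+
      then have *: "near z (\<lambda>x. S (v(j := x)) \<and> k (v(j := x)) = k (v(j := z)))" by simp
      show "near z ?A \<or> near z (\<lambda>z. \<not> ?A z)"
      proof (cases "k (v(j := z)) = k (v(j := t))")
        case True
        then show ?thesis using * by simp
      next
        case False
        have "near z (\<lambda>z. \<not> ?A z)" by (rule near_mono[OF *]) (use False in auto)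
        then show ?thesis by blast
      qed
    qed (use C less_imp_le[OF \<open>t < t'\<close>] C_def in blast)+
    then show ?thesis by blast
  qed
  have const: "k (v(j := t)) = k (v(j := t'))" if "C i t v" "C i t' v" for i t t' v
    using const_less[of i t v t'] const_less[of i t' v t] that by (cases t t' rule: linorder_cases) auto
  have C_S: "S (v(j := t))" if "C i t v" for i t v using that unfolding C_def by blast
  define k' where "k' i v = k (v(j := (SOME t. C i t v)))" for i v
  have k': "k' i v = k (v(j := t))" if "C i t v" for i t v
    unfolding k'_def using const someI[of "\<lambda>t. C i t v"] that by blast
  have fin': "finite (k' i ` {v. \<exists>t. C i t v})" for i
  proof (rule insert.IH[of "k' i" "\<lambda>v. \<exists>t. C i t v" "\<lambda>l v. \<exists>t. C i t v \<and> G l (v(j := t)) \<and> near (v l) (\<lambda>x. C i t (v(l := x)))"])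
    show "UFI J" if "J \<subset> I" for J by (rule UF) (use that insert.hyps in auto)
    show "deps I (k' i)"
      unfolding deps_def
    proof (intro allI impI)
      fix v w :: "nat \<Rightarrow> 'm" assume vw: "\<forall>i\<in>I. v i = w i"
      then have "C i t v = C i t w" for t using C_cong by blast
      then have "(SOME t. C i t v) = (SOME t. C i t w)" by simp
      moreover have "k (v(j := t)) = k (w(j := t))" for t by (rule deps_upd[OF dk]) (use vw in blast)
      ultimately show "k' i v = k' i w" unfolding k'_def by simp
    qed
    show "deps I (\<lambda>v. \<exists>t. C i t v)" unfolding deps_def using C_cong by blast
    show "Def (\<lambda>v. \<exists>t. C i t v)" by (intro def_intro DefP_app[OF DC])
    have "((\<exists>t. C i t v) \<and> k' i v = \<kappa>) \<longleftrightarrow> (\<exists>t. C i t v \<and> S (v(j := t)) \<and> k (v(j := t)) = \<kappa>)" for v \<kappa>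
      using k' C_S by metis
    moreover have "Def (\<lambda>v. \<exists>t. C i t v \<and> S (v(j := t)) \<and> k (v(j := t)) = \<kappa>)" for \<kappa>
      by (intro Def_ex Def_conj[OF DefP_app[OF DC] Def_subst[OF Dk]] dfn_var dfn_upd)
    ultimately show "Def (\<lambda>v. (\<exists>t. C i t v) \<and> k' i v = \<kappa>)" for \<kappa> by simp
    fix l assume l: "l \<in> I"
    then have "l \<noteq> j" and l': "l \<in> insert j I" using insert.hyps by auto
    show "Def (\<lambda>v. \<exists>t. C i t v \<and> G l (v(j := t)) \<and> near (v l) (\<lambda>x. C i t (v(l := x))))"
      by (intro def_intro DefP_app[OF DC] Def_subst[OF DG[OF l']])
    show "deps I (\<lambda>v. \<exists>t. C i t v \<and> G l (v(j := t)) \<and> near (v l) (\<lambda>x. C i t (v(l := x))))"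
      unfolding deps_def
    proof (intro allI impI)
      fix v w :: "nat \<Rightarrow> 'm" assume vw: "\<forall>i\<in>I. v i = w i"
      have "C i t (v(l := x)) = C i t (w(l := x))" for t x by (rule C_cong) (use vw in auto)
      moreover have "C i t v = C i t w" for t by (rule C_cong) (use vw in auto)
      moreover have "G l (v(j := t)) = G l (w(j := t))" for t
        by (rule deps_upd[OF dG[OF l']]) (use vw in auto)
      ultimately show "(\<exists>t. C i t v \<and> G l (v(j := t)) \<and> near (v l) (\<lambda>x. C i t (v(l := x)))) =
          (\<exists>t. C i t w \<and> G l (w(j := t)) \<and> near (w l) (\<lambda>x. C i t (w(l := x))))"
        using vw l by simp
    qed
    show "finite (k' i ` {v. (\<exists>t. C i t v) \<and> B v})"
      if B: "Def B" "deps I B" "\<And>v x x'. B (v(l := x)) \<Longrightarrow> B (v(l := x')) \<Longrightarrow> x = x'" for B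
    proof -
      have dB: "deps (insert j I) B" using B(2) unfolding deps_def by blast
      have "k' i ` {v. (\<exists>t. C i t v) \<and> B v} \<subseteq> k ` {v. S v \<and> B v}"
      proof (rule image_subsetI, elim CollectE conjE exE)
        fix v t assume "C i t v" "B v"
        moreover have "B (v(j := t)) = B v" by (rule depsD[OF B(2)]) (use insert.hyps in auto)
        ultimately show "k' i v \<in> k ` {v. S v \<and> B v}"
          using k' unfolding C_def by (intro image_eqI[of _ _ "v(j := t)"]) auto
      qed
      moreover have "finite (k ` {v. S v \<and> B v})" by (rule graph[OF l' B(1) dB]) (rule B(3))
      ultimately show ?thesis by (rule finite_subset)
    qed
    show "near (v l) (\<lambda>x. (\<exists>t. C i t (v(l := x))) \<and> k' i (v(l := x)) = k' i v)"
      if ex: "\<exists>t. C i t v \<and> G l (v(j := t)) \<and> near (v l) (\<lambda>x. C i t (v(l := x)))" for v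
    proof -
      obtain t where t: "C i t v" "G l (v(j := t))" "near (v l) (\<lambda>x. C i t (v(l := x)))" using ex by blast
      have "near ((v(j := t)) l) (\<lambda>x. S ((v(j := t))(l := x)) \<and> k ((v(j := t))(l := x)) = k (v(j := t)))"
        by (rule loc[OF l' C_S[OF t(1)] t(2)])
      then have "near (v l) (\<lambda>x. k (v(l := x, j := t)) = k (v(j := t)))"
        using \<open>l \<noteq> j\<close> by (auto simp: fun_upd_twist elim!: near_mono)
      from near_conj[OF t(3) this] show ?thesis
        by (rule near_mono) (use k' t(1) in metis)
    qed
    show "finite {x. (\<exists>t. C i t (v(l := x))) \<and> \<not> (\<exists>t. C i t (v(l := x)) \<and> G l (v(l := x, j := t)) \<and>
        near ((v(l := x)) l) (\<lambda>x'. C i t (v(l := x, l := x'))))}" for v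
    proof (rule ccontr)
      let ?X = "{x. (\<exists>t. C i t (v(l := x))) \<and> \<not> (\<exists>t. C i t (v(l := x)) \<and> G l (v(l := x, j := t)) \<and>
        near ((v(l := x)) l) (\<lambda>x'. C i t (v(l := x, l := x'))))}"
      assume inf: "infinite ?X"
      \<comment> \<open>If the piece over \<open>x\<close> has no suitable point, all its points are
        bad, and they are infinitely many because the piece is open. Exchange then gives one
        \<open>t\<close> that is bad for infinitely many \<open>x\<close>, which \<open>exc\<close>
        and \<open>finite_boundary\<close> exclude.\<close>
      let ?Y = "\<lambda>x t. C i t (v(l := x)) \<and> \<not> (G l (v(l := x, j := t)) \<and> near x (\<lambda>x'. C i t (v(l := x'))))"
      have DY: "D2 ?Y" by (intro def_intro DefP_app[OF DC] Def_subst[OF DG[OF l']])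
      have "?X \<subseteq> {x. infinite {t. ?Y x t}}"
      proof
        fix x assume x: "x \<in> ?X"
        then obtain t where t: "C i t (v(l := x))" by blast
        have "{t. C i t (v(l := x))} \<subseteq> {t. ?Y x t}" using x by auto
        then show "x \<in> {x. infinite {t. ?Y x t}}"
          using near_infinite[OF C_open[OF t]] finite_subset by blast
      qed
      then have "infinite {x. infinite {t. ?Y x t}}" using inf finite_subset by blast
      from exchange_weak[OF DY this] obtain t where t: "infinite {x. ?Y x t}" by blast
      have "{x. ?Y x t} \<subseteq> {x. S ((v(j := t))(l := x)) \<and> \<not> G l ((v(j := t))(l := x))} \<union>
          {x. \<not> near x (\<lambda>x. C i t (v(l := x))) \<and> \<not> near x (\<lambda>x. \<not> C i t (v(l := x)))}"
        using near_self[of _ "\<lambda>x. \<not> C i t (v(l := x))"] \<open>l \<noteq> j\<close> unfolding C_def by (auto simp: fun_upd_twist)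
      moreover have "D1 (\<lambda>x. C i t (v(l := x)))" by (intro def_intro DefP_app[OF DC])
      ultimately show False using t exc[OF l'] finite_boundary by (meson finite_UnI finite_subset)
    qed
  qed
  \<comment> \<open>For a fixed index the cut points form the graph of a function of the other
    coordinates, so the hypothesis \<open>graph\<close> takes care of them.\<close>
  have finB: "finite (k ` {v. S v \<and> (E (v j) v \<and> idx (v j) v = i)})" for i
  proof (rule graph[of j])
    show "Def (\<lambda>v. E (v j) v \<and> idx (v j) v = i)"
      by (intro def_intro DefP_app[OF DE] DefP_app[OF Didx])
    show "deps (insert j I) (\<lambda>v. E (v j) v \<and> idx (v j) v = i)"
      unfolding deps_def using E_cong idx_cong by (metis insertCI)
    fix v x x' assume "E ((v(j := x)) j) (v(j := x)) \<and> idx ((v(j := x)) j) (v(j := x)) = i"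
      "E ((v(j := x')) j) (v(j := x')) \<and> idx ((v(j := x')) j) (v(j := x')) = i"
    then have "E x v" "E x' v" "idx x v = idx x' v" by (simp_all add: upd_E upd_idx)
    then show "x = x'"
      using card_below_less[OF fE, of x v x'] card_below_less[OF fE, of x' v x] unfolding idx_def
      by (cases x x' rule: linorder_cases) auto
  qed simp
  have "k ` {v. S v} \<subseteq> (\<Union>i\<in>{..N}. k ` {v. S v \<and> (E (v j) v \<and> idx (v j) v = i)}) \<union>
      (\<Union>i\<in>{..N}. k' i ` {v. \<exists>t. C i t v})"
  proof (rule image_subsetI, elim CollectE)
    fix v assume "S v"
    show "k v \<in> (\<Union>i\<in>{..N}. k ` {v. S v \<and> (E (v j) v \<and> idx (v j) v = i)}) \<union>
      (\<Union>i\<in>{..N}. k' i ` {v. \<exists>t. C i t v})"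
    proof (cases "E (v j) v")
      case True
      then show ?thesis using \<open>S v\<close> idx_le by blast
    next
      case False
      then have "C (idx (v j) v) (v j) v" using \<open>S v\<close> unfolding C_def by simp
      moreover from k'[OF this] have "k v = k' (idx (v j) v) v" by simp
      ultimately show ?thesis using idx_le by blast
    qed
  qed
  moreover have "finite ((\<Union>i\<in>{..N}. k ` {v. S v \<and> (E (v j) v \<and> idx (v j) v = i)}) \<union>
      (\<Union>i\<in>{..N}. k' i ` {v. \<exists>t. C i t v}))" using finB fin' by simp
  ultimately show ?case by (rule finite_subset)
qed

lemma DefPP_app:
  assumes "Def (\<lambda>w. P (w 0) (w (Suc 0)) (\<lambda>i. w (Suc (Suc i))))" "dfn s" "dfn t" "\<And>i. dfn (\<lambda>v. u v i)"
  shows "Def (\<lambda>v. P (s v) (t v) (u v))"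
proof -
  have "dfn (\<lambda>v. case_nat (s v) (case_nat (t v) (u v)) i)" for i
  proof (cases i)
    case (Suc j)
    then show ?thesis using assms(3,4) by (cases j) simp_all
  qed (use assms(2) in simp)
  from Def_subst[OF assms(1), of "\<lambda>v. case_nat (s v) (case_nat (t v) (u v))", OF this] show ?thesis by simp
qed

lemma Def_steady:
  assumes "Def (\<lambda>w. X (w 0) (w (Suc 0)) (\<lambda>i. w (Suc (Suc i))))" "dfn t"
  shows "Def (\<lambda>v. steady (\<lambda>x y. X x y v) (t v))"
  unfolding steady_def
  by (intro def_intro DefPP_app[OF assms(1)] dfn_comp[OF assms(2)])

text \<open>\<open>finite_range\<close> is applied to the number of points in a fibre, with
  \<open>steady\<close> as the notion of a good point; a function of finite range is bounded. The
  endpoints of the line are set aside and added at the end.\<close>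

lemma UFI_finite: "finite I \<Longrightarrow> UFI I"
proof (induction I rule: finite_psubset_induct)
  case (psubset I)
  have inner_case: "\<exists>N. \<forall>v. card {t. P t v} \<le> N"
    if DP: "DefP P" and dP: "\<And>t. deps I (P t)" and fP: "\<And>v. finite {t. P t v}"
      and inn: "\<And>t v. P t v \<Longrightarrow> inner t" for P
  proof -
    let ?k = "\<lambda>v. card {t. P t v}"
    let ?G = "\<lambda>l v. steady (\<lambda>x t. P t (v(l := x))) (v l)"
    have D2: "D2 (\<lambda>x t. P t (v(l := x)))" for v l
      by (intro DefP_app[OF DP] def_intro)
    have "finite (?k ` {v. True})"
    proof (rule finite_range[OF \<open>finite I\<close>, where G = ?G])
      show "UFI J" if "J \<subset> I" for J by (rule psubset.IH[OF that])
      show "deps I ?k"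
        unfolding deps_def
      proof (intro allI impI)
        fix v w :: "nat \<Rightarrow> 'm" assume vw: "\<forall>i\<in>I. v i = w i"
        have "P t v = P t w" for t by (rule depsD[OF dP]) (use vw in blast)
        then show "?k v = ?k w" by simp
      qed
      show "deps I (\<lambda>v. True)" unfolding deps_def by simp
      show "Def (\<lambda>v. True)" by (rule Def_const)
      show "Def (\<lambda>v. True \<and> ?k v = \<kappa>)" for \<kappa>
        by (intro Def_conj Def_const Def_card_eq DP fP)
      fix l assume l: "l \<in> I"
      show "Def (?G l)"
        by (rule Def_steady) (intro DefP_app[OF DP] def_intro)+
      show "deps I (?G l)"
        unfolding deps_def
      proof (intro allI impI)
        fix v w :: "nat \<Rightarrow> 'm" assume vw: "\<forall>i\<in>I. v i = w i"
        have "P t (v(l := x)) = P t (w(l := x))" for x t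
          by (rule depsD[OF dP]) (use vw in auto)
        then show "?G l v = ?G l w" using vw l by simp
      qed
      show "finite {x. True \<and> \<not> ?G l (v(l := x))}" for v
      proof -
        have "finite {x. \<not> steady (\<lambda>x t. P t (v(l := x))) x}"
          by (rule finite_not_steady[OF D2]) (use fP inn in blast)+
        then show ?thesis by simp
      qed
      show "near (v l) (\<lambda>x. True \<and> ?k (v(l := x)) = ?k v)" if "?G l v" for v
        using steady_card[OF D2 fP inn that] by simp
      fix B assume B: "Def B" "deps I B" "\<And>v x x'. B (v(l := x)) \<Longrightarrow> B (v(l := x')) \<Longrightarrow> x = x'"
      \<comment> \<open>On the graph \<open>B\<close> coordinate \<open>l\<close> is a function of
        the others; quantifying it away leaves a family with parameters in \<open>I - {l}\<close>,
        where the induction hypothesis is available.\<close>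
      let ?Q = "\<lambda>t v. \<exists>x. B (v(l := x)) \<and> P t (v(l := x))"
      have DQ: "DefP ?Q" by (intro def_intro DefP_app[OF DP] Def_subst[OF B(1)])
      have dQ: "deps (I - {l}) (?Q t)" for t
        unfolding deps_def
      proof (intro allI impI)
        fix v w :: "nat \<Rightarrow> 'm" assume vw: "\<forall>i\<in>I - {l}. v i = w i"
        have "P t (v(l := x)) = P t (w(l := x))" for x by (rule depsD[OF dP]) (use vw in auto)
        moreover have "B (v(l := x)) = B (w(l := x))" for x by (rule depsD[OF B(2)]) (use vw in auto)
        ultimately show "?Q t v = ?Q t w" by simp
      qed
      have fQ: "finite {t. ?Q t v}" for v
      proof (cases "\<exists>x. B (v(l := x))")
        case True
        then obtain x where "B (v(l := x))" by blast
        then have "{t. ?Q t v} \<subseteq> {t. P t (v(l := x))}" using B(3) by blast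
        then show ?thesis using fP finite_subset by blast
      qed simp
      have "UFI (I - {l})" by (rule psubset.IH) (use l in auto)
      then obtain N where N: "\<And>v. card {t. ?Q t v} \<le> N" using UFI_D[OF _ DQ dQ fQ] by blast
      have "?k ` {v. True \<and> B v} \<subseteq> {..N}"
      proof (rule image_subsetI)
        fix v assume "v \<in> {v. True \<and> B v}"
        then have "B (v(l := v l))" by simp
        then have "{t. P t v} \<subseteq> {t. ?Q t v}" by (metis (mono_tags, lifting) Collect_mono fun_upd_triv)
        from card_mono[OF fQ this] show "?k v \<in> {..N}" using N[of v] by simp
      qed
      then show "finite (?k ` {v. True \<and> B v})" using finite_subset by blast
    qed
    then have "?k v \<le> Max (range ?k)" for v by (intro Max_ge) auto
    then show ?thesis by blast
  qed
  show ?case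
    unfolding UFI_def
  proof (intro allI impI)
    fix P assume DP: "DefP P" and dP: "\<forall>t. deps I (P t)" and fP: "\<forall>v. finite {t. P t v}"
    have "\<exists>N. \<forall>v. card {t. P t v \<and> inner t} \<le> N"
    proof (rule inner_case)
      show "DefP (\<lambda>t v. P t v \<and> inner t)" by (intro def_intro DefP_app[OF DP])
      show "deps I (\<lambda>v. P t v \<and> inner t)" for t using dP unfolding deps_def by blast
      show "finite {t. P t v \<and> inner t}" for v using fP by simp
    qed simp
    then obtain N where N: "\<And>v. card {t. P t v \<and> inner t} \<le> N" by blast
    have "card {t. P t v} \<le> N + card {t. \<not> inner t}" for v
    proof -
      have "card {t. P t v} \<le> card ({t. P t v \<and> inner t} \<union> {t. \<not> inner t})"
        by (rule card_mono) (use fP finite_not_inner in auto)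
      also have "\<dots> \<le> card {t. P t v \<and> inner t} + card {t. \<not> inner t}" by (rule card_Un_le)
      finally show ?thesis using N[of v] by linarith
    qed
    then show "\<exists>N. \<forall>v. card {t. P t v} \<le> N" by blast
  qed
qed

theorem uniform_finiteness:
  assumes "DefP P" "\<And>v. finite {t. P t v}"
  obtains N where "\<And>v. card {t. P t v} \<le> N"
proof -
  obtain n where n: "\<And>v w. (\<forall>i<(n::nat). v i = w i) \<Longrightarrow>
      P (v 0) (\<lambda>i. v (Suc i)) = P (w 0) (\<lambda>i. w (Suc i))"
    using Def_finite_vars[OF assms(1)] by blast
  have "deps {..<n} (P t)" for t
    unfolding deps_def
  proof (intro allI impI)
    fix v w :: "nat \<Rightarrow> 'm" assume "\<forall>i\<in>{..<n}. v i = w i"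
    then have "\<forall>i<n. case_nat t v i = case_nat t w i" by (auto split: nat.splits)
    from n[OF this] show "P t v = P t w" by simp
  qed
  then show thesis using UFI_finite[of "{..<n}"] assms that unfolding UFI_def by blast
qed

end

context omin
begin

section \<open>Integration with respect to the Euler characteristic\<close>

text \<open>The constructible functions of Euler integration. As the range is finite, operations on
  them are expressed by finite disjunctions over values.\<close>

definition constr :: "((nat \<Rightarrow> 'm) \<Rightarrow> int) \<Rightarrow> bool" where
  "constr F \<longleftrightarrow> finite (range F) \<and> (\<forall>k. Def (\<lambda>v. F v = k))"

lemma constr_Def: "constr F \<Longrightarrow> Def (\<lambda>v. F v = k)"
  unfolding constr_def by blast

lemma constr_op:
  assumes F: "constr F" and G: "constr G" shows "constr (\<lambda>v. h (F v) (G v))"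
  unfolding constr_def
proof (intro conjI allI)
  have fin: "finite (range F)" "finite (range G)" using F G unfolding constr_def by auto
  have "range (\<lambda>v. h (F v) (G v)) \<subseteq> (\<lambda>(a, b). h a b) ` (range F \<times> range G)" by auto
  then show "finite (range (\<lambda>v. h (F v) (G v)))" using fin finite_subset by blast
  fix k
  have "Def (\<lambda>v. \<exists>a\<in>range F. \<exists>b\<in>range G. (F v = a \<and> G v = b) \<and> h a b = k)"
    by (intro Def_fbex[OF fin(1)] Def_fbex[OF fin(2)] Def_conj Def_const constr_Def F G)
  then show "Def (\<lambda>v. h (F v) (G v) = k)"
    by (rule back_subst[of Def]) (auto simp: fun_eq_iff)
qed

lemma constr_const: "constr (\<lambda>v. c)"
  unfolding constr_def by (simp add: Def_const)

lemma constr_of_bool: assumes "Def P" shows "constr (\<lambda>v. of_bool (P v))"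
  unfolding constr_def
proof (intro conjI allI)
  have "range (\<lambda>v. of_bool (P v)) \<subseteq> {0, 1 :: int}" by auto
  then show "finite (range (\<lambda>v. of_bool (P v) :: int))" by (rule finite_subset) simp
  fix k :: int
  have "Def (\<lambda>v. P v \<and> k = 1 \<or> \<not> P v \<and> k = 0)" by (intro Def_disj Def_conj Def_neg Def_const assms)
  then show "Def (\<lambda>v. of_bool (P v) = k)"
    by (rule back_subst[of Def]) (auto simp: fun_eq_iff)
qed

lemma constr_sum: "finite A \<Longrightarrow> (\<And>a. a \<in> A \<Longrightarrow> constr (F a)) \<Longrightarrow> constr (\<lambda>v. \<Sum>a\<in>A. F a v)"
proof (induction A rule: finite_induct)
  case (insert a A)
  then show ?case using constr_op[of "F a" "\<lambda>v. \<Sum>a\<in>A. F a v" "(+)"] by simp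
qed (simp add: constr_const)

lemma constr_subst:
  assumes "constr F" "\<And>i. dfn (\<lambda>v. s v i)" shows "constr (\<lambda>v. F (s v))"
  unfolding constr_def
proof (intro conjI allI)
  have "range (\<lambda>v. F (s v)) \<subseteq> range F" by auto
  then show "finite (range (\<lambda>v. F (s v)))"
    using assms(1) finite_subset unfolding constr_def by blast
  show "Def (\<lambda>v. F (s v) = k)" for k
    by (rule Def_subst[OF constr_Def[OF assms(1)] assms(2)])
qed

text \<open>Germs, at a point from the right or at the left end of the line, decide every definable set.\<close>

definition isgerm :: "(('m \<Rightarrow> bool) \<Rightarrow> bool) \<Rightarrow> bool" where
  "isgerm \<Gamma> \<longleftrightarrow> (\<forall>P Q. \<Gamma> P \<longrightarrow> \<Gamma> Q \<longrightarrow> \<Gamma> (\<lambda>z. P z \<and> Q z)) \<and> (\<forall>P Q. \<Gamma> P \<longrightarrow> (\<forall>z. P z \<longrightarrow> Q z) \<longrightarrow> \<Gamma> Q) \<and>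
     (\<forall>Q. D1 Q \<longrightarrow> \<Gamma> Q \<or> \<Gamma> (\<lambda>z. \<not> Q z)) \<and> \<not> \<Gamma> (\<lambda>z. False)"

lemma isgerm_conj: "isgerm \<Gamma> \<Longrightarrow> \<Gamma> P \<Longrightarrow> \<Gamma> Q \<Longrightarrow> \<Gamma> (\<lambda>z. P z \<and> Q z)"
  and isgerm_mono: "isgerm \<Gamma> \<Longrightarrow> \<Gamma> P \<Longrightarrow> (\<And>z. P z \<Longrightarrow> Q z) \<Longrightarrow> \<Gamma> Q"
  and isgerm_dich: "isgerm \<Gamma> \<Longrightarrow> D1 Q \<Longrightarrow> \<Gamma> Q \<or> \<Gamma> (\<lambda>z. \<not> Q z)"
  and isgerm_False: "isgerm \<Gamma> \<Longrightarrow> \<not> \<Gamma> (\<lambda>z. False)"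
  unfolding isgerm_def by simp_all

definition gval :: "(('m \<Rightarrow> bool) \<Rightarrow> bool) \<Rightarrow> ('m \<Rightarrow> int) \<Rightarrow> int" where
  "gval \<Gamma> f = (THE k. \<Gamma> (\<lambda>z. f z = k))"

definition tame :: "('m \<Rightarrow> int) \<Rightarrow> bool" where
  "tame f \<longleftrightarrow> finite (range f) \<and> (\<forall>k. D1 (\<lambda>x. f x = k))"

lemma gval_eqI: assumes "isgerm \<Gamma>" "\<Gamma> (\<lambda>z. f z = k)" shows "gval \<Gamma> f = k"
  unfolding gval_def
proof (rule the_equality)
  show "\<Gamma> (\<lambda>z. f z = k)" by (rule assms(2))
  fix l assume "\<Gamma> (\<lambda>z. f z = l)"
  then have *: "\<Gamma> (\<lambda>z. f z = l \<and> f z = k)" using isgerm_conj[OF assms(1) _ assms(2)] by blast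
  show "l = k"
  proof (rule ccontr)
    assume "l \<noteq> k"
    then have "\<Gamma> (\<lambda>z. False)" by (intro isgerm_mono[OF assms(1) *]) blast
    then show False using isgerm_False[OF assms(1)] by blast
  qed
qed

text \<open>The germ decides each of the finitely many values. If it rejected all of them, the
  conjunction would put the empty set into the germ.\<close>

lemma gval: assumes \<Gamma>: "isgerm \<Gamma>" and f: "tame f" shows "\<Gamma> (\<lambda>z. f z = gval \<Gamma> f)"
proof -
  have "\<exists>k. \<Gamma> (\<lambda>z. f z = k)"
  proof (rule ccontr)
    assume "\<nexists>k. \<Gamma> (\<lambda>z. f z = k)"
    then have "\<not> \<Gamma> (\<lambda>z. f z = k)" for k by blast
    moreover have "D1 (\<lambda>z. f z = k)" for k using f unfolding tame_def by blast
    ultimately have no: "\<Gamma> (\<lambda>z. f z \<noteq> k)" for k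
      using isgerm_dich[OF \<Gamma>, of "\<lambda>z. f z = k"] by blast
    have fin: "finite (range f)" using f unfolding tame_def by blast
    have "\<Gamma> (\<lambda>z. \<forall>k\<in>K. f z \<noteq> k)" if "finite K" "K \<noteq> {}" for K
      using that
    proof (induction K rule: finite_ne_induct)
      case (singleton k)
      then show ?case using no[of k] by simp
    next
      case (insert k K)
      have "\<Gamma> (\<lambda>z. f z \<noteq> k \<and> (\<forall>k\<in>K. f z \<noteq> k))"
        by (rule isgerm_conj[OF \<Gamma> no insert.IH])
      then show ?case by simp
    qed
    from this[OF fin] have "\<Gamma> (\<lambda>z. \<forall>k\<in>range f. f z \<noteq> k)" by simp
    then have "\<Gamma> (\<lambda>z. False)" by (rule isgerm_mono[OF \<Gamma>]) blast
    then show False using isgerm_False[OF \<Gamma>] by blast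
  qed
  then show ?thesis using gval_eqI[OF \<Gamma>] by metis
qed

lemma gval_op:
  assumes \<Gamma>: "isgerm \<Gamma>" and f: "tame f" and g: "tame g"
  shows "gval \<Gamma> (\<lambda>z. h (f z) (g z)) = h (gval \<Gamma> f) (gval \<Gamma> g)"
proof (rule gval_eqI[OF \<Gamma>])
  have "\<Gamma> (\<lambda>z. f z = gval \<Gamma> f \<and> g z = gval \<Gamma> g)"
    by (rule isgerm_conj[OF \<Gamma> gval[OF \<Gamma> f] gval[OF \<Gamma> g]])
  then show "\<Gamma> (\<lambda>z. h (f z) (g z) = h (gval \<Gamma> f) (gval \<Gamma> g))"
    by (rule isgerm_mono[OF \<Gamma>]) simp
qed

text \<open>The germ at minus infinity, considered on a line without least element.\<close>

definition botgerm :: "('m \<Rightarrow> bool) \<Rightarrow> bool" where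
  "botgerm Q \<longleftrightarrow> (\<exists>b. \<forall>z<b. Q z)"

lemma isgerm_right: assumes "x < y" shows "isgerm (germr (<) x)"
  unfolding isgerm_def
proof (intro conjI allI impI)
  show "germr (<) x (\<lambda>z. P z \<and> Q z)" if "germr (<) x P" "germr (<) x Q" for P Q
    by (rule germr_conj[OF lin_less that])
  show "germr (<) x Q" if "germr (<) x P" "\<forall>z. P z \<longrightarrow> Q z" for P Q
    by (rule germr_mono[OF that(1)]) (use that(2) in blast)
  show "germr (<) x Q \<or> germr (<) x (\<lambda>z. \<not> Q z)" if "D1 Q" for Q
    by (rule germr_dichotomy[OF lin_less that assms])
  show "\<not> germr (<) x (\<lambda>z. False)" using germr_ex[OF lin_less] by blast
qed

lemma isgerm_bot: assumes nomin: "\<And>x::'m. \<exists>y. y < x" shows "isgerm botgerm"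
  unfolding isgerm_def
proof (intro conjI allI impI)
  show "botgerm (\<lambda>z. P z \<and> Q z)" if PQ: "botgerm P" "botgerm Q" for P Q
  proof -
    obtain a b where "\<forall>z<a. P z" "\<forall>z<b. Q z" using PQ unfolding botgerm_def by blast
    then show ?thesis unfolding botgerm_def by (intro exI[of _ "min a b"]) auto
  qed
  show "botgerm Q" if "botgerm P" "\<forall>z. P z \<longrightarrow> Q z" for P Q
    using that unfolding botgerm_def by blast
  show "botgerm Q \<or> botgerm (\<lambda>z. \<not> Q z)" if D: "D1 Q" for Q
  proof -
    let ?B = "{x. \<not> near x Q \<and> \<not> near x (\<lambda>z. \<not> Q z)}"
    obtain b where b: "\<forall>z<b. z \<notin> ?B"
    proof (cases "?B = {}")
      case False
      then have "\<forall>z<Min ?B. z \<notin> ?B" using Min_le[OF finite_boundary[OF D]] by (meson not_le)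
      then show thesis by (rule that)
    qed (use that in blast)
    have *: "Q z" if "z < b" "w < b" "Q w" for z w
      by (rule connected[where C = "\<lambda>z. z < b" and x = w and y = z, OF D])
        (use b that in \<open>auto simp: conv_def\<close>)
    show ?thesis
    proof (cases "\<exists>w<b. Q w")
      case True
      then show ?thesis using * unfolding botgerm_def by blast
    qed (auto simp: botgerm_def)
  qed
  show "\<not> botgerm (\<lambda>z. False)" using nomin unfolding botgerm_def by blast
qed

text \<open>A greatest element has nothing to its right; the default 0 lets it contribute its full
  value to \<open>integ\<close>.\<close>

definition rlim :: "('m \<Rightarrow> int) \<Rightarrow> 'm \<Rightarrow> int" where
  "rlim f x = (if \<exists>y. x < y then gval (germr (<) x) f else 0)"

text \<open>The limit at minus infinity, which acts as the right limit of a jump at an absent left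
  end of the line. If the line has a least element there is no such end, and the term
  vanishes.\<close>

definition bval :: "('m \<Rightarrow> int) \<Rightarrow> int" where
  "bval f = (if \<forall>x::'m. \<exists>y. y < x then gval botgerm f else 0)"

lemma bval_min: "\<not> (\<forall>x::'m. \<exists>y. y < x) \<Longrightarrow> bval f = 0"
  unfolding bval_def by (rule if_not_P)

definition jump :: "('m \<Rightarrow> int) \<Rightarrow> 'm \<Rightarrow> int" where
  "jump f x = f x - rlim f x"

text \<open>This is the number of points minus the number of open intervals for the indicator function of a
  definable set: every component which does not contain its left end contributes a jump of \<open>-1\<close> there.\<close>

definition integ :: "('m \<Rightarrow> int) \<Rightarrow> int" where
  "integ f = (\<Sum>x | jump f x \<noteq> 0. jump f x) - bval f"

lemma rlim_eqI: "x < y \<Longrightarrow> germr (<) x (\<lambda>z. f z = k) \<Longrightarrow> rlim f x = k"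
  unfolding rlim_def using gval_eqI[OF isgerm_right] by auto

section \<open>Linearity and normalisation of the integral\<close>

lemma rlim_op:
  assumes "tame f" "tame g" "h 0 0 = 0" shows "rlim (\<lambda>z. h (f z) (g z)) x = h (rlim f x) (rlim g x)"
  using gval_op[OF isgerm_right assms(1,2)] assms(3) unfolding rlim_def by auto

lemma bval_op:
  assumes "tame f" "tame g" "h 0 0 = 0" shows "bval (\<lambda>z. h (f z) (g z)) = h (bval f) (bval g)"
  using gval_op[OF isgerm_bot assms(1,2)] assms(3) unfolding bval_def by auto

lemma finite_jump: assumes f: "tame f" shows "finite {x. jump f x \<noteq> 0}"
proof -
  let ?B = "\<lambda>k. {x. \<not> near x (\<lambda>x. f x = k) \<and> \<not> near x (\<lambda>x. f x \<noteq> k)}"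
  have "{x. jump f x \<noteq> 0} \<subseteq> (\<Union>k\<in>range f. ?B k)"
  proof (rule subsetI, rule ccontr)
    fix x assume x: "x \<in> {x. jump f x \<noteq> 0}" "x \<notin> (\<Union>k\<in>range f. ?B k)"
    then have "near x (\<lambda>z. f z = f x)" using near_self by fastforce
    then have "germr (<) x (\<lambda>z. f z = f x)" "\<exists>y. x < y"
      using near_germr[OF lin_less] unfolding near_def by auto
    then have "rlim f x = f x" using rlim_eqI by blast
    then show False using x(1) unfolding jump_def by simp
  qed
  moreover have "finite (\<Union>k\<in>range f. ?B k)"
    using f unfolding tame_def by (intro finite_UN_I finite_boundary) blast+
  ultimately show ?thesis by (rule finite_subset)
qed

lemma integ_superset:
  assumes "finite T" "{x. jump f x \<noteq> 0} \<subseteq> T" shows "integ f = (\<Sum>x\<in>T. jump f x) - bval f"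
proof -
  have "(\<Sum>x | jump f x \<noteq> 0. jump f x) = (\<Sum>x\<in>T. jump f x)"
    by (rule sum.mono_neutral_left[OF assms]) auto
  then show ?thesis unfolding integ_def by simp
qed

lemma integ_add:
  assumes f: "tame f" and g: "tame g" shows "integ (\<lambda>x. f x + g x) = integ f + integ g"
proof -
  let ?T = "{x. jump f x \<noteq> 0} \<union> {x. jump g x \<noteq> 0}"
  have j: "jump (\<lambda>x. f x + g x) x = jump f x + jump g x" for x
    unfolding jump_def using rlim_op[OF f g, of "(+)" x] by simp
  have T: "finite ?T" using finite_jump f g by blast
  have "integ (\<lambda>x. f x + g x) = (\<Sum>x\<in>?T. jump (\<lambda>x. f x + g x) x) - bval (\<lambda>x. f x + g x)"
    by (rule integ_superset[OF T]) (auto simp: j)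
  moreover have "integ f = (\<Sum>x\<in>?T. jump f x) - bval f" by (rule integ_superset[OF T]) auto
  moreover have "integ g = (\<Sum>x\<in>?T. jump g x) - bval g" by (rule integ_superset[OF T]) auto
  ultimately show ?thesis
    using bval_op[OF f g, of "(+)"] by (simp add: j sum.distrib)
qed

lemma integ_cmult:
  assumes f: "tame f" shows "integ (\<lambda>x. c * f x) = c * integ f"
proof -
  have j: "jump (\<lambda>x. c * f x) x = c * jump f x" for x
    unfolding jump_def using rlim_op[OF f f, of "\<lambda>a b. c * a" x] by (simp add: algebra_simps)
  have "integ (\<lambda>x. c * f x) = (\<Sum>x | jump f x \<noteq> 0. jump (\<lambda>x. c * f x) x) - bval (\<lambda>x. c * f x)"
    by (rule integ_superset[OF finite_jump[OF f]]) (auto simp: j)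
  then show ?thesis
    using bval_op[OF f f, of "\<lambda>a b. c * a"]
    by (simp add: integ_def j sum_distrib_left right_diff_distrib)
qed

lemma tame_constr: "tame f \<longleftrightarrow> constr (\<lambda>v. f (v 0))"
proof -
  have "range (\<lambda>v::nat \<Rightarrow> 'm. f (v 0)) = range f" by (auto intro!: image_eqI[of _ _ "\<lambda>_. _"])
  then show ?thesis unfolding tame_def constr_def by simp
qed

lemma tame_const: "tame (\<lambda>x. c)"
  unfolding tame_constr by (rule constr_const)

lemma tame_of_bool: "D1 A \<Longrightarrow> tame (\<lambda>x. of_bool (A x))"
  unfolding tame_constr by (rule constr_of_bool)

lemma integ_zero: "integ (\<lambda>x. 0) = 0"
  using integ_cmult[OF tame_const, of 0 0] by simp

lemma integ_point: "integ (\<lambda>x. of_bool (x = p)) = 1"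
proof -
  let ?f = "\<lambda>x. of_bool (x = p) :: int"
  have "rlim ?f x = 0" for x
  proof (cases "\<exists>y. x < y")
    case True
    then obtain y where y: "x < y" by blast
    obtain b where b: "x < b" "\<forall>z\<in>{p}. \<not> (x < z \<and> z < b)"
      using avoid_finite[OF lin_less y, of "{p}"] by blast
    then have "germr (<) x (\<lambda>z. ?f z = 0)" unfolding germr_def by (intro exI[of _ b]) auto
    then show ?thesis by (rule rlim_eqI[OF y])
  qed (simp add: rlim_def)
  then have j: "jump ?f x = ?f x" for x unfolding jump_def by simp
  have "bval ?f = 0"
  proof (cases "\<forall>x::'m. \<exists>y. y < x")
    case True
    have "botgerm (\<lambda>z. ?f z = 0)" unfolding botgerm_def by (intro exI[of _ p]) auto
    then show ?thesis using gval_eqI[OF isgerm_bot] True unfolding bval_def by simp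
  qed (rule bval_min)
  moreover have "{x. jump ?f x \<noteq> 0} = {p}" unfolding j by auto
  ultimately show ?thesis unfolding integ_def j by simp
qed

text \<open>Open intervals described without their ends, so that bounded and unbounded ones are
  treated alike.\<close>

definition opint :: "('m \<Rightarrow> bool) \<Rightarrow> bool" where
  "opint J \<longleftrightarrow> conv J \<and> (\<exists>x. J x) \<and> (\<forall>x. J x \<longrightarrow> (\<exists>y. J y \<and> y < x) \<and> (\<exists>y. J y \<and> x < y))"

lemma opint_near: assumes "opint J" "J x" shows "near x J"
proof -
  obtain a b where "J a" "a < x" "J b" "x < b" using assms unfolding opint_def by blast
  then show ?thesis using assms(1) unfolding opint_def conv_def near_def by blast
qed

text \<open>Everything comes from the left end: at an infimum the value 0 meets the right limit 1,
  and without an infimum the germ at minus infinity has value 1. The right end contributes nothing,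
  since jumps compare a value with the limit from the right.\<close>

lemma integ_opint:
  assumes D: "D1 J" and J: "opint J" shows "integ (\<lambda>x. of_bool (J x)) = -1"
proof -
  let ?f = "\<lambda>x. of_bool (J x) :: int"
  have cJ: "J z" if "J x" "J y" "x < z" "z < y" for x y z
    using J that unfolding opint_def conv_def by blast
  have inJ: "jump ?f x = 0" if "J x" for x
  proof -
    have "near x (\<lambda>z. ?f z = 1)" using opint_near[OF J that] by (rule near_mono) simp
    then obtain y where "germr (<) x (\<lambda>z. ?f z = 1)" "x < y"
      using near_germr[OF lin_less] unfolding near_def by auto
    then have "rlim ?f x = 1" using rlim_eqI by simp
    then show ?thesis unfolding jump_def using that by simp
  qed
  have zero: "jump ?f x = 0" if "\<not> J x" and u: "\<And>y. x < y \<Longrightarrow> \<exists>u>x. \<forall>z. x < z \<longrightarrow> z < u \<longrightarrow> \<not> J z" for x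
  proof -
    have "rlim ?f x = 0"
    proof (cases "\<exists>y. x < y")
      case True
      then obtain y where y: "x < y" by blast
      then have "germr (<) x (\<lambda>z. ?f z = 0)" using u[OF y] unfolding germr_def by auto
      then show ?thesis by (rule rlim_eqI[OF y])
    qed (simp add: rlim_def)
    then show ?thesis unfolding jump_def using that by simp
  qed
  have above: "jump ?f x = 0" if x: "\<not> J x" "J w" "w < x" for x w
  proof (rule zero[OF x(1)])
    fix y assume "x < y"
    moreover have "\<not> J z" if "x < z" for z using cJ[OF x(2) _ x(3) that] x(1) by blast
    ultimately show "\<exists>u>x. \<forall>z. x < z \<longrightarrow> z < u \<longrightarrow> \<not> J z" by blast
  qed
  obtain j where j: "J j" using J unfolding opint_def by blast
  show ?thesis
  proof (cases "\<exists>u. \<forall>z. J z \<longrightarrow> u \<le> z")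
    case True
    then obtain u where "\<And>z. J z \<Longrightarrow> z = u \<or> z > u" by (metis le_less)
    then obtain g where g: "islub (>) J g" using lub_ex[OF lin_greater D j] by blast
    have low: "g \<le> z" if "J z" for z using g that unfolding islub_def by (auto simp: le_less)
    have "\<not> J g"
    proof
      assume "J g"
      then obtain y where "J y" "y < g" using J unfolding opint_def by blast
      then show False using low[of y] by simp
    qed
    then have less: "g < z" if "J z" for z using low[OF that] that by (auto simp: le_less)
    have "J z" if z: "g < z" "z < j" for z
    proof -
      obtain w where "J w" "w < z" using g z(1) unfolding islub_def by blast
      then show ?thesis using cJ j z(2) by blast
    qed
    then have "germr (<) g (\<lambda>z. ?f z = 1)" unfolding germr_def using less[OF j] by (intro exI[of _ j]) auto
    then have jg: "jump ?f g = -1"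
      unfolding jump_def using rlim_eqI[OF less[OF j]] \<open>\<not> J g\<close> by simp
    have "jump ?f x = 0" if "x \<noteq> g" for x
    proof (cases "J x")
      case False
      show ?thesis
      proof (cases "x < g")
        case True
        show ?thesis
        proof (rule zero[OF False], intro exI[of _ g] conjI allI impI)
          show "x < g" by fact
          show "\<not> J z" if "x < z" "z < g" for z using low[of z] that(2) by auto
        qed
      next
        case nl: False
        then have "g < x" using that by auto
        then obtain w where "J w" "w < x" using g unfolding islub_def by blast
        then show ?thesis using above False by blast
      qed
    qed (rule inJ)
    then have "{x. jump ?f x \<noteq> 0} = {g}" using jg by auto
    moreover have "bval ?f = 0"
    proof (cases "\<forall>x::'m. \<exists>y. y < x")
      case True
      have "botgerm (\<lambda>z. ?f z = 0)"
        unfolding botgerm_def by (intro exI[of _ g]) (use low leD in auto)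
      then show ?thesis using gval_eqI[OF isgerm_bot] True unfolding bval_def by simp
    qed (rule bval_min)
    ultimately show ?thesis unfolding integ_def using jg by simp
  next
    case False
    then have down: "\<exists>z. J z \<and> z < u" for u by (meson not_le)
    have "jump ?f x = 0" for x using inJ above down by blast
    moreover have "\<forall>x::'m. \<exists>y. y < x" using down by blast
    moreover have "botgerm (\<lambda>z. ?f z = 1)"
      unfolding botgerm_def
    proof (intro exI[of _ j] allI impI)
      fix z assume "z < j"
      obtain w where "J w" "w < z" using down by blast
      then show "?f z = 1" using cJ[OF _ j _ \<open>z < j\<close>] by auto
    qed
    ultimately show ?thesis
      unfolding integ_def bval_def using gval_eqI[OF isgerm_bot, of ?f 1] by simp
  qed
qed

lemma constr_fix: assumes "constr F" shows "tame (\<lambda>x. F (v(i := x)))"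
  unfolding tame_constr by (rule constr_subst[OF assms]) (intro def_intro)

definition intg :: "nat \<Rightarrow> ((nat \<Rightarrow> 'm) \<Rightarrow> int) \<Rightarrow> (nat \<Rightarrow> 'm) \<Rightarrow> int" where
  "intg i F v = integ (\<lambda>x. F (v(i := x)))"

text \<open>For each nonzero \<open>d\<close> the points with jump \<open>d\<close> are finite in
  number, so \<open>uniform_finiteness\<close> bounds this number and each of its values is a
  definable condition. The integral is a finite combination of these counts and
  \<open>bval\<close>.\<close>

lemma constr_intg: assumes F: "constr F" shows "constr (intg i F)"
proof -
  \<comment> \<open>The value 0 joins the range because it is the default of \<open>rlim\<close> at
    a greatest element.\<close>
  let ?R = "insert 0 (range F)"
  let ?D = "(\<lambda>(a, b). a - b) ` (?R \<times> ?R) - {0}"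
  let ?f = "\<lambda>v x. F (v(i := x))"
  have finR: "finite ?R" using F unfolding constr_def by simp
  have rv: "rlim (?f v) x = b \<longleftrightarrow>
      (\<exists>y. x < y) \<and> germr (<) x (\<lambda>z. F (v(i := z)) = b) \<or> \<not> (\<exists>y. x < y) \<and> b = 0" for v x b
  proof (cases "\<exists>y. x < y")
    case True
    then have "isgerm (germr (<) x)" using isgerm_right by blast
    from gval_eqI[OF this, of "?f v" b] gval[OF this constr_fix[OF F], of v i]
    have "germr (<) x (\<lambda>z. F (v(i := z)) = b) \<longleftrightarrow> gval (germr (<) x) (?f v) = b" by auto
    then show ?thesis unfolding rlim_def using True by simp
  qed (auto simp: rlim_def)
  have rR: "rlim (?f v) x \<in> ?R" for v x
  proof (cases "\<exists>y. x < y")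
    case True
    then have "germr (<) x (\<lambda>z. F (v(i := z)) = rlim (?f v) x)" using rv by blast
    from germr_ex[OF lin_less this] show ?thesis by (metis insertCI rangeI)
  qed (simp add: rlim_def)
  have Dr: "DefP (\<lambda>x v. rlim (?f v) x = b)" for b
    unfolding rv by (intro def_intro lin_less Def_subst[OF constr_Def[OF F]])
  have "Def (\<lambda>w. \<exists>a\<in>?R. \<exists>b\<in>?R. (F ((\<lambda>j. w (Suc j))(i := w 0)) = a \<and>
      rlim (?f (\<lambda>j. w (Suc j))) (w 0) = b) \<and> a - b = d)" for d
    by (intro Def_fbex[OF finR] Def_conj Def_const Def_subst[OF constr_Def[OF F]] Dr dfn_var dfn_upd)
  then have DJ: "DefP (\<lambda>x v. jump (?f v) x = d)" for d
  proof (rule back_subst[of Def], intro ext iffI)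
    fix w assume "jump (?f (\<lambda>j. w (Suc j))) (w 0) = d"
    then show "\<exists>a\<in>?R. \<exists>b\<in>?R. (F ((\<lambda>j. w (Suc j))(i := w 0)) = a \<and>
      rlim (?f (\<lambda>j. w (Suc j))) (w 0) = b) \<and> a - b = d"
      using rR unfolding jump_def by blast
  qed (auto simp: jump_def)
  have finJ: "finite {x. jump (?f v) x = d}" if "d \<noteq> 0" for v d
    using finite_jump[OF constr_fix[OF F], of v i] by (rule rev_finite_subset) (use that in auto)
  have cc: "constr (\<lambda>v. int (card {x. jump (?f v) x = d}))" if d: "d \<noteq> 0" for d
  proof -
    obtain N where N: "\<And>v. card {x. jump (?f v) x = d} \<le> N"
      by (rule uniform_finiteness[OF DJ[of d] finJ[OF d]]) (rule that)
    have "range (\<lambda>v. int (card {x. jump (?f v) x = d})) \<subseteq> {0..int N}" using N by auto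
    moreover have "Def (\<lambda>v. int (card {x. jump (?f v) x = d}) = k)" for k
    proof (cases "0 \<le> k")
      case True
      then have "(int c = k) = (c = nat k)" for c by auto
      then show ?thesis using Def_card_eq[OF DJ finJ[OF d], of "nat k"] by simp
    next
      case False
      then have "int c \<noteq> k" for c by auto
      then show ?thesis by (simp add: Def_const)
    qed
    ultimately show ?thesis unfolding constr_def using finite_subset by blast
  qed
  have cb: "constr (\<lambda>v. bval (?f v))"
  proof (cases "\<forall>x::'m. \<exists>y. y < x")
    case True
    then have "isgerm botgerm" using isgerm_bot by blast
    then have eq: "bval (?f v) = k \<longleftrightarrow> botgerm (\<lambda>z. F (v(i := z)) = k)" for v k
      unfolding bval_def using True gval_eqI gval[OF _ constr_fix[OF F]] by auto
    have "Def (\<lambda>v. bval (?f v) = k)" for k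
      unfolding eq botgerm_def by (intro def_intro Def_subst[OF constr_Def[OF F]])
    moreover have "bval (?f v) \<in> range F" for v
    proof -
      have "botgerm (\<lambda>z. F (v(i := z)) = bval (?f v))" using eq by blast
      then obtain z where "F (v(i := z)) = bval (?f v)" unfolding botgerm_def using True by blast
      then show ?thesis by (metis rangeI)
    qed
    then have "range (\<lambda>v. bval (?f v)) \<subseteq> range F" by blast
    ultimately show ?thesis unfolding constr_def using F finite_subset unfolding constr_def by blast
  next
    case False
    then have "bval g = 0" for g by (rule bval_min)
    then show ?thesis by (simp add: constr_const)
  qed
  have "intg i F v = (\<Sum>d\<in>?D. d * int (card {x. jump (?f v) x = d})) - bval (?f v)" for v
  proof -
    have "(\<Sum>x | jump (?f v) x \<noteq> 0. jump (?f v) x) =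
        (\<Sum>d\<in>?D. \<Sum>x | x \<in> {x. jump (?f v) x \<noteq> 0} \<and> jump (?f v) x = d. jump (?f v) x)"
    proof (rule sum.group[symmetric, OF finite_jump[OF constr_fix[OF F]]])
      show "finite ?D" using finR by simp
      show "jump (?f v) ` {x. jump (?f v) x \<noteq> 0} \<subseteq> ?D"
      proof (rule image_subsetI, rule DiffI)
        fix x assume "x \<in> {x. jump (?f v) x \<noteq> 0}"
        then show "jump (?f v) x \<notin> {0}" by simp
        show "jump (?f v) x \<in> (\<lambda>(a, b). a - b) ` (?R \<times> ?R)"
          by (rule image_eqI[of _ _ "(F (v(i := x)), rlim (?f v) x)"]) (use rR in \<open>auto simp: jump_def\<close>)
      qed
    qed
    also have "\<dots> = (\<Sum>d\<in>?D. d * int (card {x. jump (?f v) x = d}))"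
    proof (rule sum.cong[OF refl])
      fix d assume "d \<in> ?D"
      then have "{x. x \<in> {x. jump (?f v) x \<noteq> 0} \<and> jump (?f v) x = d} = {x. jump (?f v) x = d}" by auto
      then show "(\<Sum>x | x \<in> {x. jump (?f v) x \<noteq> 0} \<and> jump (?f v) x = d. jump (?f v) x) =
          d * int (card {x. jump (?f v) x = d})" by (simp add: mult.commute)
    qed
    finally show ?thesis unfolding intg_def integ_def by simp
  qed
  then have "intg i F = (\<lambda>v. (\<Sum>d\<in>?D. d * int (card {x. jump (?f v) x = d})) - bval (?f v))" by blast
  moreover have "constr (\<lambda>v. (\<Sum>d\<in>?D. d * int (card {x. jump (?f v) x = d})) - bval (?f v))"
  proof (rule constr_op[OF constr_sum cb])
    show "finite ?D" using finR by simp
    fix d assume "d \<in> ?D"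
    then show "constr (\<lambda>v. d * int (card {x. jump (?f v) x = d}))"
      by (intro constr_op[OF constr_const cc]) simp
  qed
  ultimately show ?thesis by simp
qed

section \<open>Fubini\<close>

definition constr2 :: "('m \<Rightarrow> 'm \<Rightarrow> int) \<Rightarrow> bool" where
  "constr2 F \<longleftrightarrow> constr (\<lambda>v. F (v 0) (v (Suc 0)))"

lemma constr2_app: assumes "constr2 F" "dfn s" "dfn t" shows "constr (\<lambda>v. F (s v) (t v))"
proof -
  have "dfn (\<lambda>v. if i = 0 then s v else t v)" for i :: nat
    using assms(2,3) by (cases i) simp_all
  from constr_subst[OF assms(1)[unfolded constr2_def], of "\<lambda>v i. if i = 0 then s v else t v", OF this]
  show ?thesis by simp
qed

lemma constr2_swap: "constr2 F \<Longrightarrow> constr2 (\<lambda>x y. F y x)"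
  unfolding constr2_def[of "\<lambda>x y. F y x"] by (intro constr2_app dfn_var)

lemma constr2_tame: "constr2 F \<Longrightarrow> tame (F x)"
  unfolding tame_constr by (intro constr2_app def_intro)

lemma constr2_tame': "constr2 F \<Longrightarrow> tame (\<lambda>x. F x y)"
  using constr2_tame[OF constr2_swap] .

lemma constr2_integ: assumes "constr2 F" shows "tame (\<lambda>x. integ (F x))"
proof -
  have "intg (Suc 0) (\<lambda>v. F (v 0) (v (Suc 0))) = (\<lambda>v. integ (F (v 0)))"
    by (simp add: intg_def fun_eq_iff)
  then show ?thesis
    using constr_intg[OF assms[unfolded constr2_def], of "Suc 0"] unfolding tame_constr by simp
qed

lemma constr2_integ': "constr2 F \<Longrightarrow> tame (\<lambda>y. integ (\<lambda>x. F x y))"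
  using constr2_integ[OF constr2_swap] .

lemma constr2_op: "constr2 F \<Longrightarrow> constr2 G \<Longrightarrow> constr2 (\<lambda>x y. h (F x y) (G x y))"
  unfolding constr2_def
  by (rule constr_op[of "\<lambda>v. F (v 0) (v (Suc 0))" "\<lambda>v. G (v 0) (v (Suc 0))" h])

lemma constr2_of_bool: "D2 X \<Longrightarrow> constr2 (\<lambda>x y. of_bool (X x y))"
  unfolding constr2_def by (rule constr_of_bool)

lemma constr2_const: "constr2 (\<lambda>x y. c)"
  unfolding constr2_def by (rule constr_const)

lemma constr2_restrict: "D1 A \<Longrightarrow> constr2 F \<Longrightarrow> constr2 (\<lambda>x y. of_bool (A x) * F x y)"
  unfolding constr2_def by (intro constr_op[where h = "(*)"] constr_of_bool)

lemma constr2_sum: "finite A \<Longrightarrow> (\<And>a. a \<in> A \<Longrightarrow> constr2 (F a)) \<Longrightarrow> constr2 (\<lambda>x y. \<Sum>a\<in>A. F a x y)"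
  unfolding constr2_def by (rule constr_sum)

section \<open>Closure properties of the Fubini identity\<close>

definition Fub :: "('m \<Rightarrow> 'm \<Rightarrow> int) \<Rightarrow> bool" where
  "Fub F \<longleftrightarrow> integ (\<lambda>x. integ (\<lambda>y. F x y)) = integ (\<lambda>y. integ (\<lambda>x. F x y))"

lemma Fub_swap: "Fub F \<Longrightarrow> Fub (\<lambda>x y. F y x)"
  unfolding Fub_def by simp

lemma Fub_add:
  assumes "constr2 F" "constr2 G" "Fub F" "Fub G" shows "Fub (\<lambda>x y. F x y + G x y)"
proof -
  have "integ (\<lambda>y. F x y + G x y) = integ (F x) + integ (G x)" for x
    by (intro integ_add constr2_tame assms)
  moreover have "integ (\<lambda>x. F x y + G x y) = integ (\<lambda>x. F x y) + integ (\<lambda>x. G x y)" for y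
    by (intro integ_add constr2_tame' assms)
  ultimately show ?thesis
    using assms(3,4) unfolding Fub_def
    by (simp add: integ_add constr2_integ constr2_integ' assms(1,2))
qed

lemma Fub_cmult: assumes "constr2 F" "Fub F" shows "Fub (\<lambda>x y. c * F x y)"
proof -
  have "integ (\<lambda>y. c * F x y) = c * integ (F x)" for x
    by (intro integ_cmult constr2_tame assms)
  moreover have "integ (\<lambda>x. c * F x y) = c * integ (\<lambda>x. F x y)" for y
    by (intro integ_cmult constr2_tame' assms)
  ultimately show ?thesis
    using assms(2) unfolding Fub_def by (simp add: integ_cmult constr2_integ constr2_integ' assms(1))
qed

lemma Fub_zero: "Fub (\<lambda>x y. 0)"
  unfolding Fub_def by simp

lemma Fub_sum:
  "finite A \<Longrightarrow> (\<And>a. a \<in> A \<Longrightarrow> constr2 (F a)) \<Longrightarrow> (\<And>a. a \<in> A \<Longrightarrow> Fub (F a)) \<Longrightarrow> Fub (\<lambda>x y. \<Sum>a\<in>A. F a x y)"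
proof (induction A rule: finite_induct)
  case (insert a A)
  have "Fub (\<lambda>x y. F a x y + (\<Sum>a\<in>A. F a x y))"
    by (intro Fub_add constr2_sum insert) (use insert in auto)
  then show ?case using insert.hyps by simp
qed (simp add: Fub_zero)

lemma Fub_product: assumes "tame f" "tame g" shows "Fub (\<lambda>x y. f x * g y)"
proof -
  have "integ (\<lambda>x. f x * g y) = g y * integ f" for y
    using integ_cmult[OF assms(1), of "g y"] by (simp add: mult.commute)
  moreover have "integ (\<lambda>x. f x * integ g) = integ g * integ f"
    using integ_cmult[OF assms(1), of "integ g"] by (simp add: mult.commute)
  moreover have "integ (\<lambda>y. g y * integ f) = integ f * integ g"
    using integ_cmult[OF assms(2), of "integ f"] by (simp add: mult.commute)
  ultimately show ?thesis unfolding Fub_def by (simp add: integ_cmult assms)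
qed

lemma integ_at_point: "integ (\<lambda>x. of_bool (x = p) * f x) = f p"
proof -
  have "(\<lambda>x. of_bool (x = p) * f x) = (\<lambda>x. f p * of_bool (x = p))" by auto
  then show ?thesis
    using integ_cmult[OF tame_of_bool, of "\<lambda>x. x = p" "f p"] by (simp add: integ_point def_intro)
qed

lemma Fub_point: "Fub (\<lambda>x y. of_bool (x = p) * F x y)"
proof -
  have "integ (\<lambda>y. of_bool (x = p) * F x y) = of_bool (x = p) * integ (F x)" for x
    by (simp add: integ_zero)
  then show ?thesis unfolding Fub_def by (simp add: integ_at_point)
qed

lemma Fub_points:
  assumes "constr2 F" "finite B" shows "Fub (\<lambda>x y. of_bool (x \<in> B) * F x y)"
proof -
  have "(\<lambda>x y. of_bool (x \<in> B) * F x y) = (\<lambda>x y. \<Sum>p\<in>B. of_bool (x = p) * F x y)"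
    using assms(2) by (simp add: sum_distrib_right[symmetric] of_bool_def sum.delta')
  moreover have "Fub (\<lambda>x y. \<Sum>p\<in>B. of_bool (x = p) * F x y)"
    by (intro Fub_sum Fub_point constr2_restrict assms def_intro)
  ultimately show ?thesis by simp
qed

lemma opint_below: assumes J: "opint J" and p: "J p" shows "opint (\<lambda>x. J x \<and> x < p)"
  unfolding opint_def
proof (intro conjI allI impI)
  show "conv (\<lambda>x. J x \<and> x < p)" using J unfolding opint_def conv_def by (meson less_trans)
  show "\<exists>x. J x \<and> x < p" using assms unfolding opint_def by blast
  fix x assume x: "J x \<and> x < p"
  then show "\<exists>y. (J y \<and> y < p) \<and> y < x" using J unfolding opint_def by (meson less_trans)
  obtain y where "x < y" "y < p" using x dense by blast
  then show "\<exists>y. (J y \<and> y < p) \<and> x < y" using J x p unfolding opint_def conv_def by blast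
qed

lemma opint_above: assumes J: "opint J" and p: "J p" shows "opint (\<lambda>x. J x \<and> p < x)"
  unfolding opint_def
proof (intro conjI allI impI)
  show "conv (\<lambda>x. J x \<and> p < x)" using J unfolding opint_def conv_def by (meson less_trans)
  show "\<exists>x. J x \<and> p < x" using assms unfolding opint_def by blast
  fix x assume x: "J x \<and> p < x"
  then show "\<exists>y. (J y \<and> p < y) \<and> x < y" using J unfolding opint_def by (meson less_trans)
  obtain y where "p < y" "y < x" using x dense by blast
  then show "\<exists>y. (J y \<and> p < y) \<and> y < x" using J x p unfolding opint_def conv_def by blast
qed

lemma opint_inner: "opint inner"
  unfolding opint_def
proof (intro conjI allI impI)
  show "conv inner" unfolding conv_def inner_def by (meson less_trans)
  obtain a b :: 'm where "a < b" using nontrivial by (metis linorder_neqE)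
  then obtain c where "a < c" "c < b" using dense by blast
  then show "\<exists>x. inner x" using inner_between by blast
  fix x assume "inner x"
  then obtain a b where "a < x" "x < b" unfolding inner_def by blast
  then obtain c d where "a < c" "c < x" "x < d" "d < b" using dense by meson
  then show "\<exists>y. inner y \<and> y < x" "\<exists>y. inner y \<and> x < y"
    using inner_between[of a c x] inner_between[of x d b] by blast+
qed

text \<open>By additivity in the first variable the identity may be checked on single columns, where
  it is trivial, and on open intervals that avoid \<open>B\<close>. Cutting at the points of
  \<open>B\<close> is an induction on their number.\<close>

lemma Fub_local:
  assumes F: "constr2 F" and B: "finite B"
    and loc: "\<And>J. D1 J \<Longrightarrow> opint J \<Longrightarrow> (\<And>x. J x \<Longrightarrow> x \<notin> B) \<Longrightarrow> Fub (\<lambda>x y. of_bool (J x) * F x y)"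
  shows "Fub F"
proof -
  have step: "Fub (\<lambda>x y. of_bool (J x) * F x y)" if "D1 J" "opint J" "card {x\<in>B. J x} = n" for J n
    using that
  proof (induction n arbitrary: J rule: less_induct)
    case (less n)
    show ?case
    proof (cases "\<exists>p\<in>B. J p")
      case True
      then obtain p where p: "p \<in> B" "J p" by blast
      let ?L = "\<lambda>x. J x \<and> x < p" and ?R = "\<lambda>x. J x \<and> p < x"
      have D: "D1 ?L" "D1 ?R" by (intro def_intro less.prems(1))+
      have "card {x\<in>B. ?L x} < n" "card {x\<in>B. ?R x} < n"
        unfolding less.prems(3)[symmetric] using B p by (intro psubset_card_mono; auto)+
      then have "Fub (\<lambda>x y. of_bool (?L x) * F x y)" "Fub (\<lambda>x y. of_bool (?R x) * F x y)"
        using less.IH[OF _ D(1) opint_below[OF less.prems(2) p(2)] refl]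
          less.IH[OF _ D(2) opint_above[OF less.prems(2) p(2)] refl] by blast+
      then have "Fub (\<lambda>x y. of_bool (x = p) * F x y + (of_bool (?L x) * F x y + of_bool (?R x) * F x y))"
        by (intro Fub_add Fub_point constr2_op[where h = "(+)"] constr2_restrict F D def_intro)
      moreover have "of_bool (x = p) * F x y + (of_bool (?L x) * F x y + of_bool (?R x) * F x y) =
          of_bool (J x) * F x y" for x y
        using p(2) by (cases x p rule: linorder_cases) auto
      ultimately show ?thesis by simp
    next
      case False
      then show ?thesis using loc less.prems by blast
    qed
  qed
  have "Fub (\<lambda>x y. of_bool (inner x) * F x y + of_bool (x \<in> {x. \<not> inner x}) * F x y)"
  proof (intro Fub_add)
    show "Fub (\<lambda>x y. of_bool (inner x) * F x y)" by (rule step[OF D1_inner opint_inner refl])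
    show "Fub (\<lambda>x y. of_bool (x \<in> {x. \<not> inner x}) * F x y)"
      by (rule Fub_points[OF F finite_not_inner])
    show "constr2 (\<lambda>x y. of_bool (inner x) * F x y)" by (rule constr2_restrict[OF D1_inner F])
    have "D1 (\<lambda>x. x \<in> {x. \<not> inner x})" unfolding mem_Collect_eq by (intro def_intro)
    then show "constr2 (\<lambda>x y. of_bool (x \<in> {x. \<not> inner x}) * F x y)" by (rule constr2_restrict[OF _ F])
  qed
  moreover have "of_bool (inner x) * F x y + of_bool (x \<in> {x. \<not> inner x}) * F x y = F x y" for x y by simp
  ultimately show ?thesis by simp
qed

lemma connected_all:
  assumes "D1 A" "conv J" "J x" "A x" "\<And>z. J z \<Longrightarrow> near z A \<or> near z (\<lambda>z. \<not> A z)" "J y"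
  shows "A y"
  using connected[OF assms(1,2,5,3,6,4)] .

text \<open>For a continuous strictly monotone \<open>b\<close> on an interval \<open>J\<close>, both orders of integration give \<open>-1\<close> on
  the graph and \<open>1\<close> on the region above it.\<close>

lemma Fub_monotone:
  assumes D: "D1 J" and J: "opint J" and b: "Dfun b" and r: "lin r"
    and mono: "\<And>x y. J x \<Longrightarrow> J y \<Longrightarrow> x < y \<Longrightarrow> r (b x) (b y)"
    and cont: "\<And>x. J x \<Longrightarrow> cont b x" and inn: "\<And>x. J x \<Longrightarrow> inner (b x)"
  shows "Fub (\<lambda>x y. of_bool (J x \<and> y = b x))" "Fub (\<lambda>x y. of_bool (J x \<and> inner y \<and> b x < y))"
proof -
  have cJ: "conv J" using J unfolding opint_def by blast
  obtain j where j: "J j" using J unfolding opint_def by blast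
  have inj: "x = y" if "J x" "J y" "b x = b y" for x y
    using mono[of x y] mono[of y x] that lin_irrefl[OF r] by (cases x y rule: linorder_cases) auto
  let ?I = "\<lambda>y. \<exists>x. J x \<and> b x = y"
  have "integ (\<lambda>y. of_bool (J x \<and> y = b x)) = of_bool (J x)" for x
    by (cases "J x") (simp_all add: integ_point integ_zero)
  then have L: "integ (\<lambda>x. integ (\<lambda>y. of_bool (J x \<and> y = b x))) = -1"
    using integ_opint[OF D J] by simp
  have "integ (\<lambda>x. of_bool (J x \<and> y = b x)) = of_bool (?I y)" for y
  proof (cases "?I y")
    case True
    then obtain x0 where "J x0" "b x0 = y" by blast
    then have "(\<lambda>x. of_bool (J x \<and> y = b x)) = (\<lambda>x. of_bool (x = x0) :: int)"
      using inj by (intro ext arg_cong[of _ _ of_bool]) auto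
    then show ?thesis using True by (simp add: integ_point)
  next
    case False
    then have "(\<lambda>x. of_bool (J x \<and> y = b x)) = (\<lambda>x. 0 :: int)" by (intro ext) auto
    then show ?thesis using False by (simp add: integ_zero)
  qed
  moreover have "opint ?I"
    unfolding opint_def
  proof (intro conjI allI impI)
    show "\<exists>y. ?I y" using j by blast
    show "conv ?I" unfolding conv_def
    proof (intro allI impI)
      fix y1 y2 y assume "?I y1" "?I y2" and y: "y1 < y" "y < y2"
      then obtain x1 x2 where x: "J x1" "b x1 = y1" "J x2" "b x2 = y2" by blast
      show "?I y"
      proof (rule ccontr)
        assume no: "\<not> ?I y"
        \<comment> \<open>The intermediate value property: if \<open>y\<close> were not attained,
          the condition \<open>b z < y\<close> would be locally constant on \<open>J\<close> and
          hence constant.\<close>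
        have DA: "D1 (\<lambda>z. b z < y)" by (intro def_intro Dfun_app[OF b])
        have "b x2 < y"
        proof (rule connected_all[OF DA cJ x(1)])
          fix z assume z: "J z"
          then have "b z \<noteq> y" using no by blast
          then consider "b z < y" | "y < b z" by (metis linorder_neqE)
          then show "near z (\<lambda>z. b z < y) \<or> near z (\<lambda>z. \<not> b z < y)"
          proof cases
            case 1
            then show ?thesis using cont_lin2[OF cont[OF z] lin_less] by blast
          next
            case 2
            have "near z (\<lambda>z. \<not> b z < y)"
              by (rule near_mono[OF cont_lin1[OF cont[OF z] lin_less 2]]) auto
            then show ?thesis by blast
          qed
        qed (use x y in auto)
        then show False using x y by auto
      qed
    qed
    fix y assume "?I y"
    then obtain x where x: "J x" "b x = y" by blast
    then obtain u w where uw: "J u" "u < x" "J w" "x < w" using J unfolding opint_def by blast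
    then have "r (b u) y" "r y (b w)" using mono x by blast+
    then show "\<exists>z. ?I z \<and> z < y" "\<exists>z. ?I z \<and> y < z" using r uw unfolding lin_def by auto
  qed
  moreover have "D1 ?I" by (intro def_intro D1_app[OF D] Dfun_app[OF b])
  ultimately have "integ (\<lambda>y. integ (\<lambda>x. of_bool (J x \<and> y = b x))) = -1"
    using integ_opint by simp
  then show "Fub (\<lambda>x y. of_bool (J x \<and> y = b x))" using L unfolding Fub_def by simp
  have up: "opint (\<lambda>y. inner y \<and> b x < y)" if "J x" for x
    using opint_above[OF opint_inner inn[OF that]] .
  have "D1 (\<lambda>y. inner y \<and> b x < y)" for x by (intro def_intro)
  from integ_opint[OF this up]
  have "integ (\<lambda>y. of_bool (J x \<and> inner y \<and> b x < y)) = (-1) * of_bool (J x)" for x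
    by (cases "J x") (simp_all add: integ_zero)
  then have L': "integ (\<lambda>x. integ (\<lambda>y. of_bool (J x \<and> inner y \<and> b x < y))) = 1"
    using integ_cmult[OF tame_of_bool[OF D], of "-1"] integ_opint[OF D J] by simp
  let ?U = "\<lambda>y. inner y \<and> (\<exists>x. J x \<and> b x < y)"
  have DU: "D1 ?U" by (intro def_intro D1_app[OF D] Dfun_app[OF b])
  have "integ (\<lambda>x. of_bool (J x \<and> inner y \<and> b x < y)) = (-1) * of_bool (?U y)" for y
  proof (cases "?U y")
    case True
    \<comment> \<open>By monotonicity the row at height \<open>y\<close> is an initial or final
      segment of \<open>J\<close>, possibly all of it, and continuity shows that it has no end in
      itself.\<close>
    have "opint (\<lambda>x. J x \<and> b x < y)"
      unfolding opint_def
    proof (intro conjI allI impI)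
      show "conv (\<lambda>x. J x \<and> b x < y)"
        unfolding conv_def
      proof (intro allI impI)
        fix u w z assume u: "J u \<and> b u < y" and w: "J w \<and> b w < y" and z: "u < z" "z < w"
        then have "J z" using cJ unfolding conv_def by blast
        then have "r (b u) (b z)" "r (b z) (b w)" using mono u w z by blast+
        then have "b z < y" using r u w unfolding lin_def by auto
        then show "J z \<and> b z < y" using \<open>J z\<close> by blast
      qed
      show "\<exists>x. J x \<and> b x < y" using True by blast
      fix x assume x: "J x \<and> b x < y"
      have "near x (\<lambda>z. J z \<and> b z < y)"
        by (rule near_conj[OF opint_near[OF J] cont_lin2[OF cont lin_less]]) (use x in auto)
      then have "germr (<) x (\<lambda>z. J z \<and> b z < y)" "germr (>) x (\<lambda>z. J z \<and> b z < y)"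
        using near_germr[OF lin_less] near_germr[OF lin_greater] by blast+
      then show "\<exists>z. (J z \<and> b z < y) \<and> z < x" "\<exists>z. (J z \<and> b z < y) \<and> x < z"
        using germr_ex[OF lin_less] germr_ex[OF lin_greater] by blast+
    qed
    moreover have "D1 (\<lambda>x. J x \<and> b x < y)" by (intro def_intro D1_app[OF D] Dfun_app[OF b])
    ultimately show ?thesis using integ_opint True by simp
  next
    case False
    then have "(\<lambda>x. of_bool (J x \<and> inner y \<and> b x < y)) = (\<lambda>x. 0 :: int)" by auto
    then show ?thesis using False by (simp add: integ_zero)
  qed
  moreover have "opint ?U"
    unfolding opint_def
  proof (intro conjI allI impI)
    show "conv ?U" using opint_inner unfolding opint_def conv_def by (meson less_trans)
    obtain c where "inner c" "b j < c" using up[OF j] unfolding opint_def by blast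
    then show "\<exists>y. ?U y" using j by blast
    fix y assume y: "?U y"
    then obtain x where x: "J x" "b x < y" by blast
    obtain z where z: "b x < z" "z < y" using dense[OF x(2)] by blast
    then show "\<exists>z. ?U z \<and> z < y" using inner_between[OF z] x by blast
    obtain w where "inner w" "y < w" using y opint_inner unfolding opint_def by blast
    then show "\<exists>z. ?U z \<and> y < z" using x by (meson less_trans)
  qed
  ultimately have "integ (\<lambda>y. integ (\<lambda>x. of_bool (J x \<and> inner y \<and> b x < y))) = 1"
    using integ_cmult[OF tame_of_bool[OF DU], of "-1"] integ_opint[OF DU] by simp
  then show "Fub (\<lambda>x y. of_bool (J x \<and> inner y \<and> b x < y))" using L' unfolding Fub_def by simp
qed

text \<open>By monotonicity, the points where \<open>b\<close> is neither locally constant nor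
  locally monotone and continuous are finite in number. After cutting at these and at the boundaries
  of the types, each piece has one type, and connectedness turns the local behaviour into a global
  one.\<close>

lemma Fub_curve:
  assumes A: "D1 A" and b: "Dfun b" and inn: "\<And>x. A x \<Longrightarrow> inner (b x)"
  shows "Fub (\<lambda>x y. of_bool (A x \<and> y = b x))" "Fub (\<lambda>x y. of_bool (A x \<and> inner y \<and> b x < y))"
proof -
  define LC where "LC x \<longleftrightarrow> near x (\<lambda>z. b z = b x)" for x
  define LI where "LI r x \<longleftrightarrow> germr (<) x (\<lambda>z. r (b x) (b z)) \<and> germr (>) x (\<lambda>z. r (b z) (b x)) \<and> cont b x" for r x
  have DLC: "D1 LC" unfolding LC_def by (intro def_intro Dfun_app[OF b])
  have DLI: "D1 (LI r)" if "lin r" for r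
    unfolding LI_def by (intro def_intro lin_less lin_greater Def_lin[OF that] Dfun_app[OF b] D1_app[OF D1_cont[OF b]])
  define N where "N x \<longleftrightarrow> \<not> LC x \<and> \<not> LI (<) x \<and> \<not> LI (>) x" for x
  have DN: "D1 N" unfolding N_def by (intro def_intro DLC DLI lin_less lin_greater)
  have finN: "finite {x. N x}"
  proof (rule ccontr)
    assume inf: "infinite {x. N x}"
    obtain p q where pq: "p < q" "\<And>x. p < x \<Longrightarrow> x < q \<Longrightarrow> N x"
      by (rule infinite_imp_intervalE[OF inf DN]) (rule that)
    show False
    proof (rule monotonicity[OF b pq(1)])
      fix c d k assume cd: "p \<le> c" "c < d" "d \<le> q" and k: "\<And>x. c < x \<Longrightarrow> x < d \<Longrightarrow> b x = k"
      obtain x where x: "c < x" "x < d" using dense[OF cd(2)] by blast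
      have "LC x" unfolding LC_def by (rule near_mono[OF near_interval[OF x]]) (use k x in auto)
      then show False using pq(2)[of x] x cd unfolding N_def by auto
    next
      fix c d r assume cd: "p \<le> c" "c < d" "d \<le> q" and r: "lin r"
        and mono: "\<And>x y. c < x \<Longrightarrow> x < y \<Longrightarrow> y < d \<Longrightarrow> r (b x) (b y)"
        and ct: "\<And>x. c < x \<Longrightarrow> x < d \<Longrightarrow> cont b x"
      obtain x where x: "c < x" "x < d" using dense[OF cd(2)] by blast
      have "germr (<) x (\<lambda>z. r (b x) (b z))" unfolding germr_def using mono x by blast
      moreover have "germr (>) x (\<lambda>z. r (b z) (b x))" unfolding germr_def using mono x by blast
      ultimately have "LI r x" unfolding LI_def using ct x by blast
      then show False using pq(2)[of x] x cd r unfolding N_def lin_def by auto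
    qed
  qed
  let ?bd = "\<lambda>A. {x. \<not> near x A \<and> \<not> near x (\<lambda>z. \<not> A z)}"
  let ?B = "(?bd A \<union> ?bd LC) \<union> (?bd (LI (<)) \<union> ?bd (LI (>)) \<union> {x. N x})"
  have finB: "finite ?B"
    by (intro finite_UnI finite_boundary A DLC DLI lin_less lin_greater finN)
  have D1': "D2 (\<lambda>x y. A x \<and> y = b x)" "D2 (\<lambda>x y. A x \<and> inner y \<and> b x < y)"
    by (intro def_intro D1_app[OF A] Dfun_app[OF b])+
  have main: "Fub (\<lambda>x y. of_bool (J x \<and> A x \<and> y = b x)) \<and> Fub (\<lambda>x y. of_bool (J x \<and> A x \<and> inner y \<and> b x < y))"
    if D: "D1 J" and J: "opint J" and JB: "\<And>x. J x \<Longrightarrow> x \<notin> ?B" for J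
  proof -
    have cJ: "conv J" using J unfolding opint_def by blast
    obtain j where j: "J j" using J unfolding opint_def by blast
    have all: "(\<forall>x. J x \<longrightarrow> P x) \<or> (\<forall>x. J x \<longrightarrow> \<not> P x)" if P: "D1 P" "?bd P \<subseteq> ?B" for P
      using connected_all[OF P(1) cJ] P(2) JB by blast
    consider "\<forall>x. J x \<longrightarrow> \<not> A x" | "\<forall>x. J x \<longrightarrow> A x" using all[OF A] by blast
    then show ?thesis
    proof cases
      case 1
      then have z: "(J x \<and> A x \<and> R) = False" for x R by blast
      show ?thesis unfolding z by (simp add: Fub_zero)
    next
      case 2
      then have JA: "(J x \<and> A x \<and> R) = (J x \<and> R)" for x R by blast
      have inn': "inner (b x)" if "J x" for x using inn 2 that by blast
      have "\<not> N j" using JB[OF j] by blast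
      then consider "LC j" | r where "lin r" "LI r j"
        unfolding N_def using lin_less lin_greater by blast
      then show ?thesis
      proof cases
        case 1
        then have LC: "LC x" if "J x" for x using all[OF DLC] j that by blast
        have const: "b x = b j" if "J x" for x
        proof (rule connected_all[OF _ cJ j refl _ that])
          show "D1 (\<lambda>x. b x = b j)" by (intro def_intro Dfun_app[OF b])
          fix z assume z: "J z"
          have "near z (\<lambda>x. b x = b z)" using LC[OF z] unfolding LC_def .
          then show "near z (\<lambda>z. b z = b j) \<or> near z (\<lambda>z. b z \<noteq> b j)"
            by (cases "b z = b j") (simp, use near_mono[of z "\<lambda>x. b x = b z" "\<lambda>x. b x \<noteq> b j"] in simp)
        qed
        have "(\<lambda>x y. of_bool (J x \<and> y = b x)) = (\<lambda>x y. of_bool (J x) * of_bool (y = b j) :: int)"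
          "(\<lambda>x y. of_bool (J x \<and> inner y \<and> b x < y)) = (\<lambda>x y. of_bool (J x) * of_bool (inner y \<and> b j < y) :: int)"
          using const by (auto simp: fun_eq_iff)
        moreover have "Fub (\<lambda>x y. of_bool (J x) * of_bool (y = b j))"
          "Fub (\<lambda>x y. of_bool (J x) * of_bool (inner y \<and> b j < y))"
          by (intro Fub_product tame_of_bool D def_intro)+
        ultimately show ?thesis unfolding JA by simp
      next
        case 2
        have "?bd (LI r) \<subseteq> ?B" using 2(1) unfolding lin_def by blast
        from all[OF DLI[OF 2(1)] this] have LI: "LI r x" if "J x" for x using j 2(2) that by blast
        have mono: "r (b x) (b y)" if "J x" "J y" "x < y" for x y
          by (rule local_increasing[OF 2(1) b cJ _ _ that]) (use LI LI_def in blast)+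
        have ct: "cont b x" if "J x" for x using LI[OF that] unfolding LI_def by blast
        show ?thesis unfolding JA using Fub_monotone[OF D J b 2(1) mono ct inn'] by blast
      qed
    qed
  qed
  show "Fub (\<lambda>x y. of_bool (A x \<and> y = b x))"
    by (rule Fub_local[OF constr2_of_bool[OF D1'(1)] finB]) (use main in \<open>simp add: of_bool_conj[symmetric]\<close>)
  show "Fub (\<lambda>x y. of_bool (A x \<and> inner y \<and> b x < y))"
    by (rule Fub_local[OF constr2_of_bool[OF D1'(2)] finB]) (use main in \<open>simp add: of_bool_conj[symmetric]\<close>)
qed

end

context omin
begin

lemma index_surj:
  assumes "finite (S :: 'm set)" "k < card S"
  shows "\<exists>e\<in>S. card {z\<in>S. z < e} = k"
proof -
  let ?f = "\<lambda>e. card {z\<in>S. z < e}"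
  have fin: "finite {z. z \<in> S}" using assms(1) by simp
  have inj: "inj_on ?f S"
  proof (rule inj_onI)
    fix x y assume "x \<in> S" "y \<in> S" "?f x = ?f y"
    then show "x = y"
      using card_below_less[OF fin, of x y] card_below_less[OF fin, of y x]
      by (cases x y rule: linorder_cases) auto
  qed
  have "?f ` S \<subseteq> {..<card S}"
  proof (rule image_subsetI)
    fix e assume "e \<in> S"
    then have "{z\<in>S. z < e} \<subset> S" by auto
    from psubset_card_mono[OF assms(1) this] show "?f e \<in> {..<card S}" by simp
  qed
  moreover have "card (?f ` S) = card {..<card S}" using card_image[OF inj] by simp
  ultimately have "?f ` S = {..<card S}" by (intro card_subset_eq) auto
  then have "k \<in> ?f ` S" using assms(2) by simp
  then show ?thesis by auto
qed

text \<open>A definable set is cut into graphs of functions and into regions between two graphs, which are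
  differences of regions above graphs.\<close>

lemma Fub_set_inner:
  assumes X: "D2 X" and inn: "\<And>x y. X x y \<Longrightarrow> inner y"
  shows "Fub (\<lambda>x y. of_bool (X x y))"
proof -
  \<comment> \<open>Boundary points of the vertical fibres. Their number is bounded uniformly in
    \<open>x\<close>, and the one with index \<open>k\<close> is given by a definable function
    \<open>e k\<close> wherever it exists.\<close>
  define E where "E x y \<longleftrightarrow> inner y \<and> \<not> near y (X x) \<and> \<not> near y (\<lambda>z. \<not> X x z)" for x y
  have DX: "D1 (X x)" for x by (intro D2_app[OF X] def_intro)
  have DE: "D2 E" unfolding E_def by (intro def_intro D2_app[OF X])
  have fE: "finite {y. E x y}" for x
    using finite_boundary[OF DX[of x]] by (rule rev_finite_subset) (auto simp: E_def)
  define idx where "idx x y = card {z. E x z \<and> z < y}" for x y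
  have Didx: "D2 (\<lambda>x y. idx x y = i)" for i
    unfolding idx_def
  proof (rule Def_card_eq)
    show "DefP (\<lambda>z v. E (v 0) z \<and> z < v (Suc 0))" by (intro def_intro D2_app[OF DE])
    show "finite {z. E (v 0) z \<and> z < v (Suc 0)}" for v
      using fE[of "v 0"] by (rule rev_finite_subset) blast
  qed
  have "DefP (\<lambda>t v. E (v 0) t)" by (intro D2_app[OF DE] def_intro)
  then obtain N where N: "\<And>v::nat \<Rightarrow> 'm. card {t. E (v 0) t} \<le> N"
    by (rule uniform_finiteness[of "\<lambda>t v. E (v 0) t", OF _ fE]) (rule that)
  have idxN: "idx x y \<le> N" for x y
    unfolding idx_def using card_mono[OF fE[of x], of "{z. E x z \<and> z < y}"] N[of "\<lambda>_. x"] by fastforce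
  let ?R = "\<lambda>k x y. E x y \<and> idx x y = k"
  have DR: "D2 (?R k)" for k by (intro Def_conj DE Didx)
  have R_unique: "y = y'" if "?R k x y" "?R k x y'" for k x y y'
    using that card_below_less[OF fE, of x y y'] card_below_less[OF fE, of x y' y] unfolding idx_def
    by (cases y y' rule: linorder_cases) auto
  have "\<exists>f. Dfun f \<and> (\<forall>x y. ?R k x y \<longrightarrow> f x = y)" for k
    by (rule Dfun_from_relation[OF DR R_unique]) blast+
  then obtain e where De: "\<And>k. Dfun (e k)" and e: "\<And>k x y. ?R k x y \<Longrightarrow> e k x = y" by metis
  have e_iff: "?R k x y \<longleftrightarrow> (\<exists>z. ?R k x z) \<and> y = e k x" for k x y using e by metis
  have inner_e: "inner (e k x)" if "\<exists>z. ?R k x z" for k x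
    using that e_iff[of x "e k x" k] unfolding E_def by blast
  have below_e: "(\<exists>z. ?R k x z \<and> z < y) \<longleftrightarrow> (\<exists>z. ?R k x z) \<and> e k x < y" for k x y
    by (metis e)
  let ?A = "\<lambda>i x. \<exists>y. inner y \<and> \<not> E x y \<and> idx x y = i \<and> X x y"
  have DA: "D1 (?A i)" for i by (intro def_intro D2_app[OF DE] D2_app[OF Didx] D2_app[OF X])
  have const_less: "X x y \<longleftrightarrow> X x y'"
    if y: "inner y" "\<not> E x y" "inner y'" "\<not> E x y'" "idx x y = idx x y'" "y < y'" for x y y'
  proof -
    let ?I = "\<lambda>z. y \<le> z \<and> z \<le> y'"
    have cI: "conv ?I" unfolding conv_def by auto
    have near: "near z (X x) \<or> near z (\<lambda>z. \<not> X x z)" if z: "?I z" for z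
    proof -
      have "\<not> E x z"
      proof
        assume Ez: "E x z"
        then have "z \<noteq> y" "z \<noteq> y'" using y by auto
        then have "y < z" "z < y'" using z by auto
        have "card {w. E x w \<and> w < z} < card {w. E x w \<and> w < y'}"
          by (rule card_below_less[OF fE Ez \<open>z < y'\<close>])
        moreover have "card {w. E x w \<and> w < y} \<le> card {w. E x w \<and> w < z}"
        proof (rule card_mono)
          show "finite {w. E x w \<and> w < z}" using fE[of x] by (rule rev_finite_subset) blast
        qed (use \<open>y < z\<close> in auto)
        ultimately show False using y(5) unfolding idx_def by simp
      qed
      moreover have "inner z"
      proof -
        obtain a b where "a < y" "y' < b" using y(1,3) unfolding inner_def by blast
        then show ?thesis using z by (intro inner_between[of a z b]) auto
      qed
      ultimately show ?thesis unfolding E_def by blast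
    qed
    have I: "?I y" "?I y'" using y(6) by auto
    show ?thesis
      using connected_all[OF DX cI I(1) _ near I(2)] connected_all[OF DX cI I(2) _ near I(1)] by blast
  qed
  have A_X: "X x y" if A: "?A i x" and y: "inner y" "\<not> E x y" "idx x y = i" for i x y
  proof -
    obtain w where "inner w" "\<not> E x w" "idx x w = i" "X x w" using A by blast
    then show ?thesis
      using const_less[of y x w] const_less[of w x y] y by (cases y w rule: linorder_cases) auto
  qed
  \<comment> \<open>The region with at least \<open>k\<close> boundary points below; for
    \<open>k > 0\<close> this is the region above the graph of \<open>e (k - 1)\<close>.\<close>
  let ?T = "\<lambda>k x y. inner y \<and> k \<le> idx x y"
  have T_Suc: "?T (Suc k) x y \<longleftrightarrow> inner y \<and> (\<exists>z. ?R k x z \<and> z < y)" for k x y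
  proof (intro iffI conjI)
    assume T: "?T (Suc k) x y"
    have "finite {z. E x z \<and> z < y}" using fE[of x] by (rule rev_finite_subset) blast
    moreover have "k < card {z. E x z \<and> z < y}" using T unfolding idx_def by simp
    ultimately obtain z where z: "E x z" "z < y" "card {w \<in> {z. E x z \<and> z < y}. w < z} = k"
      using index_surj by blast
    have "{w \<in> {z. E x z \<and> z < y}. w < z} = {w. E x w \<and> w < z}" using z(2) by auto
    then show "\<exists>z. ?R k x z \<and> z < y" using z unfolding idx_def by auto
  next
    assume "inner y \<and> (\<exists>z. ?R k x z \<and> z < y)"
    then obtain z where "E x z" "idx x z = k" "z < y" by blast
    then show "Suc k \<le> idx x y" using card_below_less[OF fE, of x z y] unfolding idx_def by simp
  qed auto
  have Fub_graph: "Fub (\<lambda>x y. of_bool (B x \<and> ?R k x y))" if B: "D1 B" for B k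
  proof -
    let ?B = "\<lambda>x. B x \<and> (\<exists>z. ?R k x z)"
    have "D1 ?B" by (intro def_intro D1_app[OF B] D2_app[OF DE] D2_app[OF Didx])
    moreover have "inner (e k x)" if "?B x" for x using that inner_e by blast
    ultimately have "Fub (\<lambda>x y. of_bool (?B x \<and> y = e k x))" by (rule Fub_curve(1)[OF _ De])
    moreover have "(?B x \<and> y = e k x) = (B x \<and> ?R k x y)" for x y using e_iff[of x y k] by blast
    ultimately show ?thesis by (simp only:)
  qed
  have Fub_T: "Fub (\<lambda>x y. of_bool (B x \<and> ?T k x y))" if B: "D1 B" for B k
  proof (cases k)
    case 0
    have "Fub (\<lambda>x y. of_bool (B x) * of_bool (inner y))"
      by (intro Fub_product tame_of_bool B D1_inner)
    then show ?thesis using 0 by (simp add: of_bool_conj)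
  next
    case (Suc l)
    let ?B = "\<lambda>x. B x \<and> (\<exists>z. ?R l x z)"
    have "D1 ?B" by (intro def_intro D1_app[OF B] D2_app[OF DE] D2_app[OF Didx])
    moreover have "inner (e l x)" if "?B x" for x using that inner_e by blast
    ultimately have "Fub (\<lambda>x y. of_bool (?B x \<and> inner y \<and> e l x < y))" by (rule Fub_curve(2)[OF _ De])
    moreover have "(?B x \<and> inner y \<and> e l x < y) = (B x \<and> ?T k x y)" for x y
      unfolding Suc T_Suc below_e by blast
    ultimately show ?thesis by (simp only:)
  qed
  have DT: "D2 (?T k)" for k
  proof (cases k)
    case 0
    then show ?thesis by (simp add: def_intro)
  next
    case (Suc l)
    show ?thesis unfolding Suc T_Suc by (intro def_intro D2_app[OF DE] D2_app[OF Didx])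
  qed
  have c: "constr2 (\<lambda>x y. of_bool (?A i x \<and> ?T k x y))" "constr2 (\<lambda>x y. of_bool (?A i x \<and> ?R k x y))" for i k
    by (rule constr2_of_bool[OF Def_conj[OF DA DT]], rule constr2_of_bool[OF Def_conj[OF DA DR]])
  have region: "Fub (\<lambda>x y. of_bool (\<not> E x y \<and> idx x y = i \<and> X x y))" for i
  proof -
    \<comment> \<open>The open strip with index \<open>i\<close> is \<open>?T i\<close> without
      \<open>?T (Suc i)\<close> and without its upper boundary graph, whose points also have index
      \<open>i\<close>.\<close>
    have "Fub (\<lambda>x y. of_bool (?A i x \<and> ?T i x y) +
        (-1 * of_bool (?A i x \<and> ?T (Suc i) x y) + -1 * of_bool (?A i x \<and> ?R i x y)))"
      by (intro Fub_add Fub_cmult Fub_T Fub_graph DA c constr2_op[where h = "(+)"] constr2_op[OF constr2_const, where h = "(*)"])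
    moreover have "of_bool (?A i x \<and> ?T i x y) +
        (-1 * of_bool (?A i x \<and> ?T (Suc i) x y) + -1 * of_bool (?A i x \<and> ?R i x y)) =
        (of_bool (\<not> E x y \<and> idx x y = i \<and> X x y) :: int)" for x y
    proof (cases "?A i x \<and> inner y \<and> idx x y = i")
      case True
      then have A: "?A i x" "inner y" "idx x y = i" by blast+
      then have "X x y" if "\<not> E x y" using A_X that by blast
      then show ?thesis using A by (cases "E x y") simp_all
    next
      case False
      then have "\<not> (\<not> E x y \<and> idx x y = i \<and> X x y)" using inn by blast
      moreover have "(?A i x \<and> ?T i x y) = (?A i x \<and> ?T (Suc i) x y)" using False by (auto simp: le_eq_less_or_eq)
      moreover have "\<not> (?A i x \<and> ?R i x y)" using False unfolding E_def by blast
      ultimately show ?thesis by simp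
    qed
    ultimately show ?thesis by (simp only:)
  qed
  have graph: "Fub (\<lambda>x y. of_bool (E x y \<and> idx x y = i \<and> X x y))" for i
  proof -
    let ?B = "\<lambda>x. \<exists>y. ?R i x y \<and> X x y"
    have "D1 ?B" by (intro def_intro D2_app[OF DE] D2_app[OF Didx] D2_app[OF X])
    then have "Fub (\<lambda>x y. of_bool (?B x \<and> ?R i x y))" by (rule Fub_graph)
    moreover have "(?B x \<and> ?R i x y) = (E x y \<and> idx x y = i \<and> X x y)" for x y
      using R_unique[of x y i] by blast
    ultimately show ?thesis by (simp only:)
  qed
  have "constr2 (\<lambda>x y. of_bool (E x y \<and> idx x y = i \<and> X x y))"
    "constr2 (\<lambda>x y. of_bool (\<not> E x y \<and> idx x y = i \<and> X x y))" for i
    by (intro constr2_of_bool Def_conj Def_neg DE Didx X)+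
  then have "Fub (\<lambda>x y. \<Sum>i\<in>{..N}. of_bool (E x y \<and> idx x y = i \<and> X x y) +
      of_bool (\<not> E x y \<and> idx x y = i \<and> X x y))"
    by (intro Fub_sum Fub_add constr2_op[where h = "(+)"] region graph) auto
  moreover have "(\<Sum>i\<in>{..N}. of_bool (E x y \<and> idx x y = i \<and> X x y) +
      of_bool (\<not> E x y \<and> idx x y = i \<and> X x y)) = (of_bool (X x y) :: int)" for x y
  proof -
    have "of_bool (E x y \<and> idx x y = i \<and> X x y) + of_bool (\<not> E x y \<and> idx x y = i \<and> X x y) =
        (if idx x y = i then of_bool (X x y) else (0::int))" for i by auto
    then show ?thesis using idxN[of x y] by (simp add: sum.delta')
  qed
  ultimately show ?thesis by (simp only:)
qed

lemma Fub_set: assumes X: "D2 X" shows "Fub (\<lambda>x y. of_bool (X x y))"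
proof -
  have D: "D2 (\<lambda>x y. X x y \<and> inner y)" by (intro def_intro D2_app[OF X])
  have "Fub (\<lambda>x y. of_bool (y \<in> {y. \<not> inner y}) * of_bool (X x y))"
    using Fub_swap[OF Fub_points[OF constr2_swap[OF constr2_of_bool[OF X]] finite_not_inner]] .
  moreover have "D2 (\<lambda>x y. y \<in> {y. \<not> inner y})" unfolding mem_Collect_eq by (intro def_intro)
  ultimately have "Fub (\<lambda>x y. of_bool (X x y \<and> inner y) + of_bool (y \<in> {y. \<not> inner y}) * of_bool (X x y))"
    by (intro Fub_add Fub_set_inner D constr2_of_bool constr2_op[where h = "(*)"] X) auto
  moreover have "of_bool (X x y \<and> inner y) + of_bool (y \<in> {y. \<not> inner y}) * of_bool (X x y) =
      (of_bool (X x y) :: int)" for x y by simp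
  ultimately show ?thesis by (simp only:)
qed

text \<open>A constructible function is a finite combination of indicator functions of definable
  sets, so linearity reduces it to \<open>Fub_set\<close>.\<close>

theorem fubini: assumes F: "constr2 F" shows "Fub F"
proof -
  let ?K = "range (\<lambda>v::nat \<Rightarrow> 'm. F (v 0) (v (Suc 0)))"
  have fin: "finite ?K" using F unfolding constr2_def constr_def by blast
  have D: "D2 (\<lambda>x y. F x y = k)" for k using F unfolding constr2_def constr_def by blast
  have "Fub (\<lambda>x y. \<Sum>k\<in>?K. k * of_bool (F x y = k))"
    by (intro Fub_sum Fub_cmult Fub_set constr2_op[OF constr2_const, where h = "(*)"] constr2_of_bool D fin)
  moreover have "(\<Sum>k\<in>?K. k * of_bool (F x y = k)) = F x y" for x y
  proof -
    have "F x y \<in> ?K" by (rule image_eqI[of _ _ "case_nat x (\<lambda>_. y)"]) simp_all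
    moreover have "(\<Sum>k\<in>?K. k * of_bool (F x y = k)) = (\<Sum>k\<in>?K. if F x y = k then k else 0)"
      by (intro sum.cong) auto
    ultimately show ?thesis using fin by (simp add: sum.delta')
  qed
  ultimately show ?thesis by (simp only:)
qed

lemma intg_commute: assumes F: "constr F" shows "intg i (intg j F) = intg j (intg i F)"
proof (cases "i = j")
  case False
  have "intg i (intg j F) v = intg j (intg i F) v" for v
  proof -
    have "constr2 (\<lambda>x y. F (v(i := x, j := y)))"
      unfolding constr2_def by (rule constr_subst[OF F]) (intro def_intro)
    from fubini[OF this] show ?thesis
      unfolding Fub_def intg_def using False by (simp add: fun_upd_twist)
  qed
  then show ?thesis by blast
qed simp

section \<open>The Euler characteristic of definable sets\<close>

primrec intgs :: "nat list \<Rightarrow> ((nat \<Rightarrow> 'm) \<Rightarrow> int) \<Rightarrow> (nat \<Rightarrow> 'm) \<Rightarrow> int" where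
  "intgs [] F = F"
| "intgs (i # js) F = intg i (intgs js F)"

lemma constr_intgs: "constr F \<Longrightarrow> constr (intgs js F)"
  by (induction js) (auto intro: constr_intg)

lemma intgs_intg_commute: "constr F \<Longrightarrow> intgs js (intg i F) = intg i (intgs js F)"
  by (induction js) (simp_all add: intg_commute constr_intgs)

lemma intgs_commute: "constr F \<Longrightarrow> intgs is (intgs js F) = intgs js (intgs is F)"
proof (induction "is")
  case (Cons i "is")
  then show ?case using intgs_intg_commute[OF constr_intgs[OF Cons.prems, of "is"], of js i] by simp
qed simp

lemma intgs_add: "constr F \<Longrightarrow> constr G \<Longrightarrow> intgs js (\<lambda>v. F v + G v) = (\<lambda>v. intgs js F v + intgs js G v)"
proof (induction js)
  case (Cons j js)
  then show ?case
    by (simp add: fun_eq_iff intg_def integ_add constr_fix constr_intgs)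
qed simp

lemma intgs_cong:
  "(\<And>w. (\<forall>j. j \<notin> set js \<longrightarrow> w j = v j) \<Longrightarrow> F w = G w) \<Longrightarrow> intgs js F v = intgs js G v"
proof (induction js arbitrary: v)
  case (Cons i js)
  have "intgs js F (v(i := x)) = intgs js G (v(i := x))" for x
  proof (rule Cons.IH)
    fix w assume "\<forall>j. j \<notin> set js \<longrightarrow> w j = (v(i := x)) j"
    then show "F w = G w" by (intro Cons.prems) auto
  qed
  then show ?case by (simp add: intg_def)
qed simp

lemma intgs_zero: "intgs js (\<lambda>v. 0) v = 0"
  by (induction js arbitrary: v) (simp_all add: intg_def integ_zero)

text \<open>The iterated integral of the indicator function, first coordinate outermost. Through
  \<open>intgs_echar\<close> it becomes integration over named coordinates, whose order may be
  exchanged.\<close>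

primrec echar :: "nat \<Rightarrow> 'm list set \<Rightarrow> int" where
  "echar 0 X = of_bool ([] \<in> X)"
| "echar (Suc n) X = integ (\<lambda>u. echar n {w. u # w \<in> X})"

lemma intgs_echar:
  "distinct js \<Longrightarrow> intgs js (\<lambda>v. of_bool (map v js \<in> X)) v = echar (length js) X"
proof (induction js arbitrary: X v)
  case (Cons i js)
  have "intgs js (\<lambda>v. of_bool (map v (i # js) \<in> X)) (v(i := u)) = echar (length js) {w. u # w \<in> X}" for u
  proof -
    have "intgs js (\<lambda>v. of_bool (map v (i # js) \<in> X)) (v(i := u)) =
        intgs js (\<lambda>v. of_bool (map v js \<in> {w. u # w \<in> X})) (v(i := u))"
    proof (rule intgs_cong)
      fix w assume "\<forall>j. j \<notin> set js \<longrightarrow> w j = (v(i := u)) j"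
      then have "w i = u" using Cons.prems by simp
      then show "of_bool (map w (i # js) \<in> X) = (of_bool (map w js \<in> {w. u # w \<in> X}) :: int)" by simp
    qed
    also have "\<dots> = echar (length js) {w. u # w \<in> X}"
      by (rule Cons.IH) (use Cons.prems in simp)
    finally show ?thesis .
  qed
  then show ?case by (simp add: intg_def)
qed simp

lemma echar_empty: "echar n {} = 0"
  by (induction n) (simp_all add: integ_zero)

lemma echar_singleton: "echar (length c) {c} = 1"
proof (induction c)
  case (Cons a c)
  have "echar (length c) {w. u # w \<in> {a # c}} = of_bool (u = a)" for u
    using Cons by (cases "u = a") (simp_all add: echar_empty)
  then show ?case by (simp add: integ_point)
qed simp

abbreviation dset :: "nat \<Rightarrow> 'm list set \<Rightarrow> bool" where
  "dset n X \<equiv> Def (\<lambda>v. map v [0..<n] \<in> X)"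

lemma echar_Un:
  assumes "dset n X" "dset n Y" "X \<inter> Y = {}" shows "echar n (X \<union> Y) = echar n X + echar n Y"
proof -
  have c: "constr (\<lambda>v. of_bool (map v [0..<n] \<in> X))" "constr (\<lambda>v. of_bool (map v [0..<n] \<in> Y))"
    by (intro constr_of_bool assms)+
  have "of_bool (map v [0..<n] \<in> X \<union> Y) = (of_bool (map v [0..<n] \<in> X) + of_bool (map v [0..<n] \<in> Y) :: int)" for v
    using assms(3) by auto
  then have "intgs [0..<n] (\<lambda>v. of_bool (map v [0..<n] \<in> X \<union> Y)) =
      (\<lambda>v. intgs [0..<n] (\<lambda>v. of_bool (map v [0..<n] \<in> X)) v + intgs [0..<n] (\<lambda>v. of_bool (map v [0..<n] \<in> Y)) v)"
    using intgs_add[OF c] by simp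
  from fun_cong[OF this, of undefined] show ?thesis
    by (simp only: intgs_echar distinct_upt length_upt minus_nat.diff_0)
qed

text \<open>The Euler characteristic of the graph is computed in both orders.\<close>

lemma echar_bij:
  assumes f: "bij_betw f X Y" and X: "\<And>x. x \<in> X \<Longrightarrow> length x = n" and Y: "\<And>y. y \<in> Y \<Longrightarrow> length y = m"
    and graph: "Def (\<lambda>v. map v [0..<n] \<in> X \<and> map v [n..<n + m] = f (map v [0..<n]))"
  shows "echar n X = echar m Y"
proof -
  let ?F = "\<lambda>v. of_bool (map v [0..<n] \<in> X \<and> map v [n..<n + m] = f (map v [0..<n])) :: int"
  let ?i = "[0..<n]" and ?j = "[n..<n + m]"
  \<comment> \<open>Over the block \<open>js\<close> the integrand is the indicator of the single
    point \<open>c\<close>, or zero.\<close>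
  have inner_int: "intgs js F v = of_bool P"
    if "distinct js" "length c = length js" "\<And>w. (\<forall>j. j \<notin> set js \<longrightarrow> w j = v j) \<Longrightarrow> F w = of_bool (P \<and> map w js = c)"
    for js F v P and c :: "'m list"
  proof (cases P)
    case True
    have "intgs js F v = intgs js (\<lambda>w. of_bool (map w js \<in> {c})) v"
      by (rule intgs_cong) (use that(3) True in simp)
    then show ?thesis using intgs_echar[OF that(1), of "{c}" v] echar_singleton[of c] that(2) True by simp
  next
    case False
    have "intgs js F v = intgs js (\<lambda>w. 0) v" by (rule intgs_cong) (use that(3) False in simp)
    then show ?thesis using False by (simp add: intgs_zero)
  qed
  have 1: "intgs ?j ?F v = of_bool (map v ?i \<in> X)" for v
  proof (cases "map v ?i \<in> X")
    case True
    show ?thesis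
    proof (rule inner_int)
      have "f (map v ?i) \<in> Y" using f True by (auto simp: bij_betw_def)
      then show "length (f (map v ?i)) = length ?j" using Y by simp
      fix w assume "\<forall>j. j \<notin> set ?j \<longrightarrow> w j = v j"
      then have eq: "map w ?i = map v ?i" by simp
      show "?F w = of_bool (map v ?i \<in> X \<and> map w ?j = f (map v ?i))" unfolding eq ..
    qed simp
  next
    case False
    have "intgs ?j ?F v = intgs ?j (\<lambda>w. 0) v"
    proof (rule intgs_cong)
      fix w assume "\<forall>j. j \<notin> set ?j \<longrightarrow> w j = v j"
      then have eq: "map w ?i = map v ?i" by simp
      show "?F w = 0" unfolding eq using False by simp
    qed
    then show ?thesis using False by (simp add: intgs_zero)
  qed
  have 2: "intgs ?i ?F v = of_bool (map v ?j \<in> Y)" for v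
  proof (cases "map v ?j \<in> Y")
    case True
    then obtain x where x: "x \<in> X" "f x = map v ?j" using f by (force simp: bij_betw_def)
    show ?thesis
    proof (rule inner_int)
      show "length x = length ?i" using X[OF x(1)] by simp
      fix w assume "\<forall>j. j \<notin> set ?i \<longrightarrow> w j = v j"
      then have eq: "map w ?j = map v ?j" by simp
      have "(a \<in> X \<and> map v ?j = f a) = (map v ?j \<in> Y \<and> a = x)" for a
        using x f True unfolding bij_betw_def inj_on_def by metis
      then show "?F w = of_bool (map v ?j \<in> Y \<and> map w ?i = x)" unfolding eq by (simp only:)
    qed simp
  next
    case False
    have "intgs ?i ?F v = intgs ?i (\<lambda>w. 0) v"
    proof (rule intgs_cong)
      fix w assume "\<forall>j. j \<notin> set ?i \<longrightarrow> w j = v j"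
      then have eq: "map w ?j = map v ?j" by simp
      have "\<not> (a \<in> X \<and> map v ?j = f a)" for a using False bij_betwE[OF f] by metis
      then show "?F w = 0" unfolding eq by (simp only: of_bool_eq)
    qed
    then show ?thesis using False by (simp add: intgs_zero)
  qed
  have "intgs ?i (intgs ?j ?F) undefined = intgs ?j (intgs ?i ?F) undefined"
    using intgs_commute[OF constr_of_bool[OF graph]] by simp
  moreover have "intgs ?j ?F = (\<lambda>v. of_bool (map v ?i \<in> X))" using 1 by blast
  moreover have "intgs ?i ?F = (\<lambda>v. of_bool (map v ?j \<in> Y))" using 2 by blast
  ultimately show ?thesis by (simp add: intgs_echar)
qed

section \<open>Dimension of families\<close>

text \<open>A lower bound \<open>e\<close> for the dimension, read off slice by slice. Only lower
  bounds are ever needed, and they are confronted with \<open>big_le\<close>.\<close>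

primrec big :: "nat \<Rightarrow> nat \<Rightarrow> 'm list set \<Rightarrow> bool" where
  "big 0 e X \<longleftrightarrow> e = 0 \<and> [] \<in> X"
| "big (Suc n) e X \<longleftrightarrow> (\<exists>u. big n e {w. u # w \<in> X}) \<or> (e > 0 \<and> infinite {u. big n (e - 1) {w. u # w \<in> X}})"

lemma big_le: "big n e X \<Longrightarrow> e \<le> n"
proof (induction n arbitrary: e X)
  case (Suc n)
  then consider u where "big n e {w. u # w \<in> X}" | "e > 0" "infinite {u. big n (e - 1) {w. u # w \<in> X}}"
    by auto
  then show ?case
  proof cases
    case 1
    then show ?thesis using Suc.IH by fastforce
  next
    case 2
    then obtain u where "big n (e - 1) {w. u # w \<in> X}" using infinite_imp_nonempty by blast
    then show ?thesis using Suc.IH by fastforce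
  qed
qed simp

lemma big_mono: "big n e X \<Longrightarrow> (\<And>w. length w = n \<Longrightarrow> w \<in> X \<Longrightarrow> w \<in> Y) \<Longrightarrow> big n e Y"
proof (induction n arbitrary: e X Y)
  case (Suc n)
  have sub: "big n k {w. u # w \<in> X} \<Longrightarrow> big n k {w. u # w \<in> Y}" for u k
    by (rule Suc.IH) (use Suc.prems(2) in auto)
  from Suc.prems(1) consider u where "big n e {w. u # w \<in> X}"
    | "e > 0" "infinite {u. big n (e - 1) {w. u # w \<in> X}}" by auto
  then show ?case
  proof cases
    case 1
    then show ?thesis using sub by auto
  next
    case 2
    have "{u. big n (e - 1) {w. u # w \<in> X}} \<subseteq> {u. big n (e - 1) {w. u # w \<in> Y}}" using sub by blast
    then have "infinite {u. big n (e - 1) {w. u # w \<in> Y}}" using 2(2) finite_subset by blast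
    then show ?thesis using 2(1) by simp
  qed
qed simp

lemma big_nonempty: "big n e X \<Longrightarrow> X \<noteq> {}"
proof (induction n arbitrary: e X)
  case (Suc n)
  then consider u where "big n e {w. u # w \<in> X}" | "infinite {u. big n (e - 1) {w. u # w \<in> X}}"
    by auto
  then show ?case
  proof cases
    case 1
    then show ?thesis using Suc.IH by blast
  next
    case 2
    then obtain u where "big n (e - 1) {w. u # w \<in> X}" using infinite_imp_nonempty by blast
    then show ?thesis using Suc.IH by blast
  qed
qed auto

lemma big_zero: "X \<noteq> {} \<Longrightarrow> (\<And>w. w \<in> X \<Longrightarrow> length w = n) \<Longrightarrow> big n 0 X"
proof (induction n arbitrary: X)
  case 0
  then show ?case by force
next
  case (Suc n)
  then obtain u w where "u # w \<in> X" by (metis all_not_in_conv length_Suc_conv)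
  moreover have "length w = n" if "u # w \<in> X" for w using Suc.prems(2)[OF that] by simp
  ultimately have "big n 0 {w. u # w \<in> X}" by (intro Suc.IH) auto
  then show ?case by auto
qed

end

context omin
begin

section \<open>Definability for tuples\<close>

definition dlist :: "nat \<Rightarrow> ((nat \<Rightarrow> 'm) \<Rightarrow> 'm list) \<Rightarrow> bool" where
  "dlist n t \<longleftrightarrow> (\<forall>v. length (t v) = n) \<and> (\<forall>i<n. dfn (\<lambda>v. t v ! i))"

lemma dlist_length: "dlist n t \<Longrightarrow> length (t v) = n"
  and dlist_nth: "dlist n t \<Longrightarrow> i < n \<Longrightarrow> dfn (\<lambda>v. t v ! i)"
  unfolding dlist_def by auto

lemma dlist_comp: "dlist n t \<Longrightarrow> (\<And>i. dfn (\<lambda>v. s v i)) \<Longrightarrow> dlist n (\<lambda>v. t (s v))"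
  unfolding dlist_def using dfn_comp by blast

lemma dlist_const: "length c = n \<Longrightarrow> dlist n (\<lambda>v. c)"
  unfolding dlist_def by (simp add: dfn_const)

lemma dlist_map: "length js = n \<Longrightarrow> (\<And>j. dfn (\<lambda>v. s v j)) \<Longrightarrow> dlist n (\<lambda>v. map (s v) js)"
  unfolding dlist_def by simp

lemma dlist_append: "dlist a s \<Longrightarrow> dlist b t \<Longrightarrow> a + b = n \<Longrightarrow> dlist n (\<lambda>v. s v @ t v)"
  unfolding dlist_def nth_append
proof (intro conjI allI impI, goal_cases)
  case (2 i)
  then show ?case by (cases "i < a") auto
qed auto

lemma dlist_Cons: "dfn s \<Longrightarrow> dlist n t \<Longrightarrow> dlist (Suc n) (\<lambda>v. s v # t v)"
  unfolding dlist_def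
proof (intro conjI allI impI, goal_cases)
  case (2 i)
  then show ?case by (cases i) auto
qed auto

lemma dlist_take: "dlist n t \<Longrightarrow> a \<le> n \<Longrightarrow> dlist a (\<lambda>v. take a (t v))"
  unfolding dlist_def by auto

lemma dlist_drop: "dlist n t \<Longrightarrow> a + b = n \<Longrightarrow> dlist b (\<lambda>v. drop a (t v))"
  unfolding dlist_def by auto

lemma Def_list_app:
  assumes "Def (\<lambda>w. P (map w [0..<n]) (\<lambda>i. w (i + n)))" "dlist n t" "\<And>i. dfn (\<lambda>v. s v i)"
  shows "Def (\<lambda>v. P (t v) (s v))"
proof -
  have "dfn (\<lambda>v. if i < n then t v ! i else s v (i - n))" for i
    using dlist_nth[OF assms(2)] assms(3) by (cases "i < n") simp_all
  from Def_subst[OF assms(1), of "\<lambda>v i. if i < n then t v ! i else s v (i - n)", OF this]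
  have "Def (\<lambda>v. P (map (\<lambda>i. if i < n then t v ! i else s v (i - n)) [0..<n]) (s v))" by simp
  moreover have "map (\<lambda>i. if i < n then t v ! i else s v (i - n)) [0..<n] = t v" for v
    using dlist_length[OF assms(2), of v] by (intro nth_equalityI) auto
  ultimately show ?thesis by simp
qed

lemma Def_mem: "dset n X \<Longrightarrow> dlist n t \<Longrightarrow> Def (\<lambda>v. t v \<in> X)"
  by (rule Def_list_app[of "\<lambda>x v. x \<in> X" n t "\<lambda>v. v"]) (auto intro: def_intro)

lemma Def_list_all:
  "Def (\<lambda>w. Q (map w [0..<n]) (\<lambda>i. w (i + n))) \<Longrightarrow> Def (\<lambda>v. \<forall>xs. length xs = n \<longrightarrow> Q xs v)"
  using Def_neg[OF Def_list_ex[OF Def_neg, of Q n]] by simp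

lemma Def_list_eq: assumes "dlist n s" "dlist n t" shows "Def (\<lambda>v. s v = t v)"
proof -
  have "Def (\<lambda>v. \<forall>i\<in>{..<n}. s v ! i = t v ! i)"
    by (intro Def_fball Def_eq dlist_nth[OF assms(1)] dlist_nth[OF assms(2)]) auto
  moreover have "s v = t v \<longleftrightarrow> (\<forall>i\<in>{..<n}. s v ! i = t v ! i)" for v
    using dlist_length[OF assms(1), of v] dlist_length[OF assms(2), of v] by (auto simp: list_eq_iff_nth_eq)
  ultimately show ?thesis by simp
qed

lemma dlist_graph:
  assumes len: "\<And>v. length (f v) = n" and D: "Def (\<lambda>w. map w [0..<n] = f (\<lambda>i. w (i + n)))"
  shows "dlist n f"
  unfolding dlist_def
proof (intro conjI allI impI)
  fix i assume "i < n"
  have "Def (\<lambda>w. \<exists>xs. length xs = n \<and> (xs = f (\<lambda>i. w (Suc i)) \<and> w 0 = xs ! i))"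
  proof (rule Def_list_ex, rule Def_conj)
    show "Def (\<lambda>w. map w [0..<n] = f (\<lambda>i. w (Suc i + n)))"
      by (rule Def_list_app[OF D dlist_map]) (rule dfn_var | simp)+
    have "Def (\<lambda>w. w (0 + n) = w i)" by (intro def_intro)
    then show "Def (\<lambda>w. w (0 + n) = map w [0..<n] ! i)" using \<open>i < n\<close> by simp
  qed
  moreover have "(\<exists>xs. length xs = n \<and> (xs = f (\<lambda>i. w (Suc i)) \<and> w 0 = xs ! i)) \<longleftrightarrow>
      w 0 = f (\<lambda>i. w (Suc i)) ! i" for w using len by blast
  ultimately show "dfn (\<lambda>v. f v ! i)" unfolding dfn_def by simp
qed (rule len)

text \<open>The lexicographic order, which selects one element from a finite set of tuples: in
  orbits of a finite group here, in the fibres of a quotient later.\<close>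

definition lless :: "nat \<Rightarrow> 'm list \<Rightarrow> 'm list \<Rightarrow> bool" where
  "lless n x y \<longleftrightarrow> (\<exists>i\<in>{..<n}. (\<forall>j\<in>{..<i}. x ! j = y ! j) \<and> x ! i < y ! i)"

lemma Def_lless: assumes "dlist n s" "dlist n t" shows "Def (\<lambda>v. lless n (s v) (t v))"
  unfolding lless_def
  by (intro Def_fbex Def_fball Def_conj Def_eq Def_less dlist_nth[OF assms(1)] dlist_nth[OF assms(2)]) auto

lemma lless_irrefl: "\<not> lless n x x"
  unfolding lless_def by simp

lemma lless_trans: assumes "lless n x y" "lless n y z" shows "lless n x z"
proof -
  obtain i where i: "i < n" "\<forall>j<i. x ! j = y ! j" "x ! i < y ! i" using assms(1) unfolding lless_def by auto
  obtain k where k: "k < n" "\<forall>j<k. y ! j = z ! j" "y ! k < z ! k" using assms(2) unfolding lless_def by auto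
  have "\<forall>j<min i k. x ! j = z ! j" using i k by simp
  moreover have "x ! min i k < z ! min i k"
  proof (cases i k rule: linorder_cases)
    case less
    then have "y ! i = z ! i" using k(2) by blast
    then show ?thesis using i(3) less by (simp add: min_def)
  next
    case equal
    then show ?thesis using i(3) k(3) by simp
  next
    case greater
    then have "x ! k = y ! k" using i(2) by blast
    then show ?thesis using k(3) greater by (simp add: min_def)
  qed
  ultimately show ?thesis unfolding lless_def using i(1) by (intro bexI[of _ "min i k"]) auto
qed

lemma lless_total:
  assumes "length x = n" "length y = n" "x \<noteq> y" shows "lless n x y \<or> lless n y x"
proof -
  have "\<exists>i. i < n \<and> x ! i \<noteq> y ! i" using assms by (auto simp: list_eq_iff_nth_eq)
  then obtain i where i: "i < n \<and> x ! i \<noteq> y ! i" "\<And>j. j < i \<Longrightarrow> \<not> (j < n \<and> x ! j \<noteq> y ! j)"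
    using exists_least_iff[of "\<lambda>i. i < n \<and> x ! i \<noteq> y ! i"] by blast
  then have eq: "x ! j = y ! j" if "j < i" for j using that by force
  consider "x ! i < y ! i" | "y ! i < x ! i" using i(1) by (metis linorder_neqE)
  then show ?thesis
    using i(1) eq unfolding lless_def by cases (metis lessThan_iff)+
qed

lemma lless_min:
  "finite A \<Longrightarrow> A \<noteq> {} \<Longrightarrow> (\<And>x. x \<in> A \<Longrightarrow> length x = n) \<Longrightarrow> \<exists>m\<in>A. \<forall>x\<in>A. \<not> lless n x m"
proof (induction A rule: finite_ne_induct)
  case (insert a A)
  then obtain m where m: "m \<in> A" "\<forall>x\<in>A. \<not> lless n x m" by auto
  show ?case
  proof (cases "lless n a m")
    case True
    have "\<not> lless n x a" if "x \<in> A" for x using m(2) that lless_trans[OF _ True] by blast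
    then show ?thesis using lless_irrefl by (intro bexI[of _ a]) auto
  qed (use m in auto)
qed (simp add: lless_irrefl)

section \<open>Free actions of finite groups\<close>

lemma echar_UN:
  assumes "finite I" "\<And>i. i \<in> I \<Longrightarrow> dset n (X i)" "\<And>i j. i \<in> I \<Longrightarrow> j \<in> I \<Longrightarrow> i \<noteq> j \<Longrightarrow> X i \<inter> X j = {}"
  shows "echar n (\<Union>i\<in>I. X i) = (\<Sum>i\<in>I. echar n (X i)) \<and> dset n (\<Union>i\<in>I. X i)"
  using assms
proof (induction I rule: finite_induct)
  case (insert a I)
  then have IH: "echar n (\<Union>i\<in>I. X i) = (\<Sum>i\<in>I. echar n (X i))" "dset n (\<Union>i\<in>I. X i)" by auto
  have dis: "X a \<inter> (\<Union>i\<in>I. X i) = {}" using insert.prems(2)[of a] insert.hyps by fastforce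
  have "echar n (X a \<union> (\<Union>i\<in>I. X i)) = echar n (X a) + echar n (\<Union>i\<in>I. X i)"
    by (rule echar_Un[OF _ IH(2) dis]) (use insert.prems in auto)
  moreover have "Def (\<lambda>v. map v [0..<n] \<in> X a \<or> map v [0..<n] \<in> (\<Union>i\<in>I. X i))"
    by (intro Def_disj IH(2) insert.prems) auto
  ultimately show ?case using insert.hyps IH by simp
qed (simp add: echar_empty Def_const)

text \<open>The lexicographically least points of the orbits form a definable set \<open>T\<close>.
  Its translates cover \<open>X\<close>, freeness makes them disjoint, and each has the Euler
  characteristic of \<open>T\<close> by \<open>echar_bij\<close>. The laws of the action are
  required on \<open>X\<close> alone.\<close>

lemma free_action:
  fixes n :: nat
  assumes fin: "finite \<Phi>" and ne: "\<Phi> \<noteq> {}" and X: "dset n X" and len: "\<And>x. x \<in> X \<Longrightarrow> length x = n"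
    and def: "\<And>\<phi> t. \<phi> \<in> \<Phi> \<Longrightarrow> dlist n t \<Longrightarrow> dlist n (\<lambda>v. \<phi> (t v))"
    and maps: "\<And>\<phi> x. \<phi> \<in> \<Phi> \<Longrightarrow> x \<in> X \<Longrightarrow> \<phi> x \<in> X"
    and comp: "\<And>\<phi> \<psi>. \<phi> \<in> \<Phi> \<Longrightarrow> \<psi> \<in> \<Phi> \<Longrightarrow> \<exists>\<chi>\<in>\<Phi>. \<forall>x\<in>X. \<chi> x = \<phi> (\<psi> x)"
    and inv: "\<And>\<phi>. \<phi> \<in> \<Phi> \<Longrightarrow> \<exists>\<psi>\<in>\<Phi>. \<forall>x\<in>X. \<psi> (\<phi> x) = x"
    and free: "\<And>\<phi> \<psi> x. \<phi> \<in> \<Phi> \<Longrightarrow> \<psi> \<in> \<Phi> \<Longrightarrow> x \<in> X \<Longrightarrow> \<phi> x = \<psi> x \<Longrightarrow> \<phi> = \<psi>"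
  shows "int (card \<Phi>) dvd echar n X"
proof -
  define T where "T = {x \<in> X. \<forall>\<phi>\<in>\<Phi>. \<not> lless n (\<phi> x) x}"
  have dv: "dlist n (\<lambda>v. map v [0..<n])" by (intro dlist_map def_intro) simp
  have "dset n T"
    unfolding T_def mem_Collect_eq by (rule Def_conj[OF X Def_fball[OF fin Def_neg[OF Def_lless[OF def[OF _ dv] dv]]]])
  note T_mem = Def_mem[OF this]
  have TX: "T \<subseteq> X" unfolding T_def by blast
  have inj: "inj_on \<phi> X" if "\<phi> \<in> \<Phi>" for \<phi>
    using inv[OF that] by (metis inj_onI)
  have D: "dset n (\<phi> ` T)" if p: "\<phi> \<in> \<Phi>" for \<phi>
  proof -
    have "Def (\<lambda>v. \<exists>x. length x = n \<and> (x \<in> T \<and> map v [0..<n] = \<phi> x))"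
      by (rule Def_list_ex) (intro Def_conj T_mem Def_list_eq[of n] def[OF p] dlist_map def_intro; simp)
    moreover have "y \<in> \<phi> ` T \<longleftrightarrow> (\<exists>x. length x = n \<and> (x \<in> T \<and> y = \<phi> x))" for y
      using TX len by blast
    ultimately show ?thesis by (simp only:)
  qed
  have E: "echar n (\<phi> ` T) = echar n T" if p: "\<phi> \<in> \<Phi>" for \<phi>
  proof (rule echar_bij[symmetric, where f = \<phi>])
    show "bij_betw \<phi> T (\<phi> ` T)" using inj[OF p] TX by (simp add: bij_betw_def inj_on_subset)
    show "length x = n" if "x \<in> T" for x using that TX len by blast
    show "length y = n" if "y \<in> \<phi> ` T" for y using that TX len maps[OF p] by blast
    have "dlist n (\<lambda>v. map v [n..<n + n])" by (intro dlist_map def_intro) simp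
    then show "Def (\<lambda>v. map v [0..<n] \<in> T \<and> map v [n..<n + n] = \<phi> (map v [0..<n]))"
      by (intro Def_conj T_mem Def_list_eq[of n] def[OF p] dv)
  qed
  have dis: "\<phi> ` T \<inter> \<psi> ` T = {}" if pq: "\<phi> \<in> \<Phi>" "\<psi> \<in> \<Phi>" "\<phi> \<noteq> \<psi>" for \<phi> \<psi>
  proof (rule ccontr)
    assume "\<phi> ` T \<inter> \<psi> ` T \<noteq> {}"
    then obtain x y where xy: "x \<in> T" "y \<in> T" "\<phi> x = \<psi> y" by blast
    then have X': "x \<in> X" "y \<in> X" using TX by auto
    obtain \<phi>' where p': "\<phi>' \<in> \<Phi>" "\<forall>x\<in>X. \<phi>' (\<phi> x) = x" using inv[OF pq(1)] by blast
    obtain \<psi>' where q': "\<psi>' \<in> \<Phi>" "\<forall>x\<in>X. \<psi>' (\<psi> x) = x" using inv[OF pq(2)] by blast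
    obtain \<chi> where c: "\<chi> \<in> \<Phi>" "\<forall>x\<in>X. \<chi> x = \<phi>' (\<psi> x)" using comp[OF p'(1) pq(2)] by blast
    obtain \<xi> where d: "\<xi> \<in> \<Phi>" "\<forall>x\<in>X. \<xi> x = \<psi>' (\<phi> x)" using comp[OF q'(1) pq(1)] by blast
    have "\<chi> y = x" using c(2) p'(2) X' xy(3) by metis
    moreover have "\<xi> x = y" using d(2) q'(2) X' xy(3) by metis
    ultimately have "\<not> lless n x y" "\<not> lless n y x"
      using xy(1,2) c(1) d(1) unfolding T_def by auto
    then have "x = y" using lless_total[of x n y] len X' by blast
    then show False using free[OF pq(1,2) X'(1)] xy(3) pq(3) by blast
  qed
  have "X = (\<Union>\<phi>\<in>\<Phi>. \<phi> ` T)"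
  proof (intro equalityI subsetI)
    fix x assume x: "x \<in> X"
    let ?A = "(\<lambda>\<phi>. \<phi> x) ` \<Phi>"
    have "\<exists>m\<in>?A. \<forall>y\<in>?A. \<not> lless n y m"
      by (rule lless_min) (use fin ne maps x len in auto)
    then obtain \<phi> where p: "\<phi> \<in> \<Phi>" "\<forall>\<psi>\<in>\<Phi>. \<not> lless n (\<psi> x) (\<phi> x)" by blast
    have "\<phi> x \<in> T"
      unfolding T_def
    proof (intro CollectI conjI ballI)
      show "\<phi> x \<in> X" by (rule maps[OF p(1) x])
      fix \<psi> assume "\<psi> \<in> \<Phi>"
      then obtain \<chi> where "\<chi> \<in> \<Phi>" "\<forall>x\<in>X. \<chi> x = \<psi> (\<phi> x)" using comp p(1) by blast
      then show "\<not> lless n (\<psi> (\<phi> x)) (\<phi> x)" using p(2) x by metis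
    qed
    obtain \<psi> where q: "\<psi> \<in> \<Phi>" "\<psi> (\<phi> x) = x" using inv[OF p(1)] x by blast
    have "x \<in> \<psi> ` T" using imageI[OF \<open>\<phi> x \<in> T\<close>, of \<psi>] q(2) by simp
    then show "x \<in> (\<Union>\<phi>\<in>\<Phi>. \<phi> ` T)" using q(1) by blast
  qed (use TX maps in auto)
  moreover have "echar n (\<Union>\<phi>\<in>\<Phi>. \<phi> ` T) = (\<Sum>\<phi>\<in>\<Phi>. echar n (\<phi> ` T))"
    using echar_UN[OF fin, of n "\<lambda>\<phi>. \<phi> ` T"] D dis by blast
  ultimately have "echar n X = int (card \<Phi>) * echar n T" using E by simp
  then show ?thesis by simp
qed

section \<open>Definable families of disjoint large sets\<close>

text \<open>The value \<open>p\<close> is determined by the class, so infinitely many values require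
  infinitely many classes.\<close>

lemma infinite_image_if:
  assumes inf: "infinite {p. \<exists>x\<in>S. R x p}"
    and unique: "\<And>x y p q. x \<in> S \<Longrightarrow> y \<in> S \<Longrightarrow> c x = c y \<Longrightarrow> R x p \<Longrightarrow> R y q \<Longrightarrow> p = q"
  shows "infinite (c ` S)"
proof
  assume fin: "finite (c ` S)"
  let ?h = "\<lambda>C. SOME p. \<exists>x\<in>S. c x = C \<and> R x p"
  have "{p. \<exists>x\<in>S. R x p} \<subseteq> ?h ` (c ` S)"
  proof
    fix p assume "p \<in> {p. \<exists>x\<in>S. R x p}"
    then obtain x where x: "x \<in> S" "R x p" by blast
    then have "\<exists>y\<in>S. c y = c x \<and> R y (?h (c x))"
      using someI[of "\<lambda>p. \<exists>y\<in>S. c y = c x \<and> R y p" p] by blast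
    then obtain y where y: "y \<in> S" "c y = c x" "R y (?h (c x))" by blast
    have "?h (c x) = p" by (rule unique[OF y(1) x(1) y(2,3) x(2)])
    then show "p \<in> ?h ` (c ` S)" using x(1) by blast
  qed
  then show False using inf fin finite_subset by blast
qed

lemma infinite_image_pigeonhole:
  assumes "finite A" "infinite (c ` S)" "\<And>x. x \<in> S \<Longrightarrow> \<exists>a\<in>A. R x a"
  shows "\<exists>a\<in>A. infinite (c ` {x \<in> S. R x a})"
proof (rule ccontr)
  assume "\<not> ?thesis"
  then have "finite (\<Union>a\<in>A. c ` {x \<in> S. R x a})" using assms(1) by blast
  moreover have "c ` S \<subseteq> (\<Union>a\<in>A. c ` {x \<in> S. R x a})" using assms(3) by blast
  ultimately show False using assms(2) finite_subset by blast
qed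

text \<open>The exchange lemma where the second coordinate ranges over the classes \<open>c ` S\<close>. The class of \<open>x\<close>
  is replaced by the endpoints of the first interval in the fibre \<open>Q _ x\<close>.\<close>

lemma exchange_classes:
  assumes S: "dset k S" and lenS: "\<And>x. x \<in> S \<Longrightarrow> length x = k"
    and Q: "\<And>t s. dfn t \<Longrightarrow> dlist k s \<Longrightarrow> Def (\<lambda>v. Q (t v) (s v))"
    and cong: "\<And>x y u. x \<in> S \<Longrightarrow> y \<in> S \<Longrightarrow> c x = c y \<Longrightarrow> Q u x \<longleftrightarrow> Q u y"
    and infS: "infinite (c ` S)" and infQ: "\<And>x. x \<in> S \<Longrightarrow> infinite {u. Q u x}"
  shows "infinite {u. infinite (c ` {x \<in> S. Q u x})}"
proof -
  obtain c0 :: 'm where True by blast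
  have "\<exists>r. lin r \<and> infinite {u. Q u x \<and> r c0 u}" if x: "x \<in> S" for x
  proof (rule ccontr)
    assume no: "\<not> ?thesis"
    have "{u. Q u x} \<subseteq> insert c0 ({u. Q u x \<and> c0 < u} \<union> {u. Q u x \<and> c0 > u})" by auto
    moreover have "finite {u. Q u x \<and> c0 < u}" "finite {u. Q u x \<and> c0 > u}"
      using no lin_less lin_greater by blast+
    ultimately show False using infQ[OF x] by (meson finite_UnI finite_insert finite_subset)
  qed
  then have "\<exists>r\<in>{(<), (>)}. infinite (c ` {x \<in> S. infinite {u. Q u x \<and> r c0 u}})"
    by (intro infinite_image_pigeonhole[OF _ infS]) (auto simp: lin_def)
  then obtain r where r: "lin r" and inf1: "infinite (c ` {x \<in> S. infinite {u. Q u x \<and> r c0 u}})"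
    using lin_less lin_greater by blast
  note tr = lin_trans[OF r] and r' = lin_conv[OF r]
  define Z where "Z x u \<longleftrightarrow> Q u x \<and> r c0 u" for x u
  define S1 where "S1 = {x \<in> S. infinite {u. Z x u}}"
  have inf1: "infinite (c ` S1)" using inf1 unfolding S1_def Z_def .
  have S1S: "S1 \<subseteq> S" unfolding S1_def by blast
  have Z_app: "Def (\<lambda>v. Z (s v) (t v))" if "dlist k s" "dfn t" for s t
    unfolding Z_def by (intro Def_conj Q that Def_lin[OF r] dfn_const)
  have Z_cong: "Z x u = Z y u" if "x \<in> S1" "y \<in> S1" "c x = c y" for x y u
    using cong[of x y u] that S1S unfolding Z_def by blast
  \<comment> \<open>Here \<open>L x p\<close> says that \<open>p\<close> is the left end, in the
    direction \<open>r\<close>, of the first interval in the fibre of \<open>x\<close> beyond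
    \<open>c0\<close>. It depends only on the class of \<open>x\<close>.\<close>
  define P where "P x p \<longleftrightarrow> (p = c0 \<or> r c0 p) \<and> germr r p (Z x)" for x p
  define L where "L x p \<longleftrightarrow> P x p \<and> (\<forall>q. P x q \<longrightarrow> q = p \<or> r p q)" for x p
  have P_app: "Def (\<lambda>v. P (s v) (t v))" if s: "dlist k s" "dfn t" for s t
    unfolding P_def by (intro def_intro Def_lin[OF r] r Z_app dlist_comp[OF s(1)] dfn_comp[OF s(2)] s)
  have L_app: "Def (\<lambda>v. L (s v) (t v))" if s: "dlist k s" "dfn t" for s t
    unfolding L_def by (intro def_intro Def_lin[OF r] P_app dlist_comp[OF s(1)] dfn_comp[OF s(2)] s)
  have S1_app: "Def (\<lambda>v. s v \<in> S1)" if s: "dlist k s" for s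
    unfolding S1_def mem_Collect_eq
    by (intro Def_conj Def_infinite Def_mem[OF S s] Z_app dlist_comp[OF s] def_intro)
  have DZ: "D1 (Z x)" if "x \<in> S" for x by (intro Z_app dlist_const lenS that def_intro)
  have L_ex: "\<exists>p. L x p" if "x \<in> S1" for x
    unfolding L_def P_def by (rule first_germ[OF r DZ]) (use that S1S in \<open>auto simp: Z_def S1_def\<close>)
  have L_unique: "p = q" if "L x p" "L x q" for x p q
    using that lin_asym[OF r] unfolding L_def by blast
  have L_cong: "L x p = L y p" if "x \<in> S1" "y \<in> S1" "c x = c y" for x y p
  proof -
    have "Z x = Z y" using Z_cong[OF that] by blast
    then show ?thesis unfolding L_def P_def by simp
  qed
  define K where "K x p v \<longleftrightarrow> r p v \<and> (\<forall>z. r p z \<longrightarrow> z = v \<or> r z v \<longrightarrow> Z x z)" for x p v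
  have K_app: "Def (\<lambda>v. K (s v) (t v) (u v))" if s: "dlist k s" "dfn t" "dfn u" for s t u
    unfolding K_def
    by (intro def_intro Def_lin[OF r] Z_app dlist_comp[OF s(1)] dfn_comp[OF s(2)] dfn_comp[OF s(3)] s)
  have L_K: "germr r p (K x p)" if "L x p" for x p
  proof -
    obtain b where "r p b" "\<And>z. r p z \<Longrightarrow> r z b \<Longrightarrow> Z x z"
      using \<open>L x p\<close> unfolding L_def P_def germr_def by blast
    then show ?thesis unfolding germr_def K_def using tr by blast
  qed
  have germ_inf: "infinite {v. A v}" if g: "germr r p A" for p and A :: "'m \<Rightarrow> bool"
  proof -
    obtain b where b: "r p b" "\<And>z. r p z \<Longrightarrow> r z b \<Longrightarrow> A z" using g unfolding germr_def by blast
    show ?thesis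
      using r interval_infinite[of p b A] interval_infinite[of b p A] b unfolding lin_def by blast
  qed
  have sub: "infinite {u. infinite (c ` {x \<in> S. Q u x})}"
    if "infinite V" "\<And>v. v \<in> V \<Longrightarrow> infinite (c ` {x \<in> S1. Z x v})" for V
  proof (rule infinite_super[OF _ that(1)])
    show "V \<subseteq> {u. infinite (c ` {x \<in> S. Q u x})}"
    proof
      fix v assume "v \<in> V"
      moreover have "c ` {x \<in> S1. Z x v} \<subseteq> c ` {x \<in> S. Q v x}" using S1S unfolding Z_def by blast
      ultimately show "v \<in> {u. infinite (c ` {x \<in> S. Q u x})}" using that(2) finite_subset by blast
    qed
  qed
  show ?thesis
  proof (cases "finite {p. \<exists>x\<in>S1. L x p}")
    case False
    \<comment> \<open>If the left ends are infinitely many, they stand in for the classes: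
      exchanging \<open>p\<close> and \<open>v\<close> gives infinitely many \<open>v\<close>, each
      in the fibres of infinitely many classes.\<close>
    let ?Y = "\<lambda>p v. \<exists>x. length x = k \<and> (x \<in> S1 \<and> L x p \<and> K x p v)"
    have "D2 ?Y"
      by (rule Def_list_ex) (intro Def_conj S1_app L_app K_app dlist_map def_intro; simp)
    moreover have "infinite {p. infinite {v. ?Y p v}}"
    proof (rule infinite_super[OF _ False], rule subsetI)
      fix p assume "p \<in> {p. \<exists>x\<in>S1. L x p}"
      then obtain x where x: "x \<in> S1" "L x p" by blast
      then have "{v. K x p v} \<subseteq> {v. ?Y p v}" using lenS S1S by blast
      then show "p \<in> {p. infinite {v. ?Y p v}}" using germ_inf[OF L_K[OF x(2)]] finite_subset by blast
    qed
    ultimately have inf: "infinite {v. infinite {p. ?Y p v}}" by (rule exchange)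
    show ?thesis
    proof (rule sub[OF inf])
      fix v assume "v \<in> {v. infinite {p. ?Y p v}}"
      then have "infinite {p. ?Y p v}" by blast
      moreover have "{p. ?Y p v} \<subseteq> {p. \<exists>x\<in>{x \<in> S1. Z x v}. L x p}" unfolding K_def by blast
      ultimately have "infinite {p. \<exists>x\<in>{x \<in> S1. Z x v}. L x p}" using finite_subset by blast
      then show "infinite (c ` {x \<in> S1. Z x v})"
        by (rule infinite_image_if) (use L_cong L_unique in blast)
    qed
  next
    case True
    \<comment> \<open>Otherwise infinitely many classes share one left end \<open>p\<close>, and
      their right ends \<open>b\<close> are examined next.\<close>
    have "\<exists>p\<in>{p. \<exists>x\<in>S1. L x p}. infinite (c ` {x \<in> S1. L x p})"
      by (rule infinite_image_pigeonhole[OF True inf1]) (use L_ex in blast)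
    then obtain p x0 where infp: "infinite (c ` {x \<in> S1. L x p})" and x0: "L x0 p" by blast
    obtain v0 where v0: "r p v0" using germr_ex[OF r L_K[OF x0]] by blast
    let ?T = "\<lambda>x. \<forall>v. r p v \<longrightarrow> Z x v"
    have inf_up: "infinite {v. r p v}"
      by (rule germ_inf[of p]) (use v0 germr_def in blast)
    have "c ` {x \<in> S1. L x p} = c ` {x \<in> S1. L x p \<and> ?T x} \<union> c ` {x \<in> S1. L x p \<and> \<not> ?T x}" by blast
    then consider "infinite (c ` {x \<in> S1. L x p \<and> ?T x})" | "infinite (c ` {x \<in> S1. L x p \<and> \<not> ?T x})"
      using infp by auto
    then show ?thesis
    proof cases
      case 1
      show ?thesis
      proof (rule sub[OF inf_up])
        fix v assume "v \<in> {v. r p v}"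
        then have "c ` {x \<in> S1. L x p \<and> ?T x} \<subseteq> c ` {x \<in> S1. Z x v}" by blast
        then show "infinite (c ` {x \<in> S1. Z x v})" using 1 finite_subset by blast
      qed
    next
      case 2
      define S2 where "S2 = {x \<in> S1. L x p \<and> \<not> ?T x}"
      have inf2: "infinite (c ` S2)" using 2 unfolding S2_def .
      have S2S: "S2 \<subseteq> S1" unfolding S2_def by blast
      define B where "B x b \<longleftrightarrow> islub (\<lambda>x y. r y x) (\<lambda>v. r p v \<and> \<not> Z x v) b" for x b
      have B_ex: "\<exists>b. B x b" if x: "x \<in> S2" for x
      proof -
        obtain v where "r p v \<and> \<not> Z x v" using x unfolding S2_def by blast
        moreover have "D1 (\<lambda>v. r p v \<and> \<not> Z x v)"
          by (intro def_intro Def_lin[OF r] D1_app[OF DZ]) (use x S2S S1S in auto)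
        ultimately show ?thesis
          unfolding B_def using lub_ex[OF r', of "\<lambda>v. r p v \<and> \<not> Z x v" v p] by blast
      qed
      have B_Z: "Z x v" if "B x b" "r p v" "r v b" for x b v
        using that lin_asym[OF r] lin_irrefl[OF r] unfolding B_def islub_def by blast
      have B_p: "r p b" if xb: "x \<in> S2" "B x b" for x b
      proof (rule ccontr)
        assume no: "\<not> r p b"
        have "L x p" using xb(1) unfolding S2_def by blast
        then obtain t where t: "r p t" "\<And>z. r p z \<Longrightarrow> r z t \<Longrightarrow> Z x z"
          unfolding L_def P_def germr_def by blast
        have "r b t" using no t(1) lin_total[OF r] tr by metis
        then show False using xb(2) t(2) unfolding B_def islub_def by blast
      qed
      have DB: "D1 (\<lambda>b. \<exists>x. length x = k \<and> (x \<in> S2 \<and> B x b))"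
      proof (rule Def_list_ex)
        have dv: "dlist k (\<lambda>w. map w [0..<k])" by (intro dlist_map def_intro) simp
        show "Def (\<lambda>w. map w [0..<k] \<in> S2 \<and> B (map w [0..<k]) (w (0 + k)))"
          unfolding S2_def B_def mem_Collect_eq
          by (intro def_intro r' S1_app L_app Z_app Def_lin[OF r] dv dlist_comp[OF dv])
      qed
      have B_iff: "(\<exists>x. length x = k \<and> (x \<in> S2 \<and> B x b)) \<longleftrightarrow> (\<exists>x\<in>S2. B x b)" for b
        using lenS S2S S1S by blast
      show ?thesis
      proof (cases "finite {b. \<exists>x\<in>S2. B x b}")
        case True
        have "\<exists>b\<in>{b. \<exists>x\<in>S2. B x b}. infinite (c ` {x \<in> S2. B x b})"
          by (rule infinite_image_pigeonhole[OF True inf2]) (use B_ex in blast)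
        then obtain b x1 where b: "infinite (c ` {x \<in> S2. B x b})" "x1 \<in> S2" "B x1 b" by blast
        have infv: "infinite {v. r p v \<and> r v b}"
          by (rule germ_inf[of p]) (use B_p[OF b(2,3)] germr_def in blast)
        show ?thesis
        proof (rule sub[OF infv])
          fix v assume "v \<in> {v. r p v \<and> r v b}"
          then have "c ` {x \<in> S2. B x b} \<subseteq> c ` {x \<in> S1. Z x v}" using B_Z S2S by blast
          then show "infinite (c ` {x \<in> S1. Z x v})" using b(1) finite_subset by blast
        qed
      next
        case False
        obtain b0 b1 where b01: "b0 < b1" "\<And>b. b0 < b \<Longrightarrow> b < b1 \<Longrightarrow> \<exists>x\<in>S2. B x b"
          by (rule infinite_imp_intervalE[OF False DB[unfolded B_iff]]) (rule that)
        \<comment> \<open>The fibre of every class with right end beyond \<open>b\<close> contains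
          the segment from \<open>p\<close> to \<open>b\<close>, and infinitely many right ends lie
          beyond \<open>b\<close>.\<close>
        obtain b where b: "b0 < b" "b < b1" using dense[OF b01(1)] by blast
        have infb: "infinite {b'. r b b' \<and> (\<exists>x\<in>S2. B x b')}"
        proof (rule germ_inf[of b])
          have "near b (\<lambda>b'. \<exists>x\<in>S2. B x b')"
            by (rule near_mono[OF near_interval[OF b]]) (use b01(2) in blast)
          from near_germr[OF r this] show "germr r b (\<lambda>b'. r b b' \<and> (\<exists>x\<in>S2. B x b'))"
            by (rule germr_mono) blast
        qed
        have "r p b" using b01(2)[OF b] B_p by blast
        have infv: "infinite {v. r p v \<and> r v b}"
          by (rule germ_inf[of p]) (use \<open>r p b\<close> germr_def in blast)
        show ?thesis
        proof (rule sub[OF infv])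
          fix v assume v: "v \<in> {v. r p v \<and> r v b}"
          have "{b'. r b b' \<and> (\<exists>x\<in>S2. B x b')} \<subseteq> {b'. \<exists>x\<in>{x \<in> S1. Z x v}. B x b'}"
          proof
            fix b' assume "b' \<in> {b'. r b b' \<and> (\<exists>x\<in>S2. B x b')}"
            then obtain x where x: "r b b'" "x \<in> S2" "B x b'" by blast
            then have "Z x v" using B_Z[of x b' v] v tr by blast
            then show "b' \<in> {b'. \<exists>x\<in>{x \<in> S1. Z x v}. B x b'}" using x S2S by blast
          qed
          then have "infinite {b'. \<exists>x\<in>{x \<in> S1. Z x v}. B x b'}" using infb finite_subset by blast
          then show "infinite (c ` {x \<in> S1. Z x v})"
          proof (rule infinite_image_if)
            fix x y b' b'' assume xy: "x \<in> {x \<in> S1. Z x v}" "y \<in> {x \<in> S1. Z x v}" "c x = c y" "B x b'" "B y b''"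
            have "Z x = Z y" using Z_cong[of x y] xy by blast
            then show "b' = b''" using islub_unique[OF r'] xy(4,5) unfolding B_def by simp
          qed
        qed
      qed
    qed
  qed
qed

lemma Def_big:
  assumes "\<And>t s. dlist n t \<Longrightarrow> (\<And>i. dfn (\<lambda>v. s v i)) \<Longrightarrow> Def (\<lambda>v. P (t v) (s v))"
  shows "Def (\<lambda>v. big n e {w. P w v})"
  using assms
proof (induction n arbitrary: e P)
  case 0
  then have "Def (\<lambda>v. P [] v)" by (intro 0 dlist_const def_intro) simp
  then show ?case by (simp add: Def_conj Def_const)
next
  case (Suc n)
  have "DefP (\<lambda>u v. big n k {w. P (u # w) v})" for k
    by (rule Suc.IH) (intro Suc.prems dlist_Cons)
  then show ?case by (simp add: Def_conj Def_const Def_disj Def_ex Def_infinite)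
qed

text \<open>\<open>E\<close> is an equivalence relation on the set \<open>{x. E x x}\<close>. If
  infinitely many classes have infinitely many slices of dimension at least \<open>e - 1\<close>,
  then \<open>exchange_classes\<close> finds infinitely many slices that meet infinitely many
  classes in this dimension, and the induction hypothesis applies to these slices. Otherwise
  infinitely many classes have a slice of dimension at least \<open>e\<close>, either over one
  common point or over infinitely many points in total.\<close>

lemma big_classes:
  assumes E: "\<And>s t. dlist n s \<Longrightarrow> dlist n t \<Longrightarrow> Def (\<lambda>v. E (s v) (t v))"
    and len: "\<And>x y. E x y \<Longrightarrow> length x = n"
    and sym: "\<And>x y. E x y \<Longrightarrow> E y x" and trans: "\<And>x y z. E x y \<Longrightarrow> E y z \<Longrightarrow> E x z"
    and inf: "infinite {C. \<exists>x. E x x \<and> C = {y. E x y} \<and> big n e C}"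
  shows "big n (Suc e) {x. E x x}"
  using assms
proof (induction n arbitrary: E e)
  case 0
  have "{C. \<exists>x. E x x \<and> C = {y. E x y} \<and> big 0 e C} \<subseteq> {{y. E [] y}}" using 0(2) by force
  then have "finite {C. \<exists>x. E x x \<and> C = {y. E x y} \<and> big 0 e C}" by (rule finite_subset) simp
  then show ?case using 0(5) by blast
next
  case (Suc n)
  note E = Suc.prems(1) and len = Suc.prems(2) and sym = Suc.prems(3) and trans = Suc.prems(4)
    and inf = Suc.prems(5)
  let ?c = "\<lambda>x. {y. E x y}"
  let ?sl = "\<lambda>u C. {w. u # w \<in> C}"
  have E_self: "E x x" if "E x y" for x y using sym trans that by blast
  \<comment> \<open>Distinct classes with nonempty slices over \<open>u\<close> stay distinct there,
    since such a slice determines its class.\<close>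
  have slice: "big n (Suc k) {w. E (u # w) (u # w)}"
    if inf': "infinite (?c ` {x. E x x \<and> big n k (?sl u (?c x))})" for u k
  proof -
    have "big n (Suc k) {w. (\<lambda>w w'. E (u # w) (u # w')) w w}"
    proof (rule Suc.IH[of "\<lambda>w w'. E (u # w) (u # w')" k])
      show "Def (\<lambda>v. E (u # s v) (u # t v))" if "dlist n s" "dlist n t" for s t
        by (intro E dlist_Cons that dfn_const)
      show "length w = n" if "E (u # w) (u # w')" for w w' using len[OF that] by simp
      show "E (u # w') (u # w)" if "E (u # w) (u # w')" for w w' using sym[OF that] .
      show "E (u # w) (u # w'')" if "E (u # w) (u # w')" "E (u # w') (u # w'')" for w w' w''
        using trans[OF that] .
      let ?D = "{C. \<exists>w. E (u # w) (u # w) \<and> C = {w'. E (u # w) (u # w')} \<and> big n k C}"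
      have "?sl u ` (?c ` {x. E x x \<and> big n k (?sl u (?c x))}) \<subseteq> ?D"
      proof (intro subsetI, elim imageE CollectE conjE, hypsubst)
        fix x assume x: "E x x" "big n k (?sl u (?c x))"
        then have "?sl u (?c x) \<noteq> {}" using big_nonempty by blast
        then obtain w where w: "E x (u # w)" by blast
        then have "?sl u (?c x) = {w'. E (u # w) (u # w')}" using sym trans by blast
        then show "?sl u (?c x) \<in> ?D" using x(2) w E_self sym by auto
      qed
      moreover have "inj_on (?sl u) (?c ` {x. E x x \<and> big n k (?sl u (?c x))})"
      proof (rule inj_onI, elim imageE CollectE conjE, hypsubst)
        fix x y assume x: "big n k (?sl u (?c x))" and eq: "?sl u (?c x) = ?sl u (?c y)"
        then have "?sl u (?c x) \<noteq> {}" using big_nonempty by blast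
        then obtain w where "w \<in> ?sl u (?c x)" by blast
        then have "E x (u # w)" "E y (u # w)" using eq by auto
        then show "?c x = ?c y" using sym trans by blast
      qed
      ultimately show "infinite ?D"
        using inf' finite_imageD[of "?sl u" "?c ` {x. E x x \<and> big n k (?sl u (?c x))}"] finite_subset by blast
    qed
    then show ?thesis by simp
  qed
  let ?A = "{x. E x x \<and> e > 0 \<and> infinite {u. big n (e - 1) (?sl u (?c x))}}"
  let ?B = "{x. E x x \<and> (\<exists>u. big n e (?sl u (?c x)))}"
  have "{C. \<exists>x. E x x \<and> C = ?c x \<and> big (Suc n) e C} \<subseteq> ?c ` ?A \<union> ?c ` ?B"
  proof
    fix C assume "C \<in> {C. \<exists>x. E x x \<and> C = ?c x \<and> big (Suc n) e C}"
    then obtain x where x: "E x x" "C = ?c x" "big (Suc n) e (?c x)" by blast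
    from x(3) have "x \<in> ?A \<or> x \<in> ?B" using x(1) by auto
    then show "C \<in> ?c ` ?A \<union> ?c ` ?B" using x(2) by blast
  qed
  then have "infinite (?c ` ?A \<union> ?c ` ?B)" using inf finite_subset by blast
  then consider "infinite (?c ` ?A)" | "infinite (?c ` ?B)" by auto
  then show ?case
  proof cases
    case 1
    from infinite_imp_nonempty[OF 1] have "?A \<noteq> {}" by (simp only: image_is_empty not_False_eq_True)
    then have e: "e > 0" by blast
    have big_app: "Def (\<lambda>v. big n k {w. E (s v) (t v # w)})" if s: "dlist (Suc n) s" "dfn t" for s t k
      by (rule Def_big) (intro E dlist_Cons dlist_comp[OF s(1)] dfn_comp[OF s(2)])
    have dv: "dlist (Suc n) (\<lambda>v. map v [0..<Suc n])" by (intro dlist_map def_intro) simp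
    have infU: "infinite {u. infinite (?c ` {x \<in> ?A. big n (e - 1) (?sl u (?c x))})}"
    proof (rule exchange_classes[where k = "Suc n" and c = ?c and S = ?A and Q = "\<lambda>u x. big n (e - 1) (?sl u (?c x))"])
      show "dset (Suc n) ?A"
        unfolding mem_Collect_eq
        by (intro Def_conj Def_const E Def_infinite big_app dv dlist_comp[OF dv] def_intro)
      show "length x = Suc n" if "x \<in> ?A" for x using that len by blast
      show "Def (\<lambda>v. big n (e - 1) (?sl (t v) (?c (s v))))" if "dfn t" "dlist (Suc n) s" for s t
        unfolding mem_Collect_eq by (rule big_app[OF that(2,1)])
    qed (use 1 in auto)
    then have "infinite {u. big n e {w. E (u # w) (u # w)}}"
    proof (rule infinite_super[rotated], intro subsetI CollectI)
      fix u assume u: "u \<in> {u. infinite (?c ` {x \<in> ?A. big n (e - 1) (?sl u (?c x))})}"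
      have "?c ` {x \<in> ?A. big n (e - 1) (?sl u (?c x))} \<subseteq> ?c ` {x. E x x \<and> big n (e - 1) (?sl u (?c x))}"
        by blast
      then have "infinite (?c ` {x. E x x \<and> big n (e - 1) (?sl u (?c x))})" using u finite_subset by blast
      from slice[OF this] show "big n e {w. E (u # w) (u # w)}" using e by simp
    qed
    then show ?thesis by simp
  next
    case 2
    show ?thesis
    proof (cases "finite {u. \<exists>x. E x x \<and> big n e (?sl u (?c x))}")
      case True
      have "\<exists>u\<in>{u. \<exists>x. E x x \<and> big n e (?sl u (?c x))}. infinite (?c ` {x \<in> ?B. big n e (?sl u (?c x))})"
        by (rule infinite_image_pigeonhole[OF True 2]) blast
      then obtain u where u: "infinite (?c ` {x \<in> ?B. big n e (?sl u (?c x))})" by blast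
      have "?c ` {x \<in> ?B. big n e (?sl u (?c x))} \<subseteq> ?c ` {x. E x x \<and> big n e (?sl u (?c x))}" by blast
      then have "infinite (?c ` {x. E x x \<and> big n e (?sl u (?c x))})" using u finite_subset by blast
      from slice[OF this] show ?thesis by auto
    next
      case False
      have "{u. \<exists>x. E x x \<and> big n e (?sl u (?c x))} \<subseteq> {u. big n e {w. E (u # w) (u # w)}}"
      proof (intro subsetI CollectI, elim CollectE exE conjE)
        fix u x assume "big n e (?sl u (?c x))"
        then show "big n e {w. E (u # w) (u # w)}" by (rule big_mono) (use E_self sym in blast)
      qed
      then have "infinite {u. big n e {w. E (u # w) (u # w)}}" using False finite_subset by blast
      then show ?thesis by simp
    qed
  qed
qed

end

section \<open>Abelian definable groups\<close>

context omin
begin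

lemma dlist_var: "dlist n (\<lambda>v. map v [a..<a + n])"
  by (intro dlist_map dfn_var) simp

lemma dlist_var0: "dlist n (\<lambda>v. map v [0..<n])"
  using dlist_var[of n 0] by simp

end

locale dgroup = omin Def + comm_group H
  for Def :: "((nat \<Rightarrow> 'm::dense_linorder) \<Rightarrow> bool) \<Rightarrow> bool" and H :: "'m list monoid" (structure) +
  fixes n :: nat
  assumes len: "x \<in> carrier H \<Longrightarrow> length x = n"
    and carrier_def: "dset n (carrier H)"
    and mult_def: "dset (3 * n) {x @ y @ (x \<otimes> y) |x y. x \<in> carrier H \<and> y \<in> carrier H}"
begin

text \<open>The multiplication extended to all tuples by a constant value of length
  \<open>n\<close>, so that compositions stay within \<open>dlist\<close> without side
  conditions.\<close>

definition mul :: "'m list \<Rightarrow> 'm list \<Rightarrow> 'm list" where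
  "mul x y = (if x \<in> carrier H \<and> y \<in> carrier H then x \<otimes> y else replicate n undefined)"

lemma mul: "x \<in> carrier H \<Longrightarrow> y \<in> carrier H \<Longrightarrow> mul x y = x \<otimes> y"
  unfolding mul_def by simp

lemma length_mul: "length (mul x y) = n"
  unfolding mul_def by (simp add: len)

lemma dlist_mul: assumes s: "dlist n s" and t: "dlist n t" shows "dlist n (\<lambda>v. mul (s v) (t v))"
proof (rule dlist_graph)
  let ?G = "{x @ y @ (x \<otimes> y) |x y. x \<in> carrier H \<and> y \<in> carrier H}"
  have s': "dlist n (\<lambda>w. s (\<lambda>i. w (i + n)))" and t': "dlist n (\<lambda>w. t (\<lambda>i. w (i + n)))"
    by (intro dlist_comp[OF s] dlist_comp[OF t] dfn_var)+
  have d: "dlist (3 * n) (\<lambda>w. s (\<lambda>i. w (i + n)) @ t (\<lambda>i. w (i + n)) @ map w [0..<n])"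
    by (rule dlist_append[OF s' dlist_append[OF t' dlist_var0 refl]]) simp
  have "Def (\<lambda>w. s (\<lambda>i. w (i + n)) @ t (\<lambda>i. w (i + n)) @ map w [0..<n] \<in> ?G \<or>
      \<not> (s (\<lambda>i. w (i + n)) \<in> carrier H \<and> t (\<lambda>i. w (i + n)) \<in> carrier H) \<and> map w [0..<n] = replicate n undefined)"
    by (intro Def_disj Def_conj Def_neg Def_mem[OF mult_def d] Def_mem[OF carrier_def s']
      Def_mem[OF carrier_def t'] Def_list_eq[OF dlist_var0 dlist_const]) simp
  moreover have "a @ b @ c \<in> ?G \<or> \<not> (a \<in> carrier H \<and> b \<in> carrier H) \<and> c = replicate n undefined \<longleftrightarrow> c = mul a b"
    if "length a = n" "length b = n" for a b c
  proof -
    have "a @ b @ c \<in> ?G \<longleftrightarrow> a \<in> carrier H \<and> b \<in> carrier H \<and> c = a \<otimes> b"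
    proof
      assume "a @ b @ c \<in> ?G"
      then obtain x y where xy: "a @ b @ c = x @ y @ (x \<otimes> y)" "x \<in> carrier H" "y \<in> carrier H" by blast
      then have "a = x" "b @ c = y @ (x \<otimes> y)" using len[OF xy(2)] \<open>length a = n\<close> by auto
      then show "a \<in> carrier H \<and> b \<in> carrier H \<and> c = a \<otimes> b"
        using len[OF xy(3)] \<open>length b = n\<close> xy by auto
    qed blast
    then show ?thesis unfolding mul_def by auto
  qed
  ultimately show "Def (\<lambda>w. map w [0..<n] = mul (s (\<lambda>i. w (i + n))) (t (\<lambda>i. w (i + n))))"
    using dlist_length[OF s] dlist_length[OF t] by (simp only:)
qed (rule length_mul)

definition ivl :: "'m list \<Rightarrow> 'm list" where
  "ivl x = (if x \<in> carrier H then inv x else replicate n undefined)"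

lemma dlist_ivl: assumes s: "dlist n s" shows "dlist n (\<lambda>v. ivl (s v))"
proof (rule dlist_graph)
  show "length (ivl (s v)) = n" for v unfolding ivl_def by (simp add: len)
  have s': "dlist n (\<lambda>w. s (\<lambda>i. w (i + n)))" by (intro dlist_comp[OF s] dfn_var)
  have "Def (\<lambda>w. (s (\<lambda>i. w (i + n)) \<in> carrier H \<and> map w [0..<n] \<in> carrier H \<and>
      mul (s (\<lambda>i. w (i + n))) (map w [0..<n]) = \<one>) \<or>
      \<not> s (\<lambda>i. w (i + n)) \<in> carrier H \<and> map w [0..<n] = replicate n undefined)"
    by (intro Def_disj Def_conj Def_neg Def_mem[OF carrier_def s'] Def_mem[OF carrier_def dlist_var0]
      Def_list_eq[OF dlist_mul[OF s' dlist_var0] dlist_const] Def_list_eq[OF dlist_var0 dlist_const])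
      (simp_all add: len)
  moreover have "(x \<in> carrier H \<and> y \<in> carrier H \<and> mul x y = \<one>) \<or>
      \<not> x \<in> carrier H \<and> y = replicate n undefined \<longleftrightarrow> y = ivl x" for x y
    unfolding ivl_def mul_def using inv_equality[of y x] m_comm[of x y] by auto
  ultimately show "Def (\<lambda>w. map w [0..<n] = ivl (s (\<lambda>i. w (i + n))))" by (simp only:)
qed

primrec pw :: "nat \<Rightarrow> 'm list \<Rightarrow> 'm list" where
  "pw 0 x = \<one>"
| "pw (Suc k) x = mul (pw k x) x"

lemma pw: "x \<in> carrier H \<Longrightarrow> pw k x = x [^] k"
  by (induction k) (simp_all add: mul)

lemma dlist_pw: "dlist n s \<Longrightarrow> dlist n (\<lambda>v. pw k (s v))"
  by (induction k) (simp_all add: dlist_const len dlist_mul)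

text \<open>An element \<open>x\<close> outside \<open>F\<close> enlarges it to the set of products
  of elements of \<open>F\<close> with powers of \<open>x\<close>, which is finite because the
  exponent is bounded.\<close>

lemma finite_subgroups:
  fixes m :: nat
  assumes V: "subgroup V H" "infinite V" and m: "m > 0" and exp: "\<And>x. x \<in> V \<Longrightarrow> x [^] m = \<one>"
  shows "\<exists>F\<subseteq>V. finite F \<and> N \<le> card F \<and> subgroup F H"
proof (induction N)
  case 0
  have "{\<one>} \<subseteq> V" using subgroup.one_closed[OF V(1)] by simp
  then show ?case using triv_subgroup by (intro exI[of _ "{\<one>}"]) auto
next
  case (Suc N)
  then obtain F where F: "F \<subseteq> V" "finite F" "N \<le> card F" "subgroup F H" by blast
  have VC: "V \<subseteq> carrier H" using subgroup.subset[OF V(1)] .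
  obtain x where x: "x \<in> V" "x \<notin> F" using V(2) F(1,2) by (metis finite_subset subsetI)
  have xC: "x \<in> carrier H" and FC: "F \<subseteq> carrier H" using x(1) F(1) VC by auto
  have one: "\<one> \<in> F" using subgroup.one_closed[OF F(4)] .
  let ?F = "(\<lambda>(a, j). a \<otimes> x [^] j) ` (F \<times> {..<m})"
  have F'V: "?F \<subseteq> V"
  proof -
    have "x [^] j \<in> V" for j :: nat
      by (induction j) (simp_all add: subgroup.one_closed[OF V(1)] subgroup.m_closed[OF V(1)] x(1))
    then have "a \<otimes> x [^] (j::nat) \<in> V" if "a \<in> F" for a and j :: nat
      using F(1) subgroup.m_closed[OF V(1)] that by blast
    then show ?thesis by auto
  qed
  have closed: "y \<otimes> z \<in> ?F" if yz: "y \<in> ?F" "z \<in> ?F" for y z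
  proof -
    obtain a i where a: "a \<in> F" "i < m" "y = a \<otimes> x [^] i" using yz(1) by auto
    obtain b j where b: "b \<in> F" "j < m" "z = b \<otimes> x [^] j" using yz(2) by auto
    have C: "a \<in> carrier H" "b \<in> carrier H" using a b FC by auto
    have "x [^] (i + j) = x [^] (m * ((i + j) div m) + (i + j) mod m)" by simp
    also have "\<dots> = x [^] (m * ((i + j) div m)) \<otimes> x [^] ((i + j) mod m)"
      using nat_pow_mult[OF xC] by metis
    also have "x [^] (m * ((i + j) div m)) = \<one>"
      using nat_pow_pow[OF xC, of m "(i + j) div m"] exp[OF x(1)] by simp
    finally have "x [^] i \<otimes> x [^] j = x [^] ((i + j) mod m)"
      using nat_pow_mult[OF xC, of i j] xC by simp
    then have "y \<otimes> z = (a \<otimes> b) \<otimes> x [^] ((i + j) mod m)"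
      unfolding a b using C xC by (metis m_assoc m_lcomm m_closed nat_pow_closed)
    moreover have "a \<otimes> b \<in> F" using subgroup.m_closed[OF F(4)] a b by blast
    ultimately show ?thesis using m by (intro image_eqI[of _ _ "(a \<otimes> b, (i + j) mod m)"]) auto
  qed
  have F_sub: "F \<subseteq> ?F"
  proof
    fix a assume "a \<in> F"
    then show "a \<in> ?F" using m FC by (intro image_eqI[of _ _ "(a, 0)"]) auto
  qed
  have "x \<in> ?F"
  proof -
    have "m \<noteq> 1" using exp[OF x(1)] x(2) one xC by auto
    then show ?thesis using m one xC by (intro image_eqI[of _ _ "(\<one>, 1)"]) auto
  qed
  have "subgroup ?F H"
  proof (rule subgroupI)
    show "?F \<subseteq> carrier H" using F'V VC by blast
    show "?F \<noteq> {}" using F_sub one by blast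
    show "y \<otimes> z \<in> ?F" if "y \<in> ?F" "z \<in> ?F" for y z by (rule closed[OF that])
    fix y assume y: "y \<in> ?F"
    then have yC: "y \<in> carrier H" using F'V VC by blast
    have pow: "y [^] (k::nat) \<in> ?F" for k
    proof (induction k)
      case 0
      then show ?case using F_sub one by auto
    next
      case (Suc k)
      then show ?case using closed[OF Suc y] by simp
    qed
    have "y [^] (m - 1) \<otimes> y = \<one>"
      using exp[of y] y F'V m nat_pow_Suc[of y "m - 1"] by auto
    then have "inv y = y [^] (m - 1)" using yC inv_equality by simp
    then show "inv y \<in> ?F" using pow by simp
  qed
  moreover have "finite ?F" using F(2) by simp
  moreover have "Suc N \<le> card ?F"
  proof -
    have "Suc N \<le> card (insert x F)" using F x by simp
    also have "\<dots> \<le> card ?F" by (rule card_mono[OF \<open>finite ?F\<close>]) (use F_sub \<open>x \<in> ?F\<close> in auto)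
    finally show ?thesis .
  qed
  ultimately show ?case using F'V by blast
qed

section \<open>Finiteness of the torsion subgroups\<close>

definition tors :: "nat \<Rightarrow> 'm list set" where
  "tors m = {x \<in> carrier H. x [^] m = \<one>}"

lemma subgroup_tors: "subgroup (tors m) H"
  by (rule subgroupI) (auto simp: tors_def pow_mult_distrib m_comm nat_pow_inv)

lemma dset_tors: "dset n (tors m)"
proof -
  have "Def (\<lambda>v. map v [0..<n] \<in> carrier H \<and> pw m (map v [0..<n]) = \<one>)"
    by (intro Def_conj carrier_def Def_list_eq[OF dlist_pw[OF dlist_var0] dlist_const]) (simp add: len)
  moreover have "x \<in> tors m \<longleftrightarrow> x \<in> carrier H \<and> pw m x = \<one>" for x unfolding tors_def using pw by auto
  ultimately show ?thesis by (simp only:)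
qed

text \<open>The Euler characteristic of \<open>V \<times> V\<close>, for an infinite torsion group \<open>V\<close> of bounded exponent: it is
  divisible by the order of every finite subgroup, hence zero. The group \<open>V \<times> V\<close> without its neutral
  element admits a free action of a group of order 2 or 3, a contradiction.\<close>

context
  fixes m :: nat
  assumes m: "m > 0" and inf: "infinite (tors m)"
begin

text \<open>The product is realised by concatenation as a set of tuples of length
  \<open>n + n\<close>, where the Euler characteristic is defined.\<close>

definition VV :: "'m list set" where
  "VV = {x @ y |x y. x \<in> tors m \<and> y \<in> tors m}"

lemma tors_len: "x \<in> tors m \<Longrightarrow> length x = n"
  unfolding tors_def by (simp add: len)

lemma tors_carrier: "x \<in> tors m \<Longrightarrow> x \<in> carrier H"
  unfolding tors_def by simp

lemma VV_len: "z \<in> VV \<Longrightarrow> length z = n + n"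
  unfolding VV_def by (auto simp: tors_len)

lemma VV_iff: "length z = n + n \<Longrightarrow> z \<in> VV \<longleftrightarrow> take n z \<in> tors m \<and> drop n z \<in> tors m"
proof
  assume "z \<in> VV"
  then show "take n z \<in> tors m \<and> drop n z \<in> tors m" unfolding VV_def by (auto simp: tors_len)
next
  assume "take n z \<in> tors m \<and> drop n z \<in> tors m"
  then show "z \<in> VV" unfolding VV_def by simp (metis append_take_drop_id)
qed

lemma VV_append: "x \<in> tors m \<Longrightarrow> y \<in> tors m \<Longrightarrow> x @ y \<in> VV"
  unfolding VV_def by blast

lemma VV_E:
  assumes "z \<in> VV" obtains x y where "z = x @ y" "x \<in> tors m" "y \<in> tors m" "take n z = x" "drop n z = y"
  using assms tors_len unfolding VV_def by auto

lemma dset_VV: "dset (n + n) VV"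
proof -
  have "Def (\<lambda>v. take n (map v [0..<n + n]) \<in> tors m \<and> drop n (map v [0..<n + n]) \<in> tors m)"
    by (intro Def_conj Def_mem[OF dset_tors] dlist_take[OF dlist_var0] dlist_drop[OF dlist_var0]) auto
  moreover have "map v [0..<n + n] \<in> VV \<longleftrightarrow>
      take n (map v [0..<n + n]) \<in> tors m \<and> drop n (map v [0..<n + n]) \<in> tors m" for v
    by (rule VV_iff) simp
  ultimately show ?thesis by (simp only:)
qed

lemma tors_mul: "x \<in> tors m \<Longrightarrow> y \<in> tors m \<Longrightarrow> mul x y = x \<otimes> y \<and> x \<otimes> y \<in> tors m"
  using mul[OF tors_carrier tors_carrier] subgroup.m_closed[OF subgroup_tors] by blast

lemma tors_ivl: "x \<in> tors m \<Longrightarrow> ivl x = inv x \<and> inv x \<in> tors m"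
  using subgroup.m_inv_closed[OF subgroup_tors] tors_carrier unfolding ivl_def by auto

lemma echar_VV: "echar (n + n) VV = 0"
proof (rule ccontr)
  assume nz: "echar (n + n) VV \<noteq> 0"
  \<comment> \<open>A finite subgroup larger than the absolute value of the Euler characteristic; it
    acts freely by translation of the first factor.\<close>
  obtain F where F: "F \<subseteq> tors m" "finite F" "Suc (nat \<bar>echar (n + n) VV\<bar>) \<le> card F" "subgroup F H"
    using finite_subgroups[OF subgroup_tors inf m, of "Suc (nat \<bar>echar (n + n) VV\<bar>)"] unfolding tors_def by auto
  let ?f = "\<lambda>a z. mul a (take n z) @ drop n z"
  have f: "?f a (x @ y) = (a \<otimes> x) @ y" if "a \<in> F" "x \<in> tors m" "y \<in> tors m" for a x y
    using that tors_len[of x] tors_mul[of a x] F(1) by auto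
  have one: "\<one> \<in> tors m" using subgroup.one_closed[OF subgroup_tors] .
  have inj: "inj_on ?f F"
  proof (rule inj_onI)
    fix a b assume ab: "a \<in> F" "b \<in> F" "?f a = ?f b"
    then have "?f a (\<one> @ \<one>) = ?f b (\<one> @ \<one>)" by metis
    then have "(a \<otimes> \<one>) @ \<one> = (b \<otimes> \<one>) @ \<one>"
      using f[OF ab(1) one one] f[OF ab(2) one one] by metis
    moreover have "a \<in> carrier H" "b \<in> carrier H" using ab(1,2) F(1) tors_carrier by auto
    ultimately show "a = b" by simp
  qed
  have "int (card (?f ` F)) dvd echar (n + n) VV"
  proof (rule free_action)
    show "finite (?f ` F)" "?f ` F \<noteq> {}" using F subgroup.one_closed[OF F(4)] by auto
    show "dset (n + n) VV" by (rule dset_VV)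
    show "length z = n + n" if "z \<in> VV" for z by (rule VV_len[OF that])
    show "dlist (n + n) (\<lambda>v. \<phi> (t v))" if "\<phi> \<in> ?f ` F" "dlist (n + n) t" for \<phi> t
    proof -
      obtain a where a: "a \<in> F" "\<phi> = ?f a" using \<open>\<phi> \<in> _\<close> by blast
      have "length a = n" using a F(1) tors_len by blast
      then show ?thesis unfolding a(2)
        by (intro dlist_append[OF dlist_mul[OF dlist_const dlist_take[OF that(2)]] dlist_drop[OF that(2)] refl]) auto
    qed
    show "\<phi> z \<in> VV" if pz: "\<phi> \<in> ?f ` F" "z \<in> VV" for \<phi> z
    proof -
      obtain a where a: "a \<in> F" "\<phi> = ?f a" using pz(1) by blast
      obtain x y where "z = x @ y" "x \<in> tors m" "y \<in> tors m" using pz(2) by (rule VV_E)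
      then show ?thesis using a f VV_append tors_mul F(1) by auto
    qed
    show "\<exists>\<chi>\<in>?f ` F. \<forall>z\<in>VV. \<chi> z = \<phi> (\<psi> z)" if pq: "\<phi> \<in> ?f ` F" "\<psi> \<in> ?f ` F" for \<phi> \<psi>
    proof -
      obtain a b where ab: "a \<in> F" "\<phi> = ?f a" "b \<in> F" "\<psi> = ?f b" using pq by blast
      have abF: "a \<otimes> b \<in> F" using subgroup.m_closed[OF F(4)] ab by blast
      show ?thesis
      proof (rule bexI[of _ "?f (a \<otimes> b)"], rule ballI)
        fix z assume "z \<in> VV"
        then obtain x y where z: "z = x @ y" "x \<in> tors m" "y \<in> tors m" by (rule VV_E)
        have "b \<in> tors m" "a \<in> tors m" using ab F(1) by auto
        then have "b \<otimes> x \<in> tors m" "a \<otimes> (b \<otimes> x) = (a \<otimes> b) \<otimes> x"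
          using tors_mul z(2) m_assoc tors_carrier by auto
        then show "?f (a \<otimes> b) z = \<phi> (\<psi> z)"
          unfolding ab z using f[OF abF z(2,3)] f[OF ab(3) z(2,3)] f[OF ab(1) _ z(3), of "b \<otimes> x"] by simp
      qed (use abF in blast)
    qed
    show "\<exists>\<psi>\<in>?f ` F. \<forall>z\<in>VV. \<psi> (\<phi> z) = z" if p: "\<phi> \<in> ?f ` F" for \<phi>
    proof -
      obtain a where a: "a \<in> F" "\<phi> = ?f a" using p by blast
      have aF: "inv a \<in> F" using subgroup.m_inv_closed[OF F(4)] a by blast
      show ?thesis
      proof (rule bexI[of _ "?f (inv a)"], rule ballI)
        fix z assume "z \<in> VV"
        then obtain x y where z: "z = x @ y" "x \<in> tors m" "y \<in> tors m" by (rule VV_E)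
        have "a \<in> tors m" using a F(1) by auto
        then have "a \<otimes> x \<in> tors m" using tors_mul z(2) by blast
        moreover have "inv a \<otimes> (a \<otimes> x) = x"
          using tors_carrier[OF z(2)] tors_carrier[OF \<open>a \<in> tors m\<close>] by (simp add: m_assoc[symmetric])
        ultimately
        show "?f (inv a) (\<phi> z) = z"
          unfolding a z using f[OF a(1) z(2,3)] f[OF aF _ z(3), of "a \<otimes> x"] by simp
      qed (use aF in blast)
    qed
    show "\<phi> = \<psi>" if pq: "\<phi> \<in> ?f ` F" "\<psi> \<in> ?f ` F" "z \<in> VV" "\<phi> z = \<psi> z" for \<phi> \<psi> z
    proof -
      obtain a b where ab: "a \<in> F" "\<phi> = ?f a" "b \<in> F" "\<psi> = ?f b" using pq by blast
      obtain x y where z: "z = x @ y" "x \<in> tors m" "y \<in> tors m" using pq(3) by (rule VV_E)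
      have "(a \<otimes> x) @ y = (b \<otimes> x) @ y"
        using pq(4) f[OF ab(1) z(2,3)] f[OF ab(3) z(2,3)] unfolding ab(2,4) z(1) by metis
      then have "a \<otimes> x = b \<otimes> x" by simp
      moreover have "a \<in> carrier H" "b \<in> carrier H" "x \<in> carrier H" using ab(1,3) F(1) z(2) tors_carrier by auto
      ultimately have "a = b" by simp
      then show ?thesis using ab by simp
    qed
  qed
  then have "int (card F) dvd echar (n + n) VV" using card_image[OF inj] by simp
  from dvd_imp_le_int[OF nz this] show False using F(3) by linarith
qed

lemma echar_VV1: "echar (n + n) (VV - {\<one> @ \<one>}) = -1" and dset_VV1: "dset (n + n) (VV - {\<one> @ \<one>})"
proof -
  have one: "\<one> \<in> tors m" using subgroup.one_closed[OF subgroup_tors] .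
  have l: "length (\<one> @ \<one>) = n + n" using tors_len[OF one] by simp
  have D: "dset (n + n) {\<one> @ \<one>}"
    unfolding singleton_iff by (rule Def_list_eq[OF dlist_var0 dlist_const[OF l]])
  have "Def (\<lambda>v. map v [0..<n + n] \<in> VV \<and> \<not> map v [0..<n + n] \<in> {\<one> @ \<one>})"
    by (intro Def_conj Def_neg D dset_VV)
  then show D': "dset (n + n) (VV - {\<one> @ \<one>})" by (simp only: Diff_iff)
  have "echar (n + n) ((VV - {\<one> @ \<one>}) \<union> {\<one> @ \<one>}) = echar (n + n) (VV - {\<one> @ \<one>}) + echar (n + n) {\<one> @ \<one>}"
    by (rule echar_Un[OF D' D]) blast
  moreover have "(VV - {\<one> @ \<one>}) \<union> {\<one> @ \<one>} = VV" using VV_append[OF one one] by blast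
  moreover have "echar (n + n) {\<one> @ \<one>} = 1" using echar_singleton[of "\<one> @ \<one>"] l by simp
  ultimately show "echar (n + n) (VV - {\<one> @ \<one>}) = -1" using echar_VV by simp
qed

lemma no_free_action:
  assumes fin: "finite \<Phi>" "1 < card \<Phi>"
    and def: "\<And>\<phi> t. \<phi> \<in> \<Phi> \<Longrightarrow> dlist (n + n) t \<Longrightarrow> dlist (n + n) (\<lambda>v. \<phi> (t v))"
    and maps: "\<And>\<phi> z. \<phi> \<in> \<Phi> \<Longrightarrow> z \<in> VV - {\<one> @ \<one>} \<Longrightarrow> \<phi> z \<in> VV - {\<one> @ \<one>}"
    and comp: "\<And>\<phi> \<psi>. \<phi> \<in> \<Phi> \<Longrightarrow> \<psi> \<in> \<Phi> \<Longrightarrow> \<exists>\<chi>\<in>\<Phi>. \<forall>z\<in>VV - {\<one> @ \<one>}. \<chi> z = \<phi> (\<psi> z)"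
    and inv: "\<And>\<phi>. \<phi> \<in> \<Phi> \<Longrightarrow> \<exists>\<psi>\<in>\<Phi>. \<forall>z\<in>VV - {\<one> @ \<one>}. \<psi> (\<phi> z) = z"
    and free: "\<And>\<phi> \<psi> z. \<phi> \<in> \<Phi> \<Longrightarrow> \<psi> \<in> \<Phi> \<Longrightarrow> z \<in> VV - {\<one> @ \<one>} \<Longrightarrow> \<phi> z = \<psi> z \<Longrightarrow> \<phi> = \<psi>"
  shows False
proof -
  have "int (card \<Phi>) dvd echar (n + n) (VV - {\<one> @ \<one>})"
  proof (rule free_action)
    show "\<Phi> \<noteq> {}" using fin(2) by auto
    show "length z = n + n" if "z \<in> VV - {\<one> @ \<one>}" for z using that VV_len by blast
  qed (fact fin(1) dset_VV1 def maps comp inv free)+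
  then have "int (card \<Phi>) dvd 1" unfolding echar_VV1 by simp
  then show False using fin(2) by simp
qed

text \<open>For odd exponent inversion fixes only the neutral element, so together with the identity
  it forms a free action of order 2 on the rest.\<close>

lemma tors_even: "even m"
proof (rule ccontr)
  assume odd: "odd m"
  define f where "f = (\<lambda>z. ivl (take n z) @ ivl (drop n z))"
  have fxy: "f (x @ y) = inv x @ inv y" if "x \<in> tors m" "y \<in> tors m" for x y
    using that tors_len tors_ivl unfolding f_def by simp
  have ff: "f (f z) = z \<and> f z \<in> VV" if z: "z \<in> VV" for z
  proof -
    obtain x y where xy: "z = x @ y" "x \<in> tors m" "y \<in> tors m" using z by (rule VV_E)
    then show ?thesis using fxy tors_ivl tors_carrier VV_append by simp
  qed
  have two: "x = \<one>" if x: "x \<in> tors m" "inv x = x" for x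
  proof -
    have C: "x \<in> carrier H" using tors_carrier x by blast
    then have "x [^] (2::nat) = \<one>" using x(2) r_inv[OF C] by (simp add: numeral_2_eq_2)
    obtain k where "m = 2 * k + 1" using odd by (rule oddE)
    then have "x [^] m = (x [^] (2::nat)) [^] k \<otimes> x" using C by (simp add: nat_pow_pow)
    then have "x [^] m = x" using \<open>x [^] (2::nat) = \<one>\<close> C by simp
    then show ?thesis using x(1) unfolding tors_def by simp
  qed
  have fixpt: "z = \<one> @ \<one>" if z: "z \<in> VV" "f z = z" for z
  proof -
    obtain x y where xy: "z = x @ y" "x \<in> tors m" "y \<in> tors m" using z(1) by (rule VV_E)
    have "inv x @ inv y = x @ y" using z(2) fxy xy by simp
    moreover have "length (inv x) = length x" using tors_ivl tors_len xy by metis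
    ultimately have "inv x = x" "inv y = y" by auto
    then show ?thesis using two xy by metis
  qed
  have f1: "f (\<one> @ \<one>) = \<one> @ \<one>" using fxy[of \<one> \<one>] subgroup.one_closed[OF subgroup_tors] by simp
  have one: "\<one> @ \<one> \<in> VV" using VV_append subgroup.one_closed[OF subgroup_tors] by blast
  have mp: "f z \<in> VV - {\<one> @ \<one>}" if "z \<in> VV - {\<one> @ \<one>}" for z
    using that ff[of z] f1 by (metis Diff_iff singleton_iff)
  have ne: "f \<noteq> (\<lambda>z. z)"
  proof
    assume eq: "f = (\<lambda>z. z)"
    obtain x where x: "x \<in> tors m" "x \<noteq> \<one>" using inf by (metis finite.simps finite_subset insertCI subsetI)
    have "x @ x \<in> VV" using VV_append x by blast
    then have "x @ x = \<one> @ \<one>" using fixpt eq by metis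
    moreover have "length x = length \<one>" using tors_len x subgroup.one_closed[OF subgroup_tors] by metis
    ultimately show False using x(2) by simp
  qed
  show False
  proof (rule no_free_action[of "{\<lambda>z. z, f}"])
    show "finite {\<lambda>z. z, f}" "1 < card {\<lambda>z. z, f}" using ne by auto
    show "dlist (n + n) (\<lambda>v. \<phi> (t v))" if "\<phi> \<in> {\<lambda>z. z, f}" "dlist (n + n) t" for \<phi> t
    proof -
      have "dlist (n + n) (\<lambda>v. f (t v))"
        unfolding f_def by (rule dlist_append[OF dlist_ivl[OF dlist_take[OF that(2)]] dlist_ivl[OF dlist_drop[OF that(2)]] refl]) auto
      then show ?thesis using that by auto
    qed
    show "\<phi> z \<in> VV - {\<one> @ \<one>}" if "\<phi> \<in> {\<lambda>z. z, f}" "z \<in> VV - {\<one> @ \<one>}" for \<phi> z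
      using that mp by blast
    show "\<exists>\<chi>\<in>{\<lambda>z. z, f}. \<forall>z\<in>VV - {\<one> @ \<one>}. \<chi> z = \<phi> (\<psi> z)"
      if pq: "\<phi> \<in> {\<lambda>z. z, f}" "\<psi> \<in> {\<lambda>z. z, f}" for \<phi> \<psi>
    proof -
      have "\<phi> = (\<lambda>z. z) \<or> \<psi> = (\<lambda>z. z) \<or> \<phi> = f \<and> \<psi> = f" using pq by simp metis
      then show ?thesis
      proof (elim disjE conjE)
        show ?thesis if "\<phi> = (\<lambda>z. z)" using that pq(2) by (intro bexI[of _ \<psi>]) auto
        show ?thesis if "\<psi> = (\<lambda>z. z)" using that pq(1) by (intro bexI[of _ \<phi>]) auto
        show ?thesis if "\<phi> = f" "\<psi> = f" using that ff by (intro bexI[of _ "\<lambda>z. z"]) auto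
      qed
    qed
    show "\<exists>\<psi>\<in>{\<lambda>z. z, f}. \<forall>z\<in>VV - {\<one> @ \<one>}. \<psi> (\<phi> z) = z" if "\<phi> \<in> {\<lambda>z. z, f}" for \<phi>
      using that ff by auto
    show "\<phi> = \<psi>" if "\<phi> \<in> {\<lambda>z. z, f}" "\<psi> \<in> {\<lambda>z. z, f}" "z \<in> VV - {\<one> @ \<one>}" "\<phi> z = \<psi> z" for \<phi> \<psi> z
      using that fixpt[of z] by auto
  qed
qed

text \<open>The map \<open>f\<close> sends (x, y) to (y, xy). In exponent 2 its cube is the
  identity, as two further applications give (xy, x) and (x, y). A fixed point has y = x and xy = y,
  hence is neutral, and a fixed point of the square is one of \<open>f\<close>.\<close>

lemma tors_not_two: "m \<noteq> 2"
proof
  assume m2: "m = 2"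
  define f where "f = (\<lambda>z. drop n z @ mul (take n z) (drop n z))"
  have sq: "x \<otimes> x = \<one>" if "x \<in> tors m" for x
    using that unfolding tors_def m2 by (auto simp: numeral_2_eq_2)
  have fxy: "f (x @ y) = y @ (x \<otimes> y)" if "x \<in> tors m" "y \<in> tors m" for x y
    using that tors_len tors_mul unfolding f_def by simp
  have cyc: "f z \<in> VV \<and> f (f (f z)) = z \<and> (f z = z \<longrightarrow> z = \<one> @ \<one>) \<and> (f (f z) = z \<longrightarrow> z = \<one> @ \<one>) \<and>
      (f (f z) = f z \<longrightarrow> z = \<one> @ \<one>)" if z: "z \<in> VV" for z
  proof -
    obtain x y where xy: "z = x @ y" "x \<in> tors m" "y \<in> tors m" using z by (rule VV_E)
    have C: "x \<in> carrier H" "y \<in> carrier H" using xy tors_carrier by auto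
    have xyT: "x \<otimes> y \<in> tors m" using tors_mul xy by blast
    have e1: "y \<otimes> (x \<otimes> y) = x" using sq[OF xy(3)] C by (metis m_comm m_assoc r_one)
    have e2: "(x \<otimes> y) \<otimes> x = y" using sq[OF xy(2)] C by (metis m_comm m_assoc r_one)
    have f1: "f z = y @ (x \<otimes> y)" using fxy xy by simp
    have f2: "f (f z) = (x \<otimes> y) @ x" unfolding f1 fxy[OF xy(3) xyT] e1 ..
    have f3: "f (f (f z)) = x @ y" unfolding f2 fxy[OF xyT xy(2)] e2 ..
    have l: "length x = n" "length y = n" "length (x \<otimes> y) = n" using tors_len xy xyT by auto
    have 1: "z = \<one> @ \<one>" if "f z = z"
    proof -
      have "y @ (x \<otimes> y) = x @ y" using that f1 xy(1) by metis
      then have "y = x" "x \<otimes> y = y" using append_eq_append_conv[of y x "x \<otimes> y" y] l by auto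
      then show ?thesis using sq[OF xy(2)] xy(1) by simp
    qed
    have 2: "z = \<one> @ \<one>" if "f (f z) = z"
    proof -
      have "f (f (f z)) = f z" using that by simp
      then show ?thesis using 1 f3 xy(1) by simp
    qed
    have 3: "z = \<one> @ \<one>" if "f (f z) = f z"
    proof -
      have "f (f (f z)) = f (f z)" using that by simp
      then show ?thesis using 2 f3 xy(1) by simp
    qed
    have "f z \<in> VV" unfolding f1 using VV_append xy(3) xyT by blast
    then show ?thesis using 1 2 3 f3 xy(1) by simp
  qed
  let ?g = "\<lambda>z. f (f z)"
  let ?\<Phi> = "{\<lambda>z. z, f, ?g}"
  obtain x where x: "x \<in> tors m" "x \<noteq> \<one>" using inf by (metis finite.simps finite_subset insertCI subsetI)
  have xx: "x @ x \<in> VV" using VV_append x by blast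
  have "x @ x \<noteq> \<one> @ \<one>"
    using x tors_len[OF x(1)] tors_len[OF subgroup.one_closed[OF subgroup_tors]] by simp
  then have "f (x @ x) \<noteq> x @ x" "?g (x @ x) \<noteq> x @ x" "?g (x @ x) \<noteq> f (x @ x)" using cyc[OF xx] by blast+
  then have ne: "f \<noteq> (\<lambda>z. z)" "?g \<noteq> (\<lambda>z. z)" "?g \<noteq> f" by metis+
  have one: "f (\<one> @ \<one>) = \<one> @ \<one>" using fxy[of \<one> \<one>] subgroup.one_closed[OF subgroup_tors] by simp
  have mp: "f z \<in> VV - {\<one> @ \<one>}" if z: "z \<in> VV - {\<one> @ \<one>}" for z
  proof -
    have "f z \<noteq> \<one> @ \<one>"
    proof
      assume "f z = \<one> @ \<one>"
      then have "f (f z) = f z" using one by simp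
      then show False using cyc z by blast
    qed
    then show ?thesis using cyc z by blast
  qed
  show False
  proof (rule no_free_action[of ?\<Phi>])
    show "finite ?\<Phi>" by simp
    show "1 < card ?\<Phi>" using ne by (simp add: card_insert_if)
    have D: "dlist (n + n) (\<lambda>v. f (t v))" if "dlist (n + n) t" for t
      unfolding f_def by (rule dlist_append[OF dlist_drop[OF that] dlist_mul[OF dlist_take[OF that] dlist_drop[OF that]] refl]) auto
    show "dlist (n + n) (\<lambda>v. \<phi> (t v))" if "\<phi> \<in> ?\<Phi>" "dlist (n + n) t" for \<phi> t
    proof -
      have "\<phi> = (\<lambda>z. z) \<or> \<phi> = f \<or> \<phi> = ?g" using that(1) by blast
      then show ?thesis
        using that(2) D[OF that(2)] D[OF D[OF that(2)]] by (elim disjE) simp_all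
    qed
    show "\<phi> z \<in> VV - {\<one> @ \<one>}" if "\<phi> \<in> ?\<Phi>" "z \<in> VV - {\<one> @ \<one>}" for \<phi> z
    proof -
      have "\<phi> = (\<lambda>z. z) \<or> \<phi> = f \<or> \<phi> = ?g" using that(1) by blast
      then show ?thesis using mp[OF that(2)] mp[OF mp[OF that(2)]] that(2) by (elim disjE) simp_all
    qed
    have f3: "f (?g z) = z" if "z \<in> VV - {\<one> @ \<one>}" for z using cyc that by blast
    show "\<exists>\<chi>\<in>?\<Phi>. \<forall>z\<in>VV - {\<one> @ \<one>}. \<chi> z = \<phi> (\<psi> z)" if pq: "\<phi> \<in> ?\<Phi>" "\<psi> \<in> ?\<Phi>" for \<phi> \<psi>
    proof -
      consider "\<phi> = (\<lambda>z. z)" | "\<psi> = (\<lambda>z. z)" | "\<phi> = f \<and> \<psi> = f" | "\<phi> = f \<and> \<psi> = ?g \<or> \<phi> = ?g \<and> \<psi> = f"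
        | "\<phi> = ?g \<and> \<psi> = ?g" using pq by blast
      then show ?thesis
      proof cases
        case 1
        then show ?thesis using pq by (intro bexI[of _ \<psi>]) auto
      next
        case 2
        then show ?thesis using pq by (intro bexI[of _ \<phi>]) auto
      next
        case 3
        then show ?thesis by (intro bexI[of _ ?g]) auto
      next
        case 4
        have "z = \<phi> (\<psi> z)" if "z \<in> VV - {\<one> @ \<one>}" for z using 4 f3[OF that] by auto
        then show ?thesis by (intro bexI[of _ "\<lambda>z. z"]) auto
      next
        case 5
        have "f z = \<phi> (\<psi> z)" if "z \<in> VV - {\<one> @ \<one>}" for z
          using 5 f3[OF mp[OF that]] f3[OF that] by simp
        then show ?thesis by (intro bexI[of _ f]) auto
      qed
    qed
    show "\<exists>\<psi>\<in>?\<Phi>. \<forall>z\<in>VV - {\<one> @ \<one>}. \<psi> (\<phi> z) = z" if "\<phi> \<in> ?\<Phi>" for \<phi>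
    proof -
      have "\<phi> = (\<lambda>z. z) \<or> \<phi> = f \<or> \<phi> = ?g" using that by simp
      then show ?thesis
      proof (elim disjE)
        show ?thesis if "\<phi> = (\<lambda>z. z)" using that by auto
        show ?thesis if "\<phi> = f" using that f3 by (intro bexI[of _ ?g]) auto
        show ?thesis if "\<phi> = ?g" using that f3 by (intro bexI[of _ f]) auto
      qed
    qed
    show "\<phi> = \<psi>" if pq: "\<phi> \<in> ?\<Phi>" "\<psi> \<in> ?\<Phi>" "z \<in> VV - {\<one> @ \<one>}" "\<phi> z = \<psi> z" for \<phi> \<psi> z
    proof -
      have z: "f z \<noteq> z" "?g z \<noteq> z" "?g z \<noteq> f z" using cyc pq(3) by blast+
      have "\<phi> = (\<lambda>z. z) \<or> \<phi> = f \<or> \<phi> = ?g" "\<psi> = (\<lambda>z. z) \<or> \<psi> = f \<or> \<psi> = ?g" using pq(1,2) by blast+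
      then show ?thesis using z pq(4) by (elim disjE) auto
    qed
  qed
qed

end

text \<open>Infinite torsion would force \<open>m = 2 * k\<close> with \<open>m > 2\<close>.
  Squaring maps it to the \<open>k\<close>-torsion, and each nonempty fibre lies in a coset of the
  2-torsion; both are finite by induction.\<close>

theorem torsion_finite: "m > 0 \<Longrightarrow> finite (tors m)"
proof (induction m rule: less_induct)
  case (less m)
  show ?case
  proof (rule ccontr)
    assume inf: "infinite (tors m)"
    obtain k where k: "m = 2 * k" using tors_even[OF less.prems inf] by (rule evenE)
    have "m \<noteq> 2" by (rule tors_not_two[OF less.prems inf])
    then have "k < m" "0 < k" "2 < m" using k less.prems by auto
    then have fin: "finite (tors k)" "finite (tors 2)" using less.IH by auto
    have "tors m \<subseteq> (\<Union>y\<in>tors k. {x \<in> carrier H. x [^] (2::nat) = y})"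
    proof
      fix x assume "x \<in> tors m"
      then have x: "x \<in> carrier H" "(x [^] (2::nat)) [^] k = \<one>"
        unfolding tors_def k by (auto simp: nat_pow_pow)
      then show "x \<in> (\<Union>y\<in>tors k. {x \<in> carrier H. x [^] (2::nat) = y})" unfolding tors_def by auto
    qed
    moreover have "finite {x \<in> carrier H. x [^] (2::nat) = y}" for y
    proof (cases "{x \<in> carrier H. x [^] (2::nat) = y} = {}")
      case False
      then obtain x0 where x0: "x0 \<in> carrier H" "x0 [^] (2::nat) = y" by blast
      have "{x \<in> carrier H. x [^] (2::nat) = y} \<subseteq> (\<lambda>t. t \<otimes> x0) ` tors 2"
      proof
        fix x assume "x \<in> {x \<in> carrier H. x [^] (2::nat) = y}"
        then have x: "x \<in> carrier H" "x [^] (2::nat) = y" by auto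
        have "(x \<otimes> inv x0) [^] (2::nat) = y \<otimes> inv y"
          using x x0 by (simp add: pow_mult_distrib m_comm nat_pow_inv)
        then have "x \<otimes> inv x0 \<in> tors 2" unfolding tors_def using x x0 by auto
        moreover have "x = (x \<otimes> inv x0) \<otimes> x0" using x x0 by (simp add: m_assoc)
        ultimately show "x \<in> (\<lambda>t. t \<otimes> x0) ` tors 2" by blast
      qed
      then show ?thesis using fin(2) finite_subset by blast
    qed (metis finite.emptyI)
    ultimately show False using inf fin(1) finite_subset by blast
  qed
qed

section \<open>Power subgroups and their index\<close>

definition powers :: "nat \<Rightarrow> 'm list set" where
  "powers k = (\<lambda>x. x [^] k) ` carrier H"

lemma subgroup_powers: "subgroup (powers k) H"
proof (rule subgroupI)
  show "powers k \<subseteq> carrier H" unfolding powers_def by auto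
  show "powers k \<noteq> {}" unfolding powers_def using one_closed by blast
  fix a assume "a \<in> powers k"
  then obtain x where x: "x \<in> carrier H" "a = x [^] k" unfolding powers_def by blast
  then show "inv a \<in> powers k"
    unfolding powers_def by (intro image_eqI[of _ _ "inv x"]) (auto simp: nat_pow_inv)
  fix b assume "b \<in> powers k"
  then obtain y where "y \<in> carrier H" "b = y [^] k" unfolding powers_def by blast
  then show "a \<otimes> b \<in> powers k"
    unfolding powers_def using x by (intro image_eqI[of _ _ "x \<otimes> y"]) (auto simp: pow_mult_distrib m_comm)
qed

lemma Def_powers: assumes "dlist n s" shows "Def (\<lambda>v. s v \<in> powers k)"
proof -
  have "Def (\<lambda>v. \<exists>x. length x = n \<and> (x \<in> carrier H \<and> s v = pw k x))"
    by (rule Def_list_ex)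
      (intro Def_conj carrier_def Def_list_eq[of n] dlist_pw dlist_var0 dlist_comp[OF assms] dfn_var)
  moreover have "y \<in> powers k \<longleftrightarrow> (\<exists>x. length x = n \<and> (x \<in> carrier H \<and> y = pw k x))" for y
    by (simp add: powers_def image_iff) (metis pw len)
  ultimately show ?thesis by (simp only:)
qed

text \<open>If \<open>powers m\<close> had infinite index, then so would \<open>powers (m ^ (i + 1))\<close> in \<open>powers (m ^ i)\<close> for all
  \<open>i\<close>, as the torsion is finite, and the dimension of \<open>H\<close> would be infinite.\<close>

lemma finite_index_powers:
  assumes m: "m > 0" shows "finite (rcosets (powers m))"
proof (rule ccontr)
  assume inf: "infinite (rcosets (powers m))"
  \<comment> \<open>The coset of \<open>a\<close> modulo the powers with exponent
    \<open>m ^ i\<close>. The claim below is that every such coset has dimension at least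
    \<open>j\<close>, for every \<open>j\<close>.\<close>
  define cs where "cs i a = {x \<in> carrier H. x \<otimes> inv a \<in> powers (m ^ i)}" for i a
  have self: "a \<in> cs i a" if "a \<in> carrier H" for i a
    unfolding cs_def using that subgroup.one_closed[OF subgroup_powers] by simp
  have "big n j (cs i a)" if "a \<in> carrier H" for j i a
    using that
  proof (induction j arbitrary: i a)
    case 0
    then show ?case using self by (intro big_zero) (auto simp: cs_def len)
  next
    case (Suc j)
    \<comment> \<open>The coset is partitioned by the next power subgroup, and the parts have
      dimension at least \<open>j\<close> by the induction hypothesis.\<close>
    let ?E = "\<lambda>x y. x \<in> cs i a \<and> y \<in> cs i a \<and> x \<otimes> inv y \<in> powers (m ^ Suc i)"
    let ?e = "\<lambda>x y. mul x (ivl y)"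
    have e: "?e x y = x \<otimes> inv y" if "x \<in> carrier H" "y \<in> carrier H" for x y
      using that unfolding ivl_def by (simp add: mul)
    have csC: "x \<in> carrier H" if "x \<in> cs i a" for x using that unfolding cs_def by simp
    have cs_app: "Def (\<lambda>v. s v \<in> cs i a)" if "dlist n s" for s
    proof -
      have "Def (\<lambda>v. s v \<in> carrier H \<and> ?e (s v) a \<in> powers (m ^ i))"
        using len[OF Suc.prems]
        by (intro Def_conj Def_mem[OF carrier_def that] Def_powers dlist_mul dlist_ivl dlist_const that)
      moreover have "x \<in> cs i a \<longleftrightarrow> x \<in> carrier H \<and> ?e x a \<in> powers (m ^ i)" for x
        unfolding cs_def using e Suc.prems by auto
      ultimately show ?thesis by (simp only:)
    qed
    have "big n (Suc j) {x. ?E x x}"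
    proof (rule big_classes[where E = ?E])
      show "Def (\<lambda>v. ?E (s v) (t v))" if "dlist n s" "dlist n t" for s t
      proof -
        have "Def (\<lambda>v. s v \<in> cs i a \<and> t v \<in> cs i a \<and> ?e (s v) (t v) \<in> powers (m ^ Suc i))"
          by (intro Def_conj cs_app Def_powers dlist_mul dlist_ivl that)
        moreover have "?E x y \<longleftrightarrow> x \<in> cs i a \<and> y \<in> cs i a \<and> ?e x y \<in> powers (m ^ Suc i)" for x y
          using e csC by auto
        ultimately show ?thesis by (simp only:)
      qed
      show "length x = n" if "?E x y" for x y using that csC len by blast
      show "?E y x" if xy: "?E x y" for x y
      proof -
        have "inv (x \<otimes> inv y) \<in> powers (m ^ Suc i)" using subgroup.m_inv_closed[OF subgroup_powers] xy by blast
        moreover have "inv (x \<otimes> inv y) = y \<otimes> inv x" using xy csC by (simp add: inv_mult_group)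
        ultimately show ?thesis using xy by simp
      qed
      show "?E x z" if xyz: "?E x y" "?E y z" for x y z
      proof -
        have "(x \<otimes> inv y) \<otimes> (y \<otimes> inv z) \<in> powers (m ^ Suc i)"
          using subgroup.m_closed[OF subgroup_powers] xyz by blast
        moreover have "(x \<otimes> inv y) \<otimes> (y \<otimes> inv z) = x \<otimes> inv z"
        proof -
          have C: "x \<in> carrier H" "y \<in> carrier H" "z \<in> carrier H" using xyz csC by auto
          then have "(x \<otimes> inv y) \<otimes> (y \<otimes> inv z) = x \<otimes> (inv y \<otimes> (y \<otimes> inv z))" by (simp add: m_assoc)
          also have "inv y \<otimes> (y \<otimes> inv z) = inv z" using C by (simp add: m_assoc[symmetric])
          finally show ?thesis .
        qed
        ultimately show ?thesis using xyz by simp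
      qed
      let ?cl = "\<lambda>z. {y. ?E (a \<otimes> z [^] (m ^ i)) y}"
      let ?D = "{C. \<exists>x. ?E x x \<and> C = {y. ?E x y} \<and> big n j C}"
      have mem: "a \<otimes> z [^] (m ^ i) \<in> cs i a" if "z \<in> carrier H" for z
      proof -
        have "a \<otimes> z [^] (m ^ i) \<otimes> inv a = z [^] (m ^ i)" using that Suc.prems by (simp add: m_comm m_assoc[symmetric] inv_solve_right')
        then show ?thesis unfolding cs_def powers_def using that Suc.prems by auto
      qed
      have refl: "?E x x" if "x \<in> cs i a" for x
        using that csC subgroup.one_closed[OF subgroup_powers] by simp
      have "?cl z \<in> ?D" if z: "z \<in> carrier H" for z
      proof -
        let ?x = "a \<otimes> z [^] (m ^ i)"
        have xC: "?x \<in> carrier H" using z Suc.prems by simp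
        have "big n j (cs (Suc i) ?x)" by (rule Suc.IH[OF xC])
        then have "big n j (?cl z)"
        proof (rule big_mono)
          fix y assume y: "y \<in> cs (Suc i) ?x"
          then have yC: "y \<in> carrier H" and yx: "y \<otimes> inv ?x \<in> powers (m ^ Suc i)" unfolding cs_def by auto
          then obtain w where w: "w \<in> carrier H" "y \<otimes> inv ?x = w [^] (m ^ Suc i)" unfolding powers_def by blast
          have "w [^] (m ^ Suc i) = (w [^] m) [^] (m ^ i)" using w by (simp add: nat_pow_pow)
          then have "y = (w [^] m) [^] (m ^ i) \<otimes> ?x" using w yC xC by (metis inv_solve_right' nat_pow_closed)
          then have "y = ((w [^] m) [^] (m ^ i) \<otimes> z [^] (m ^ i)) \<otimes> a"
            using w(1) z Suc.prems by (simp add: m_ac)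
          then have "y \<otimes> inv a = (w [^] m \<otimes> z) [^] (m ^ i)"
            by (subst inv_solve_right') (use w(1) z Suc.prems yC in \<open>simp_all add: pow_mult_distrib m_comm\<close>)
          then have "y \<in> cs i a" unfolding cs_def powers_def using yC w(1) z by auto
          moreover have "?x \<otimes> inv y \<in> powers (m ^ Suc i)"
          proof -
            have "inv (y \<otimes> inv ?x) \<in> powers (m ^ Suc i)" using subgroup.m_inv_closed[OF subgroup_powers] yx .
            then show ?thesis using yC xC by (simp add: inv_mult_group)
          qed
          ultimately show "y \<in> ?cl z" using mem[OF z] by blast
        qed
        then show ?thesis using refl[OF mem[OF z]] by blast
      qed
      then have sub: "?cl ` carrier H \<subseteq> ?D" by blast
      show "infinite ?D"
      proof
        assume "finite ?D"
        then have fin: "finite (?cl ` carrier H)" using sub finite_subset by blast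
        let ?r = "\<lambda>C. inv_into (carrier H) ?cl C"
        \<comment> \<open>A class determines \<open>z\<close> up to powers with exponent
          \<open>m\<close> and up to torsion of exponent \<open>m ^ i\<close>. As this torsion is
          finite, finitely many classes would leave finitely many cosets of
          \<open>powers m\<close>.\<close>
        have "rcosets (powers m) \<subseteq> (\<lambda>(C, t). powers m #> (?r C \<otimes> t)) ` (?cl ` carrier H \<times> tors (m ^ i))"
        proof
          fix K assume "K \<in> rcosets (powers m)"
          then obtain z where z: "z \<in> carrier H" "K = powers m #> z" unfolding RCOSETS_def by blast
          obtain z0 where z0_eq: "z0 = ?r (?cl z)" by blast
          have z0: "z0 \<in> carrier H" "?cl z0 = ?cl z"
            unfolding z0_eq
            by (fact inv_into_into[OF imageI[where f = ?cl, OF z(1)]])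
              (fact f_inv_into_f[OF imageI[where f = ?cl, OF z(1)]])
          have "a \<otimes> z [^] (m ^ i) \<in> ?cl z" using refl[OF mem[OF z(1)]] by simp
          then have "?E (a \<otimes> z0 [^] (m ^ i)) (a \<otimes> z [^] (m ^ i))" using z0(2) by blast
          then obtain w where w: "w \<in> carrier H"
            "(a \<otimes> z0 [^] (m ^ i)) \<otimes> inv (a \<otimes> z [^] (m ^ i)) = w [^] (m ^ Suc i)"
            unfolding powers_def by blast
          define t where "t = z \<otimes> w [^] m \<otimes> inv z0"
          have tC: "t \<in> carrier H" unfolding t_def using z z0 w by simp
          have "a \<otimes> z0 [^] (m ^ i) = w [^] (m ^ Suc i) \<otimes> (a \<otimes> z [^] (m ^ i))"
            by (rule iffD1[OF inv_solve_right' w(2)]) (use w(1) z(1) z0(1) Suc.prems in simp_all)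
          also have "\<dots> = a \<otimes> (w [^] (m ^ Suc i) \<otimes> z [^] (m ^ i))"
            using w z(1) Suc.prems by (simp add: m_lcomm)
          finally have "z0 [^] (m ^ i) = w [^] (m ^ Suc i) \<otimes> z [^] (m ^ i)"
            using w z(1) z0(1) Suc.prems by simp
          also have "w [^] (m ^ Suc i) = (w [^] m) [^] (m ^ i)" using w by (simp add: nat_pow_pow)
          finally have eq: "z0 [^] (m ^ i) = (w [^] m) [^] (m ^ i) \<otimes> z [^] (m ^ i)" .
          have "t [^] (m ^ i) = (z [^] (m ^ i) \<otimes> (w [^] m) [^] (m ^ i)) \<otimes> inv (z0 [^] (m ^ i))"
            unfolding t_def using z(1) z0(1) w(1) by (simp add: pow_mult_distrib m_comm nat_pow_inv)
          also have "\<dots> = \<one>" unfolding eq using z(1) w(1) by (simp add: m_comm)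
          finally have "t \<in> tors (m ^ i)" unfolding tors_def using tC by simp
          moreover have "t \<otimes> z0 = z \<otimes> w [^] m"
            unfolding t_def using z(1) z0(1) w(1) by (simp add: m_assoc)
          then have "z0 \<otimes> t = w [^] m \<otimes> z" using tC z(1) z0(1) w(1) by (simp add: m_comm)
          then have "z0 \<otimes> t \<in> powers m #> z" unfolding r_coset_def powers_def using w(1) by auto
          then have "K = powers m #> (z0 \<otimes> t)"
            unfolding z(2) by (rule repr_independence[OF _ z(1) subgroup_powers])
          ultimately show "K \<in> (\<lambda>(C, t). powers m #> (?r C \<otimes> t)) ` (?cl ` carrier H \<times> tors (m ^ i))"
            using z(1) unfolding z0_eq by (intro image_eqI[of _ _ "(?cl z, t)"]) auto
        qed
        moreover have "finite (tors (m ^ i))" using m by (intro torsion_finite) simp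
        ultimately show False using inf fin finite_subset by blast
      qed
    qed
    then show ?case by (rule big_mono) simp
  qed
  \<comment> \<open>Dimension \<open>Suc n\<close> is impossible for a set of tuples of length
    \<open>n\<close>.\<close>
  from this[OF one_closed, of "Suc n"] have "Suc n \<le> n" by (rule big_le)
  then show False by simp
qed

end

section \<open>The definable copy of the extension\<close>

locale finite_extension = dgroup Def H n
  for Def :: "((nat \<Rightarrow> 'm::dense_linorder) \<Rightarrow> bool) \<Rightarrow> bool" and H :: "'m list monoid" (structure) and n +
  fixes \<Gamma> :: "'c monoid" and \<iota> :: "'c \<Rightarrow> 'g" and G :: "'g monoid" and \<pi> :: "'g \<Rightarrow> 'm list"
  assumes ext: "finite_central_extension \<Gamma> \<iota> G \<pi> H"
    and divisible: "h \<in> carrier H \<Longrightarrow> \<exists>a\<in>carrier H. h = a [^] order \<Gamma>"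
begin

section \<open>Commutativity of the extension\<close>

lemma incl: "group_hom \<Gamma> G \<iota>" and proj: "group_hom G H \<pi>"
  and inj: "inj_on \<iota> (carrier \<Gamma>)" and exact: "\<iota> ` carrier \<Gamma> = kernel G H \<pi>"
  and onto: "\<pi> ` carrier G = carrier H" and fin: "finite (carrier \<Gamma>)"
  and central: "c \<in> carrier \<Gamma> \<Longrightarrow> g \<in> carrier G \<Longrightarrow> \<iota> c \<otimes>\<^bsub>G\<^esub> g = g \<otimes>\<^bsub>G\<^esub> \<iota> c"
  using ext unfolding finite_central_extension_def by blast+

sublocale incl: group_hom \<Gamma> G \<iota> by (rule incl)
sublocale proj: group_hom G H \<pi> by (rule proj)

lemma proj_incl: "c \<in> carrier \<Gamma> \<Longrightarrow> \<pi> (\<iota> c) = \<one>"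
  using exact unfolding kernel_def by blast

text \<open>\<open>\<Gamma>\<close> embeds into the centre of \<open>G\<close> and is therefore
  abelian; the order of a finite abelian group annihilates each element.\<close>

lemma incl_torsion: "c \<in> carrier \<Gamma> \<Longrightarrow> \<iota> c [^]\<^bsub>G\<^esub> order \<Gamma> = \<one>\<^bsub>G\<^esub>"
proof -
  assume c: "c \<in> carrier \<Gamma>"
  interpret comm_group \<Gamma>
  proof (rule incl.G.group_comm_groupI)
    fix x y assume xy: "x \<in> carrier \<Gamma>" "y \<in> carrier \<Gamma>"
    then have "\<iota> (x \<otimes>\<^bsub>\<Gamma>\<^esub> y) = \<iota> (y \<otimes>\<^bsub>\<Gamma>\<^esub> x)" using central[of x "\<iota> y"] by simp
    then show "x \<otimes>\<^bsub>\<Gamma>\<^esub> y = y \<otimes>\<^bsub>\<Gamma>\<^esub> x" by (rule inj_onD[OF inj]) (use xy in simp_all)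
  qed
  show ?thesis using incl.hom_nat_pow[OF c, of "order \<Gamma>"] power_order_eq_one[OF fin c] by (simp add: order_def)
qed

lemma same_fibre:
  assumes "a \<in> carrier G" "b \<in> carrier G" "\<pi> a = \<pi> b"
  obtains c where "c \<in> carrier \<Gamma>" "a = \<iota> c \<otimes>\<^bsub>G\<^esub> b"
proof -
  have "a \<otimes>\<^bsub>G\<^esub> inv\<^bsub>G\<^esub> b \<in> \<iota> ` carrier \<Gamma>" using assms unfolding exact kernel_def by simp
  then obtain c where c: "c \<in> carrier \<Gamma>" "a \<otimes>\<^bsub>G\<^esub> inv\<^bsub>G\<^esub> b = \<iota> c" by blast
  then have "a = \<iota> c \<otimes>\<^bsub>G\<^esub> b" using assms incl.H.inv_solve_right'[of "\<iota> c" a b] by simp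
  then show thesis using that c(1) by blast
qed

lemma lift: assumes "h \<in> carrier H" obtains a where "a \<in> carrier G" "\<pi> a = h"
  using assms[folded onto] by blast

lemma root:
  assumes "g \<in> carrier G"
  obtains c a where "c \<in> carrier \<Gamma>" "a \<in> carrier G" "g = \<iota> c \<otimes>\<^bsub>G\<^esub> a [^]\<^bsub>G\<^esub> order \<Gamma>"
proof -
  obtain x where x: "x \<in> carrier H" "\<pi> g = x [^] order \<Gamma>" using divisible[of "\<pi> g"] assms by auto
  obtain a where a: "a \<in> carrier G" "\<pi> a = x" using lift[OF x(1)] .
  have "\<pi> g = \<pi> (a [^]\<^bsub>G\<^esub> order \<Gamma>)" using x a proj.hom_nat_pow by simp
  then show thesis using same_fibre[OF assms, of "a [^]\<^bsub>G\<^esub> order \<Gamma>"] a(1) that by blast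
qed

text \<open>As \<open>H\<close> is abelian, \<open>g\<close> commutes with \<open>a\<close> up to an element of \<open>\<Gamma>\<close>, hence exactly with
  \<open>a [^] order \<Gamma>\<close>; up to the centre every element has this form by divisibility of \<open>H\<close>.\<close>

lemma abelian:
  assumes g: "g \<in> carrier G" and h: "h \<in> carrier G" shows "g \<otimes>\<^bsub>G\<^esub> h = h \<otimes>\<^bsub>G\<^esub> g"
proof -
  obtain d a where d: "d \<in> carrier \<Gamma>" "a \<in> carrier G" "h = \<iota> d \<otimes>\<^bsub>G\<^esub> a [^]\<^bsub>G\<^esub> order \<Gamma>" using root[OF h] .
  have "\<pi> (g \<otimes>\<^bsub>G\<^esub> a) = \<pi> (a \<otimes>\<^bsub>G\<^esub> g)" using g d(2) m_comm by simp
  then obtain c where c: "c \<in> carrier \<Gamma>" "g \<otimes>\<^bsub>G\<^esub> a = \<iota> c \<otimes>\<^bsub>G\<^esub> (a \<otimes>\<^bsub>G\<^esub> g)"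
    using same_fibre[of "g \<otimes>\<^bsub>G\<^esub> a" "a \<otimes>\<^bsub>G\<^esub> g"] g d(2) by auto
  have "g \<otimes>\<^bsub>G\<^esub> a [^]\<^bsub>G\<^esub> k = \<iota> c [^]\<^bsub>G\<^esub> k \<otimes>\<^bsub>G\<^esub> (a [^]\<^bsub>G\<^esub> k \<otimes>\<^bsub>G\<^esub> g)" for k :: nat
  proof (induction k)
    case 0
    then show ?case using g by simp
  next
    case (Suc k)
    let ?c = "\<iota> c [^]\<^bsub>G\<^esub> k" and ?a = "a [^]\<^bsub>G\<^esub> k"
    have "g \<otimes>\<^bsub>G\<^esub> a [^]\<^bsub>G\<^esub> Suc k = (g \<otimes>\<^bsub>G\<^esub> ?a) \<otimes>\<^bsub>G\<^esub> a" using g d(2) by (simp add: incl.H.m_assoc)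
    also have "\<dots> = ?c \<otimes>\<^bsub>G\<^esub> (?a \<otimes>\<^bsub>G\<^esub> (g \<otimes>\<^bsub>G\<^esub> a))"
      unfolding Suc using g d(2) c(1) by (simp add: incl.H.m_assoc)
    also have "\<dots> = ?c \<otimes>\<^bsub>G\<^esub> ((?a \<otimes>\<^bsub>G\<^esub> \<iota> c) \<otimes>\<^bsub>G\<^esub> (a \<otimes>\<^bsub>G\<^esub> g))"
      unfolding c(2) using g d(2) c(1) by (simp add: incl.H.m_assoc)
    also have "?a \<otimes>\<^bsub>G\<^esub> \<iota> c = \<iota> c \<otimes>\<^bsub>G\<^esub> ?a" using central[OF c(1), of ?a] d(2) by simp
    finally show ?case using g d(2) c(1) by (simp add: incl.H.m_assoc)
  qed
  from this[of "order \<Gamma>"] have *: "g \<otimes>\<^bsub>G\<^esub> a [^]\<^bsub>G\<^esub> order \<Gamma> = a [^]\<^bsub>G\<^esub> order \<Gamma> \<otimes>\<^bsub>G\<^esub> g"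
    using g d(2) by (simp add: incl_torsion[OF c(1)])
  have "g \<otimes>\<^bsub>G\<^esub> h = (g \<otimes>\<^bsub>G\<^esub> \<iota> d) \<otimes>\<^bsub>G\<^esub> a [^]\<^bsub>G\<^esub> order \<Gamma>"
    unfolding d(3) using g d(1,2) by (simp add: incl.H.m_assoc)
  also have "\<dots> = \<iota> d \<otimes>\<^bsub>G\<^esub> (g \<otimes>\<^bsub>G\<^esub> a [^]\<^bsub>G\<^esub> order \<Gamma>)"
    unfolding central[OF d(1) g, symmetric] using g d(1,2) by (simp add: incl.H.m_assoc)
  also have "\<dots> = h \<otimes>\<^bsub>G\<^esub> g" unfolding * d(3) using g d(1,2) by (simp add: incl.H.m_assoc)
  finally show ?thesis .
qed

sublocale G: comm_group G
  by (rule group.group_comm_groupI[OF incl.H.is_group]) (rule abelian)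

text \<open>The power map of \<open>G\<close>, pushed down to \<open>H\<close>. The choice of the
  lift is immaterial, because two lifts differ by an element that the order of
  \<open>\<Gamma>\<close> annihilates. This is a homomorphism but in general not a section of
  \<open>\<pi>\<close>: followed by \<open>\<pi>\<close> it gives the power map of \<open>H\<close>,
  see \<open>proj_sec\<close>.\<close>

definition sec :: "'m list \<Rightarrow> 'g" where
  "sec h = (SOME a. a \<in> carrier G \<and> \<pi> a = h) [^]\<^bsub>G\<^esub> order \<Gamma>"

lemma sec_proj: assumes g: "g \<in> carrier G" shows "sec (\<pi> g) = g [^]\<^bsub>G\<^esub> order \<Gamma>"
proof -
  let ?a = "SOME a. a \<in> carrier G \<and> \<pi> a = \<pi> g"
  have a: "?a \<in> carrier G \<and> \<pi> ?a = \<pi> g" by (rule someI[of _ g]) (simp add: g)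
  then obtain c where c: "c \<in> carrier \<Gamma>" "?a = \<iota> c \<otimes>\<^bsub>G\<^esub> g" using same_fibre[of ?a g] g by blast
  have "sec (\<pi> g) = (\<iota> c \<otimes>\<^bsub>G\<^esub> g) [^]\<^bsub>G\<^esub> order \<Gamma>" unfolding sec_def c(2) ..
  also have "\<dots> = g [^]\<^bsub>G\<^esub> order \<Gamma>"
    using incl.H.pow_mult_distrib[OF central[OF c(1) g]] c(1) g incl_torsion by simp
  finally show ?thesis .
qed

lemma sec_closed: "h \<in> carrier H \<Longrightarrow> sec h \<in> carrier G"
  by (erule lift) (use sec_proj in auto)

lemma sec_mult: assumes "h \<in> carrier H" "k \<in> carrier H" shows "sec (h \<otimes> k) = sec h \<otimes>\<^bsub>G\<^esub> sec k"
proof -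
  obtain a where a: "a \<in> carrier G" "\<pi> a = h" using lift[OF assms(1)] .
  obtain b where b: "b \<in> carrier G" "\<pi> b = k" using lift[OF assms(2)] .
  have "sec (\<pi> (a \<otimes>\<^bsub>G\<^esub> b)) = a [^]\<^bsub>G\<^esub> order \<Gamma> \<otimes>\<^bsub>G\<^esub> b [^]\<^bsub>G\<^esub> order \<Gamma>"
    using a(1) b(1) sec_proj[of "a \<otimes>\<^bsub>G\<^esub> b"] by (simp add: incl.H.pow_mult_distrib G.m_comm)
  then show ?thesis using a b by (simp add: sec_proj[symmetric])
qed

lemma sec_one: "sec \<one> = \<one>\<^bsub>G\<^esub>"
  using sec_proj[of "\<one>\<^bsub>G\<^esub>"] by simp

lemma proj_sec: "h \<in> carrier H \<Longrightarrow> \<pi> (sec h) = h [^] order \<Gamma>"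
  by (erule lift) (use sec_proj proj.hom_nat_pow in auto)

lemma decompose:
  assumes "g \<in> carrier G" obtains c h where "c \<in> carrier \<Gamma>" "h \<in> carrier H" "g = \<iota> c \<otimes>\<^bsub>G\<^esub> sec h"
proof -
  obtain c a where "c \<in> carrier \<Gamma>" "a \<in> carrier G" "g = \<iota> c \<otimes>\<^bsub>G\<^esub> a [^]\<^bsub>G\<^esub> order \<Gamma>" using root[OF assms] .
  then show thesis using that[of c "\<pi> a"] sec_proj by simp
qed

text \<open>These sets describe the kernel of the surjection from \<open>\<Gamma>\<close> \<times> H
  to G that sends (c, h) to the product of \<open>\<iota> c\<close> and \<open>sec h\<close>: it
  consists of the pairs of the inverse of c and k, with k in \<open>defect c\<close>.\<close>

definition defect :: "'c \<Rightarrow> 'm list set" where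
  "defect c = {k \<in> carrier H. sec k = \<iota> c}"

lemma finite_defect: assumes c: "c \<in> carrier \<Gamma>" shows "finite (defect c)"
proof (rule finite_subset)
  show "defect c \<subseteq> tors (order \<Gamma>)"
  proof
    fix k assume "k \<in> defect c"
    then have k: "k \<in> carrier H" "sec k = \<iota> c" unfolding defect_def by auto
    then have "k [^] order \<Gamma> = \<one>" using proj_sec[OF k(1)] proj_incl[OF c] by simp
    then show "k \<in> tors (order \<Gamma>)" unfolding tors_def using k(1) by simp
  qed
  show "finite (tors (order \<Gamma>))"
    by (rule torsion_finite) (use fin incl.G.one_closed in \<open>auto simp: order_def card_gt_0_iff\<close>)
qed

text \<open>Two pairs represent the same element of \<open>G\<close> exactly when they differ by the
  kernel, so on pairs the group law of \<open>G\<close> becomes a choice between finitely many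
  equations in \<open>H\<close> with parameters \<open>k\<close>.\<close>

lemma sec_eq_iff:
  assumes c: "c1 \<in> carrier \<Gamma>" "c2 \<in> carrier \<Gamma>" "c3 \<in> carrier \<Gamma>"
    and h: "x \<in> carrier H" "y \<in> carrier H" "z \<in> carrier H"
  shows "\<iota> c3 \<otimes>\<^bsub>G\<^esub> sec z = (\<iota> c1 \<otimes>\<^bsub>G\<^esub> sec x) \<otimes>\<^bsub>G\<^esub> (\<iota> c2 \<otimes>\<^bsub>G\<^esub> sec y) \<longleftrightarrow>
    (\<exists>k\<in>defect (c1 \<otimes>\<^bsub>\<Gamma>\<^esub> c2 \<otimes>\<^bsub>\<Gamma>\<^esub> inv\<^bsub>\<Gamma>\<^esub> c3). z = x \<otimes> y \<otimes> k)"
proof -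
  let ?c = "c1 \<otimes>\<^bsub>\<Gamma>\<^esub> c2 \<otimes>\<^bsub>\<Gamma>\<^esub> inv\<^bsub>\<Gamma>\<^esub> c3"
  have C: "?c \<in> carrier \<Gamma>" "\<iota> c1 \<in> carrier G" "\<iota> c2 \<in> carrier G" "\<iota> c3 \<in> carrier G" using c by auto
  have s: "sec x \<in> carrier G" "sec y \<in> carrier G" using h sec_closed by auto
  have eq: "\<iota> c3 \<otimes>\<^bsub>G\<^esub> \<iota> ?c = \<iota> c1 \<otimes>\<^bsub>G\<^esub> \<iota> c2"
  proof -
    have "\<iota> c3 \<otimes>\<^bsub>G\<^esub> \<iota> ?c = (\<iota> c1 \<otimes>\<^bsub>G\<^esub> \<iota> c2) \<otimes>\<^bsub>G\<^esub> (inv\<^bsub>G\<^esub> \<iota> c3 \<otimes>\<^bsub>G\<^esub> \<iota> c3)"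
      using c by (simp add: G.m_ac)
    then show ?thesis using C by simp
  qed
  have key: "\<iota> c3 \<otimes>\<^bsub>G\<^esub> sec (x \<otimes> y \<otimes> k) = (\<iota> c1 \<otimes>\<^bsub>G\<^esub> sec x) \<otimes>\<^bsub>G\<^esub> (\<iota> c2 \<otimes>\<^bsub>G\<^esub> sec y) \<longleftrightarrow> k \<in> defect ?c"
    if k: "k \<in> carrier H" for k
  proof -
    have sk: "sec k \<in> carrier G" using sec_closed k .
    have "\<iota> c3 \<otimes>\<^bsub>G\<^esub> sec (x \<otimes> y \<otimes> k) = (\<iota> c3 \<otimes>\<^bsub>G\<^esub> sec k) \<otimes>\<^bsub>G\<^esub> (sec x \<otimes>\<^bsub>G\<^esub> sec y)"
      using h k s sk C by (simp add: sec_mult G.m_ac)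
    moreover have "(\<iota> c1 \<otimes>\<^bsub>G\<^esub> sec x) \<otimes>\<^bsub>G\<^esub> (\<iota> c2 \<otimes>\<^bsub>G\<^esub> sec y) = (\<iota> c1 \<otimes>\<^bsub>G\<^esub> \<iota> c2) \<otimes>\<^bsub>G\<^esub> (sec x \<otimes>\<^bsub>G\<^esub> sec y)"
      using s C by (simp add: G.m_ac)
    moreover have "(\<iota> c3 \<otimes>\<^bsub>G\<^esub> sec k) \<otimes>\<^bsub>G\<^esub> (sec x \<otimes>\<^bsub>G\<^esub> sec y) = (\<iota> c3 \<otimes>\<^bsub>G\<^esub> u) \<otimes>\<^bsub>G\<^esub> (sec x \<otimes>\<^bsub>G\<^esub> sec y) \<longleftrightarrow>
        sec k = u" if "u \<in> carrier G" for u
      using s sk C that by simp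
    note this[OF incl.hom_closed[OF C(1)]]
    ultimately show ?thesis unfolding eq defect_def using k by auto
  qed
  show ?thesis
  proof
    assume *: "\<iota> c3 \<otimes>\<^bsub>G\<^esub> sec z = (\<iota> c1 \<otimes>\<^bsub>G\<^esub> sec x) \<otimes>\<^bsub>G\<^esub> (\<iota> c2 \<otimes>\<^bsub>G\<^esub> sec y)"
    let ?k = "inv (x \<otimes> y) \<otimes> z"
    have k: "?k \<in> carrier H" using h by simp
    have z: "z = x \<otimes> y \<otimes> ?k" using h by (metis inv_solve_left m_closed inv_closed)
    have "?k \<in> defect ?c" using * key[OF k] z by metis
    then show "\<exists>k\<in>defect ?c. z = x \<otimes> y \<otimes> k" using z by blast
  next
    assume "\<exists>k\<in>defect ?c. z = x \<otimes> y \<otimes> k"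
    then show "\<iota> c3 \<otimes>\<^bsub>G\<^esub> sec z = (\<iota> c1 \<otimes>\<^bsub>G\<^esub> sec x) \<otimes>\<^bsub>G\<^esub> (\<iota> c2 \<otimes>\<^bsub>G\<^esub> sec y)"
      using key unfolding defect_def by blast
  qed
qed

section \<open>Coding the extension by tuples\<close>

definition code :: "'c \<Rightarrow> 'm" where
  "code = (SOME f. inj_on f (carrier \<Gamma>))"

text \<open>An interval of the dense order is infinite and so has enough points to name the finitely
  many elements of \<open>\<Gamma>\<close>.\<close>

lemma inj_code: "inj_on code (carrier \<Gamma>)"
proof -
  obtain a b :: 'm where "a < b" using nontrivial neq_iff by blast
  then have "infinite {a<..<b}" by (rule infinite_Ioo)
  then obtain B where B: "finite B" "card B = card (carrier \<Gamma>)" "B \<subseteq> {a<..<b}"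
    using infinite_arbitrarily_large by metis
  obtain f where "bij_betw f (carrier \<Gamma>) B"
    using finite_same_card_bij[OF fin B(1)] B(2) by auto
  then have "inj_on f (carrier \<Gamma>)" by (rule bij_betw_imp_inj_on)
  then show ?thesis unfolding code_def by (rule someI[of "\<lambda>f. inj_on f (carrier \<Gamma>)" f])
qed

definition codes :: "'m list set" where
  "codes = {code c # h |c h. c \<in> carrier \<Gamma> \<and> h \<in> carrier H}"

definition decode :: "'m list \<Rightarrow> 'g" where
  "decode x = \<iota> (inv_into (carrier \<Gamma>) code (hd x)) \<otimes>\<^bsub>G\<^esub> sec (tl x)"

lemma decode: "c \<in> carrier \<Gamma> \<Longrightarrow> decode (code c # h) = \<iota> c \<otimes>\<^bsub>G\<^esub> sec h"
  unfolding decode_def using inj_code by simp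

lemma codesE: assumes "x \<in> codes" obtains c h where "x = code c # h" "c \<in> carrier \<Gamma>" "h \<in> carrier H"
  using assms unfolding codes_def by blast

lemma codesI: "c \<in> carrier \<Gamma> \<Longrightarrow> h \<in> carrier H \<Longrightarrow> code c # h \<in> codes"
  unfolding codes_def by blast

lemma codes_len: "x \<in> codes \<Longrightarrow> length x = Suc n"
  by (erule codesE) (simp add: len)

lemma decode_closed: "x \<in> codes \<Longrightarrow> decode x \<in> carrier G"
  by (erule codesE) (simp add: decode sec_closed)

lemma decode_onto: assumes "g \<in> carrier G" shows "\<exists>x\<in>codes. decode x = g"
proof -
  obtain c h where "c \<in> carrier \<Gamma>" "h \<in> carrier H" "g = \<iota> c \<otimes>\<^bsub>G\<^esub> sec h" using decompose[OF assms] .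
  then show ?thesis by (intro bexI[of _ "code c # h"]) (simp_all add: decode codesI)
qed

text \<open>On codes the projection is the power map of \<open>H\<close> applied to the last
  \<open>n\<close> coordinates, hence definable.\<close>

lemma proj_decode: "x \<in> codes \<Longrightarrow> pw (order \<Gamma>) (drop 1 x) = \<pi> (decode x)"
  by (erule codesE) (simp add: decode sec_closed proj_sec proj_incl pw)

definition codes_mult :: "'m list \<Rightarrow> 'm list \<Rightarrow> 'm list \<Rightarrow> bool" where
  "codes_mult x y z \<longleftrightarrow> x \<in> codes \<and> y \<in> codes \<and> z \<in> codes \<and> decode z = decode x \<otimes>\<^bsub>G\<^esub> decode y"

text \<open>\<open>decode\<close> takes values in the abstract group \<open>G\<close>, about which
  definability says nothing. On the right all quantifiers range over fixed finite sets, which leaves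
  a finite disjunction of definable conditions.\<close>

lemma codes_mult_iff:
  "codes_mult x y z \<longleftrightarrow> (\<exists>c1\<in>carrier \<Gamma>. \<exists>c2\<in>carrier \<Gamma>. \<exists>c3\<in>carrier \<Gamma>. \<exists>k\<in>defect (c1 \<otimes>\<^bsub>\<Gamma>\<^esub> c2 \<otimes>\<^bsub>\<Gamma>\<^esub> inv\<^bsub>\<Gamma>\<^esub> c3).
    take 1 x = [code c1] \<and> take 1 y = [code c2] \<and> take 1 z = [code c3] \<and>
    drop 1 x \<in> carrier H \<and> drop 1 y \<in> carrier H \<and> drop 1 z \<in> carrier H \<and>
    drop 1 z = mul (mul (drop 1 x) (drop 1 y)) k)" (is "_ \<longleftrightarrow> ?r")
proof
  assume codes_mult: "codes_mult x y z"
  obtain c1 h1 where x: "x = code c1 # h1" "c1 \<in> carrier \<Gamma>" "h1 \<in> carrier H"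
    using codes_mult unfolding codes_mult_def by (auto elim: codesE)
  obtain c2 h2 where y: "y = code c2 # h2" "c2 \<in> carrier \<Gamma>" "h2 \<in> carrier H"
    using codes_mult unfolding codes_mult_def by (auto elim: codesE)
  obtain c3 h3 where z: "z = code c3 # h3" "c3 \<in> carrier \<Gamma>" "h3 \<in> carrier H"
    using codes_mult unfolding codes_mult_def by (auto elim: codesE)
  have "\<iota> c3 \<otimes>\<^bsub>G\<^esub> sec h3 = (\<iota> c1 \<otimes>\<^bsub>G\<^esub> sec h1) \<otimes>\<^bsub>G\<^esub> (\<iota> c2 \<otimes>\<^bsub>G\<^esub> sec h2)"
    using codes_mult x y z decode unfolding codes_mult_def by simp
  then obtain k where k: "k \<in> defect (c1 \<otimes>\<^bsub>\<Gamma>\<^esub> c2 \<otimes>\<^bsub>\<Gamma>\<^esub> inv\<^bsub>\<Gamma>\<^esub> c3)" "h3 = h1 \<otimes> h2 \<otimes> k"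
    using sec_eq_iff[OF x(2) y(2) z(2) x(3) y(3) z(3)] by blast
  then have "h3 = mul (mul h1 h2) k" using x(3) y(3) unfolding defect_def by (simp add: mul)
  then have "take 1 x = [code c1] \<and> take 1 y = [code c2] \<and> take 1 z = [code c3] \<and>
      drop 1 x \<in> carrier H \<and> drop 1 y \<in> carrier H \<and> drop 1 z \<in> carrier H \<and>
      drop 1 z = mul (mul (drop 1 x) (drop 1 y)) k"
    using x y z by simp
  then show ?r using x(2) y(2) z(2) k(1) by blast
next
  assume ?r
  then obtain c1 c2 c3 k where c: "c1 \<in> carrier \<Gamma>" "c2 \<in> carrier \<Gamma>" "c3 \<in> carrier \<Gamma>"
    and k: "k \<in> defect (c1 \<otimes>\<^bsub>\<Gamma>\<^esub> c2 \<otimes>\<^bsub>\<Gamma>\<^esub> inv\<^bsub>\<Gamma>\<^esub> c3)"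
    and t: "take 1 x = [code c1]" "take 1 y = [code c2]" "take 1 z = [code c3]"
    and h: "drop 1 x \<in> carrier H" "drop 1 y \<in> carrier H" "drop 1 z \<in> carrier H"
    and eq: "drop 1 z = mul (mul (drop 1 x) (drop 1 y)) k" by blast
  have split: "x = code c1 # drop 1 x" "y = code c2 # drop 1 y" "z = code c3 # drop 1 z"
    using t append_take_drop_id[of 1 x] append_take_drop_id[of 1 y] append_take_drop_id[of 1 z] by simp_all
  have "drop 1 z = drop 1 x \<otimes> drop 1 y \<otimes> k" using eq h k unfolding defect_def by (simp add: mul)
  then have "\<iota> c3 \<otimes>\<^bsub>G\<^esub> sec (drop 1 z) = (\<iota> c1 \<otimes>\<^bsub>G\<^esub> sec (drop 1 x)) \<otimes>\<^bsub>G\<^esub> (\<iota> c2 \<otimes>\<^bsub>G\<^esub> sec (drop 1 y))"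
    using sec_eq_iff[OF c h] k by blast
  then have "decode z = decode x \<otimes>\<^bsub>G\<^esub> decode y" using decode[OF c(1)] decode[OF c(2)] decode[OF c(3)] split by metis
  moreover have "x \<in> codes" "y \<in> codes" "z \<in> codes" using codesI[OF c(1) h(1)] codesI[OF c(2) h(2)] codesI[OF c(3) h(3)] split by metis+
  ultimately show "codes_mult x y z" unfolding codes_mult_def by blast
qed

lemma Def_codes_mult:
  assumes "dlist (Suc n) r" "dlist (Suc n) s" "dlist (Suc n) t" shows "Def (\<lambda>v. codes_mult (r v) (s v) (t v))"
  unfolding codes_mult_iff
proof (intro Def_fbex fin finite_defect Def_conj)
  have d: "dlist 1 (\<lambda>v. take 1 (u v))" "dlist n (\<lambda>v. drop 1 (u v))" if "dlist (Suc n) u" for u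
    by (rule dlist_take[OF that], simp) (rule dlist_drop[OF that], simp)
  have *: "Def (\<lambda>v. take 1 (u v) = [c])" if "dlist (Suc n) u" for u c
    by (rule Def_list_eq[OF d(1)[OF that] dlist_const]) simp
  show "Def (\<lambda>v. take 1 (r v) = [code c])" for c by (rule *[OF assms(1)])
  show "Def (\<lambda>v. take 1 (s v) = [code c])" for c by (rule *[OF assms(2)])
  show "Def (\<lambda>v. take 1 (t v) = [code c])" for c by (rule *[OF assms(3)])
  show "Def (\<lambda>v. drop 1 (r v) \<in> carrier H)" by (rule Def_mem[OF carrier_def d(2)[OF assms(1)]])
  show "Def (\<lambda>v. drop 1 (s v) \<in> carrier H)" by (rule Def_mem[OF carrier_def d(2)[OF assms(2)]])
  show "Def (\<lambda>v. drop 1 (t v) \<in> carrier H)" by (rule Def_mem[OF carrier_def d(2)[OF assms(3)]])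
  fix c1 c2 c3 k assume "k \<in> defect (c1 \<otimes>\<^bsub>\<Gamma>\<^esub> c2 \<otimes>\<^bsub>\<Gamma>\<^esub> inv\<^bsub>\<Gamma>\<^esub> c3)"
  then have "length k = n" unfolding defect_def using len by blast
  then show "Def (\<lambda>v. drop 1 (t v) = mul (mul (drop 1 (r v)) (drop 1 (s v))) k)"
    by (intro Def_list_eq[OF d(2)[OF assms(3)]] dlist_mul d(2)[OF assms(1)] d(2)[OF assms(2)] dlist_const)
qed auto

definition code_one :: "'m list" where
  "code_one = code \<one>\<^bsub>\<Gamma>\<^esub> # \<one>"

lemma code_one: "code_one \<in> codes" "decode code_one = \<one>\<^bsub>G\<^esub>"
  unfolding code_one_def by (simp_all add: codesI decode sec_one)

text \<open>Multiplication by the code of the neutral element expresses that two codes name the same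
  element, so this relation is definable along with the group law.\<close>

lemma codes_mult_one: "codes_mult x code_one y \<longleftrightarrow> x \<in> codes \<and> y \<in> codes \<and> decode y = decode x"
  unfolding codes_mult_def using code_one decode_closed by auto

definition reps :: "'m list set" where
  "reps = {x \<in> codes. \<forall>y. length y = Suc n \<longrightarrow> codes_mult x code_one y \<longrightarrow> \<not> lless (Suc n) y x}"

lemma reps_codes: "x \<in> reps \<Longrightarrow> x \<in> codes"
  unfolding reps_def by blast

lemma Def_codes: assumes "dlist (Suc n) t" shows "Def (\<lambda>v. t v \<in> codes)"
proof -
  have "Def (\<lambda>v. codes_mult (t v) code_one (t v))" by (rule Def_codes_mult[OF assms dlist_const assms]) (use code_one codes_len in blast)
  then show ?thesis by (simp only: codes_mult_one simp_thms)
qed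

lemma Def_reps: assumes t: "dlist (Suc n) t" shows "Def (\<lambda>v. t v \<in> reps)"
proof -
  have t': "dlist (Suc n) (\<lambda>w. t (\<lambda>i. w (i + Suc n)))" by (intro dlist_comp[OF t] dfn_var)
  have e': "dlist (Suc n) (\<lambda>w. code_one)" by (rule dlist_const) (use code_one codes_len in blast)
  have "Def (\<lambda>v. t v \<in> codes \<and> (\<forall>y. length y = Suc n \<longrightarrow> codes_mult (t v) code_one y \<longrightarrow> \<not> lless (Suc n) y (t v)))"
    by (intro Def_conj Def_codes[OF t] Def_list_all Def_imp Def_neg Def_codes_mult[OF t' e' dlist_var0]
      Def_lless[OF dlist_var0 t'])
  then show ?thesis unfolding reps_def by (simp only: mem_Collect_eq)
qed

text \<open>Two codes of one element differ by the name of an element of \<open>\<Gamma>\<close> and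
  by a defect, and there are finitely many of both.\<close>

lemma finite_fibre: "finite {x \<in> codes. decode x = g}"
proof (cases "{x \<in> codes. decode x = g} = {}")
  case False
  then obtain x0 where x0: "x0 \<in> codes" "decode x0 = g" by blast
  have "{x \<in> codes. decode x = g} \<subseteq>
    (\<Union>c1\<in>carrier \<Gamma>. \<Union>c2\<in>carrier \<Gamma>. \<Union>c3\<in>carrier \<Gamma>. \<Union>k\<in>defect (c1 \<otimes>\<^bsub>\<Gamma>\<^esub> c2 \<otimes>\<^bsub>\<Gamma>\<^esub> inv\<^bsub>\<Gamma>\<^esub> c3).
      {[code c3] @ mul (mul (drop 1 x0) (drop 1 code_one)) k})"
  proof
    fix x assume "x \<in> {x \<in> codes. decode x = g}"
    then have "codes_mult x0 code_one x" using x0 codes_mult_one by simp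
    then obtain c1 c2 c3 k where "c1 \<in> carrier \<Gamma>" "c2 \<in> carrier \<Gamma>" "c3 \<in> carrier \<Gamma>"
      "k \<in> defect (c1 \<otimes>\<^bsub>\<Gamma>\<^esub> c2 \<otimes>\<^bsub>\<Gamma>\<^esub> inv\<^bsub>\<Gamma>\<^esub> c3)"
      "take 1 x = [code c3]" "drop 1 x = mul (mul (drop 1 x0) (drop 1 code_one)) k"
      unfolding codes_mult_iff by blast
    moreover from this(5,6) have "x = [code c3] @ mul (mul (drop 1 x0) (drop 1 code_one)) k"
      using append_take_drop_id[of 1 x] by metis
    ultimately show "x \<in> (\<Union>c1\<in>carrier \<Gamma>. \<Union>c2\<in>carrier \<Gamma>. \<Union>c3\<in>carrier \<Gamma>. \<Union>k\<in>defect (c1 \<otimes>\<^bsub>\<Gamma>\<^esub> c2 \<otimes>\<^bsub>\<Gamma>\<^esub> inv\<^bsub>\<Gamma>\<^esub> c3).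
      {[code c3] @ mul (mul (drop 1 x0) (drop 1 code_one)) k})" by blast
  qed
  moreover have "finite (\<Union>c1\<in>carrier \<Gamma>. \<Union>c2\<in>carrier \<Gamma>. \<Union>c3\<in>carrier \<Gamma>. \<Union>k\<in>defect (c1 \<otimes>\<^bsub>\<Gamma>\<^esub> c2 \<otimes>\<^bsub>\<Gamma>\<^esub> inv\<^bsub>\<Gamma>\<^esub> c3).
      {[code c3] @ mul (mul (drop 1 x0) (drop 1 code_one)) k})"
    by (intro finite_UN_I fin finite_defect) auto
  ultimately show ?thesis by (rule finite_subset)
qed (metis finite.emptyI)

lemma bij_decode: "bij_betw decode reps (carrier G)"
proof (rule bij_betw_imageI)
  show "inj_on decode reps"
  proof (rule inj_onI, rule ccontr)
    fix x y assume xy: "x \<in> reps" "y \<in> reps" "decode x = decode y" "x \<noteq> y"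
    then have "length x = Suc n" "length y = Suc n" using reps_codes codes_len by auto
    then have "lless (Suc n) x y \<or> lless (Suc n) y x" using lless_total xy(4) by blast
    moreover have "codes_mult x code_one y" "codes_mult y code_one x" using xy reps_codes codes_mult_one by auto
    ultimately show False using xy(1,2) \<open>length x = Suc n\<close> \<open>length y = Suc n\<close> unfolding reps_def by blast
  qed
  show "decode ` reps = carrier G"
  proof
    show "decode ` reps \<subseteq> carrier G" using reps_codes decode_closed by blast
    show "carrier G \<subseteq> decode ` reps"
    proof
      fix g assume g: "g \<in> carrier G"
      have "\<exists>x\<in>{x \<in> codes. decode x = g}. \<forall>y\<in>{x \<in> codes. decode x = g}. \<not> lless (Suc n) y x"
        by (rule lless_min[OF finite_fibre]) (use decode_onto[OF g] codes_len in auto)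
      then obtain x where x: "x \<in> codes" "decode x = g" "\<And>y. y \<in> codes \<Longrightarrow> decode y = g \<Longrightarrow> \<not> lless (Suc n) y x" by blast
      then have "x \<in> reps" unfolding reps_def codes_mult_one by auto
      then show "g \<in> decode ` reps" using x(2) by blast
    qed
  qed
qed

section \<open>Transport of the group law to representatives\<close>

definition rep :: "'g \<Rightarrow> 'm list" where
  "rep = inv_into reps decode"

lemma bij_rep: "bij_betw rep (carrier G) reps"
  unfolding rep_def using bij_decode by (rule bij_betw_inv_into)

lemma rep_in: "g \<in> carrier G \<Longrightarrow> rep g \<in> reps"
  using bij_rep bij_betwE by blast

lemma decode_rep: "g \<in> carrier G \<Longrightarrow> decode (rep g) = g"
  unfolding rep_def using bij_decode by (simp add: bij_betw_inv_into_right)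

lemma rep_decode: "x \<in> reps \<Longrightarrow> rep (decode x) = x"
  unfolding rep_def using bij_decode by (simp add: bij_betw_inv_into_left)

definition G\<^sub>0 :: "'m list monoid" where
  "G\<^sub>0 = \<lparr>carrier = reps, mult = (\<lambda>x y. rep (decode x \<otimes>\<^bsub>G\<^esub> decode y)), one = rep \<one>\<^bsub>G\<^esub>\<rparr>"

definition \<pi>\<^sub>0 :: "'m list \<Rightarrow> 'm list" where
  "\<pi>\<^sub>0 x = pw (order \<Gamma>) (drop 1 x)"

lemma iso_rep: "rep \<in> iso G G\<^sub>0"
  unfolding iso_def hom_def using bij_rep rep_in decode_rep unfolding G\<^sub>0_def by auto

lemma group_G\<^sub>0: "group G\<^sub>0"
  using group.iso_imp_img_group[OF incl.H.is_group iso_rep] by (simp add: G\<^sub>0_def)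

lemma carrier_G\<^sub>0: "carrier G\<^sub>0 = reps"
  by (simp add: G\<^sub>0_def)

lemma \<pi>\<^sub>0: "x \<in> reps \<Longrightarrow> \<pi>\<^sub>0 x = \<pi> (decode x)"
  unfolding \<pi>\<^sub>0_def by (rule proj_decode[OF reps_codes])

lemma \<pi>\<^sub>0_hom: "\<pi>\<^sub>0 \<in> hom G\<^sub>0 H"
proof (rule homI)
  fix x y assume "x \<in> carrier G\<^sub>0" "y \<in> carrier G\<^sub>0"
  then have xy: "x \<in> reps" "y \<in> reps" "decode x \<in> carrier G" "decode y \<in> carrier G"
    using carrier_G\<^sub>0 reps_codes decode_closed by auto
  then show "\<pi>\<^sub>0 x \<in> carrier H" by (simp add: \<pi>\<^sub>0)
  have "\<pi>\<^sub>0 (rep (decode x \<otimes>\<^bsub>G\<^esub> decode y)) = \<pi> (decode x \<otimes>\<^bsub>G\<^esub> decode y)" using xy(3,4) by (simp add: \<pi>\<^sub>0 rep_in decode_rep)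
  then show "\<pi>\<^sub>0 (x \<otimes>\<^bsub>G\<^sub>0\<^esub> y) = \<pi>\<^sub>0 x \<otimes> \<pi>\<^sub>0 y" using xy by (simp add: G\<^sub>0_def \<pi>\<^sub>0)
qed

lemma dset_reps: "dset (Suc n) reps"
  by (rule Def_reps[OF dlist_var0])

lemma reps_len: "x \<in> reps \<Longrightarrow> length x = Suc n"
  using reps_codes codes_len by blast

lemma dset_mult: "dset (3 * Suc n) {x @ y @ (x \<otimes>\<^bsub>G\<^sub>0\<^esub> y) |x y. x \<in> carrier G\<^sub>0 \<and> y \<in> carrier G\<^sub>0}"
proof -
  let ?w = "\<lambda>v. map v [0..<3 * Suc n]"
  let ?x = "\<lambda>w. take (Suc n) w" and ?y = "\<lambda>w. take (Suc n) (drop (Suc n) w)"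
    and ?z = "\<lambda>w. drop (Suc n) (drop (Suc n) w)"
  have d: "dlist (2 * Suc n) (\<lambda>v. drop (Suc n) (?w v))" by (rule dlist_drop[OF dlist_var0]) simp
  have D: "dlist (Suc n) (\<lambda>v. ?x (?w v))" "dlist (Suc n) (\<lambda>v. ?y (?w v))" "dlist (Suc n) (\<lambda>v. ?z (?w v))"
    by (rule dlist_take[OF dlist_var0] dlist_take[OF d] dlist_drop[OF d], simp)+
  \<comment> \<open>The product is the unique representative that codes it, so the graph of the
    multiplication is \<open>codes_mult\<close> restricted to \<open>reps\<close>.\<close>
  have "Def (\<lambda>v. ?x (?w v) \<in> reps \<and> ?y (?w v) \<in> reps \<and> ?z (?w v) \<in> reps \<and> codes_mult (?x (?w v)) (?y (?w v)) (?z (?w v)))"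
    by (intro Def_conj Def_reps Def_codes_mult D)
  moreover have "w \<in> {x @ y @ (x \<otimes>\<^bsub>G\<^sub>0\<^esub> y) |x y. x \<in> carrier G\<^sub>0 \<and> y \<in> carrier G\<^sub>0} \<longleftrightarrow>
      ?x w \<in> reps \<and> ?y w \<in> reps \<and> ?z w \<in> reps \<and> codes_mult (?x w) (?y w) (?z w)" for w
  proof
    assume "w \<in> {x @ y @ (x \<otimes>\<^bsub>G\<^sub>0\<^esub> y) |x y. x \<in> carrier G\<^sub>0 \<and> y \<in> carrier G\<^sub>0}"
    then obtain x y where w: "w = x @ y @ rep (decode x \<otimes>\<^bsub>G\<^esub> decode y)" "x \<in> reps" "y \<in> reps" unfolding G\<^sub>0_def by auto
    then have "decode x \<in> carrier G" "decode y \<in> carrier G" "x \<in> codes" "y \<in> codes" using reps_codes decode_closed by auto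
    moreover have "?x w = x" "?y w = y" "?z w = rep (decode x \<otimes>\<^bsub>G\<^esub> decode y)" using w reps_len by auto
    ultimately show "?x w \<in> reps \<and> ?y w \<in> reps \<and> ?z w \<in> reps \<and> codes_mult (?x w) (?y w) (?z w)"
      using w(2,3) unfolding codes_mult_def by (simp add: rep_in decode_rep reps_codes)
  next
    assume *: "?x w \<in> reps \<and> ?y w \<in> reps \<and> ?z w \<in> reps \<and> codes_mult (?x w) (?y w) (?z w)"
    then have "?z w = rep (decode (?x w) \<otimes>\<^bsub>G\<^esub> decode (?y w))" using rep_decode[of "?z w"] unfolding codes_mult_def by metis
    moreover have "w = ?x w @ ?y w @ ?z w" by (metis append_take_drop_id)
    ultimately have "w = ?x w @ ?y w @ (?x w \<otimes>\<^bsub>G\<^sub>0\<^esub> ?y w)" unfolding G\<^sub>0_def by simp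
    then show "w \<in> {x @ y @ (x \<otimes>\<^bsub>G\<^sub>0\<^esub> y) |x y. x \<in> carrier G\<^sub>0 \<and> y \<in> carrier G\<^sub>0}"
      using * carrier_G\<^sub>0 by blast
  qed
  ultimately show ?thesis by (simp only:)
qed

lemma \<pi>\<^sub>0_len: "length (\<pi>\<^sub>0 x) = n"
proof -
  have "length (pw k y) = n" for k y by (cases k) (simp_all add: len length_mul)
  then show ?thesis unfolding \<pi>\<^sub>0_def .
qed

lemma dset_\<pi>\<^sub>0: "dset (Suc n + n) {x @ \<pi>\<^sub>0 x |x. x \<in> carrier G\<^sub>0}"
proof -
  let ?w = "\<lambda>v. map v [0..<Suc n + n]"
  have D: "dlist (Suc n) (\<lambda>v. take (Suc n) (?w v))" "dlist n (\<lambda>v. drop (Suc n) (?w v))"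
    by (rule dlist_take[OF dlist_var0] dlist_drop[OF dlist_var0], simp)+
  have "dlist n (\<lambda>v. drop 1 (take (Suc n) (?w v)))" by (rule dlist_drop[OF D(1)]) simp
  then have "Def (\<lambda>v. take (Suc n) (?w v) \<in> reps \<and> drop (Suc n) (?w v) = \<pi>\<^sub>0 (take (Suc n) (?w v)))"
    unfolding \<pi>\<^sub>0_def by (intro Def_conj Def_reps Def_list_eq[of n] D dlist_pw)
  moreover have "w \<in> {x @ \<pi>\<^sub>0 x |x. x \<in> carrier G\<^sub>0} \<longleftrightarrow> take (Suc n) w \<in> reps \<and> drop (Suc n) w = \<pi>\<^sub>0 (take (Suc n) w)" for w
  proof
    assume "w \<in> {x @ \<pi>\<^sub>0 x |x. x \<in> carrier G\<^sub>0}"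
    then show "take (Suc n) w \<in> reps \<and> drop (Suc n) w = \<pi>\<^sub>0 (take (Suc n) w)"
      using reps_len carrier_G\<^sub>0 by auto
  next
    assume *: "take (Suc n) w \<in> reps \<and> drop (Suc n) w = \<pi>\<^sub>0 (take (Suc n) w)"
    then have "w = take (Suc n) w @ \<pi>\<^sub>0 (take (Suc n) w)" by (metis append_take_drop_id)
    then show "w \<in> {x @ \<pi>\<^sub>0 x |x. x \<in> carrier G\<^sub>0}" using * carrier_G\<^sub>0 by blast
  qed
  ultimately show ?thesis by (simp only:)
qed

lemma extension_iso: "extension_iso_over \<Gamma> \<iota> G \<pi> G\<^sub>0 \<pi>\<^sub>0 H (rep \<circ> \<iota>) rep"
proof -
  have rep: "\<pi>\<^sub>0 (rep g) = \<pi> g" if "g \<in> carrier G" for g using that by (simp add: \<pi>\<^sub>0 rep_in decode_rep)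
  have img: "rep ` kernel G H \<pi> = kernel G\<^sub>0 H \<pi>\<^sub>0"
  proof
    show "rep ` kernel G H \<pi> \<subseteq> kernel G\<^sub>0 H \<pi>\<^sub>0" unfolding kernel_def carrier_G\<^sub>0 using rep rep_in by auto
    show "kernel G\<^sub>0 H \<pi>\<^sub>0 \<subseteq> rep ` kernel G H \<pi>"
    proof
      fix x assume "x \<in> kernel G\<^sub>0 H \<pi>\<^sub>0"
      then have x: "x \<in> reps" "\<pi>\<^sub>0 x = \<one>" unfolding kernel_def carrier_G\<^sub>0 by auto
      then have "decode x \<in> kernel G H \<pi>" unfolding kernel_def using reps_codes decode_closed \<pi>\<^sub>0 by auto
      then show "x \<in> rep ` kernel G H \<pi>" using rep_decode[OF x(1)] by (metis imageI)
    qed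
  qed
  have "inj_on rep (kernel G H \<pi>)"
    using bij_rep unfolding kernel_def bij_betw_def by (auto intro: inj_on_subset)
  then have "bij_betw (rep \<circ> \<iota>) (carrier \<Gamma>) (kernel G\<^sub>0 H \<pi>\<^sub>0)"
    using inj exact img by (intro bij_betw_trans[of \<iota> _ "kernel G H \<pi>"]) (simp_all add: bij_betw_def)
  moreover have "rep (\<iota> (a \<otimes>\<^bsub>\<Gamma>\<^esub> b)) = rep (\<iota> a) \<otimes>\<^bsub>G\<^sub>0\<^esub> rep (\<iota> b)" if "a \<in> carrier \<Gamma>" "b \<in> carrier \<Gamma>" for a b
    using that by (simp add: G\<^sub>0_def decode_rep)
  ultimately have "rep \<circ> \<iota> \<in> iso \<Gamma> (G\<^sub>0\<lparr>carrier := kernel G\<^sub>0 H \<pi>\<^sub>0\<rparr>)"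
    unfolding iso_def hom_def by (auto dest: bij_betwE)
  then show ?thesis unfolding extension_iso_over_def using iso_rep rep by simp
qed

end

section \<open>Instantiating the abstract setting with definability in \<open>M\<close>\<close>

theorem theorem2p9:
  fixes M :: "('f, 'r, 'm::dense_linorder) fo_structure"
    and n :: nat
    and H :: "'m list monoid"
    and \<Gamma> :: "'c monoid"
    and G :: "'g monoid"
    and \<iota> :: "'c \<Rightarrow> 'g"
    and \<pi> :: "'g \<Rightarrow> 'm list"
  assumes "o_minimal M"
    and "definable_group M n H"
    and "comm_group H"
    and "definably_connected M n H"
    and "finite_central_extension \<Gamma> \<iota> G \<pi> H"
  shows "naturally_interpretable M n \<Gamma> \<iota> G \<pi> H"
proof -
  interpret comm_group H by (rule assms(3))
  have len: "length x = n" if "x \<in> carrier H" for x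
    using assms(2) that unfolding definable_group_def definable_def by blast
  have def: "definable M n (carrier H)"
    "definable M (3 * n) {x @ y @ (x \<otimes>\<^bsub>H\<^esub> y) |x y. x \<in> carrier H \<and> y \<in> carrier H}"
    using assms(2) unfolding definable_group_def by blast+
  interpret dgroup "dpred M" H n
  proof
    show "\<exists>a b :: 'm. a \<noteq> b" using assms(1) unfolding o_minimal_def by blast
    show "dpred M (\<lambda>v. \<not> Q v)" if "dpred M Q" for Q by (rule dpred_neg[OF that])
    show "dpred M (\<lambda>v. Q v \<and> Q' v)" if "dpred M Q" "dpred M Q'" for Q Q' by (rule dpred_conj[OF that])
    show "dpred M (\<lambda>v. \<exists>a. Q (case_nat a v))" if "dpred M Q" for Q by (rule dpred_ex[OF that])
    show "dpred M (\<lambda>v. v i < v j)" for i j by (rule dpred_less)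
    show "dpred M (\<lambda>v. Q (look \<sigma> v))" if "dpred M Q" for Q \<sigma> by (rule dpred_look[OF that])
    show "\<exists>n::nat. \<forall>v w. (\<forall>i<n. v i = w i) \<longrightarrow> Q v = Q w" if "dpred M Q" for Q
      by (rule dpred_finite_vars[OF that])
    show "\<exists>F. finite F \<and> (\<forall>J\<in>F. (\<exists>a. J = {a}) \<or> open_interval J) \<and> A = \<Union>F"
      if A: "dpred M (\<lambda>v. v 0 \<in> A)" for A
    proof -
      have "definable M 1 {[x] |x. x \<in> A}"
        by (rule dpred_imp_definable) (use A in auto)
      then show ?thesis using assms(1) unfolding o_minimal_def by force
    qed
    show "length x = n" if "x \<in> carrier H" for x by (rule len[OF that])
    show "dpred M (\<lambda>v. map v [0..<n] \<in> carrier H)"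
      "dpred M (\<lambda>v. map v [0..<3 * n] \<in> {x @ y @ (x \<otimes>\<^bsub>H\<^esub> y) |x y. x \<in> carrier H \<and> y \<in> carrier H})"
      by (fact definable_imp_dpred[OF def(1)] definable_imp_dpred[OF def(2)])+
  qed
  have order: "order \<Gamma> > 0"
    using assms(5) unfolding finite_central_extension_def group_hom_def
    by (simp add: monoid.order_gt_0_iff_finite group.is_monoid)
  interpret finite_extension "dpred M" H n \<Gamma> \<iota> G \<pi>
  proof
    fix h assume h: "h \<in> carrier H"
    \<comment> \<open>Definable connectedness enters here: the powers form a definable subgroup of
      finite index, hence all of \<open>H\<close>, which is the divisibility required of the
      extension.\<close>
    have "definable M n (powers (order \<Gamma>))"
      by (rule dpred_imp_definable[OF Def_powers[OF dlist_var0]])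
        (use subgroup.subset[OF subgroup_powers] len in blast)
    then have "powers (order \<Gamma>) = carrier H"
      using assms(4) subgroup_powers finite_index_powers[OF order] unfolding definably_connected_def by blast
    then show "\<exists>a\<in>carrier H. h = a [^]\<^bsub>H\<^esub> order \<Gamma>" using h unfolding powers_def by blast
  qed (rule assms(5))
  have "definable M (Suc n) (carrier G\<^sub>0)"
    unfolding carrier_G\<^sub>0 by (rule dpred_imp_definable[OF dset_reps reps_len])
  moreover have "definable M (3 * Suc n) {x @ y @ (x \<otimes>\<^bsub>G\<^sub>0\<^esub> y) |x y. x \<in> carrier G\<^sub>0 \<and> y \<in> carrier G\<^sub>0}"
  proof (rule dpred_imp_definable[OF dset_mult])
    fix w assume "w \<in> {x @ y @ (x \<otimes>\<^bsub>G\<^sub>0\<^esub> y) |x y. x \<in> carrier G\<^sub>0 \<and> y \<in> carrier G\<^sub>0}"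
    then obtain x y where "w = x @ y @ (x \<otimes>\<^bsub>G\<^sub>0\<^esub> y)" "x \<in> reps" "y \<in> reps" unfolding carrier_G\<^sub>0 by blast
    moreover from this have "x \<otimes>\<^bsub>G\<^sub>0\<^esub> y \<in> reps"
      using monoid.m_closed[OF group.is_monoid[OF group_G\<^sub>0]] unfolding carrier_G\<^sub>0 by blast
    ultimately show "length w = 3 * Suc n" using reps_len by simp
  qed
  ultimately have "definable_group M (Suc n) G\<^sub>0" unfolding definable_group_def using group_G\<^sub>0 by blast
  moreover have "definable_map M (Suc n) n (carrier G\<^sub>0) \<pi>\<^sub>0"
    unfolding definable_map_def
    by (rule dpred_imp_definable[OF dset_\<pi>\<^sub>0]) (use reps_len \<pi>\<^sub>0_len carrier_G\<^sub>0 in auto)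
  ultimately show ?thesis
    unfolding naturally_interpretable_def using \<pi>\<^sub>0_hom extension_iso by blast
qed

end
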